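(* Let $p$ be a prime with $p\equiv5\bmod8$, and let $v_k$ denote the image of the $k$-th Hazewinkel generator of $BP_*$ (at $p$) under $\varphi^L$. Then $v_{2}$ is non-zero modulo the ideal $(p,v_{1})$ of $M_*^{\mathbb{Z}_{(p)}}(G)$. In particular, $M_{*}^{\mathbb{Z}_{(p)}}(G)[v_{2}^{-1}]$ admits the structure of a Landweber exact algebra (over $BP_*$) of height two.
   Context: Group: $U(1,1;\mathbb{Z}[i])$ is the group of matrices $g$ with entries in $\mathbb{Z}[i]$ satisfying $\bar g^{tr}Hg=H$, $H=\mathrm{diag}(1,-1)$. Put $g_0=\frac{1}{\sqrt2}\begin{pmatrix}1&i\\ i&1\end{pmatrix}$ and $G=g_0\,U(1,1;\mathbb{Z}[i])\,g_0^{-1}\subset GL_2(\mathbb{C})$, which acts on the upper half plane $\mathbb{H}_1$ by fractional linear transformations. Automorphic forms: an automorphic form of weight $k$ for $G$ is a holomorphic function $f$ on $\mathbb{H}_1$ with $f(\frac{a\tau+b}{c\tau+d})=(c\tau+d)^kf(\tau)$ for all $\begin{pmatrix}a&b\\c&d\end{pmatrix}\in G$, holomorphic at the unique cusp $i\infty$ (i.e. with a power series expansion in $q^{1/2}$, $q=e^{2\pi i\tau}$). Its degree is twice its weight. $M^{\mathbb{C}}_*(G)$ is the ring of automorphic forms graded by degree; for a ring $\mathbb{Z}\subseteq R\subseteq\mathbb{C}$, $M^R_*(G)$ is the subring of forms with expansions in $R[\![q^{1/2}]\!]$. The forms $\alpha,\beta$: let $\theta[\begin{smallmatrix}1\\0\end{smallmatrix}](\tau)=\sum_{n\in\mathbb{Z}}e^{\pi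 i(n+1/2)^2\tau}$, $\theta[\begin{smallmatrix}0\\1\end{smallmatrix}](\tau)=\sum_{n\in\mathbb{Z}}(-1)^ne^{\pi i n^2\tau}$, $\delta'=\frac18(\theta[\begin{smallmatrix}1\\0\end{smallmatrix}]^4-\theta[\begin{smallmatrix}0\\1\end{smallmatrix}]^4)$, $\epsilon'=-\frac1{16}\theta[\begin{smallmatrix}1\\0\end{smallmatrix}]^4\theta[\begin{smallmatrix}0\\1\end{smallmatrix}]^4$; then $\alpha=-2^7(\epsilon'-\frac12\delta'^2)$ and $\beta=2^{12}\delta'^4$ are automorphic forms for $G$ of weight $4$ and $8$. For odd primes $p$, $M^{\mathbb{Z}_{(p)}}_*(G)\cong\mathbb{Z}_{(p)}[\alpha,\beta]$. Genus: the homogeneous Legendre polynomials are given by $(1-2\alpha u+\beta u^2)^{-1/2}=\sum_{k\ge0}P_k(\alpha,\beta)u^k$. The rational genus $\varphi^L\colon MU_*\otimes\mathbb{Q}\to M^{\mathbb{Q}}_*(G)$ is the ring homomorphism with $\varphi^L[\mathbb{C}P^l]=P_{l/4}(\alpha,\beta)$ if $4\mid l$ and $0$ otherwise. For a prime $p$, $BP_*\subset MU_*\otimes\mathbb{Q}$ is the polynomial ring over $\mathbb{Z}_{(p)}$ on the Hazewinkel generators $v_1,v_2,\dots$ defined by $p\,\ell_n=\sum_{0\le j<n}\ell_j v_{n-j}^{p^j}$, $\ell_j=[\mathbb{C}P^{p^j-1}]/p^j$, $\ell_0=1$. For $p\equiv1\bmod4$, $\varphi^L$ maps $BP_*$ into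 $M^{\mathbb{Z}_{(p)}}_*(G)$, and the images of the first two Hazewinkel generators, again denoted $v_1,v_2$, are $$v_{1}=P_{\frac{p-1}{4}}(\alpha,\beta),\qquad v_{2}=\tfrac{1}{p}\big(P_{\frac{p^{2}-1}{4}}(\alpha,\beta)-P_{\frac{p-1}{4}}(\alpha,\beta)^{p+1}\big).$$ Landweber exactness: a $BP_*$-algebra $A$ is Landweber exact if the images of $p,v_1,v_2,\dots$ form a regular sequence, i.e. $p$ is a non-zero-divisor on $A$ and $v_n$ is a non-zero-divisor on $A/(p,v_1,\dots,v_{n-1})$ for all $n\ge1$ (anything being allowed on the zero module). It has height two if moreover $v_2$ is invertible in $A/(p,v_1)\neq0$. The algebra structure is the one given by $\varphi^L$. *)

theory Defs
  imports
    "HOL-Analysis.Analysis"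
    "HOL-Computational_Algebra.Formal_Power_Series"
    "HOL-Computational_Algebra.Primes"
    "HOL-Library.Function_Algebras"
    "HOL-Library.Poly_Mapping"
    "HOL-Algebra.Algebraic_Closure_Type"
    "HOL-Algebra.Generated_Rings"
begin

section \<open>The group and its action on the upper half plane\<close>

typedef uhp = "{z::complex. Im z > 0}" morphisms of_uhp to_uhp
  by (rule exI [of _ \<i>]) simp

definition gauss_ints :: "complex set" where
  "gauss_ints = {z. Re z \<in> \<int> \<and> Im z \<in> \<int>}"

definition herm_form :: "complex^2^2" where
  "herm_form = vector [vector [1, 0], vector [0, -1]]"

definition U11 :: "(complex^2^2) set" where
  "U11 = {g. (\<forall>i j. g $ i $ j \<in> gauss_ints) \<and>
             transpose (\<chi> i j. cnj (g $ i $ j)) ** herm_form ** g = herm_form}"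

definition cayley :: "complex^2^2" where
  "cayley = vector [vector [1 / of_real (sqrt 2), \<i> / of_real (sqrt 2)],
                    vector [\<i> / of_real (sqrt 2), 1 / of_real (sqrt 2)]]"

definition G_group :: "(complex^2^2) set" where
  "G_group = (\<lambda>g. cayley ** g ** matrix_inv cayley) ` U11"

definition aut_factor :: "complex^2^2 \<Rightarrow> complex \<Rightarrow> complex" where
  "aut_factor g z = g $ 2 $ 1 * z + g $ 2 $ 2"

definition moebius :: "complex^2^2 \<Rightarrow> complex \<Rightarrow> complex" where
  "moebius g z = (g $ 1 $ 1 * z + g $ 1 $ 2) / aut_factor g z"

section \<open>Automorphic forms\<close>

text \<open>An automorphic form of weight \<open>k\<close> whose expansion in \<open>q\<^sup>1\<^sup>/\<^sup>2 = exp (\<pi> \<i> \<tau>)\<close> has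
  coefficients in \<open>R\<close>.\<close>

definition automorphic_form :: "complex set \<Rightarrow> int \<Rightarrow> (uhp \<Rightarrow> complex) \<Rightarrow> bool" where
  "automorphic_form R k f \<longleftrightarrow>
     (\<lambda>z. f (to_uhp z)) holomorphic_on {z. Im z > 0} \<and>
     (\<forall>g\<in>G_group. \<forall>\<tau>. f (to_uhp (moebius g (of_uhp \<tau>))) = aut_factor g (of_uhp \<tau>) powi k * f \<tau>) \<and>
     (\<exists>a::nat \<Rightarrow> complex. (\<forall>n. a n \<in> R) \<and>
        (\<forall>\<tau>. (\<lambda>n. a n * exp (of_real pi * \<i> * of_uhp \<tau>) ^ n) sums f \<tau>))"

text \<open>The graded ring is the external direct sum of its homogeneous parts: an element is a finitely
  supported family of functions indexed by the degree, and the product of \<^typ>\<open>int \<Rightarrow>\<^sub>0 (uhp \<Rightarrow> complex)\<close>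
  is convolution in the degree and pointwise multiplication of functions. The degree is twice
  the weight.\<close>

type_synonym gforms = "int \<Rightarrow>\<^sub>0 (uhp \<Rightarrow> complex)"

definition forms_ring :: "complex set \<Rightarrow> gforms ring" where
  "forms_ring R = ring_of_type_algebra \<lparr>carrier :=
     {F. \<forall>d. Poly_Mapping.lookup F d \<noteq> 0 \<longrightarrow>
             (\<exists>k. d = 2 * k \<and> automorphic_form R k (Poly_Mapping.lookup F d))}\<rparr>"

definition const_form :: "complex \<Rightarrow> gforms" where
  "const_form c = Poly_Mapping.single 0 (\<lambda>_. c)"

text \<open>The local ring of integers at \<open>p\<close>, inside any field of characteristic 0.\<close>

definition local_ints :: "nat \<Rightarrow> 'a::field_char_0 set" where
  "local_ints p = {of_int a / of_int b | a b. \<not> int p dvd b}"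

section \<open>The forms \<open>\<alpha>\<close> and \<open>\<beta>\<close>\<close>

definition theta10 :: "uhp \<Rightarrow> complex" where
  "theta10 \<tau> = (\<Sum>\<^sub>\<infinity>n::int. exp (of_real pi * \<i> * (of_int n + 1/2)\<^sup>2 * of_uhp \<tau>))"

definition theta01 :: "uhp \<Rightarrow> complex" where
  "theta01 \<tau> = (\<Sum>\<^sub>\<infinity>n::int. (-1) powi n * exp (of_real pi * \<i> * (of_int n)\<^sup>2 * of_uhp \<tau>))"

definition delta' :: "uhp \<Rightarrow> complex" where
  "delta' \<tau> = 1/8 * (theta10 \<tau> ^ 4 - theta01 \<tau> ^ 4)"

definition epsilon' :: "uhp \<Rightarrow> complex" where
  "epsilon' \<tau> = - (1/16) * theta10 \<tau> ^ 4 * theta01 \<tau> ^ 4"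

definition alpha :: "uhp \<Rightarrow> complex" where
  "alpha \<tau> = - (2^7) * (epsilon' \<tau> - 1/2 * delta' \<tau> ^ 2)"

definition beta :: "uhp \<Rightarrow> complex" where
  "beta \<tau> = 2^12 * delta' \<tau> ^ 4"

section \<open>Homogeneous Legendre polynomials\<close>

text \<open>The power series \<open>(1 - 2 a u + b u\<^sup>2)\<^sup>-\<^sup>1\<^sup>/\<^sup>2\<close> with constant term 1.\<close>

definition legendre_gf :: "'a::field_char_0 \<Rightarrow> 'a \<Rightarrow> 'a fps" where
  "legendre_gf a b = fps_binomial (-1/2) oo (fps_const (-2 * a) * fps_X + fps_const b * fps_X ^ 2)"

definition legendre_P :: "nat \<Rightarrow> 'a::field_char_0 \<Rightarrow> 'a \<Rightarrow> 'a" where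
  "legendre_P k a b = fps_nth (legendre_gf a b) k"

lemma legendre_gf_nth_0: "fps_nth (legendre_gf a b) 0 = 1"
  by (simp add: legendre_gf_def)

lemma legendre_gf_square:
  "legendre_gf a b ^ 2 * (1 - fps_const (2 * a) * fps_X + fps_const b * fps_X ^ 2) = 1"
proof -
  let ?y = "fps_const (-2 * a) * fps_X + fps_const b * fps_X ^ 2"
  have 0: "fps_nth ?y 0 = 0"
    by simp
  have "fps_binomial (-1/2) ^ 2 * (1 + fps_X) = (1 :: 'a fps)"
  proof -
    have "fps_binomial (-1/2 :: 'a) ^ 2 = fps_binomial (-1/2 + -1/2)"
      unfolding power2_eq_square by (rule fps_binomial_add_mult [symmetric])
    also have "(-1/2 + -1/2 :: 'a) = -1"
      by simp
    finally have "fps_binomial (-1/2 :: 'a) ^ 2 = inverse (1 + fps_X)"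
      by (simp add: fps_binomial_minus_one)
    then show ?thesis
      by (simp add: inverse_mult_eq_1)
  qed
  then have "(fps_binomial (-1/2) ^ 2 * (1 + fps_X)) oo ?y = (1 oo ?y :: 'a fps)"
    by simp
  then have "legendre_gf a b ^ 2 * (1 + ?y) = 1"
    unfolding legendre_gf_def power2_eq_square [of "fps_binomial _"]
      power2_eq_square [of "fps_binomial _ oo _"]
    by (simp only: fps_compose_mult_distrib [OF 0] fps_compose_add_distrib fps_compose_1
        fps_X_fps_compose_startby0 [OF 0])
  moreover have "1 + ?y = 1 - fps_const (2 * a) * fps_X + fps_const b * fps_X ^ 2"
    by (simp add: fps_const_neg [symmetric] del: fps_const_neg)
  ultimately show ?thesis
    by (simp only:)
qed

section \<open>Rational bordism and the genus\<close>

text \<open>\<open>MU\<^sub>* \<otimes> \<rat>\<close> is the polynomial ring over \<open>\<rat>\<close> on the classes of the complex projective spaces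
  of positive dimension; the variable with index \<open>i\<close> is the class of \<open>\<complex>P\<^sup>i\<^sup>+\<^sup>1\<close>.\<close>

type_synonym mu_rat = "(nat \<Rightarrow>\<^sub>0 nat) \<Rightarrow>\<^sub>0 rat"

definition mu_const :: "rat \<Rightarrow> mu_rat" where
  "mu_const c = Poly_Mapping.single 0 c"

definition CP :: "nat \<Rightarrow> mu_rat" where
  "CP l = (if l = 0 then 1 else Poly_Mapping.single (Poly_Mapping.single (l - 1) 1) 1)"

text \<open>\<open>P\<^sub>k(\<alpha>, \<beta>)\<close> has weight \<open>4 k\<close>, hence the value on \<open>\<complex>P\<^sup>l\<close> has weight \<open>l\<close> and degree \<open>2 l\<close>.\<close>

definition genus_CP :: "nat \<Rightarrow> gforms" where
  "genus_CP l = (if 4 dvd l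
     then Poly_Mapping.single (2 * int l) (\<lambda>\<tau>. legendre_P (l div 4) (alpha \<tau>) (beta \<tau>)) else 0)"

definition genus :: "mu_rat \<Rightarrow> gforms" where
  "genus x = (\<Sum>m\<in>Poly_Mapping.keys x. const_form (of_rat (Poly_Mapping.lookup x m)) *
     (\<Prod>i\<in>Poly_Mapping.keys m. genus_CP (Suc i) ^ Poly_Mapping.lookup m i))"

text \<open>\<open>genus\<close> is the ring homomorphism, linear over \<open>\<rat>\<close>, with the prescribed values.\<close>

lemma genus_CP_0: "genus_CP 0 = 1"
proof -
  have "(\<lambda>\<tau>. legendre_P 0 (alpha \<tau>) (beta \<tau>)) = 1"
    by (simp add: fun_eq_iff legendre_P_def legendre_gf_nth_0)
  then show ?thesis
    by (simp add: genus_CP_def)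
qed

lemma const_form_add: "const_form (a + b) = const_form a + const_form b"
  by (simp add: const_form_def single_add [symmetric] plus_fun_def)

lemma const_form_mult: "const_form (a * b) = const_form a * const_form b"
  by (simp add: const_form_def mult_single times_fun_def)

lemma const_form_0: "const_form 0 = 0"
  by (simp add: const_form_def zero_fun_def [symmetric])

lemma const_form_1: "const_form 1 = 1"
  by (simp add: const_form_def one_fun_def [symmetric])

lemma genus_superset:
  assumes "finite S" and "Poly_Mapping.keys x \<subseteq> S"
  shows "genus x = (\<Sum>m\<in>S. const_form (of_rat (Poly_Mapping.lookup x m)) *
     (\<Prod>i\<in>Poly_Mapping.keys m. genus_CP (Suc i) ^ Poly_Mapping.lookup m i))"
  unfolding genus_def using assms
  by (intro sum.mono_neutral_left) (auto simp: in_keys_iff const_form_0)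

lemma genus_add: "genus (x + y) = genus x + genus y"
proof -
  let ?S = "Poly_Mapping.keys x \<union> Poly_Mapping.keys y"
  have "Poly_Mapping.keys (x + y) \<subseteq> ?S"
    by (rule keys_add)
  then show ?thesis
    by (simp add: genus_superset [of ?S] lookup_add of_rat_add const_form_add
        distrib_right sum.distrib)
qed

lemma genus_0: "genus 0 = 0"
  by (simp add: genus_def)

lemma genus_sum: "genus (sum f A) = (\<Sum>a\<in>A. genus (f a))"
  by (induction A rule: infinite_finite_induct) (simp_all add: genus_0 genus_add)

lemma genus_single:
  "genus (Poly_Mapping.single m c) = const_form (of_rat c) *
     (\<Prod>i\<in>Poly_Mapping.keys m. genus_CP (Suc i) ^ Poly_Mapping.lookup m i)"
  by (subst genus_superset [of "{m}"]) auto

lemma genus_mu_const: "genus (mu_const c) = const_form (of_rat c)"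
  by (simp add: mu_const_def genus_single)

lemma genus_1: "genus 1 = 1"
  using genus_mu_const [of 1] by (simp add: mu_const_def const_form_1)

lemma genus_CP: "genus (CP l) = genus_CP l"
proof (cases l)
  case 0
  then show ?thesis
    by (simp add: CP_def genus_1 genus_CP_0)
qed (simp add: CP_def genus_single const_form_1)

lemma genus_mult: "genus (x * y) = genus x * genus y"
proof -
  let ?mon = "\<lambda>m. \<Prod>i\<in>Poly_Mapping.keys m. genus_CP (Suc i) ^ Poly_Mapping.lookup m i"
  have mon_superset: "?mon m = (\<Prod>i\<in>S. genus_CP (Suc i) ^ Poly_Mapping.lookup m i)"
    if "finite S" "Poly_Mapping.keys m \<subseteq> S" for m S
    using that by (intro prod.mono_neutral_left) (auto simp: in_keys_iff)
  have mon: "?mon (m + m') = ?mon m * ?mon m'" for m m' :: "nat \<Rightarrow>\<^sub>0 nat"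
  proof -
    let ?S = "Poly_Mapping.keys m \<union> Poly_Mapping.keys m'"
    have "Poly_Mapping.keys (m + m') \<subseteq> ?S"
      by (rule keys_add)
    then have "?mon (m + m') = (\<Prod>i\<in>?S. genus_CP (Suc i) ^ Poly_Mapping.lookup (m + m') i)"
      by (intro mon_superset) auto
    moreover have "?mon m = (\<Prod>i\<in>?S. genus_CP (Suc i) ^ Poly_Mapping.lookup m i)"
      and "?mon m' = (\<Prod>i\<in>?S. genus_CP (Suc i) ^ Poly_Mapping.lookup m' i)"
      by (intro mon_superset; auto)+
    ultimately show ?thesis
      by (simp only: lookup_add power_add prod.distrib)
  qed
  have single: "genus (Poly_Mapping.single m c * Poly_Mapping.single m' c') =
      genus (Poly_Mapping.single m c) * genus (Poly_Mapping.single m' c')" for m m' c c'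
    by (simp add: mult_single genus_single mon of_rat_mult const_form_mult mult_ac)
  have expand: "z = (\<Sum>m\<in>Poly_Mapping.keys z. Poly_Mapping.single m (Poly_Mapping.lookup z m))"
    for z :: mu_rat
    by (rule poly_mapping_eqI)
      (auto simp: lookup_sum lookup_single when_def in_keys_iff sum.delta)
  show ?thesis
    by (subst (1 2) expand, subst (5 6) expand)
      (simp only: sum_product genus_sum single)
qed

section \<open>Hazewinkel generators and \<open>BP\<^sub>*\<close>\<close>

definition log_coeff :: "nat \<Rightarrow> nat \<Rightarrow> mu_rat" where
  "log_coeff p j = mu_const (1 / of_nat (p ^ j)) * CP (p ^ j - 1)"

text \<open>With the usual convention \<open>v\<^sub>0 = p\<close>.\<close>

function hazewinkel :: "nat \<Rightarrow> nat \<Rightarrow> mu_rat" where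
  "hazewinkel p n = (if n = 0 then of_nat p else
     of_nat p * log_coeff p n -
       (\<Sum>j\<in>{0<..<n}. log_coeff p j * hazewinkel p (n - j) ^ (p ^ j)))"
  by auto
termination
  by (relation "Wellfounded.measure snd") auto

declare hazewinkel.simps [simp del]

lemma log_coeff_0: "log_coeff p 0 = 1"
  by (simp add: log_coeff_def CP_def mu_const_def)

lemma hazewinkel_relation:
  assumes "n \<ge> 1"
  shows "of_nat p * log_coeff p n = (\<Sum>j<n. log_coeff p j * hazewinkel p (n - j) ^ (p ^ j))"
proof -
  have "{..<n} = insert 0 {0<..<n}"
    using assms by auto
  moreover have "hazewinkel p n = of_nat p * log_coeff p n -
      (\<Sum>j\<in>{0<..<n}. log_coeff p j * hazewinkel p (n - j) ^ (p ^ j))"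
    using assms by (subst hazewinkel.simps) simp
  ultimately show ?thesis
    by (simp add: log_coeff_0)
qed

definition BP :: "nat \<Rightarrow> mu_rat ring" where
  "BP p = ring_of_type_algebra \<lparr>carrier :=
     generate_ring ring_of_type_algebra (mu_const ` local_ints p \<union> hazewinkel p ` {1..})\<rparr>"

section \<open>Localization at the powers of an element\<close>

text \<open>\<open>loc_frac R s a n\<close> is the fraction \<open>a / s\<^sup>n\<close>, as an equivalence class of pairs.\<close>

definition loc_frac :: "('a, 'm) ring_scheme \<Rightarrow> 'a \<Rightarrow> 'a \<Rightarrow> nat \<Rightarrow> ('a \<times> nat) set" where
  "loc_frac R s a n = {(b, m). b \<in> carrier R \<and>
     (\<exists>k::nat. s [^]\<^bsub>R\<^esub> k \<otimes>\<^bsub>R\<^esub> (s [^]\<^bsub>R\<^esub> n \<otimes>\<^bsub>R\<^esub> b) = s [^]\<^bsub>R\<^esub> k \<otimes>\<^bsub>R\<^esub> (s [^]\<^bsub>R\<^esub> m \<otimes>\<^bsub>R\<^esub> a))}"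

definition localization :: "('a, 'm) ring_scheme \<Rightarrow> 'a \<Rightarrow> ('a \<times> nat) set ring" where
  "localization R s = \<lparr>
     carrier = {loc_frac R s a n | a n. a \<in> carrier R},
     monoid.mult = (\<lambda>x y. \<Union>u\<in>x. \<Union>w\<in>y. loc_frac R s (fst u \<otimes>\<^bsub>R\<^esub> fst w) (snd u + snd w)),
     one = loc_frac R s \<one>\<^bsub>R\<^esub> 0,
     ring.zero = loc_frac R s \<zero>\<^bsub>R\<^esub> 0,
     add = (\<lambda>x y. \<Union>u\<in>x. \<Union>w\<in>y.
       loc_frac R s (s [^]\<^bsub>R\<^esub> snd w \<otimes>\<^bsub>R\<^esub> fst u \<oplus>\<^bsub>R\<^esub> s [^]\<^bsub>R\<^esub> snd u \<otimes>\<^bsub>R\<^esub> fst w) (snd u + snd w))\<rparr>"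

definition loc_map :: "('a, 'm) ring_scheme \<Rightarrow> 'a \<Rightarrow> 'a \<Rightarrow> ('a \<times> nat) set" where
  "loc_map R s a = loc_frac R s a 0"

context cring
begin

lemma loc_frac_iff:
  "(b, m) \<in> loc_frac R s a n \<longleftrightarrow> b \<in> carrier R \<and>
     (\<exists>k::nat. s [^] k \<otimes> (s [^] n \<otimes> b) = s [^] k \<otimes> (s [^] m \<otimes> a))"
  by (simp add: loc_frac_def)

lemma loc_frac_refl: "a \<in> carrier R \<Longrightarrow> (a, n) \<in> loc_frac R s a n"
  by (auto simp: loc_frac_iff)

lemma loc_frac_sym:
  "a \<in> carrier R \<Longrightarrow> (b, m) \<in> loc_frac R s a n \<Longrightarrow> (a, n) \<in> loc_frac R s b m"
  by (auto simp: loc_frac_iff) metis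

lemma loc_frac_trans:
  assumes s: "s \<in> carrier R" and a: "a \<in> carrier R"
    and ab: "(b, m) \<in> loc_frac R s a n" and bc: "(c, l) \<in> loc_frac R s b m"
  shows "(c, l) \<in> loc_frac R s a n"
proof -
  obtain j where b: "b \<in> carrier R" and j: "s [^] (j::nat) \<otimes> (s [^] n \<otimes> b) = s [^] j \<otimes> (s [^] m \<otimes> a)"
    using ab by (auto simp: loc_frac_iff)
  obtain k where c: "c \<in> carrier R" and k: "s [^] (k::nat) \<otimes> (s [^] m \<otimes> c) = s [^] k \<otimes> (s [^] l \<otimes> b)"
    using bc by (auto simp: loc_frac_iff)
  have "s [^] (j + k + m) \<otimes> (s [^] n \<otimes> c) = s [^] j \<otimes> s [^] n \<otimes> (s [^] k \<otimes> (s [^] m \<otimes> c))"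
    using s b c a by (simp add: nat_pow_mult [symmetric] m_ac)
  also have "\<dots> = s [^] k \<otimes> s [^] l \<otimes> (s [^] j \<otimes> (s [^] n \<otimes> b))"
    unfolding k using s b c a by (simp add: m_ac)
  also have "\<dots> = s [^] (j + k + m) \<otimes> (s [^] l \<otimes> a)"
    unfolding j using s b c a by (simp add: nat_pow_mult [symmetric] m_ac)
  finally show ?thesis
    using c by (auto simp: loc_frac_iff)
qed

lemma loc_frac_eq:
  assumes s: "s \<in> carrier R" and a: "a \<in> carrier R" and ab: "(b, m) \<in> loc_frac R s a n"
  shows "loc_frac R s b m = loc_frac R s a n"
proof -
  have b: "b \<in> carrier R"
    using ab by (simp add: loc_frac_iff)
  have "z \<in> loc_frac R s b m \<longleftrightarrow> z \<in> loc_frac R s a n" for z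
    using loc_frac_trans [OF s a ab, of "fst z" "snd z"]
      loc_frac_trans [OF s b loc_frac_sym [OF a ab], of "fst z" "snd z"] by auto
  then show ?thesis
    by blast
qed

lemma loc_frac_eq_iff:
  assumes "s \<in> carrier R" and "a \<in> carrier R" and "b \<in> carrier R"
  shows "loc_frac R s a n = loc_frac R s b m \<longleftrightarrow>
    (\<exists>k::nat. s [^] k \<otimes> (s [^] m \<otimes> a) = s [^] k \<otimes> (s [^] n \<otimes> b))"
proof
  assume "loc_frac R s a n = loc_frac R s b m"
  then have "(a, n) \<in> loc_frac R s b m"
    using loc_frac_refl [of a n s] assms by blast
  then show "\<exists>k::nat. s [^] k \<otimes> (s [^] m \<otimes> a) = s [^] k \<otimes> (s [^] n \<otimes> b)"
    by (simp add: loc_frac_iff)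
next
  assume "\<exists>k::nat. s [^] k \<otimes> (s [^] m \<otimes> a) = s [^] k \<otimes> (s [^] n \<otimes> b)"
  then have "(a, n) \<in> loc_frac R s b m"
    using assms by (simp add: loc_frac_iff)
  then show "loc_frac R s a n = loc_frac R s b m"
    using assms by (intro loc_frac_eq)
qed

lemma loc_frac_mult:
  assumes s: "s \<in> carrier R" and a: "a \<in> carrier R" and b: "b \<in> carrier R"
  shows "loc_frac R s a m \<otimes>\<^bsub>localization R s\<^esub> loc_frac R s b n = loc_frac R s (a \<otimes> b) (m + n)"
proof -
  have eq: "loc_frac R s (fst u \<otimes> fst w) (snd u + snd w) = loc_frac R s (a \<otimes> b) (m + n)"
    if u: "u \<in> loc_frac R s a m" and w: "w \<in> loc_frac R s b n" for u w
  proof -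
    obtain c p d q where uw: "u = (c, p)" "w = (d, q)"
      by (cases u, cases w)
    obtain j where c: "c \<in> carrier R" and j: "s [^] (j::nat) \<otimes> (s [^] m \<otimes> c) = s [^] j \<otimes> (s [^] p \<otimes> a)"
      using u by (auto simp: loc_frac_iff uw)
    obtain k where d: "d \<in> carrier R" and k: "s [^] (k::nat) \<otimes> (s [^] n \<otimes> d) = s [^] k \<otimes> (s [^] q \<otimes> b)"
      using w by (auto simp: loc_frac_iff uw)
    have "s [^] (j + k) \<otimes> (s [^] (m + n) \<otimes> (c \<otimes> d)) =
        (s [^] j \<otimes> (s [^] m \<otimes> c)) \<otimes> (s [^] k \<otimes> (s [^] n \<otimes> d))"
      using s c d by (simp add: nat_pow_mult [symmetric] m_ac)
    also have "\<dots> = s [^] (j + k) \<otimes> (s [^] (p + q) \<otimes> (a \<otimes> b))"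
      unfolding j k using s a b by (simp add: nat_pow_mult [symmetric] m_ac)
    finally show ?thesis
      using s a b c d by (intro loc_frac_eq) (auto simp: loc_frac_iff uw)
  qed
  have "(\<Union>u\<in>loc_frac R s a m. \<Union>w\<in>loc_frac R s b n.
      loc_frac R s (fst u \<otimes> fst w) (snd u + snd w)) =
    (\<Union>u\<in>loc_frac R s a m. \<Union>w\<in>loc_frac R s b n. loc_frac R s (a \<otimes> b) (m + n))"
    using eq by simp
  then show ?thesis
    using loc_frac_refl [OF a, of m s] loc_frac_refl [OF b, of n s]
    by (auto simp: localization_def)
qed

lemma loc_frac_add:
  assumes s: "s \<in> carrier R" and a: "a \<in> carrier R" and b: "b \<in> carrier R"
  shows "loc_frac R s a m \<oplus>\<^bsub>localization R s\<^esub> loc_frac R s b n =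
    loc_frac R s (s [^] n \<otimes> a \<oplus> s [^] m \<otimes> b) (m + n)"
proof -
  have eq: "loc_frac R s (s [^] snd w \<otimes> fst u \<oplus> s [^] snd u \<otimes> fst w) (snd u + snd w) =
      loc_frac R s (s [^] n \<otimes> a \<oplus> s [^] m \<otimes> b) (m + n)"
    if u: "u \<in> loc_frac R s a m" and w: "w \<in> loc_frac R s b n" for u w
  proof -
    obtain c p d q where uw: "u = (c, p)" "w = (d, q)"
      by (cases u, cases w)
    obtain j where c: "c \<in> carrier R" and j: "s [^] (j::nat) \<otimes> (s [^] m \<otimes> c) = s [^] j \<otimes> (s [^] p \<otimes> a)"
      using u by (auto simp: loc_frac_iff uw)
    obtain k where d: "d \<in> carrier R" and k: "s [^] (k::nat) \<otimes> (s [^] n \<otimes> d) = s [^] k \<otimes> (s [^] q \<otimes> b)"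
      using w by (auto simp: loc_frac_iff uw)
    have "s [^] (j + k) \<otimes> (s [^] (m + n) \<otimes> (s [^] q \<otimes> c \<oplus> s [^] p \<otimes> d)) =
        s [^] (k + n + q) \<otimes> (s [^] j \<otimes> (s [^] m \<otimes> c)) \<oplus> s [^] (j + m + p) \<otimes> (s [^] k \<otimes> (s [^] n \<otimes> d))"
      using s c d by (simp add: nat_pow_mult [symmetric] m_ac r_distr)
    also have "\<dots> = s [^] (j + k) \<otimes> (s [^] (p + q) \<otimes> (s [^] n \<otimes> a \<oplus> s [^] m \<otimes> b))"
      unfolding j k using s a b by (simp add: nat_pow_mult [symmetric] m_ac r_distr)
    finally show ?thesis
      using s a b c d by (intro loc_frac_eq) (auto simp: loc_frac_iff uw)
  qed
  have "(\<Union>u\<in>loc_frac R s a m. \<Union>w\<in>loc_frac R s b n.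
      loc_frac R s (s [^] snd w \<otimes> fst u \<oplus> s [^] snd u \<otimes> fst w) (snd u + snd w)) =
    (\<Union>u\<in>loc_frac R s a m. \<Union>w\<in>loc_frac R s b n. loc_frac R s (s [^] n \<otimes> a \<oplus> s [^] m \<otimes> b) (m + n))"
    using eq by simp
  then show ?thesis
    using loc_frac_refl [OF a, of m s] loc_frac_refl [OF b, of n s]
    by (auto simp: localization_def)
qed

lemma localization_carrier:
  "x \<in> carrier (localization R s) \<longleftrightarrow> (\<exists>a n. a \<in> carrier R \<and> x = loc_frac R s a n)"
  by (auto simp: localization_def)

lemma localization_one: "\<one>\<^bsub>localization R s\<^esub> = loc_frac R s \<one> 0"
  by (simp add: localization_def)

lemma localization_zero: "\<zero>\<^bsub>localization R s\<^esub> = loc_frac R s \<zero> 0"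
  by (simp add: localization_def)

lemma localization_cring:
  assumes s: "s \<in> carrier R"
  shows "cring (localization R s)"
proof -
  let ?L = "localization R s"
  have comm_group: "abelian_group ?L"
  proof (rule abelian_groupI)
    fix x y assume "x \<in> carrier ?L" "y \<in> carrier ?L"
    then show "x \<oplus>\<^bsub>?L\<^esub> y \<in> carrier ?L"
      unfolding localization_carrier using s loc_frac_add [OF s]
      by (metis a_closed m_closed nat_pow_closed)
  next
    fix x assume "x \<in> carrier ?L"
    then obtain a n where a: "a \<in> carrier R" and x: "x = loc_frac R s a n"
      by (auto simp: localization_carrier)
    show "\<exists>y\<in>carrier ?L. y \<oplus>\<^bsub>?L\<^esub> x = \<zero>\<^bsub>?L\<^esub>"
    proof (rule bexI)
      show "loc_frac R s (\<ominus> a) n \<in> carrier ?L"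
        using a by (auto simp: localization_carrier)
      show "loc_frac R s (\<ominus> a) n \<oplus>\<^bsub>?L\<^esub> x = \<zero>\<^bsub>?L\<^esub>"
        using s a by (simp add: x loc_frac_add localization_zero loc_frac_eq_iff r_minus l_neg)
    qed
  qed (use s in \<open>auto simp: localization_carrier localization_zero loc_frac_add a_ac r_distr
        nat_pow_mult [symmetric] m_ac add_ac\<close>)
  moreover have "Group.comm_monoid ?L"
  proof (rule comm_monoidI)
    fix x y assume "x \<in> carrier ?L" "y \<in> carrier ?L"
    then show "x \<otimes>\<^bsub>?L\<^esub> y \<in> carrier ?L"
      unfolding localization_carrier using loc_frac_mult [OF s] by (metis m_closed)
  qed (use s in \<open>auto simp: localization_carrier localization_one loc_frac_mult m_ac add_ac\<close>)
  moreover have "(x \<oplus>\<^bsub>?L\<^esub> y) \<otimes>\<^bsub>?L\<^esub> z = x \<otimes>\<^bsub>?L\<^esub> z \<oplus>\<^bsub>?L\<^esub> y \<otimes>\<^bsub>?L\<^esub> z"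
    if xyz: "x \<in> carrier ?L" "y \<in> carrier ?L" "z \<in> carrier ?L" for x y z
  proof -
    obtain a m b n c l where "a \<in> carrier R" "b \<in> carrier R" "c \<in> carrier R"
      and "x = loc_frac R s a m" "y = loc_frac R s b n" "z = loc_frac R s c l"
      using xyz by (auto simp: localization_carrier)
    then show ?thesis
      using s by (auto simp: loc_frac_mult loc_frac_add loc_frac_eq_iff r_distr l_distr
          nat_pow_mult [symmetric] m_ac)
  qed
  ultimately show ?thesis
    by (rule cringI)
qed

lemma loc_map_hom:
  assumes s: "s \<in> carrier R"
  shows "loc_map R s \<in> ring_hom R (localization R s)"
  using s by (intro ring_hom_memI)
    (auto simp: loc_map_def localization_carrier localization_one loc_frac_mult loc_frac_add)

lemma loc_map_unit:
  assumes s: "s \<in> carrier R"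
  shows "loc_map R s s \<otimes>\<^bsub>localization R s\<^esub> loc_frac R s \<one> 1 = \<one>\<^bsub>localization R s\<^esub>"
  using s by (simp add: loc_map_def localization_one loc_frac_mult loc_frac_eq_iff)

end

section \<open>Landweber exactness\<close>

definition nonzerodivisor :: "('a, 'm) ring_scheme \<Rightarrow> 'a \<Rightarrow> bool" where
  "nonzerodivisor R x \<longleftrightarrow> x \<in> carrier R \<and> (\<forall>y\<in>carrier R. x \<otimes>\<^bsub>R\<^esub> y = \<zero>\<^bsub>R\<^esub> \<longrightarrow> y = \<zero>\<^bsub>R\<^esub>)"

definition BP_algebra :: "nat \<Rightarrow> ('a, 'm) ring_scheme \<Rightarrow> (mu_rat \<Rightarrow> 'a) \<Rightarrow> bool" where
  "BP_algebra p A h \<longleftrightarrow> cring A \<and> h \<in> ring_hom (BP p) A"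

text \<open>The ideal \<open>(p, v\<^sub>1, \<dots>, v\<^sub>n\<^sub>-\<^sub>1)\<close> of \<open>A\<close>.\<close>

definition landweber_ideal :: "nat \<Rightarrow> ('a, 'm) ring_scheme \<Rightarrow> (mu_rat \<Rightarrow> 'a) \<Rightarrow> nat \<Rightarrow> 'a set" where
  "landweber_ideal p A h n = Idl\<^bsub>A\<^esub> ((\<lambda>i. h (hazewinkel p i)) ` {..<n})"

definition landweber_exact :: "nat \<Rightarrow> ('a, 'm) ring_scheme \<Rightarrow> (mu_rat \<Rightarrow> 'a) \<Rightarrow> bool" where
  "landweber_exact p A h \<longleftrightarrow> BP_algebra p A h \<and>
     nonzerodivisor A (h (of_nat p)) \<and>
     (\<forall>n\<ge>1. nonzerodivisor (A Quot landweber_ideal p A h n)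
        (landweber_ideal p A h n +>\<^bsub>A\<^esub> h (hazewinkel p n)))"

definition landweber_exact_height_two :: "nat \<Rightarrow> ('a, 'm) ring_scheme \<Rightarrow> (mu_rat \<Rightarrow> 'a) \<Rightarrow> bool" where
  "landweber_exact_height_two p A h \<longleftrightarrow> landweber_exact p A h \<and>
     (let I = landweber_ideal p A h 2 in
        carrier (A Quot I) \<noteq> {\<zero>\<^bsub>A Quot I\<^esub>} \<and>
        I +>\<^bsub>A\<^esub> h (hazewinkel p 2) \<in> Units (A Quot I))"

end

theory Submission
  imports
    Defs
    "HOL-Number_Theory.Residues"
    "HOL-Complex_Analysis.Conformal_Mappings"
    "HOL-Probability.Distributions"
begin

text \<open>Write \<open>D = (\<alpha>\<^sup>2 - \<beta>) / 256\<close>. Up to a constant it is the product of the fourth powers of two theta constants and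
  the eighth power of the third, so it has no zeros, and its expansion starts with \<open>q\<^sup>1\<^sup>/\<^sup>2\<close>; dividing by \<open>D\<close> turns a
  form of weight \<open>k\<close> without constant term into one of weight \<open>k - 8\<close>. For \<open>p \<equiv> 5 (mod 8)\<close> the number
  \<open>(p - 1) / 4\<close> is odd, hence \<open>\<alpha>\<close> divides \<open>v\<^sub>1\<close>, and \<open>v\<^sub>2 \<equiv> c \<beta>\<^sup>m\<close> modulo \<open>\<alpha>\<close>, where \<open>m = (p\<^sup>2 - 1) / 8\<close> and
  \<open>c\<close> is \<open>(-1/2 choose m) / p\<close>, a unit at \<open>p\<close> by Kummer's theorem. If a power of \<open>v\<^sub>2\<close> were in \<open>(p, v\<^sub>1)\<close>, then, as
  \<open>\<beta> \<equiv> -256 D\<close> modulo \<open>\<alpha>\<close>, so would a unit multiple of a power of \<open>D\<close> be in \<open>(p, \<alpha>)\<close>; comparing constant terms and dividing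
  by \<open>D\<close> repeatedly one reaches weights \<open>0\<close> and \<open>-4\<close>, where all forms are constant or zero, a contradiction.
  Since \<open>v\<^sub>1\<close> has constant term \<open>1\<close> it is a nonzerodivisor modulo \<open>p\<close>, and Landweber exactness follows.

  The integrality of the \<open>v\<^sub>n\<close> is a Dwork congruence for the coefficients of
  \<open>(1 - 2 \<alpha> u\<^sup>4 + \<beta> u\<^sup>8)\<^sup>-\<^sup>1\<^sup>/\<^sup>2\<close> over the power series ring in \<open>q\<^sup>1\<^sup>/\<^sup>2\<close> with the Frobenius lift \<open>q \<mapsto> q\<^sup>p\<close>.
  The inversion formulas of the theta constants come from the invariance of the arithmetic-geometric
  mean under the duplication formulas.\<close>

text \<open>The recursion for the \<open>v n\<close> divides by powers of p, so their integrality
  needs a separate reason: a functional equation for the logarithm with coefficients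
  \<open>a m / p ^ m\<close>, in which \<open>a m\<close> agrees modulo p^m with the sum of
  \<open>r i * (\<phi> ^^ i) (a (m - i))\<close>, the \<open>r i\<close> being divisible by p^(i-1).
  It is obtained from E m = S^(p^m - 1), where S is the square root of 1 - 2\<alpha>u^4 +
  \<beta>u^8. As p^m - 1 is even, E m is a polynomial in u^4, of degree at most 4(p^m - 1) in u;
  with p = 1 mod 4 this leaves one product when the coefficient of u^(p^m - 1) is read off.
  \<open>dwork_rem\<close> is the solution R of: E m is the sum of R i \<phi>^i(E (m - i)) over 0 <
  i <= m, when E 0 = 1.

  All powers of v_2 must avoid (p, v_1): a single power inside would make the quotient of the
  localization zero.

  For the inversion formulas, the duplication formulas say that doubling \<tau> is a step of the
  arithmetic-geometric mean; the behaviour at both ends of the imaginary axis then gives the limits.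
  At the end 0 it comes from Riemann sums of the Gaussian.\<close>

function dwork_rem :: "('a::comm_ring_1 \<Rightarrow> 'a) \<Rightarrow> (nat \<Rightarrow> 'a) \<Rightarrow> nat \<Rightarrow> 'a" where
  "dwork_rem \<phi> E m = E m - (\<Sum>i\<in>{0<..<m}. dwork_rem \<phi> E i * (\<phi> ^^ i) (E (m - i)))"
  by auto
termination
  by (relation "Wellfounded.measure (snd \<circ> snd)") auto

declare dwork_rem.simps [simp del]

text \<open>Integrality means membership in \<open>A\<close>, whereas \<open>\<phi>\<close> is
  additive and multiplicative on the whole type: it will be applied to logarithm coefficients, which
  have powers of p in the denominator and lie outside \<open>A\<close>.\<close>

locale frobenius_lift =
  fixes p :: nat and A :: "'a::comm_ring_1 set" and \<phi> :: "'a \<Rightarrow> 'a"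
  assumes prime_p: "Factorial_Ring.prime p"
    and one_mem: "1 \<in> A"
    and add_mem: "x \<in> A \<Longrightarrow> y \<in> A \<Longrightarrow> x + y \<in> A"
    and neg_mem: "x \<in> A \<Longrightarrow> - x \<in> A"
    and mult_mem: "x \<in> A \<Longrightarrow> y \<in> A \<Longrightarrow> x * y \<in> A"
    and phi_mem: "x \<in> A \<Longrightarrow> \<phi> x \<in> A"
    and phi_one: "\<phi> 1 = 1"
    and phi_add: "\<phi> (x + y) = \<phi> x + \<phi> y"
    and phi_mult: "\<phi> (x * y) = \<phi> x * \<phi> y"
    and frobenius: "x \<in> A \<Longrightarrow> \<exists>y\<in>A. x ^ p = \<phi> x + of_nat p * y"
begin

lemma zero_mem: "0 \<in> A"
  using add_mem [OF one_mem neg_mem [OF one_mem]] by simp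

lemma diff_mem: "x \<in> A \<Longrightarrow> y \<in> A \<Longrightarrow> x - y \<in> A"
  using add_mem [OF _ neg_mem] by fastforce

lemma power_mem: "x \<in> A \<Longrightarrow> x ^ n \<in> A"
  by (induction n) (auto intro: one_mem mult_mem)

lemma sum_mem: "(\<And>i. i \<in> I \<Longrightarrow> f i \<in> A) \<Longrightarrow> sum f I \<in> A"
  by (induction I rule: infinite_finite_induct) (auto intro: zero_mem add_mem)

lemma of_nat_mem: "of_nat n \<in> A"
  by (induction n) (auto intro: zero_mem one_mem add_mem)

lemma phi_zero: "\<phi> 0 = 0"
  using phi_add [of 0 0] by simp

lemma phi_diff: "\<phi> (x - y) = \<phi> x - \<phi> y"
  using phi_add [of "x - y" y] by (simp add: algebra_simps)

lemma phi_power: "\<phi> (x ^ n) = \<phi> x ^ n"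
  by (induction n) (auto simp: phi_one phi_mult)

lemma phi_sum: "\<phi> (sum f I) = (\<Sum>i\<in>I. \<phi> (f i))"
  by (induction I rule: infinite_finite_induct) (auto simp: phi_zero phi_add)

lemma phi_of_nat: "\<phi> (of_nat n) = of_nat n"
  by (induction n) (auto simp: phi_zero phi_add phi_one)

lemma iter_mem: "x \<in> A \<Longrightarrow> (\<phi> ^^ i) x \<in> A"
  by (induction i) (auto intro: phi_mem)

lemma iter_zero: "(\<phi> ^^ i) 0 = 0"
  by (induction i) (auto simp: phi_zero)

lemma iter_one: "(\<phi> ^^ i) 1 = 1"
  by (induction i) (auto simp: phi_one)

lemma iter_mult: "(\<phi> ^^ i) (x * y) = (\<phi> ^^ i) x * (\<phi> ^^ i) y"
  by (induction i) (auto simp: phi_mult)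

lemma iter_power: "(\<phi> ^^ i) (x ^ n) = (\<phi> ^^ i) x ^ n"
  by (induction i) (auto simp: phi_power)

lemma iter_sum: "(\<phi> ^^ i) (sum f I) = (\<Sum>j\<in>I. (\<phi> ^^ i) (f j))"
  by (induction i) (auto simp: phi_sum)

lemma iter_of_nat: "(\<phi> ^^ i) (of_nat n) = of_nat n"
  by (induction i) (auto simp: phi_of_nat)

definition pideal :: "nat \<Rightarrow> 'a set" where
  "pideal k = {of_nat p ^ k * z | z. z \<in> A}"

lemma pidealI: "z \<in> A \<Longrightarrow> x = of_nat p ^ k * z \<Longrightarrow> x \<in> pideal k"
  by (auto simp: pideal_def)

lemma pidealE: "x \<in> pideal k \<Longrightarrow> (\<And>z. z \<in> A \<Longrightarrow> x = of_nat p ^ k * z \<Longrightarrow> thesis) \<Longrightarrow> thesis"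
  by (auto simp: pideal_def)

lemma pideal_0: "pideal 0 = A"
  by (auto simp: pideal_def)

lemma pideal_zero: "0 \<in> pideal k"
  by (rule pidealI [OF zero_mem]) simp

lemma pideal_add: "x \<in> pideal k \<Longrightarrow> y \<in> pideal k \<Longrightarrow> x + y \<in> pideal k"
  by (elim pidealE, rule pidealI [OF add_mem]) (auto simp: distrib_left)

lemma pideal_neg: "x \<in> pideal k \<Longrightarrow> - x \<in> pideal k"
  by (elim pidealE, rule pidealI [OF neg_mem]) auto

lemma pideal_mult: "x \<in> pideal j \<Longrightarrow> y \<in> pideal k \<Longrightarrow> x * y \<in> pideal (j + k)"
  by (elim pidealE, rule pidealI [OF mult_mem]) (auto simp: power_add mult_ac)

lemma pideal_mult_right: "x \<in> pideal k \<Longrightarrow> y \<in> A \<Longrightarrow> x * y \<in> pideal k"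
  using pideal_mult [of x k y 0] by (simp add: pideal_0)

lemma pideal_mult_left: "y \<in> A \<Longrightarrow> x \<in> pideal k \<Longrightarrow> y * x \<in> pideal k"
  using pideal_mult [of y 0 x k] by (simp add: pideal_0)

lemma pideal_sum: "(\<And>i. i \<in> I \<Longrightarrow> f i \<in> pideal k) \<Longrightarrow> sum f I \<in> pideal k"
  by (induction I rule: infinite_finite_induct) (auto intro: pideal_zero pideal_add)

lemma pideal_antimono:
  assumes "j \<le> k" "x \<in> pideal k"
  shows "x \<in> pideal j"
proof -
  obtain z where z: "z \<in> A" "x = of_nat p ^ k * z"
    using assms(2) by (rule pidealE)
  have "x = of_nat p ^ j * (of_nat p ^ (k - j) * z)"
    using assms(1) by (simp add: z mult.assoc [symmetric] power_add [symmetric])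
  moreover have "of_nat p ^ (k - j) * z \<in> A"
    using z by (intro mult_mem power_mem of_nat_mem)
  ultimately show ?thesis
    by (auto simp: pideal_def)
qed

lemma pideal_iter: "x \<in> pideal k \<Longrightarrow> (\<phi> ^^ i) x \<in> pideal k"
  by (elim pidealE, rule pidealI [OF iter_mem]) (auto simp: iter_mult iter_power iter_of_nat)

lemma frobenius': "x \<in> A \<Longrightarrow> x ^ p - \<phi> x \<in> pideal 1"
  using frobenius [of x] by (auto simp: pideal_def)

text \<open>In the binomial expansion of \<open>((x - y) + y) ^ p\<close> the linear term gains a
  factor p from its binomial coefficient, and every later term contains \<open>(x - y) ^ 2\<close>,
  which lies in \<open>pideal (k + k)\<close>. This is inside \<open>pideal (Suc k)\<close> because
  k is at least 1.\<close>

lemma power_cong_step: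
  assumes "x \<in> A" "y \<in> A" "x - y \<in> pideal k" "k \<ge> 1"
  shows "x ^ p - y ^ p \<in> pideal (Suc k)"
proof -
  obtain z where z: "z \<in> A" "x - y = of_nat p ^ k * z"
    using assms(3) by (rule pidealE)
  let ?d = "x - y"
  let ?f = "\<lambda>j. of_nat (p choose j) * ?d ^ j * y ^ (p - j)"
  have p0: "p > 0"
    using prime_p prime_gt_0_nat by blast
  have "x ^ p = (?d + y) ^ p"
    by simp
  also have "\<dots> = sum ?f {..p}"
    by (rule binomial_ring)
  also have "{..p} = insert 0 {0<..p}"
    by auto
  also have "sum ?f \<dots> = y ^ p + sum ?f {0<..p}"
    by simp
  finally have "x ^ p - y ^ p = sum ?f {0<..p}"
    by simp
  moreover have "?f j \<in> pideal (Suc k)" if j: "j \<in> {0<..p}" for j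
  proof (cases "j = 1")
    case True
    have "of_nat p * ?d = of_nat p ^ Suc k * z"
      by (simp add: z mult.assoc)
    then have "?f j = of_nat p ^ Suc k * (z * y ^ (p - 1))"
      by (simp only: True choose_one power_one_right mult.assoc [symmetric])
    moreover have "z * y ^ (p - 1) \<in> A"
      by (intro mult_mem power_mem z assms)
    ultimately show ?thesis
      by (rule pidealI [rotated])
  next
    case False
    then have "j \<ge> 2"
      using j by auto
    have "?d ^ 2 \<in> pideal (k + k)"
      unfolding power2_eq_square by (intro pideal_mult assms)
    then have "?d ^ 2 \<in> pideal (Suc k)"
      using assms(4) by (rule_tac pideal_antimono [of _ "k + k"]) auto
    moreover have "?d ^ j = ?d ^ 2 * ?d ^ (j - 2)"
      using \<open>j \<ge> 2\<close> by (metis le_add_diff_inverse power_add)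
    ultimately have "?d ^ j \<in> pideal (Suc k)"
      using assms by (simp only: pideal_mult_right power_mem diff_mem)
    then show ?thesis
      using assms by (intro pideal_mult_right pideal_mult_left of_nat_mem power_mem)
  qed
  ultimately show ?thesis
    by (simp only: pideal_sum)
qed

lemma power_cong:
  assumes "x \<in> A" "y \<in> A" "x - y \<in> pideal k" "k \<ge> 1"
  shows "x ^ (p ^ j) - y ^ (p ^ j) \<in> pideal (k + j)"
proof (induction j)
  case (Suc j)
  have "(x ^ (p ^ j)) ^ p - (y ^ (p ^ j)) ^ p \<in> pideal (Suc (k + j))"
    using assms Suc by (intro power_cong_step power_mem) auto
  then show ?case
    by (simp add: power_mult [symmetric] mult.commute)
qed (use assms in auto)

lemma frobenius_iter:
  assumes "x \<in> A"
  shows "x ^ (p ^ i) - (\<phi> ^^ i) x \<in> pideal 1"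
proof (induction i)
  case (Suc i)
  have "(x ^ (p ^ i)) ^ p - \<phi> (x ^ (p ^ i)) \<in> pideal 1"
    using assms by (intro frobenius' power_mem)
  moreover have "\<phi> (x ^ (p ^ i)) - \<phi> ((\<phi> ^^ i) x) \<in> pideal 1"
    using pideal_iter [OF Suc, of 1] by (simp add: phi_diff)
  ultimately have "(x ^ (p ^ i)) ^ p - \<phi> ((\<phi> ^^ i) x) \<in> pideal 1"
    using pideal_add by fastforce
  then show ?case
    by (simp add: power_mult [symmetric] mult.commute)
qed (simp add: pideal_zero)

text \<open>The precision \<open>Suc (j - i)\<close> is one more than the power of p in the
  denominator of the (j - i)-th logarithm coefficient; the extra factor pays for the 1/p in the
  functional equation.\<close>

lemma frobenius_iter_power:
  assumes "x \<in> A" "i \<le> j"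
  shows "x ^ (p ^ j) - (\<phi> ^^ i) x ^ (p ^ (j - i)) \<in> pideal (Suc (j - i))"
proof -
  have "(x ^ (p ^ i)) ^ (p ^ (j - i)) - (\<phi> ^^ i) x ^ (p ^ (j - i)) \<in> pideal (1 + (j - i))"
    using assms by (intro power_cong frobenius_iter power_mem iter_mem) auto
  then show ?thesis
    using assms by (simp add: power_mult [symmetric] power_add [symmetric])
qed

subsection \<open>Dwork congruences\<close>

text \<open>Since E m = S^(p^m - p^(m-1)) E (m - 1), the expansion of E (m - 1) can be compared with
  that of E m term by term. The i-th difference contains S^(p^(m-1)) - \<phi>^i(S)^(p^(m-1-i)),
  which supplies m - i factors p, and R i supplies i - 1 more.\<close>

lemma dwork_rem_pideal:
  assumes S: "S \<in> A" and m: "m \<ge> 1"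
  defines "E \<equiv> \<lambda>m. S ^ (p ^ m - 1)"
  shows "dwork_rem \<phi> E m \<in> pideal (m - 1)"
  using m
proof (induction m rule: less_induct)
  case (less m)
  have p0: "p > 0"
    using prime_p prime_gt_0_nat by blast
  let ?R = "dwork_rem \<phi> E"
  have E0: "E 0 = 1"
    by (simp add: E_def)
  show ?case
  proof (cases "m = 1")
    case True
    have "{0<..<1} = ({} :: nat set)" by auto
    then have "?R 1 = E 1"
      by (simp only: dwork_rem.simps [of \<phi> E 1] sum.empty diff_zero)
    then show ?thesis
      using S by (simp only: True diff_self_eq_0 pideal_0 E_def power_mem)
  next
    case False
    then obtain n where n: "m = Suc n" "n \<ge> 1"
      using less.prems by (cases m) auto
    have ins: "{0<..<m} = insert n {0<..<n}"
      using n by auto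
    \<comment> \<open>The term i = n is R n itself, because E 0 = 1.\<close>
    have "E n = (\<Sum>i\<in>{0<..<m}. ?R i * (\<phi> ^^ i) (E (n - i)))"
      unfolding ins using dwork_rem.simps [of \<phi> E n] by (subst sum.insert) (auto simp: E0 iter_one)
    moreover have "E m = S ^ (p ^ m - p ^ n) * E n"
    proof -
      have "p ^ n \<le> p ^ m" "1 \<le> p ^ n"
        using p0 n by (auto intro: power_increasing)
      then show ?thesis
        by (simp add: E_def power_add [symmetric])
    qed
    ultimately have "?R m = (\<Sum>i\<in>{0<..<m}. ?R i * (S ^ (p ^ m - p ^ n) * (\<phi> ^^ i) (E (n - i)) - (\<phi> ^^ i) (E (m - i))))"
      by (subst dwork_rem.simps) (simp add: sum_distrib_left sum_subtractf [symmetric] algebra_simps)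
    also have "\<dots> \<in> pideal (m - 1)"
    proof (rule pideal_sum)
      fix i assume i: "i \<in> {0<..<m}"
      let ?T = "(\<phi> ^^ i) S"
      have T: "?T \<in> A"
        using S by (rule iter_mem)
      have e1: "p ^ m - p ^ n = p ^ n * (p - 1)"
        by (simp add: n algebra_simps)
      have "p ^ (m - i) = p * p ^ (n - i)"
        using i n by (simp add: Suc_diff_le)
      moreover have "p ^ (n - i) \<ge> 1" "p \<ge> 1"
        using p0 by auto
      ultimately have e2: "p ^ (m - i) - 1 = p ^ (n - i) * (p - 1) + (p ^ (n - i) - 1)"
        by (simp add: algebra_simps)
      have "S ^ (p ^ m - p ^ n) * (\<phi> ^^ i) (E (n - i)) - (\<phi> ^^ i) (E (m - i)) =
          ((S ^ (p ^ n)) ^ (p - 1) - (?T ^ (p ^ (n - i))) ^ (p - 1)) * ?T ^ (p ^ (n - i) - 1)"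
        unfolding E_def iter_power e1 e2 unfolding power_add power_mult by (simp add: algebra_simps)
      also have "(S ^ (p ^ n)) ^ (p - 1) - (?T ^ (p ^ (n - i))) ^ (p - 1) =
          (S ^ (p ^ n) - ?T ^ (p ^ (n - i))) *
            (\<Sum>k<p - 1. (?T ^ (p ^ (n - i))) ^ (p - 1 - Suc k) * (S ^ (p ^ n)) ^ k)"
        by (rule power_diff_sumr2)
      finally have eq: "S ^ (p ^ m - p ^ n) * (\<phi> ^^ i) (E (n - i)) - (\<phi> ^^ i) (E (m - i)) = \<dots> * ?T ^ (p ^ (n - i) - 1)" .
      have "S ^ (p ^ n) - ?T ^ (p ^ (n - i)) \<in> pideal (Suc (n - i))"
        using i n S by (intro frobenius_iter_power) auto
      then have "S ^ (p ^ m - p ^ n) * (\<phi> ^^ i) (E (n - i)) - (\<phi> ^^ i) (E (m - i)) \<in> pideal (Suc (n - i))"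
        unfolding eq using S T by (intro pideal_mult_right sum_mem mult_mem power_mem)
      moreover have "?R i \<in> pideal (i - 1)"
        using i by (intro less.IH) auto
      ultimately have "?R i * (S ^ (p ^ m - p ^ n) * (\<phi> ^^ i) (E (n - i)) - (\<phi> ^^ i) (E (m - i))) \<in> pideal (i - 1 + Suc (n - i))"
        by (rule pideal_mult [rotated])
      moreover have "i - 1 + Suc (n - i) = m - 1"
        using i n by auto
      ultimately show "?R i * (S ^ (p ^ m - p ^ n) * (\<phi> ^^ i) (E (n - i)) - (\<phi> ^^ i) (E (m - i))) \<in> pideal (m - 1)"
        by simp
    qed
    finally show ?thesis .
  qed
qed

text \<open>As H inverts S, \<phi>^i(E k) equals \<phi>^i(S)^(p^k) \<phi>^i(H). In the expansion of
  E m each power \<phi>^i(S)^(p^(m-i)) may be replaced by S^(p^m): the error has m - i + 1 factors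
  p, and R i has i - 1. Afterwards the unit S^(p^m) is cancelled.\<close>

lemma dwork_expansion:
  assumes S: "S \<in> A" and H: "H \<in> A" and SH: "S * H = 1" and m: "m \<ge> 1"
  defines "E \<equiv> \<lambda>m. S ^ (p ^ m - 1)"
  shows "H - (\<Sum>i\<in>{0<..m}. dwork_rem \<phi> E i * (\<phi> ^^ i) H) \<in> pideal m"
proof -
  have p0: "p > 0"
    using prime_p prime_gt_0_nat by blast
  let ?R = "dwork_rem \<phi> E"
  have E0: "E 0 = 1"
    by (simp add: E_def)
  have ins: "{0<..m} = insert m {0<..<m}"
    using m by auto
  have "E m = (\<Sum>i\<in>{0<..m}. ?R i * (\<phi> ^^ i) (E (m - i)))"
    unfolding ins using dwork_rem.simps [of \<phi> E m] by (subst sum.insert) (auto simp: E0 iter_one)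
  moreover have EH: "(\<phi> ^^ i) (E k) = (\<phi> ^^ i) S ^ (p ^ k) * (\<phi> ^^ i) H" for i k
  proof -
    have "p ^ k = Suc (p ^ k - 1)"
      using p0 by simp
    then have "S ^ (p ^ k) * H = S ^ (p ^ k - 1) * (S * H)"
      by (metis mult.assoc power_Suc2)
    then have "E k = S ^ (p ^ k) * H"
      by (simp add: E_def SH)
    then show ?thesis
      by (simp add: iter_mult iter_power)
  qed
  ultimately have eq: "S ^ (p ^ m) * H = (\<Sum>i\<in>{0<..m}. ?R i * ((\<phi> ^^ i) S ^ (p ^ (m - i)) * (\<phi> ^^ i) H))"
    using EH [of 0 m] by simp
  have "S ^ (p ^ m) * (H - (\<Sum>i\<in>{0<..m}. ?R i * (\<phi> ^^ i) H)) =
      - (\<Sum>i\<in>{0<..m}. ?R i * (\<phi> ^^ i) H * (S ^ (p ^ m) - (\<phi> ^^ i) S ^ (p ^ (m - i))))"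
    unfolding right_diff_distrib eq
    by (simp add: sum_distrib_left sum_subtractf algebra_simps)
  also have "\<dots> \<in> pideal m"
  proof (intro pideal_neg pideal_sum)
    fix i assume i: "i \<in> {0<..m}"
    have "?R i \<in> pideal (i - 1)"
      unfolding E_def using i S by (intro dwork_rem_pideal) auto
    moreover have "S ^ (p ^ m) - (\<phi> ^^ i) S ^ (p ^ (m - i)) \<in> pideal (Suc (m - i))"
      using i S by (intro frobenius_iter_power) auto
    ultimately have "?R i * (S ^ (p ^ m) - (\<phi> ^^ i) S ^ (p ^ (m - i))) * (\<phi> ^^ i) H \<in> pideal (i - 1 + Suc (m - i))"
      using H by (intro pideal_mult_right pideal_mult iter_mem)
    moreover have "i - 1 + Suc (m - i) = m"
      using i by auto
    ultimately show "?R i * (\<phi> ^^ i) H * (S ^ (p ^ m) - (\<phi> ^^ i) S ^ (p ^ (m - i))) \<in> pideal m"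
      by (simp add: mult_ac)
  qed
  finally have "H ^ (p ^ m) * (S ^ (p ^ m) * (H - (\<Sum>i\<in>{0<..m}. ?R i * (\<phi> ^^ i) H))) \<in> pideal m"
    by (rule pideal_mult_left [OF power_mem [OF H]])
  moreover have "H ^ (p ^ m) * (S ^ (p ^ m) * (H - (\<Sum>i\<in>{0<..m}. ?R i * (\<phi> ^^ i) H))) =
     (S * H) ^ (p ^ m) * (H - (\<Sum>i\<in>{0<..m}. ?R i * (\<phi> ^^ i) H))"
    unfolding power_mult_distrib by (simp add: mult_ac)
  ultimately show ?thesis
    by (simp add: SH)
qed

subsection \<open>Integrality of Hazewinkel generators\<close>

text \<open>A functional equation lemma in the style of Hazewinkel. With \<open>lg\<close> the
  logarithm coefficients and \<open>c i\<close> the integral quotients r i / p^(i-1), the hypothesis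
  \<open>fe\<close> reads lg m = g m + (1/p) times the sum of c i \<phi>^i(lg (m - i)), with g
  integral. Inserted into the recursion for v n, this makes all nonintegral parts cancel.\<close>

lemma hazewinkel_integral:
  assumes pinv: "of_nat p * \<pi> = 1"
    and a: "\<And>j. a j \<in> A" and r: "\<And>i. i \<ge> 1 \<Longrightarrow> r i \<in> pideal (i - 1)"
    and fe: "\<And>m. m \<ge> 1 \<Longrightarrow> a m - (\<Sum>i\<in>{0<..m}. r i * (\<phi> ^^ i) (a (m - i))) \<in> pideal m"
    and a0: "a 0 = 1"
    and v: "\<And>n. n \<ge> 1 \<Longrightarrow> of_nat p * (\<pi> ^ n * a n) = (\<Sum>j<n. \<pi> ^ j * a j * v (n - j) ^ (p ^ j))"
    and n: "n \<ge> 1"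
  shows "v n \<in> A"
  using n
proof (induction n rule: less_induct)
  case (less n)
  define lg where "lg j = \<pi> ^ j * a j" for j
  define c where "c i = \<pi> ^ (i - 1) * r i" for i
  define g where "g m = \<pi> ^ m * (a m - (\<Sum>i\<in>{0<..m}. r i * (\<phi> ^^ i) (a (m - i))))" for m
  have cancel: "\<pi> ^ k * x \<in> A" if "x \<in> pideal k" for k x
  proof -
    obtain z where "z \<in> A" "x = of_nat p ^ k * z"
      using \<open>x \<in> pideal k\<close> by (rule pidealE)
    then have "\<pi> ^ k * x = (of_nat p * \<pi>) ^ k * z"
      by (simp add: power_mult_distrib mult_ac)
    then show ?thesis
      using \<open>z \<in> A\<close> by (simp add: pinv)
  qed
  have c: "c i \<in> A" if "i \<ge> 1" for i
    unfolding c_def using r [OF that] by (rule cancel)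
  have g: "g m \<in> A" if "m \<ge> 1" for m
    unfolding g_def using fe [OF that] by (rule cancel)
  have phi_pinv: "(\<phi> ^^ i) \<pi> = \<pi>" for i
  proof -
    have "of_nat p * (\<phi> ^^ i) \<pi> = 1"
      using arg_cong [OF pinv, of "\<phi> ^^ i"] by (simp add: iter_mult iter_one iter_of_nat)
    then have "\<pi> * (of_nat p * (\<phi> ^^ i) \<pi>) = \<pi>"
      by simp
    then have "(of_nat p * \<pi>) * (\<phi> ^^ i) \<pi> = \<pi>"
      by (simp only: mult_ac)
    then show ?thesis
      by (simp add: pinv)
  qed
  have el: "lg m = g m + (\<Sum>i\<in>{0<..m}. c i * \<pi> * (\<phi> ^^ i) (lg (m - i)))" for m
  proof -
    have "c i * \<pi> * (\<phi> ^^ i) (lg (m - i)) = \<pi> ^ m * (r i * (\<phi> ^^ i) (a (m - i)))" if "i \<in> {0<..m}" for i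
    proof -
      have "i - 1 + Suc (m - i) = m"
        using that by auto
      then have "\<pi> ^ m = \<pi> ^ (i - 1) * \<pi> * \<pi> ^ (m - i)"
        by (metis mult.assoc power_Suc power_add)
      then show ?thesis
        by (simp add: c_def lg_def iter_mult iter_power phi_pinv mult_ac)
    qed
    then have "(\<Sum>i\<in>{0<..m}. c i * \<pi> * (\<phi> ^^ i) (lg (m - i))) = \<pi> ^ m * (\<Sum>i\<in>{0<..m}. r i * (\<phi> ^^ i) (a (m - i)))"
      by (simp add: sum_distrib_left)
    then show ?thesis
      by (simp add: g_def lg_def right_diff_distrib)
  qed
  have vrec: "of_nat p * lg k = (\<Sum>j<k. lg j * v (k - j) ^ (p ^ j))" if "k \<ge> 1" for k
    using v [OF that] by (simp add: lg_def)
  have vA: "v k \<in> A" if "1 \<le> k" "k < n" for k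
    using less that by auto
  have ins: "{..<n} = insert 0 {0<..<n}"
    using less.prems by auto
  \<comment> \<open>The error of moving \<phi>^i inside the power. It has j - i + 1 factors p,
    exactly what the denominator of (1/p) \<phi>^i(lg (j - i)) requires.\<close>
  define w where "w i j = v (n - j) ^ (p ^ j) - (\<phi> ^^ i) (v (n - j)) ^ (p ^ (j - i))" for i j
  have "of_nat p * lg n = v n + (\<Sum>j\<in>{0<..<n}. lg j * v (n - j) ^ (p ^ j))"
    unfolding vrec [OF less.prems] ins by (subst sum.insert) (auto simp: lg_def a0)
  also have "(\<Sum>j\<in>{0<..<n}. lg j * v (n - j) ^ (p ^ j)) =
      (\<Sum>j\<in>{0<..<n}. g j * v (n - j) ^ (p ^ j)) +
      (\<Sum>j\<in>{0<..<n}. \<Sum>i\<in>{0<..j}. c i * \<pi> * (\<phi> ^^ i) (lg (j - i)) * v (n - j) ^ (p ^ j))"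
    by (subst el) (simp add: distrib_right sum.distrib sum_distrib_right)
  also have "(\<Sum>j\<in>{0<..<n}. \<Sum>i\<in>{0<..j}. c i * \<pi> * (\<phi> ^^ i) (lg (j - i)) * v (n - j) ^ (p ^ j)) =
      (\<Sum>j\<in>{0<..<n}. \<Sum>i\<in>{0<..j}. c i * \<pi> * (\<phi> ^^ i) (lg (j - i)) * w i j) +
      (\<Sum>j\<in>{0<..<n}. \<Sum>i\<in>{0<..j}. c i * \<pi> * (\<phi> ^^ i) (lg (j - i) * v (n - j) ^ (p ^ (j - i))))"
    by (simp add: w_def sum.distrib [symmetric] iter_mult iter_power algebra_simps)
  also have "(\<Sum>j\<in>{0<..<n}. \<Sum>i\<in>{0<..j}. c i * \<pi> * (\<phi> ^^ i) (lg (j - i) * v (n - j) ^ (p ^ (j - i)))) =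
      (\<Sum>i\<in>{0<..<n}. \<Sum>j\<in>{i..<n}. c i * \<pi> * (\<phi> ^^ i) (lg (j - i) * v (n - j) ^ (p ^ (j - i))))"
    unfolding sum.Sigma [of "{0<..<n}" "\<lambda>j. {0<..j}", OF finite_greaterThanLessThan ballI [OF finite_greaterThanAtMost]]
      sum.Sigma [of "{0<..<n}" "\<lambda>i. {i..<n}", OF finite_greaterThanLessThan ballI [OF finite_atLeastLessThan]]
    by (rule sum.reindex_bij_witness [of _ "\<lambda>(i, j). (j, i)" "\<lambda>(i, j). (j, i)"]) auto
  \<comment> \<open>For fixed i the inner sum is \<phi>^i applied to the recursion at n - i. It
    yields p lg (n - i), and this p cancels \<open>\<pi>\<close>.\<close>
  also have "\<dots> = (\<Sum>i\<in>{0<..<n}. c i * (\<phi> ^^ i) (lg (n - i)))"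
  proof (rule sum.cong [OF refl])
    fix i assume i: "i \<in> {0<..<n}"
    have "(\<Sum>j\<in>{i..<n}. lg (j - i) * v (n - j) ^ (p ^ (j - i))) = (\<Sum>j<n - i. lg j * v (n - i - j) ^ (p ^ j))"
      by (rule sum.reindex_bij_witness [of _ "\<lambda>j. j + i" "\<lambda>j. j - i"]) auto
    also have "\<dots> = of_nat p * lg (n - i)"
      using i by (subst vrec) auto
    finally have "(\<Sum>j\<in>{i..<n}. c i * \<pi> * (\<phi> ^^ i) (lg (j - i) * v (n - j) ^ (p ^ (j - i)))) =
        c i * \<pi> * (\<phi> ^^ i) (of_nat p * lg (n - i))"
      by (simp add: sum_distrib_left [symmetric] iter_sum [symmetric])
    also have "\<dots> = of_nat p * \<pi> * (c i * (\<phi> ^^ i) (lg (n - i)))"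
      by (simp add: iter_mult iter_of_nat mult_ac)
    finally show "(\<Sum>j\<in>{i..<n}. c i * \<pi> * (\<phi> ^^ i) (lg (j - i) * v (n - j) ^ (p ^ (j - i)))) =
        c i * (\<phi> ^^ i) (lg (n - i))"
      by (simp add: pinv)
  qed
  finally have v_eq: "v n = of_nat p * lg n - (\<Sum>j\<in>{0<..<n}. g j * v (n - j) ^ (p ^ j))
      - (\<Sum>j\<in>{0<..<n}. \<Sum>i\<in>{0<..j}. c i * \<pi> * (\<phi> ^^ i) (lg (j - i)) * w i j)
      - (\<Sum>i\<in>{0<..<n}. c i * (\<phi> ^^ i) (lg (n - i)))"
    by (simp add: algebra_simps)
  have ins': "{0<..n} = insert n {0<..<n}"
    using less.prems by auto
  \<comment> \<open>The functional equation at n produces the same sum over 0 < i < n, so both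
    disappear; the term i = n leaves only the integral c n.\<close>
  have "of_nat p * lg n = of_nat p * g n + of_nat p * \<pi> * (\<Sum>i\<in>{0<..n}. c i * (\<phi> ^^ i) (lg (n - i)))"
    by (subst el) (simp add: distrib_left sum_distrib_left mult_ac)
  also have "\<dots> = of_nat p * g n + c n + (\<Sum>i\<in>{0<..<n}. c i * (\<phi> ^^ i) (lg (n - i)))"
    unfolding ins' pinv by (subst sum.insert) (auto simp: lg_def a0 iter_one)
  finally have "v n = of_nat p * g n + c n - (\<Sum>j\<in>{0<..<n}. g j * v (n - j) ^ (p ^ j))
      - (\<Sum>j\<in>{0<..<n}. \<Sum>i\<in>{0<..j}. c i * \<pi> * (\<phi> ^^ i) (lg (j - i)) * w i j)"
    unfolding v_eq by simp
  moreover have "c i * \<pi> * (\<phi> ^^ i) (lg (j - i)) * w i j \<in> A" if "j \<in> {0<..<n}" "i \<in> {0<..j}" for i j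
  proof -
    have "w i j \<in> pideal (Suc (j - i))"
      unfolding w_def using that by (intro frobenius_iter_power vA) auto
    then have "\<pi> ^ Suc (j - i) * w i j \<in> A"
      by (rule cancel)
    then have "c i * (\<phi> ^^ i) (a (j - i)) * (\<pi> ^ Suc (j - i) * w i j) \<in> A"
      using that by (intro mult_mem [OF mult_mem [OF c iter_mem [OF a]]]) auto
    then show ?thesis
      by (simp add: lg_def iter_mult iter_power phi_pinv mult_ac)
  qed
  ultimately show ?case
  proof (elim ssubst, intro diff_mem)
    show "of_nat p * g n + c n \<in> A"
      using less.prems by (intro add_mem mult_mem of_nat_mem g c)
    show "(\<Sum>j\<in>{0<..<n}. g j * v (n - j) ^ (p ^ j)) \<in> A"
      by (intro sum_mem mult_mem g power_mem vA) auto
    show "(\<Sum>j\<in>{0<..<n}. \<Sum>i\<in>{0<..j}. c i * \<pi> * (\<phi> ^^ i) (lg (j - i)) * w i j) \<in> A"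
      by (intro sum_mem) fact
  qed
qed

end

section \<open>Frobenius lifts on localized integers and on power series\<close>

lemma frobenius_liftI:
  fixes A :: "'a::comm_ring_1 set"
  assumes "Factorial_Ring.prime p" "1 \<in> A" "\<And>x y. x \<in> A \<Longrightarrow> y \<in> A \<Longrightarrow> x + y \<in> A" "\<And>x. x \<in> A \<Longrightarrow> - x \<in> A"
    "\<And>x y. x \<in> A \<Longrightarrow> y \<in> A \<Longrightarrow> x * y \<in> A" "\<And>x. x \<in> A \<Longrightarrow> \<phi> x \<in> A"
    "\<phi> 1 = 1" "\<And>x y. \<phi> (x + y) = \<phi> x + \<phi> y" "\<And>x y. \<phi> (x * y) = \<phi> x * \<phi> y"
    "\<And>x. x \<in> A \<Longrightarrow> \<exists>y\<in>A. x ^ p = \<phi> x + of_nat p * y"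
  shows "frobenius_lift p A \<phi>"
  using assms by (simp add: frobenius_lift_def)

definition fps_over :: "'a::zero set \<Rightarrow> 'a fps set" where
  "fps_over A = {h. \<forall>n. fps_nth h n \<in> A}"

text \<open>This is h(X) \<mapsto> h^\<phi>(X^p). The construction is used twice: in the variable
  q^(1/2) over the localized integers, and then in u over the resulting power series.\<close>

definition fps_frob :: "nat \<Rightarrow> ('a::zero \<Rightarrow> 'a) \<Rightarrow> 'a fps \<Rightarrow> 'a fps" where
  "fps_frob p \<phi> h = Abs_fps (\<lambda>n. if p dvd n then \<phi> (fps_nth h (n div p)) else 0)"

lemma fps_frob_nth: "fps_nth (fps_frob p \<phi> h) n = (if p dvd n then \<phi> (fps_nth h (n div p)) else 0)"
  by (simp add: fps_frob_def)

context frobenius_lift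
begin

lemma fps_over_one: "1 \<in> fps_over A"
  by (auto simp: fps_over_def zero_mem one_mem)

lemma fps_over_mult: "f \<in> fps_over A \<Longrightarrow> g \<in> fps_over A \<Longrightarrow> f * g \<in> fps_over A"
  by (auto simp: fps_over_def fps_mult_nth intro!: sum_mem mult_mem)

lemma fps_over_power: "f \<in> fps_over A \<Longrightarrow> f ^ n \<in> fps_over A"
  by (induction n) (auto intro: fps_over_one fps_over_mult)

lemma fps_frob_mult: "fps_frob p \<phi> (f * g) = fps_frob p \<phi> f * fps_frob p \<phi> g"
proof (rule fps_ext)
  fix n
  have p0: "p > 0"
    using prime_p prime_gt_0_nat by blast
  let ?F = "fps_frob p \<phi> f" and ?G = "fps_frob p \<phi> g"
  show "fps_nth (fps_frob p \<phi> (f * g)) n = fps_nth (?F * ?G) n"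
  proof (cases "p dvd n")
    case True
    then obtain m where m: "n = p * m" ..
    have "fps_nth (?F * ?G) n = (\<Sum>i=0..n. fps_nth ?F i * fps_nth ?G (n - i))"
      by (rule fps_mult_nth)
    also have "\<dots> = (\<Sum>i\<in>(\<lambda>i. p * i) ` {0..m}. fps_nth ?F i * fps_nth ?G (n - i))"
    proof (rule sum.mono_neutral_right)
      show "\<forall>i\<in>{0..n} - (\<lambda>i. p * i) ` {0..m}. fps_nth ?F i * fps_nth ?G (n - i) = 0"
        using p0 by (auto simp: fps_frob_nth m dvd_def)
    qed (use p0 in \<open>auto simp: m\<close>)
    also have "\<dots> = (\<Sum>i\<in>{0..m}. \<phi> (fps_nth f i) * \<phi> (fps_nth g (m - i)))"
      using p0 by (subst sum.reindex)
        (auto simp: inj_on_def fps_frob_nth m right_diff_distrib' [symmetric] intro!: sum.cong)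
    also have "\<dots> = fps_nth (fps_frob p \<phi> (f * g)) n"
      using p0 by (simp add: fps_frob_nth m fps_mult_nth phi_sum phi_mult)
    finally show ?thesis ..
  next
    case False
    then have "\<not> p dvd i \<or> \<not> p dvd (n - i)" if "i \<le> n" for i
      using that by (metis dvd_diffD)
    then have "fps_nth (?F * ?G) n = 0"
      unfolding fps_mult_nth by (intro sum.neutral) (auto simp: fps_frob_nth)
    then show ?thesis
      using False by (simp add: fps_frob_nth)
  qed
qed

lemma fps_frob_one: "fps_frob p \<phi> 1 = 1"
  using prime_p prime_gt_0_nat [of p] by (auto simp: fps_eq_iff fps_frob_nth phi_one phi_zero)

text \<open>The coefficients below \<open>n\<close> of both sides only depend on those of \<open>h\<close>, which turns the
  statement into the congruence for a polynomial, a sum of monomials.\<close>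

lemma fps_frobenius_nth:
  assumes h: "h \<in> fps_over A"
  shows "fps_nth (h ^ p - fps_frob p \<phi> h) n \<in> pideal 1"
proof -
  interpret pi: frobenius_lift p A \<phi> by unfold_locales
  have p0: "p > 0"
    using prime_p prime_gt_0_nat by blast
  define J where "J = {f :: 'a fps. \<forall>n. fps_nth f n \<in> pideal 1}"
  have J_add: "f + g \<in> J" if "f \<in> J" "g \<in> J" for f g
    using that by (auto simp: J_def intro: pideal_add)
  \<comment> \<open>Modulo p the p-th power is additive, since p divides the inner binomial
    coefficients; \<open>J\<close> consists of the series with all coefficients divisible by
    p.\<close>
  have fresh: "(f + g) ^ p - f ^ p - g ^ p \<in> J" if fg: "f \<in> fps_over A" "g \<in> fps_over A" for f g
  proof -
    let ?f = "\<lambda>k. of_nat (p choose k) * f ^ k * g ^ (p - k)"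
    have "(f + g) ^ p = sum ?f {..p}"
      by (rule binomial_ring)
    also have "{..p} = insert 0 (insert p {0<..<p})"
      by auto
    also have "sum ?f \<dots> = f ^ p + g ^ p + sum ?f {0<..<p}"
      using p0 by (simp add: algebra_simps)
    finally have "(f + g) ^ p - f ^ p - g ^ p = sum ?f {0<..<p}"
      by simp
    moreover have "fps_nth (?f k) n \<in> pideal 1" if "k \<in> {0<..<p}" for k n
    proof -
      have "p dvd (p choose k)"
        using that prime_p by (intro dvd_choose_prime) auto
      then obtain c where c: "p choose k = p * c" ..
      have "?f k = fps_const (of_nat (p * c)) * (f ^ k * g ^ (p - k))"
        by (simp only: c fps_of_nat mult.assoc)
      then have "fps_nth (?f k) n = of_nat p ^ 1 * (of_nat c * fps_nth (f ^ k * g ^ (p - k)) n)"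
        by (simp add: mult.assoc)
      moreover have "f ^ k * g ^ (p - k) \<in> fps_over A"
        using fg by (intro fps_over_mult fps_over_power)
      ultimately show ?thesis
        by (intro pidealI) (auto simp: fps_over_def intro: mult_mem of_nat_mem)
    qed
    ultimately show ?thesis
      by (auto simp: J_def fps_sum_nth intro!: pideal_sum)
  qed
  have cut: "fps_cutoff m h ^ p - fps_frob p \<phi> (fps_cutoff m h) \<in> J" for m
  proof (induction m)
    case 0
    then show ?case
      using p0 by (auto simp: J_def fps_frob_nth phi_zero power_0_left pideal_zero)
  next
    case (Suc m)
    let ?c = "fps_cutoff m h" and ?x = "fps_const (fps_nth h m) * fps_X ^ m"
    have eq: "fps_cutoff (Suc m) h = ?c + ?x"
      by (auto simp: fps_eq_iff less_Suc_eq)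
    have frob_add: "fps_frob p \<phi> (?c + ?x) = fps_frob p \<phi> ?c + fps_frob p \<phi> ?x"
      by (auto simp: fps_eq_iff fps_frob_nth phi_add)
    have "(?c + ?x) ^ p - ?c ^ p - ?x ^ p \<in> J"
      using h by (intro fresh) (auto simp: fps_over_def zero_mem)
    moreover have "?x ^ p - fps_frob p \<phi> ?x = fps_const (fps_nth h m ^ p - \<phi> (fps_nth h m)) * fps_X ^ (m * p)"
      using p0 by (auto simp: fps_eq_iff fps_frob_nth power_mult_distrib fps_const_power power_mult [symmetric] phi_zero
          simp del: fps_const_sub)
    then have "?x ^ p - fps_frob p \<phi> ?x \<in> J"
      using h frobenius' by (auto simp: J_def fps_over_def pideal_zero)
    ultimately have "((?c + ?x) ^ p - ?c ^ p - ?x ^ p) + (?x ^ p - fps_frob p \<phi> ?x) + (?c ^ p - fps_frob p \<phi> ?c) \<in> J"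
      using Suc J_add by blast
    moreover have "((?c + ?x) ^ p - ?c ^ p - ?x ^ p) + (?x ^ p - fps_frob p \<phi> ?x) + (?c ^ p - fps_frob p \<phi> ?c) =
        fps_cutoff (Suc m) h ^ p - fps_frob p \<phi> (fps_cutoff (Suc m) h)"
      unfolding eq frob_add by (simp add: algebra_simps)
    ultimately show ?case
      by simp
  qed
  have "fps_nth (fps_cutoff (Suc n) h ^ k) j = fps_nth (h ^ k) j" if "j \<le> n" for k j
    using that by (induction k arbitrary: j) (auto simp: fps_mult_nth)
  then have "fps_nth (h ^ p - fps_frob p \<phi> h) n =
      fps_nth (fps_cutoff (Suc n) h ^ p - fps_frob p \<phi> (fps_cutoff (Suc n) h)) n"
    by (simp add: fps_frob_nth le_imp_less_Suc)
  then show ?thesis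
    using cut [of "Suc n"] by (simp add: J_def)
qed

lemma fps_lift: "frobenius_lift p (fps_over A) (fps_frob p \<phi>)"
proof (rule frobenius_liftI)
  fix h assume h: "h \<in> fps_over A"
  have "\<exists>z. z \<in> A \<and> fps_nth (h ^ p - fps_frob p \<phi> h) n = of_nat p * z" for n
    using fps_frobenius_nth [OF h, of n] by (auto simp: pideal_def)
  then obtain z where z: "\<And>n. z n \<in> A" "\<And>n. fps_nth (h ^ p - fps_frob p \<phi> h) n = of_nat p * z n"
    by metis
  have "h ^ p - fps_frob p \<phi> h = of_nat p * Abs_fps z"
    by (simp add: fps_eq_iff z(2) fps_of_nat [symmetric] del: fps_sub_nth)
  then have "h ^ p = fps_frob p \<phi> h + of_nat p * Abs_fps z"
    by (metis add_diff_cancel_left' add.commute diff_add_cancel)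
  then show "\<exists>y\<in>fps_over A. h ^ p = fps_frob p \<phi> h + of_nat p * y"
    using z(1) by (intro bexI [of _ "Abs_fps z"]) (auto simp: fps_over_def)
qed (use prime_p in \<open>auto simp: fps_over_one fps_over_mult fps_frob_one fps_frob_mult phi_mem,
    auto simp: fps_over_def fps_frob_def fps_eq_iff add_mem neg_mem phi_add phi_mem zero_mem\<close>)

end

text \<open>Fermat's little theorem: for x = a/b the difference x^p - x has numerator a^p b - a b^p,
  divisible by p, over the denominator b^p b, which is prime to p.\<close>

lemma local_ints_frobenius:
  assumes p: "Factorial_Ring.prime p"
  shows "frobenius_lift p (local_ints p :: 'a::field_char_0 set) (\<lambda>x. x)"
proof (rule frobenius_liftI)
  note pr = p [THEN prime_imp_prime_elem, unfolded prime_elem_def]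
  have pint: "Factorial_Ring.prime (int p)"
    using p by simp
  show "1 \<in> (local_ints p :: 'a set)"
    using pint by (auto simp: local_ints_def intro!: exI [of _ 1] dest: not_prime_unit)
  fix x :: 'a assume "x \<in> local_ints p"
  then obtain a b where x: "x = of_int a / of_int b" and b: "\<not> int p dvd b"
    by (auto simp: local_ints_def)
  have b0: "b \<noteq> 0"
    using b by auto
  show "- x \<in> local_ints p"
    using b unfolding local_ints_def x by (intro CollectI exI [of _ "- a"] exI [of _ b]) auto
  show "\<exists>y\<in>local_ints p. x ^ p = x + of_nat p * y"
  proof -
    have fermat: "[c ^ p = c] (mod int p)" for c :: int
    proof -
      have p0: "p > 0"
        using p prime_gt_0_nat by blast
      define n where "n = nat (c mod int p)"
      have cn: "[c = int n] (mod int p)"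
        using p0 by (simp add: n_def)
      have "[n ^ p = n] (mod p)"
      proof (cases "p dvd n")
        case True
        then have "p dvd n ^ p"
          using p0 by (metis dvd_power dvd_trans)
        with True show ?thesis
          by (simp add: cong_def)
      next
        case False
        then have "[n ^ (p - 1) * n = 1 * n] (mod p)"
          using p by (intro cong_mult fermat_theorem) auto
        then show ?thesis
          using p0 by (simp add: power_Suc2 [symmetric] del: power_Suc2)
      qed
      then have "[int n ^ p = int n] (mod int p)"
        by (metis cong_int_iff of_nat_power)
      then show ?thesis
        using cn cong_pow cong_trans cong_sym by metis
    qed
    have "int p dvd a ^ p * b - a * b ^ p"
      using cong_diff [OF cong_mult [OF fermat [of a] cong_refl [of b]] cong_mult [OF cong_refl [of a] fermat [of b]]]
      by (simp add: cong_0_iff mult.commute)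
    then obtain c where c: "a ^ p * b - a * b ^ p = int p * c" ..
    show ?thesis
    proof (rule bexI)
      have "of_int (a ^ p * b - a * b ^ p) = (of_int (int p * c) :: 'a)"
        by (simp only: c)
      then have "(of_int a) ^ p * of_int b - of_int a * (of_int b) ^ p = (of_nat p * of_int c :: 'a)"
        by simp
      then show "x ^ p = x + of_nat p * (of_int c / of_int (b ^ p * b))"
        using b0 by (simp add: x power_divide field_simps)
      have "\<not> int p dvd b ^ p * b"
        using b pint prime_dvd_mult_iff prime_dvd_power by blast
      then show "of_int c / of_int (b ^ p * b) \<in> (local_ints p :: 'a set)"
        unfolding local_ints_def by blast
    qed
  qed
  fix y :: 'a assume "y \<in> local_ints p"
  then obtain c d where y: "y = of_int c / of_int d" and d: "\<not> int p dvd d"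
    by (auto simp: local_ints_def)
  have d0: "d \<noteq> 0"
    using d by auto
  have bd: "\<not> int p dvd b * d"
    using b d pint by (simp add: prime_dvd_mult_iff)
  have "x + y = of_int (a * d + c * b) / of_int (b * d)" "x * y = of_int (a * c) / of_int (b * d)"
    using b0 d0 by (auto simp: x y field_simps)
  with bd show "x + y \<in> local_ints p" "x * y \<in> local_ints p"
    unfolding local_ints_def by blast+
qed (use p in auto)


section \<open>The functional equation for Legendre coefficients\<close>

definition fps_supp4 :: "nat \<Rightarrow> 'a::zero fps \<Rightarrow> bool" where
  "fps_supp4 d f \<longleftrightarrow> (\<forall>n. fps_nth f n \<noteq> 0 \<longrightarrow> 4 dvd n \<and> n \<le> d)"

lemma fps_supp4_mult:
  fixes f g :: "'a::comm_ring_1 fps"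
  assumes "fps_supp4 d f" "fps_supp4 e g"
  shows "fps_supp4 (d + e) (f * g)"
  unfolding fps_supp4_def
proof (intro allI impI)
  fix n assume "fps_nth (f * g) n \<noteq> 0"
  then obtain i where i: "i \<le> n" "fps_nth f i * fps_nth g (n - i) \<noteq> 0"
    unfolding fps_mult_nth by (auto elim: sum.not_neutral_contains_not_neutral)
  then have "fps_nth f i \<noteq> 0" "fps_nth g (n - i) \<noteq> 0"
    by auto
  then have "4 dvd i" "i \<le> d" "4 dvd n - i" "n - i \<le> e"
    using assms by (auto simp: fps_supp4_def)
  then show "4 dvd n \<and> n \<le> d + e"
    using i(1) by (metis dvd_add le_add_diff_inverse add_mono)
qed

lemma fps_supp4_power:
  fixes f :: "'a::comm_ring_1 fps"
  assumes "fps_supp4 d f"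
  shows "fps_supp4 (d * n) (f ^ n)"
proof (induction n)
  case (Suc n)
  have "fps_supp4 (d + d * n) (f * f ^ n)"
    by (rule fps_supp4_mult [OF assms Suc])
  then show ?case
    by simp
qed (simp add: fps_supp4_def)

context frobenius_lift
begin

lemma fps_frob_iter_nth:
  "fps_nth ((fps_frob p \<phi> ^^ i) f) n = (if p ^ i dvd n then (\<phi> ^^ i) (fps_nth f (n div p ^ i)) else 0)"
proof (induction i arbitrary: n)
  case (Suc i)
  have p0: "p > 0"
    using prime_p prime_gt_0_nat by blast
  show ?case
  proof (cases "p dvd n")
    case True
    then obtain m where m: "n = p * m" ..
    show ?thesis
      using p0 by (simp add: fps_frob_nth m Suc phi_zero)
  next
    case False
    then have "\<not> p * p ^ i dvd n"
      by (meson dvd_mult_left)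
    then show ?thesis
      using False by (simp add: fps_frob_nth)
  qed
qed simp

lemma fps_supp4_frob_iter:
  assumes "fps_supp4 d f"
  shows "fps_supp4 (p ^ i * d) ((fps_frob p \<phi> ^^ i) f)"
  unfolding fps_supp4_def
proof (intro allI impI)
  fix n assume n: "fps_nth ((fps_frob p \<phi> ^^ i) f) n \<noteq> 0"
  then have "p ^ i dvd n"
    by (auto simp: fps_frob_iter_nth split: if_splits)
  then obtain m where m: "n = p ^ i * m" ..
  have p0: "p > 0"
    using prime_p prime_gt_0_nat by blast
  have "fps_nth f m \<noteq> 0"
    using n p0 by (auto simp: fps_frob_iter_nth m iter_zero)
  then have "4 dvd m" "m \<le> d"
    using assms by (auto simp: fps_supp4_def)
  then show "4 dvd n \<and> n \<le> p ^ i * d"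
    by (auto simp: m)
qed

text \<open>\<open>P ((p ^ j - 1) div 4)\<close> is the coefficient of u^(p^j - 1) in H. Reading the
  Dwork expansion of H at u^(p^m - 1) therefore gives the congruences required by
  \<open>hazewinkel_integral\<close>, provided that each product \<open>R i * \<Phi>^i(H)\<close>
  contributes through a single pair of coefficients.\<close>

theorem hazewinkel_legendre_integral:
  assumes p4: "p mod 4 = 1" and \<pi>: "of_nat p * \<pi> = 1"
    and a: "a \<in> A" and b: "b \<in> A" and P: "\<And>k. P k \<in> A" and P0: "P 0 = 1"
  defines "H \<equiv> Abs_fps (\<lambda>n. if 4 dvd n then P (n div 4) else 0)"
  assumes H: "H ^ 2 * (1 - fps_const (2 * a) * fps_X ^ 4 + fps_const b * fps_X ^ 8) = 1"
    and v: "\<And>n. n \<ge> 1 \<Longrightarrow>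
      of_nat p * (\<pi> ^ n * P ((p ^ n - 1) div 4)) = (\<Sum>j<n. \<pi> ^ j * P ((p ^ j - 1) div 4) * v (n - j) ^ (p ^ j))"
    and n: "n \<ge> 1"
  shows "v n \<in> A"
proof -
  interpret L: frobenius_lift p "fps_over A" "fps_frob p \<phi>"
    by (rule fps_lift)
  let ?\<Phi> = "fps_frob p \<phi>"
  define F where "F = 1 - fps_const (2 * a) * fps_X ^ 4 + fps_const b * fps_X ^ 8"
  \<comment> \<open>As H is the inverse square root of F, this is at once the square root of F and
    the inverse of H.\<close>
  define S where "S = F * H"
  have HF: "H ^ 2 * F = 1"
    using H by (simp add: F_def)
  have p0: "p > 0"
    using prime_p prime_gt_0_nat by blast
  have HA: "H \<in> fps_over A"
    by (auto simp: H_def fps_over_def P zero_mem)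
  have "2 * a \<in> A"
    using add_mem [OF a a] by (simp only: mult_2)
  then have FA: "F \<in> fps_over A"
    by (auto simp: F_def fps_over_def fps_X_power_nth zero_mem one_mem b intro!: add_mem diff_mem neg_mem)
  have SA: "S \<in> fps_over A"
    unfolding S_def by (rule fps_over_mult [OF FA HA])
  have SH: "S * H = 1"
    using HF by (simp add: S_def power2_eq_square mult_ac)
  have "S ^ 2 = F * (H ^ 2 * F)"
    by (simp add: S_def power2_eq_square mult_ac)
  then have S2: "S ^ 2 = F"
    by (simp add: HF)
  define E where "E m = S ^ (p ^ m - 1)" for m
  define R where "R = dwork_rem ?\<Phi> E"
  have pm4: "p ^ m mod 4 = 1" for m
    using power_mod [of p 4 m] p4 by simp
  have F4: "fps_supp4 8 F"
    by (auto simp: fps_supp4_def F_def fps_X_power_nth split: if_splits)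
  have E4: "fps_supp4 (4 * (p ^ m - 1)) (E m)" for m
  proof -
    have "odd (p ^ m)"
      using pm4 [of m] by presburger
    \<comment> \<open>p^m - 1 is even, so E m is an integral power of F and hence a polynomial,
      although S in general is not.\<close>
    then have e: "2 * ((p ^ m - 1) div 2) = p ^ m - 1"
      by simp
    then have "E m = F ^ ((p ^ m - 1) div 2)"
      by (simp add: E_def S2 [symmetric] power_mult [symmetric])
    moreover have "8 * ((p ^ m - 1) div 2) = 4 * (p ^ m - 1)"
      using e by simp
    ultimately show ?thesis
      using fps_supp4_power [OF F4, of "(p ^ m - 1) div 2"] by (simp only:)
  qed
  have R4: "fps_supp4 (4 * (p ^ m - 1)) (R m)" for m
  proof (induction m rule: less_induct)
    case (less m)
    have "fps_supp4 (4 * (p ^ m - 1)) (R i * (?\<Phi> ^^ i) (E (m - i)))" if i: "i \<in> {0<..<m}" for i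
    proof -
      have "p ^ i * p ^ (m - i) = p ^ m"
        using i by (simp add: power_add [symmetric])
      moreover have "1 \<le> p ^ i" "1 \<le> p ^ (m - i)" "p ^ i \<le> p ^ m"
        using p0 i by (auto intro: power_increasing)
      ultimately have "4 * (p ^ i - 1) + p ^ i * (4 * (p ^ (m - i) - 1)) = 4 * (p ^ m - 1)"
        by (simp add: algebra_simps)
      then show ?thesis
        using fps_supp4_mult [OF less [of i] fps_supp4_frob_iter [OF E4, of i "m - i"]] i by simp
    qed
    then have zero: "fps_nth (\<Sum>i\<in>{0<..<m}. R i * (?\<Phi> ^^ i) (E (m - i))) n = 0"
      if "\<not> (4 dvd n \<and> n \<le> 4 * (p ^ m - 1))" for n
      using that unfolding fps_sum_nth by (intro sum.neutral ballI) (auto simp: fps_supp4_def)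
    have "R m = E m - (\<Sum>i\<in>{0<..<m}. R i * (?\<Phi> ^^ i) (E (m - i)))"
      unfolding R_def by (rule dwork_rem.simps)
    then have Rm: "fps_nth (R m) n = fps_nth (E m) n - fps_nth (\<Sum>i\<in>{0<..<m}. R i * (?\<Phi> ^^ i) (E (m - i))) n" for n
      by (simp only: fps_sub_nth)
    show ?case
      unfolding fps_supp4_def
    proof (intro allI impI, rule ccontr)
      fix n assume nz: "fps_nth (R m) n \<noteq> 0" and n: "\<not> (4 dvd n \<and> n \<le> 4 * (p ^ m - 1))"
      have "fps_nth (E m) n = 0"
        using E4 [of m] n unfolding fps_supp4_def by blast
      then show False
        using nz zero [OF n] by (simp only: Rm diff_zero) simp
    qed
  qed
  have nth_pideal: "fps_nth f n \<in> pideal k" if f: "f \<in> L.pideal k" for f n k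
  proof -
    obtain z where z: "z \<in> fps_over A" "f = of_nat p ^ k * z"
      using f by (rule L.pidealE)
    have "f = fps_const (of_nat p ^ k) * z"
      by (simp add: z fps_of_nat [symmetric] fps_const_power)
    then show ?thesis
      using z by (auto simp: fps_over_def intro: pidealI)
  qed
  define c where "c j = P ((p ^ j - 1) div 4)" for j
  define r where "r i = fps_nth (R i) (p ^ i - 1)" for i
  have Hc: "fps_nth H (p ^ j - 1) = c j" for j
  proof -
    have "4 dvd p ^ j - 1"
      using pm4 [of j] by presburger
    then show ?thesis
      by (simp add: H_def c_def)
  qed
  have coeff: "fps_nth (R i * (?\<Phi> ^^ i) H) (p ^ m - 1) = r i * (\<phi> ^^ i) (c (m - i))" if i: "i \<in> {0<..m}" for i m
  proof -
    have pp: "p ^ m = p ^ i * p ^ (m - i)"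
      using i by (simp add: power_add [symmetric])
    have ge: "1 \<le> p ^ i" "1 \<le> p ^ (m - i)" "p ^ i \<le> p ^ m"
      using p0 i by (auto intro: power_increasing)
    have "fps_nth (R i * (?\<Phi> ^^ i) H) (p ^ m - 1) =
        (\<Sum>e=0..p ^ m - 1. fps_nth (R i) e * fps_nth ((?\<Phi> ^^ i) H) (p ^ m - 1 - e))"
      by (rule fps_mult_nth)
    also have "\<dots> = (\<Sum>e\<in>{p ^ i - 1}. fps_nth (R i) e * fps_nth ((?\<Phi> ^^ i) H) (p ^ m - 1 - e))"
    proof (rule sum.mono_neutral_right)
      show "\<forall>e\<in>{0..p ^ m - 1} - {p ^ i - 1}. fps_nth (R i) e * fps_nth ((?\<Phi> ^^ i) H) (p ^ m - 1 - e) = 0"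
      proof (rule ballI, rule ccontr)
        fix e assume e: "e \<in> {0..p ^ m - 1} - {p ^ i - 1}"
          and nz: "fps_nth (R i) e * fps_nth ((?\<Phi> ^^ i) H) (p ^ m - 1 - e) \<noteq> 0"
        then have "fps_nth (R i) e \<noteq> 0" "p ^ i dvd p ^ m - 1 - e"
          by (auto simp: fps_frob_iter_nth split: if_splits)
        then have e4: "4 dvd e" "e \<le> 4 * (p ^ i - 1)" and "p ^ i dvd p ^ m - 1 - e"
          using R4 [of i] by (auto simp: fps_supp4_def)
        then obtain k where "p ^ m - 1 - e = p ^ i * k"
          by auto
        then have "p ^ m = e + 1 + p ^ i * k"
          using e ge by auto
        \<comment> \<open>The index e is divisible by 4 and e + 1 = p^i w is below 4 p^i. As p^i = 1
          mod 4, also w = 1 mod 4, which leaves w = 1: only e = p^i - 1 contributes.\<close>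
        then have "p ^ i dvd e + 1"
          using pp by (metis dvd_add_left_iff dvd_triv_left)
        then obtain w where w: "e + 1 = p ^ i * w" ..
        then have "p ^ i * w < p ^ i * 4"
          using e4 ge by linarith
        then have "w < 4"
          by simp
        moreover have "w mod 4 = 1"
        proof -
          have "(p ^ i * w) mod 4 = 1"
            using e4(1) w by presburger
          then show ?thesis
            using pm4 [of i] by (metis mod_mult_left_eq mult_1)
        qed
        ultimately have "w = 1"
          by simp
        then show False
          using w e by (metis DiffD2 add_diff_cancel_right' mult.right_neutral singletonI)
      qed
    qed (use ge in auto)
    also have "\<dots> = r i * (\<phi> ^^ i) (c (m - i))"
    proof -
      have "p ^ m - 1 - (p ^ i - 1) = p ^ i * (p ^ (m - i) - 1)"
        using pp ge by (simp add: algebra_simps)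
      then show ?thesis
        using p0 Hc [of "m - i"] by (simp add: r_def fps_frob_iter_nth)
    qed
    finally show ?thesis .
  qed
  show ?thesis
  proof (rule hazewinkel_integral [where a = c and r = r and v = v, OF \<pi>])
    show "r i \<in> pideal (i - 1)" if "i \<ge> 1" for i
      unfolding r_def R_def E_def using L.dwork_rem_pideal [OF SA that] by (rule nth_pideal)
    fix m :: nat assume m: "m \<ge> 1"
    have "fps_nth (H - (\<Sum>i\<in>{0<..m}. R i * (?\<Phi> ^^ i) H)) (p ^ m - 1) \<in> pideal m"
      unfolding R_def E_def by (rule nth_pideal [OF L.dwork_expansion [OF SA HA SH m]])
    then show "c m - (\<Sum>i\<in>{0<..m}. r i * (\<phi> ^^ i) (c (m - i))) \<in> pideal m"
      by (simp only: fps_sub_nth fps_sum_nth Hc coeff cong: sum.cong)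
    show "of_nat p * (\<pi> ^ m * c m) = (\<Sum>j<m. \<pi> ^ j * c j * v (m - j) ^ (p ^ j))"
      using v [OF m] by (simp add: c_def)
  qed (use n in \<open>auto simp: c_def P P0\<close>)
qed

end

subsection \<open>Expansions at infinity\<close>

definition has_qexp :: "(complex \<Rightarrow> complex) \<Rightarrow> complex fps \<Rightarrow> bool" where
  "has_qexp f a \<longleftrightarrow> fps_conv_radius a \<ge> 1 \<and> (\<forall>\<tau>. Im \<tau> > 0 \<longrightarrow> f \<tau> = eval_fps a (exp (of_real pi * \<i> * \<tau>)))"

lemma norm_nome: "norm (exp (of_real pi * \<i> * \<tau>)) = exp (- pi * Im \<tau>)"
  by simp

lemma norm_nome_less: "Im \<tau> > 0 \<Longrightarrow> norm (exp (of_real pi * \<i> * \<tau>)) < 1"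
  unfolding norm_nome by simp

lemma nome_surj:
  assumes "t \<noteq> 0" "norm t < 1"
  obtains \<tau> where "Im \<tau> > 0" "t = exp (of_real pi * \<i> * \<tau>)"
proof
  have "ln (norm t) < 0"
    using assms by simp
  then show "Im (Ln t / (of_real pi * \<i>)) > 0"
    using assms by (simp add: Im_divide power2_eq_square divide_simps)
  show "t = exp (of_real pi * \<i> * (Ln t / (of_real pi * \<i>)))"
    using assms by simp
qed

lemma has_qexpD: "has_qexp f a \<Longrightarrow> Im \<tau> > 0 \<Longrightarrow> f \<tau> = eval_fps a (exp (of_real pi * \<i> * \<tau>))"
  by (simp add: has_qexp_def)

lemma has_qexp_sums:
  assumes "has_qexp f a" "Im \<tau> > 0"
  shows "(\<lambda>n. fps_nth a n * exp (of_real pi * \<i> * \<tau>) ^ n) sums f \<tau>"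
proof -
  have "ereal (norm (exp (of_real pi * \<i> * \<tau>))) < 1"
    using norm_nome_less [OF assms(2)] by simp
  then have "norm (exp (of_real pi * \<i> * \<tau>)) < fps_conv_radius a"
    using assms(1) unfolding has_qexp_def by (meson less_le_trans)
  then show ?thesis
    using sums_eval_fps has_qexpD [OF assms] by metis
qed

text \<open>Every nonzero point of the open unit disc is the nome of some \<tau>, so convergence on
  the half plane already forces the radius of convergence to be at least 1.\<close>

lemma has_qexpI_sums:
  assumes "\<And>\<tau>. Im \<tau> > 0 \<Longrightarrow> (\<lambda>n. fps_nth a n * exp (of_real pi * \<i> * \<tau>) ^ n) sums f \<tau>"
  shows "has_qexp f a"
  unfolding has_qexp_def
proof (intro conjI allI impI)
  show "1 \<le> fps_conv_radius a"
  proof (rule ccontr)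
    assume "\<not> 1 \<le> fps_conv_radius a"
    then obtain r where r: "fps_conv_radius a < ereal r" "r < 1"
      using ereal_dense2 [of "fps_conv_radius a" 1] by (auto simp: not_le one_ereal_def)
    have r0: "r > 0"
      using r(1) by (metis conv_radius_nonneg ereal_less(2) fps_conv_radius_def le_less_trans zero_ereal_def)
    obtain \<tau> where \<tau>: "Im \<tau> > 0" "of_real r = exp (of_real pi * \<i> * \<tau>)"
      using nome_surj [of "of_real r"] r0 r(2) by auto
    have "summable (\<lambda>n. fps_nth a n * of_real r ^ n)"
      using sums_summable [OF assms [OF \<tau>(1)]] \<tau>(2) by simp
    then have "ereal (norm (of_real r :: complex)) \<le> conv_radius (fps_nth a)"
      by (rule conv_radius_geI)
    then show False
      using r(1) r0 by (simp add: fps_conv_radius_def)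
  qed
  fix \<tau> :: complex assume "Im \<tau> > 0"
  from assms [OF this] show "f \<tau> = eval_fps a (exp (of_real pi * \<i> * \<tau>))"
    by (simp add: eval_fps_def sums_iff)
qed

lemma has_qexp_in_disk: "has_qexp f a \<Longrightarrow> norm t < 1 \<Longrightarrow> ereal (norm t) < fps_conv_radius a"
  unfolding has_qexp_def by (metis ereal_less(3) less_le_trans one_ereal_def less_ereal.simps(1))

lemma has_qexp_cong: "has_qexp f a \<Longrightarrow> (\<And>\<tau>. Im \<tau> > 0 \<Longrightarrow> f \<tau> = g \<tau>) \<Longrightarrow> has_qexp g a"
  by (simp add: has_qexp_def)

text \<open>A nome is never 0, so agreement at 0 is first obtained by continuity; then the identity
  theorem for power series applies.\<close>

lemma has_qexp_unique:
  assumes "has_qexp f a" "has_qexp f b"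
  shows "a = b"
proof (rule fps_ext)
  have rad: "fps_conv_radius a > 0" "fps_conv_radius b > 0"
    using has_qexp_in_disk [OF assms(1), of 0] has_qexp_in_disk [OF assms(2), of 0] by (simp_all add: zero_ereal_def)
  have eq: "eval_fps a t = eval_fps b t" if "t \<noteq> 0" "norm t < 1" for t
    using nome_surj [OF that] has_qexpD [OF assms(1)] has_qexpD [OF assms(2)] by metis
  have cont: "isCont (eval_fps a) 0" "isCont (eval_fps b) 0"
    using rad by (auto intro!: continuous_eval_fps simp: zero_ereal_def)
  have "eval_fps a 0 = eval_fps b 0"
  proof (rule tendsto_unique [of "at 0"])
    show "(eval_fps a \<longlongrightarrow> eval_fps a 0) (at 0)" "(eval_fps a \<longlongrightarrow> eval_fps b 0) (at 0)"
      using cont(1) apply (simp add: isCont_def)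
      apply (rule Lim_transform_eventually [of "eval_fps b"])
      using cont(2) apply (simp add: isCont_def)
      using eq by (auto simp: eventually_at intro!: exI [of _ 1])
  qed auto
  then have "\<forall>t. norm t < 1 \<longrightarrow> eval_fps a t = eval_fps b t"
    using eq by metis
  then have "eventually (\<lambda>t. eval_fps a t = eval_fps b t) (nhds 0)"
    unfolding eventually_nhds_metric by (intro exI [of _ 1]) auto
  from eval_fps_eqD [OF rad this] show "fps_nth a n = fps_nth b n" for n
    by simp
qed

lemma has_qexp_const: "has_qexp (\<lambda>_. c) (fps_const c)"
  by (simp add: has_qexp_def)

lemma has_qexp_nome_in_disk:
  "has_qexp f a \<Longrightarrow> Im \<tau> > 0 \<Longrightarrow> ereal (norm (exp (of_real pi * \<i> * \<tau>))) < fps_conv_radius a"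
  by (rule has_qexp_in_disk [OF _ norm_nome_less])

lemma has_qexp_add:
  assumes "has_qexp f a" "has_qexp g b"
  shows "has_qexp (\<lambda>\<tau>. f \<tau> + g \<tau>) (a + b)"
  unfolding has_qexp_def
proof (intro conjI allI impI)
  show "1 \<le> fps_conv_radius (a + b)"
    using assms fps_conv_radius_add [of a b] by (auto simp: has_qexp_def min_def split: if_splits)
  fix \<tau> :: complex assume \<tau>: "Im \<tau> > 0"
  show "f \<tau> + g \<tau> = eval_fps (a + b) (exp (of_real pi * \<i> * \<tau>))"
    using assms [THEN has_qexp_nome_in_disk [OF _ \<tau>]] assms [THEN has_qexpD [OF _ \<tau>]]
    by (simp only: eval_fps_add)
qed

lemma has_qexp_minus:
  assumes "has_qexp f a"
  shows "has_qexp (\<lambda>\<tau>. - f \<tau>) (- a)"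
  unfolding has_qexp_def
proof (intro conjI allI impI)
  show "1 \<le> fps_conv_radius (- a)"
    using assms by (auto simp: has_qexp_def)
  fix \<tau> :: complex assume \<tau>: "Im \<tau> > 0"
  show "- f \<tau> = eval_fps (- a) (exp (of_real pi * \<i> * \<tau>))"
    using assms [THEN has_qexp_nome_in_disk [OF _ \<tau>]] assms [THEN has_qexpD [OF _ \<tau>]]
    by (simp only: eval_fps_minus)
qed

lemma has_qexp_diff: "has_qexp f a \<Longrightarrow> has_qexp g b \<Longrightarrow> has_qexp (\<lambda>\<tau>. f \<tau> - g \<tau>) (a - b)"
  using has_qexp_add [OF _ has_qexp_minus] by fastforce

lemma has_qexp_mult:
  assumes "has_qexp f a" "has_qexp g b"
  shows "has_qexp (\<lambda>\<tau>. f \<tau> * g \<tau>) (a * b)"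
  unfolding has_qexp_def
proof (intro conjI allI impI)
  show "1 \<le> fps_conv_radius (a * b)"
    using assms fps_conv_radius_mult [of a b] by (auto simp: has_qexp_def min_def split: if_splits)
  fix \<tau> :: complex assume \<tau>: "Im \<tau> > 0"
  show "f \<tau> * g \<tau> = eval_fps (a * b) (exp (of_real pi * \<i> * \<tau>))"
    using assms [THEN has_qexp_nome_in_disk [OF _ \<tau>]] assms [THEN has_qexpD [OF _ \<tau>]]
    by (simp only: eval_fps_mult)
qed

lemma has_qexp_power: "has_qexp f a \<Longrightarrow> has_qexp (\<lambda>\<tau>. f \<tau> ^ n) (a ^ n)"
  by (induction n) (auto intro: has_qexp_mult has_qexp_const [of 1, simplified])

lemma has_qexp_sum:
  "(\<And>i. i \<in> I \<Longrightarrow> has_qexp (f i) (a i)) \<Longrightarrow> has_qexp (\<lambda>\<tau>. \<Sum>i\<in>I. f i \<tau>) (\<Sum>i\<in>I. a i)"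
  by (induction I rule: infinite_finite_induct)
    (auto intro: has_qexp_add has_qexp_const [of 0, simplified])

lemma has_qexp_nome: "has_qexp (\<lambda>\<tau>. exp (of_real pi * \<i> * \<tau>)) fps_X"
  by (simp add: has_qexp_def)

lemma has_qexp_holomorphic:
  assumes "has_qexp f a"
  shows "f holomorphic_on {z. Im z > 0}"
proof -
  have "(\<lambda>\<tau>. eval_fps a (exp (of_real pi * \<i> * \<tau>))) holomorphic_on {z. Im z > 0}"
  proof -
    have "(\<lambda>\<tau>. exp (of_real pi * \<i> * \<tau>)) holomorphic_on {z. Im z > 0}"
      by (intro holomorphic_intros)
    moreover have "eval_fps a holomorphic_on eball 0 (fps_conv_radius a)"
      by (rule holomorphic_on_eval_fps) simp
    moreover have "(\<lambda>\<tau>. exp (of_real pi * \<i> * \<tau>)) ` {z. Im z > 0} \<subseteq> eball 0 (fps_conv_radius a)"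
      using has_qexp_nome_in_disk [OF assms] by (auto simp: dist_0_norm)
    ultimately show ?thesis
      using holomorphic_on_compose_gen [of "\<lambda>\<tau>. exp (of_real pi * \<i> * \<tau>)"] by (simp add: o_def)
  qed
  then show ?thesis
    by (rule holomorphic_transform) (simp add: has_qexpD [OF assms])
qed

lemma has_qexp_periodic:
  assumes "has_qexp f a" "Im \<tau> > 0"
  shows "f (\<tau> + 2) = f \<tau>"
proof -
  have "exp (of_real pi * \<i> * (\<tau> + 2)) = exp (of_real pi * \<i> * \<tau>) * exp (2 * of_real pi * \<i>)"
    by (simp only: exp_add [symmetric]) (simp only: distrib_left mult_ac)
  then have "exp (of_real pi * \<i> * (\<tau> + 2)) = exp (of_real pi * \<i> * \<tau>)"
    using exp_two_pi_i by simp
  then show ?thesis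
    using assms by (simp only: has_qexpD [OF assms(1)]) (simp add: has_qexpD [OF assms(1)])
qed

text \<open>The common zero at the cusp cancels. As g has no zero in the half plane and u has
  nonzero constant term, u has no zero in the unit disc; the quotient is holomorphic there and its
  Taylor series is the expansion.\<close>

lemma has_qexp_quotient:
  assumes f: "has_qexp f (fps_X * a)" and g: "has_qexp g (fps_X * u)"
    and u0: "fps_nth u 0 \<noteq> 0" and nz: "\<And>\<tau>. Im \<tau> > 0 \<Longrightarrow> g \<tau> \<noteq> 0"
  obtains b where "has_qexp (\<lambda>\<tau>. f \<tau> / g \<tau>) b" "u * b = a"
proof -
  have shift: "fps_conv_radius c = fps_conv_radius (fps_X * c)" for c :: "complex fps"
    using fps_conv_radius_shift [of 1 "fps_X * c"] by (metis One_nat_def fps_shift_times_fps_X' mult.commute)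
  have rad: "ereal (norm t) < fps_conv_radius a" "ereal (norm t) < fps_conv_radius u" if "norm t < 1" for t
    using has_qexp_in_disk [OF f that] has_qexp_in_disk [OF g that] by (simp_all add: shift [symmetric])
  have ev: "eval_fps (fps_X * c) t = t * eval_fps c t" if "ereal (norm t) < fps_conv_radius c" for c :: "complex fps" and t
    using that by (subst eval_fps_mult) auto
  have unz: "eval_fps u t \<noteq> 0" if t: "norm t < 1" for t
  proof (cases "t = 0")
    case True
    then show ?thesis
      using u0 by (simp add: eval_fps_at_0)
  next
    case False
    then obtain \<tau> where "Im \<tau> > 0" "t = exp (of_real pi * \<i> * \<tau>)"
      using t by (rule nome_surj)
    then show ?thesis
      using nz [of \<tau>] has_qexpD [OF g] ev [OF rad(2) [OF t]] by auto
  qed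
  define h where "h t = eval_fps a t / eval_fps u t" for t
  have "ball (0::complex) 1 \<subseteq> eball 0 (fps_conv_radius a)" "ball (0::complex) 1 \<subseteq> eball 0 (fps_conv_radius u)"
    using rad by (auto simp: dist_0_norm)
  then have h: "h holomorphic_on ball 0 1"
    unfolding h_def using unz by (intro holomorphic_intros) (auto simp: dist_norm)
  define b where "b = fps_expansion h 0"
  have h': "h holomorphic_on eball 0 1"
    using h by (simp add: one_ereal_def)
  have rb: "fps_conv_radius b \<ge> 1"
    unfolding b_def using h' by (rule conv_radius_fps_expansion)
  have eb: "eval_fps b t = h t" if "norm t < 1" for t
    unfolding b_def using eval_fps_expansion' [OF h', of t] that by (simp add: dist_norm)
  have qb: "has_qexp (\<lambda>\<tau>. f \<tau> / g \<tau>) b"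
    unfolding has_qexp_def
  proof (intro conjI allI impI rb)
    fix \<tau> :: complex assume \<tau>: "Im \<tau> > 0"
    note t = norm_nome_less [OF \<tau>]
    show "f \<tau> / g \<tau> = eval_fps b (exp (of_real pi * \<i> * \<tau>))"
      using eb [OF t] by (simp add: has_qexpD [OF f \<tau>] has_qexpD [OF g \<tau>] ev [OF rad(1) [OF t]] ev [OF rad(2) [OF t]] h_def)
  qed
  have "has_qexp (\<lambda>\<tau>. g \<tau> * (f \<tau> / g \<tau>)) (fps_X * u * b)"
    by (rule has_qexp_mult [OF g qb])
  then have "has_qexp f (fps_X * u * b)"
    by (rule has_qexp_cong) (use nz in auto)
  then have "fps_X * u * b = fps_X * a"
    using f by (rule has_qexp_unique)
  then have "u * b = a"
    by (simp add: mult.assoc)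
  with qb that show ?thesis
    by blast
qed

subsection \<open>Theta constants\<close>

definition theta_term :: "complex \<Rightarrow> complex \<Rightarrow> complex \<Rightarrow> int \<Rightarrow> complex" where
  "theta_term \<epsilon> r \<tau> n = \<epsilon> powi n * exp (of_real pi * \<i> * (of_int n + r)\<^sup>2 * \<tau>)"

text \<open>In classical notation \<open>theta 1 0\<close>, \<open>theta (-1) 0\<close> and
  \<open>theta 1 (1/2)\<close> are \<theta>_3, \<theta>_4 and \<theta>_2; the digits in the names of
  the product formulas below refer to these indices.\<close>

definition theta :: "complex \<Rightarrow> complex \<Rightarrow> complex \<Rightarrow> complex" where
  "theta \<epsilon> r \<tau> = (\<Sum>\<^sub>\<infinity>n::int. theta_term \<epsilon> r \<tau> n)"

lemma int_UNIV_split: "(UNIV :: int set) = range int \<union> range (\<lambda>n. - 1 - int n)"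
proof -
  have "n \<in> range int \<union> range (\<lambda>n. - 1 - int n)" for n :: int
  proof (cases "n \<ge> 0")
    case True
    then show ?thesis by (metis UnI1 nonneg_int_cases rangeI)
  next
    case False
    then have "n = - 1 - int (nat (- 1 - n))" by simp
    then show ?thesis by blast
  qed
  then show ?thesis by blast
qed

lemma summable_on_int_geometric:
  fixes x :: real
  assumes "0 \<le> x" "x < 1"
  shows "(\<lambda>n::int. x ^ nat \<bar>n\<bar>) summable_on UNIV"
proof -
  have s: "summable (\<lambda>n. x ^ n)"
    using assms by (simp add: summable_geometric_iff)
  have "(\<lambda>n::int. x ^ nat \<bar>n\<bar>) summable_on range int"
    using s assms by (subst summable_on_reindex) (auto simp: o_def intro!: summable_nonneg_imp_summable_on)
  moreover have "(\<lambda>n::int. x ^ nat \<bar>n\<bar>) summable_on range (\<lambda>n. - 1 - int n)"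
  proof (subst summable_on_reindex)
    show "inj (\<lambda>n. - 1 - int n)" by (auto simp: inj_on_def)
    have "(\<lambda>n::int. x ^ nat \<bar>n\<bar>) \<circ> (\<lambda>n. - 1 - int n) = (\<lambda>n. x * x ^ n)"
      by (auto simp: fun_eq_iff nat_add_distrib)
    then show "(\<lambda>n::int. x ^ nat \<bar>n\<bar>) \<circ> (\<lambda>n. - 1 - int n) summable_on UNIV"
      using s assms by (auto intro!: summable_nonneg_imp_summable_on summable_mult)
  qed
  ultimately show ?thesis
    unfolding int_UNIV_split by (intro summable_on_Un_disjoint) auto
qed

lemma theta_summable:
  assumes "\<epsilon> = 1 \<or> \<epsilon> = -1" "r = 0 \<or> r = 1/2" "Im \<tau> > 0"
  shows "(\<lambda>n. norm (theta_term \<epsilon> r \<tau> n)) summable_on UNIV"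
proof -
  define x where "x = exp (- pi * Im \<tau>)"
  have x: "0 < x" "x < 1"
    using assms by (auto simp: x_def)
  have "norm (theta_term \<epsilon> r \<tau> n) \<le> inverse x * x ^ nat \<bar>n\<bar>" for n
  proof -
    obtain s :: real where s: "r = of_real s" "s = 0 \<or> s = 1/2"
      using assms(2) by (metis of_real_0 of_real_1 of_real_divide of_real_numeral)
    have "norm (theta_term \<epsilon> r \<tau> n) = exp (- pi * Im \<tau> * (of_int n + s)\<^sup>2)"
    proof -
      have "(of_int n + r)\<^sup>2 = complex_of_real ((of_int n + s)\<^sup>2)"
        by (simp add: s)
      then show ?thesis
        using assms(1) by (auto simp: theta_term_def norm_mult norm_power_int)
    qed
    also have "\<dots> \<le> exp (- pi * Im \<tau> * (real (nat \<bar>n\<bar>) - 1))"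
    proof -
      define N where "N = real_of_int n"
      have sq: "(N - 1/2)\<^sup>2 \<ge> 0" "(N + 1/2)\<^sup>2 \<ge> 0" "(N + 1)\<^sup>2 \<ge> 0" "N\<^sup>2 \<ge> 0"
        by simp_all
      have ex: "(N - 1/2)\<^sup>2 = N\<^sup>2 - N + 1/4" "(N + 1/2)\<^sup>2 = N\<^sup>2 + N + 1/4" "(N + 1)\<^sup>2 = N\<^sup>2 + 2 * N + 1"
        by (simp_all add: power2_sum power2_diff power_divide)
      have "(N + s)\<^sup>2 = N\<^sup>2 \<or> (N + s)\<^sup>2 = N\<^sup>2 + N + 1/4"
        using s(2) by (elim disjE) (simp_all only: ex add_0_right simp_thms)
      then have "(N + s)\<^sup>2 \<ge> \<bar>N\<bar> - 1"
        using sq unfolding ex by linarith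
      then have "(of_int n + s)\<^sup>2 \<ge> real (nat \<bar>n\<bar>) - 1"
        by (simp add: N_def)
      then show ?thesis
        using assms(3) by (simp add: mult_left_mono)
    qed
    also have "\<dots> = inverse x * x ^ nat \<bar>n\<bar>"
    proof -
      have 1: "inverse x = exp (pi * Im \<tau>)"
        by (simp add: x_def exp_minus)
      have 2: "x ^ k = exp (real k * (- pi * Im \<tau>))" for k
        unfolding x_def by (rule exp_of_nat_mult [symmetric])
      show ?thesis
        unfolding 1 2 exp_add [symmetric] by (rule arg_cong [where f = exp]) (simp add: algebra_simps)
    qed
    finally show ?thesis .
  qed
  moreover have "(\<lambda>n::int. inverse x * x ^ nat \<bar>n\<bar>) summable_on UNIV"
    using x by (intro summable_on_cmult_right summable_on_int_geometric) auto
  ultimately show ?thesis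
    by (rule_tac summable_on_comparison_test [where f = "\<lambda>n. inverse x * x ^ nat \<bar>n\<bar>"]) auto
qed

lemma has_sum_prod_int:
  fixes f g :: "int \<Rightarrow> complex"
  assumes f: "(\<lambda>n. norm (f n)) summable_on UNIV" and g: "(\<lambda>n. norm (g n)) summable_on UNIV"
  shows "((\<lambda>(m, n). f m * g n) has_sum (infsum f UNIV * infsum g UNIV)) UNIV"
proof -
  have abs: "(\<lambda>x. norm ((\<lambda>(m, n). f m * g n) x)) summable_on Sigma UNIV (\<lambda>_. UNIV)"
    unfolding Infinite_Sum.abs_summable_on_Sigma_iff
  proof (intro conjI ballI)
    show "(\<lambda>y. norm (case (x, y) of (m, n) \<Rightarrow> f m * g n)) summable_on UNIV" for x
      using summable_on_cmult_right [OF g, of "norm (f x)"] by (simp add: norm_mult)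
    have eq: "(\<lambda>x. \<Sum>\<^sub>\<infinity>y. norm (case (x, y) of (m, n) \<Rightarrow> f m * g n)) = (\<lambda>x. norm (f x) * (\<Sum>\<^sub>\<infinity>y. norm (g y)))"
      by (auto simp: norm_mult fun_eq_iff infsum_cmult_right')
    have "norm (norm (f x) * (\<Sum>\<^sub>\<infinity>y. norm (g y))) = norm (f x) * (\<Sum>\<^sub>\<infinity>y. norm (g y))" for x
      using infsum_nonneg [of UNIV "\<lambda>y. norm (g y)"] by (simp add: abs_mult)
    then show "(\<lambda>x. norm (\<Sum>\<^sub>\<infinity>y. norm (case (x, y) of (m, n) \<Rightarrow> f m * g n))) summable_on UNIV"
      using summable_on_cmult_left [OF f, of "\<Sum>\<^sub>\<infinity>y. norm (g y)"] fun_cong [OF eq] by simp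
  qed
  have "((\<lambda>(m, n). f m * g n) has_sum (infsum f UNIV * infsum g UNIV)) (Sigma UNIV (\<lambda>_. UNIV))"
  proof (rule has_sum_SigmaI)
    show "((\<lambda>y. case (x, y) of (m, n) \<Rightarrow> f m * g n) has_sum (f x * infsum g UNIV)) UNIV" for x
      using has_sum_cmult_right [OF has_sum_infsum [OF abs_summable_summable [OF g]], of "f x"] by simp
    show "((\<lambda>x. f x * infsum g UNIV) has_sum (infsum f UNIV * infsum g UNIV)) UNIV"
      by (rule has_sum_cmult_left [OF has_sum_infsum [OF abs_summable_summable [OF f]]])
    show "(\<lambda>(m, n). f m * g n) summable_on Sigma UNIV (\<lambda>_. UNIV)"
      by (rule abs_summable_summable [OF abs])
  qed
  then show ?thesis
    by simp
qed

text \<open>The pairs of integers of equal parity are the pairs \<open>(a + b, a - b)\<close>, those of different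
  parity the pairs \<open>(a + b + 1, a - b)\<close>.\<close>

lemma parity_resummation:
  fixes f g :: "int \<Rightarrow> complex"
  assumes fg: "(\<lambda>n. norm (f n)) summable_on UNIV" "(\<lambda>n. norm (g n)) summable_on UNIV"
    and hk: "(\<lambda>n. norm (h n)) summable_on UNIV" "(\<lambda>n. norm (k n)) summable_on UNIV" "(\<lambda>n. norm (h' n)) summable_on UNIV" "(\<lambda>n. norm (k' n)) summable_on UNIV"
    and even: "\<And>a b. f (a + b) * g (a - b) = h a * k b"
    and odd: "\<And>a b. f (a + b + 1) * g (a - b) = h' a * k' b"
  shows "infsum f UNIV * infsum g UNIV = infsum h UNIV * infsum k UNIV + infsum h' UNIV * infsum k' UNIV"
proof -
  let ?F = "\<lambda>(m, n). f m * g n"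
  let ?e = "\<lambda>(a, b). (a + b, a - b) :: int \<times> int" and ?o = "\<lambda>(a, b). (a + b + 1, a - b) :: int \<times> int"
  have E: "(?F has_sum (infsum h UNIV * infsum k UNIV)) (range ?e)"
  proof (subst has_sum_reindex)
    have "?F \<circ> ?e = (\<lambda>(a, b). h a * k b)"
      by (auto simp: fun_eq_iff even)
    then show "(?F \<circ> ?e has_sum (infsum h UNIV * infsum k UNIV)) UNIV"
      using has_sum_prod_int [OF hk(1,2)] by simp
  qed (auto simp: inj_on_def)
  have O: "(?F has_sum (infsum h' UNIV * infsum k' UNIV)) (range ?o)"
  proof (subst has_sum_reindex)
    have "?F \<circ> ?o = (\<lambda>(a, b). h' a * k' b)"
      by (auto simp: fun_eq_iff odd)
    then show "(?F \<circ> ?o has_sum (infsum h' UNIV * infsum k' UNIV)) UNIV"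
      using has_sum_prod_int [OF hk(3,4)] by simp
  qed (auto simp: inj_on_def)
  have disj: "range ?e \<inter> range ?o = {}"
  proof -
    have "even (fst x + snd x)" if "x \<in> range ?e" for x
      using that by auto
    moreover have "odd (fst x + snd x)" if "x \<in> range ?o" for x
      using that by auto
    ultimately show ?thesis by blast
  qed
  have un: "range ?e \<union> range ?o = UNIV"
  proof -
    have "(m, n) \<in> range ?e \<union> range ?o" for m n
    proof (cases "even (m + n)")
      case True
      then obtain c where "m + n = 2 * c" ..
      then have "(m, n) = ?e (c, c - n)"
        by auto
      then show ?thesis by blast
    next
      case False
      then obtain c where "m + n = 2 * c + 1"
        by (rule oddE)
      then have "(m, n) = ?o (c, c - n)"
        by auto
      then show ?thesis by blast
    qed
    then show ?thesis by auto
  qed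
  have "(?F has_sum (infsum h UNIV * infsum k UNIV + infsum h' UNIV * infsum k' UNIV)) UNIV"
    using has_sum_Un_disjoint [OF E O disj] unfolding un .
  then show ?thesis
    using has_sum_unique [OF has_sum_prod_int [OF fg]] by simp
qed

lemma neg_one_powi_diff: "(-1 :: complex) powi (m - n) = (-1) powi m * (-1) powi n"
  by (auto simp: power_int_minus_left)

text \<open>The exponents of the two factors add up, and the factor 2 on the right side of the
  quadratic identity is absorbed in the argument 2\<tau>. \<open>c\<close> holds the sign that the
  characters leave over.\<close>

lemma theta_term_mult:
  assumes "(of_int m + r)\<^sup>2 + (of_int n + s)\<^sup>2 = 2 * (of_int a + u)\<^sup>2 + 2 * (of_int b + v)\<^sup>2"
    and "\<epsilon> powi m * \<delta> powi n = c * (\<epsilon>' powi a * \<delta>' powi b)"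
  shows "theta_term \<epsilon> r \<tau> m * theta_term \<delta> s \<tau> n = c * theta_term \<epsilon>' u (2 * \<tau>) a * theta_term \<delta>' v (2 * \<tau>) b"
proof -
  let ?c = "of_real pi * \<i>"
  have e1: "exp (c * x * t) * exp (c * y * t) = exp (c * (x + y) * t)" for c x y t :: complex
    by (simp only: exp_add [symmetric] distrib_left distrib_right)
  have e2: "exp (c * (2 * x + 2 * y) * t) = exp (c * x * (2 * t)) * exp (c * y * (2 * t))" for c x y t :: complex
    unfolding exp_add [symmetric] by (rule arg_cong [where f = exp]) (simp add: algebra_simps)
  have "theta_term \<epsilon> r \<tau> m * theta_term \<delta> s \<tau> n = (\<epsilon> powi m * \<delta> powi n) *
      (exp (?c * (of_int m + r)\<^sup>2 * \<tau>) * exp (?c * (of_int n + s)\<^sup>2 * \<tau>))"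
    by (simp only: theta_term_def mult_ac)
  also have "\<dots> = c * theta_term \<epsilon>' u (2 * \<tau>) a * theta_term \<delta>' v (2 * \<tau>) b"
    unfolding e1 assms unfolding e2 theta_term_def by (simp only: mult_ac)
  finally show ?thesis .
qed

lemma theta_sign:
  "(-1 :: complex) powi (a - b) = (-1) powi a * (-1) powi b"
  "(-1 :: complex) powi (a + b) = (-1) powi a * (-1) powi b"
  "(-1 :: complex) powi (a + 1) = - ((-1) powi a)"
  "(-1 :: complex) powi a * ((-1) powi a * x) = x"
  "(-1 :: complex) powi a * (-1) powi a = 1"
  by (auto simp: power_int_minus_left)

lemma theta_sign_square:
  "(-1 :: complex) powi a * (-1) powi b * ((-1) powi a * (-1) powi b) = 1"
  by (simp only: mult_ac theta_sign mult_1_right)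

lemma theta_sq:
  fixes a b :: int
  shows "(of_int (a + b))\<^sup>2 + (of_int (a - b))\<^sup>2 = 2 * (of_int a)\<^sup>2 + 2 * (of_int b :: complex)\<^sup>2"
    and "(of_int (a + b + 1))\<^sup>2 + (of_int (a - b))\<^sup>2 = 2 * (of_int a + 1/2)\<^sup>2 + 2 * (of_int b + 1/2 :: complex)\<^sup>2"
    and "(of_int (a + b) + 1/2)\<^sup>2 + (of_int (a - b) + 1/2)\<^sup>2 = 2 * (of_int a + 1/2)\<^sup>2 + 2 * (of_int b :: complex)\<^sup>2"
    and "(of_int (a + b + 1) + 1/2)\<^sup>2 + (of_int (a - b) + 1/2)\<^sup>2 = 2 * (of_int (a + 1))\<^sup>2 + 2 * (of_int b + 1/2 :: complex)\<^sup>2"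
  by (simp_all add: power2_sum power2_diff power_divide)

text \<open>The reflection n \<mapsto> -1 - n preserves (n + 1/2)^2 and reverses the sign
  (-1)^n.\<close>

lemma theta_odd_zero:
  assumes "Im \<tau> > 0"
  shows "theta (-1) (1/2) \<tau> = 0"
proof -
  have "theta (-1) (1/2) \<tau> = (\<Sum>\<^sub>\<infinity>n. theta_term (-1) (1/2) \<tau> (- 1 - n))"
    unfolding theta_def
    by (rule infsum_reindex_bij_betw [symmetric])
      (auto intro!: bij_betwI [of _ _ _ "\<lambda>n. - 1 - n"])
  also have "\<dots> = (\<Sum>\<^sub>\<infinity>n. - theta_term (-1) (1/2) \<tau> n)"
  proof (rule infsum_cong)
    fix n :: int
    have "(of_int (- 1 - n) + 1/2 :: complex)\<^sup>2 = (of_int n + 1/2)\<^sup>2"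
      by (simp add: power2_eq_square algebra_simps)
    then show "theta_term (-1) (1/2) \<tau> (- 1 - n) = - theta_term (-1) (1/2) \<tau> n"
      unfolding theta_term_def neg_one_powi_diff by simp
  qed
  also have "\<dots> = - theta (-1) (1/2) \<tau>"
    by (simp add: theta_def infsum_uminus)
  finally show ?thesis
    by simp
qed

text \<open>The pairs of different parity contribute the square of \<open>theta (-1) (1/2)\<close>,
  which vanishes.\<close>

lemma theta_34:
  assumes "Im \<tau> > 0"
  shows "theta 1 0 \<tau> * theta (-1) 0 \<tau> = theta (-1) 0 (2 * \<tau>) ^ 2"
proof -
  have "theta 1 0 \<tau> * theta (-1) 0 \<tau> = theta (-1) 0 (2 * \<tau>) * theta (-1) 0 (2 * \<tau>) +
      theta (-1) (1/2) (2 * \<tau>) * theta (-1) (1/2) (2 * \<tau>)"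
    unfolding theta_def
  proof (rule parity_resummation)
    fix a b :: int
    show "theta_term 1 0 \<tau> (a + b) * theta_term (-1) 0 \<tau> (a - b) =
        theta_term (-1) 0 (2 * \<tau>) a * theta_term (-1) 0 (2 * \<tau>) b"
      by (rule trans [OF theta_term_mult [where c = 1 and a = a and b = b and u = 0 and v = 0 and \<epsilon>' = "-1" and \<delta>' = "-1"]])
        (use theta_sq in \<open>simp_all add: theta_sign theta_sign_square\<close>)
    show "theta_term 1 0 \<tau> (a + b + 1) * theta_term (-1) 0 \<tau> (a - b) =
        theta_term (-1) (1/2) (2 * \<tau>) a * theta_term (-1) (1/2) (2 * \<tau>) b"
      by (rule trans [OF theta_term_mult [where c = 1 and a = a and b = b and u = "1/2" and v = "1/2" and \<epsilon>' = "-1" and \<delta>' = "-1"]])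
        (use theta_sq in \<open>simp_all add: theta_sign theta_sign_square\<close>)
  qed (use assms in \<open>auto intro!: theta_summable\<close>)
  then show ?thesis
    using theta_odd_zero [of "2 * \<tau>"] assms by (simp add: power2_eq_square)
qed

lemma theta_33:
  assumes "Im \<tau> > 0"
  shows "theta 1 0 \<tau> ^ 2 = theta 1 0 (2 * \<tau>) ^ 2 + theta 1 (1/2) (2 * \<tau>) ^ 2"
  unfolding theta_def power2_eq_square
proof (rule parity_resummation)
  fix a b :: int
  show "theta_term 1 0 \<tau> (a + b) * theta_term 1 0 \<tau> (a - b) =
      theta_term 1 0 (2 * \<tau>) a * theta_term 1 0 (2 * \<tau>) b"
    by (rule trans [OF theta_term_mult [where c = 1 and a = a and b = b and u = 0 and v = 0 and \<epsilon>' = 1 and \<delta>' = 1]])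
      (use theta_sq in \<open>simp_all add: theta_sign theta_sign_square\<close>)
  show "theta_term 1 0 \<tau> (a + b + 1) * theta_term 1 0 \<tau> (a - b) =
      theta_term 1 (1/2) (2 * \<tau>) a * theta_term 1 (1/2) (2 * \<tau>) b"
    by (rule trans [OF theta_term_mult [where c = 1 and a = a and b = b and u = "1/2" and v = "1/2" and \<epsilon>' = 1 and \<delta>' = 1]])
      (use theta_sq in \<open>simp_all add: theta_sign theta_sign_square\<close>)
qed (use assms in \<open>auto intro!: theta_summable\<close>)

lemma theta_44:
  assumes "Im \<tau> > 0"
  shows "theta (-1) 0 \<tau> ^ 2 = theta 1 0 (2 * \<tau>) ^ 2 - theta 1 (1/2) (2 * \<tau>) ^ 2"
proof -
  have "theta (-1) 0 \<tau> * theta (-1) 0 \<tau> = theta 1 0 (2 * \<tau>) * theta 1 0 (2 * \<tau>) +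
     (\<Sum>\<^sub>\<infinity>n. -1 * theta_term 1 (1/2) (2 * \<tau>) n) * theta 1 (1/2) (2 * \<tau>)"
    unfolding theta_def
  proof (rule parity_resummation)
    fix a b :: int
    show "theta_term (-1) 0 \<tau> (a + b) * theta_term (-1) 0 \<tau> (a - b) =
        theta_term 1 0 (2 * \<tau>) a * theta_term 1 0 (2 * \<tau>) b"
      by (rule trans [OF theta_term_mult [where c = 1 and a = a and b = b and u = 0 and v = 0 and \<epsilon>' = 1 and \<delta>' = 1]])
        (use theta_sq in \<open>simp_all add: theta_sign theta_sign_square\<close>)
    show "theta_term (-1) 0 \<tau> (a + b + 1) * theta_term (-1) 0 \<tau> (a - b) =
        -1 * theta_term 1 (1/2) (2 * \<tau>) a * theta_term 1 (1/2) (2 * \<tau>) b"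
      by (rule trans [OF theta_term_mult [where c = "-1" and a = a and b = b and u = "1/2" and v = "1/2" and \<epsilon>' = 1 and \<delta>' = 1]])
        (use theta_sq in \<open>simp_all add: theta_sign theta_sign_square\<close>)
  qed (use assms in \<open>auto intro!: theta_summable\<close>)
  then show ?thesis
    by (simp add: power2_eq_square infsum_uminus theta_def)
qed

lemma theta_22:
  assumes "Im \<tau> > 0"
  shows "theta 1 (1/2) \<tau> ^ 2 = 2 * theta 1 (1/2) (2 * \<tau>) * theta 1 0 (2 * \<tau>)"
proof -
  have bij: "bij_betw (\<lambda>n::int. n + 1) UNIV UNIV"
    by (auto intro!: bij_betwI [of _ _ _ "\<lambda>n. n - 1"])
  have "theta 1 (1/2) \<tau> * theta 1 (1/2) \<tau> = theta 1 (1/2) (2 * \<tau>) * theta 1 0 (2 * \<tau>) +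
     (\<Sum>\<^sub>\<infinity>n. theta_term 1 0 (2 * \<tau>) (n + 1)) * theta 1 (1/2) (2 * \<tau>)"
    unfolding theta_def
  proof (rule parity_resummation)
    fix a b :: int
    show "theta_term 1 (1/2) \<tau> (a + b) * theta_term 1 (1/2) \<tau> (a - b) =
        theta_term 1 (1/2) (2 * \<tau>) a * theta_term 1 0 (2 * \<tau>) b"
      by (rule trans [OF theta_term_mult [where c = 1 and a = a and b = b and u = "1/2" and v = 0 and \<epsilon>' = 1 and \<delta>' = 1]])
        (use theta_sq in \<open>simp_all add: theta_sign theta_sign_square\<close>)
    show "theta_term 1 (1/2) \<tau> (a + b + 1) * theta_term 1 (1/2) \<tau> (a - b) =
        theta_term 1 0 (2 * \<tau>) (a + 1) * theta_term 1 (1/2) (2 * \<tau>) b"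
      by (rule trans [OF theta_term_mult [where c = 1 and a = "a + 1" and b = b and u = 0 and v = "1/2" and \<epsilon>' = 1 and \<delta>' = 1]])
        (use theta_sq in \<open>simp_all add: theta_sign theta_sign_square\<close>)
    show "(\<lambda>n. norm (theta_term 1 0 (2 * \<tau>) (n + 1))) summable_on UNIV"
      using summable_on_reindex_bij_betw [OF bij, of "\<lambda>n. norm (theta_term 1 0 (2 * \<tau>) n)"]
        theta_summable [of 1 0 "2 * \<tau>"] assms by simp
  qed (use assms in \<open>auto intro!: theta_summable\<close>)
  moreover have "(\<Sum>\<^sub>\<infinity>n. theta_term 1 0 (2 * \<tau>) (n + 1)) = theta 1 0 (2 * \<tau>)"
    unfolding theta_def by (rule infsum_reindex_bij_betw [OF bij])
  ultimately show ?thesis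
    by (simp add: power2_eq_square)
qed

text \<open>Purely a consequence of duplication: \<theta>_3^4 - \<theta>_4^4 is a difference of
  squares, and its factors at \<tau> are twice \<theta>_3^2 and twice \<theta>_2^2 at 2\<tau>, whose
  product is the square of \<theta>_2^2 at \<tau>.\<close>

lemma jacobi_identity:
  assumes "Im \<tau> > 0"
  shows "theta 1 0 \<tau> ^ 4 = theta 1 (1/2) \<tau> ^ 4 + theta (-1) 0 \<tau> ^ 4"
proof -
  have "theta 1 0 \<tau> ^ 4 - theta (-1) 0 \<tau> ^ 4 =
      (theta 1 0 \<tau> ^ 2 + theta (-1) 0 \<tau> ^ 2) * (theta 1 0 \<tau> ^ 2 - theta (-1) 0 \<tau> ^ 2)"
    by (simp add: algebra_simps power2_eq_square power4_eq_xxxx)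
  also have "\<dots> = (2 * theta 1 (1/2) (2 * \<tau>) * theta 1 0 (2 * \<tau>)) ^ 2"
    unfolding theta_33 [OF assms] theta_44 [OF assms] by (simp add: power2_eq_square algebra_simps)
  also have "\<dots> = theta 1 (1/2) \<tau> ^ 4"
    unfolding theta_22 [OF assms, symmetric] by simp
  finally show ?thesis
    by (simp add: algebra_simps)
qed

section \<open>Power series of the theta constants\<close>

lemma has_sum_fibres:
  fixes f :: "'i \<Rightarrow> complex" and e :: "'i \<Rightarrow> nat"
  assumes f: "(f has_sum S) UNIV" and fin: "\<And>k. finite {i. e i = k}"
  shows "(\<lambda>k. \<Sum>i\<in>{i. e i = k}. f i) sums S"
proof -
  have bij: "bij_betw snd (Sigma (UNIV :: nat set) (\<lambda>k. {i. e i = k})) (UNIV :: 'i set)"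
    by (rule bij_betwI [where g = "\<lambda>i. (e i, i)"]) auto
  have "((\<lambda>x. f (snd x)) has_sum S) (Sigma (UNIV :: nat set) (\<lambda>k. {i. e i = k}))"
    using f has_sum_reindex_bij_betw [OF bij, of f S] by simp
  then have "((\<lambda>k. \<Sum>i\<in>{i. e i = k}. f i) has_sum S) UNIV"
    by (rule has_sum_SigmaD) (simp add: has_sum_finite fin)
  then show ?thesis
    by (rule has_sum_imp_sums)
qed

lemma theta_summable':
  assumes "\<epsilon> = 1 \<or> \<epsilon> = -1" "r = 0 \<or> r = 1/2" "Im \<tau> > 0"
  shows "theta_term \<epsilon> r \<tau> summable_on UNIV"
  by (rule Infinite_Sum.abs_summable_summable [OF theta_summable [OF assms]])

definition theta_fps :: "complex \<Rightarrow> complex fps" where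
  "theta_fps \<epsilon> = Abs_fps (\<lambda>k. \<Sum>n\<in>{n::int. nat (n\<^sup>2) = k}. \<epsilon> powi n)"

text \<open>The series of \<open>theta 1 (1/2)\<close> has exponents n^2 + n + 1/4 in the nome, so
  it is no power series in it. Dividing by twice the fourth root of the nome, the terms n and -1 - n
  being equal, leaves \<open>psi\<close>, with integral coefficients and constant term 1.\<close>

definition psi :: "complex \<Rightarrow> complex" where
  "psi \<tau> = (\<Sum>\<^sub>\<infinity>n::nat. exp (of_real pi * \<i> * \<tau>) ^ (n\<^sup>2 + n))"

definition psi_fps :: "complex fps" where
  "psi_fps = Abs_fps (\<lambda>k. of_nat (card {n::nat. n\<^sup>2 + n = k}))"

lemma finite_square_fibre: "finite {n::int. nat (n\<^sup>2) = k}"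
proof (rule finite_subset)
  show "{n::int. nat (n\<^sup>2) = k} \<subseteq> {- int k..int k}"
  proof
    fix n :: int assume "n \<in> {n. nat (n\<^sup>2) = k}"
    then have k: "n\<^sup>2 = int k"
      by auto
    have "\<bar>n\<bar> * 1 \<le> \<bar>n\<bar> * \<bar>n\<bar>"
      by (cases "n = 0") (simp, intro mult_left_mono, auto)
    then have "\<bar>n\<bar> \<le> int k"
      using k by (simp add: power2_eq_square)
    then show "n \<in> {- int k..int k}"
      by auto
  qed
qed simp

lemma has_qexp_theta:
  assumes \<epsilon>: "\<epsilon> = 1 \<or> \<epsilon> = -1"
  shows "has_qexp (theta \<epsilon> 0) (theta_fps \<epsilon>)"
proof (rule has_qexpI_sums)
  fix \<tau> :: complex assume \<tau>: "Im \<tau> > 0"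
  let ?t = "exp (of_real pi * \<i> * \<tau>)"
  have trm: "theta_term \<epsilon> 0 \<tau> n = \<epsilon> powi n * ?t ^ nat (n\<^sup>2)" for n
  proof -
    have "complex_of_int (n\<^sup>2) = of_nat (nat (n\<^sup>2))"
      by (simp add: of_nat_nat)
    then have "of_real pi * \<i> * (of_int n + 0)\<^sup>2 * \<tau> = of_nat (nat (n\<^sup>2)) * (of_real pi * \<i> * \<tau>)"
      by simp
    then show ?thesis
      by (simp only: theta_term_def exp_of_nat_mult)
  qed
  have "(theta_term \<epsilon> 0 \<tau> has_sum theta \<epsilon> 0 \<tau>) UNIV"
    unfolding theta_def using \<epsilon> \<tau> by (intro has_sum_infsum theta_summable') auto
  from has_sum_fibres [OF this finite_square_fibre]
  show "(\<lambda>k. fps_nth (theta_fps \<epsilon>) k * ?t ^ k) sums theta \<epsilon> 0 \<tau>"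
    by (simp add: theta_fps_def trm sum_distrib_right)
qed

lemma theta_fps_0: "fps_nth (theta_fps \<epsilon>) 0 = 1"
proof -
  have "{n::int. nat (n\<^sup>2) = 0} = {0}"
    by auto
  then show ?thesis
    by (simp add: theta_fps_def)
qed

lemma theta_fps_Ints: "\<epsilon> = 1 \<or> \<epsilon> = -1 \<Longrightarrow> fps_nth (theta_fps \<epsilon>) k \<in> \<int>"
  unfolding theta_fps_def by (auto simp: power_int_minus_left)

lemma theta_half_psi:
  assumes \<tau>: "Im \<tau> > 0"
  shows "theta 1 (1/2) \<tau> = 2 * exp (of_real pi * \<i> * \<tau> / 4) * psi \<tau>"
    and "has_qexp psi psi_fps"
proof -
  let ?t = "\<lambda>\<tau>. exp (of_real pi * \<i> * \<tau>)"
  have trm: "theta_term 1 (1/2) \<tau> (int n) = exp (of_real pi * \<i> * \<tau> / 4) * ?t \<tau> ^ (n\<^sup>2 + n)" for n \<tau>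
  proof -
    have "of_real pi * \<i> * (of_int (int n) + 1/2)\<^sup>2 * \<tau> = of_real pi * \<i> * \<tau> / 4 + of_nat (n\<^sup>2 + n) * (of_real pi * \<i> * \<tau>)"
      by (simp add: power2_sum power_divide) (simp add: algebra_simps)
    then show ?thesis
      by (simp only: theta_term_def power_int_1_left mult_1_left exp_add exp_of_nat_mult)
  qed
  have refl: "theta_term 1 (1/2) \<tau> (- 1 - n) = theta_term 1 (1/2) \<tau> n" for n \<tau>
  proof -
    have "(of_int (- 1 - n) + 1/2 :: complex)\<^sup>2 = (of_int n + 1/2)\<^sup>2"
      by (simp add: power2_eq_square algebra_simps)
    then show ?thesis
      by (simp only: theta_term_def power_int_1_left)
  qed
  have psi_sum: "((\<lambda>n. ?t \<tau> ^ (n\<^sup>2 + n)) has_sum psi \<tau>) UNIV" if \<tau>: "Im \<tau> > 0" for \<tau>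
  proof -
    have "theta_term 1 (1/2) \<tau> summable_on UNIV"
      using \<tau> by (intro theta_summable') auto
    then have "theta_term 1 (1/2) \<tau> summable_on range int"
      by (rule summable_on_subset_banach) auto
    then have "(\<lambda>n. exp (of_real pi * \<i> * \<tau> / 4) * ?t \<tau> ^ (n\<^sup>2 + n)) summable_on UNIV"
      by (subst (asm) summable_on_reindex) (auto simp: o_def trm)
    then have "(\<lambda>n. ?t \<tau> ^ (n\<^sup>2 + n)) summable_on UNIV"
      by (subst (asm) summable_on_cmult_right') auto
    then show ?thesis
      unfolding psi_def by (rule has_sum_infsum)
  qed
  have h1: "(theta_term 1 (1/2) \<tau> has_sum (exp (of_real pi * \<i> * \<tau> / 4) * psi \<tau>)) (range int)"
    using has_sum_cmult_right [OF psi_sum [OF \<tau>], of "exp (of_real pi * \<i> * \<tau> / 4)"]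
    by (subst has_sum_reindex) (auto simp: o_def trm)
  have h2: "(theta_term 1 (1/2) \<tau> has_sum (exp (of_real pi * \<i> * \<tau> / 4) * psi \<tau>)) (range (\<lambda>n. - 1 - int n))"
    using has_sum_cmult_right [OF psi_sum [OF \<tau>], of "exp (of_real pi * \<i> * \<tau> / 4)"]
    by (subst has_sum_reindex) (auto simp: o_def trm refl inj_on_def)
  have "range int \<inter> range (\<lambda>n. - 1 - int n) = {}"
    by auto
  from has_sum_Un_disjoint [OF h1 h2 this] show "theta 1 (1/2) \<tau> = 2 * exp (of_real pi * \<i> * \<tau> / 4) * psi \<tau>"
    unfolding int_UNIV_split [symmetric] theta_def by (simp add: infsumI)
  show "has_qexp psi psi_fps"
  proof (rule has_qexpI_sums)
    fix \<tau> :: complex assume "Im \<tau> > 0"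
    have "finite {n::nat. n\<^sup>2 + n = k}" for k
      by (rule finite_subset [of _ "{..k}"]) auto
    from has_sum_fibres [OF psi_sum [OF \<open>Im \<tau> > 0\<close>] this]
    show "(\<lambda>k. fps_nth psi_fps k * ?t \<tau> ^ k) sums psi \<tau>"
      by (simp add: psi_fps_def)
  qed
qed

lemma psi_fps_0: "fps_nth psi_fps 0 = 1"
proof -
  have "{n::nat. n\<^sup>2 + n = 0} = {0}"
    by auto
  then show ?thesis
    by (simp add: psi_fps_def)
qed

lemma psi_fps_Ints: "fps_nth psi_fps k \<in> \<int>"
  by (simp add: psi_fps_def)

lemma has_qexp_psi: "has_qexp psi psi_fps"
  by (rule theta_half_psi(2) [of \<i>]) simp

subsection \<open>Non-vanishing and translation\<close>

text \<open>A zero at \<tau> propagates to all 2^n \<tau>, whose nomes tend to 0; by continuity the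
  constant term of the expansion would vanish.\<close>

lemma qexp_nonvanishing:
  assumes f: "has_qexp f a" and a0: "fps_nth a 0 \<noteq> 0"
    and double: "\<And>\<tau>. Im \<tau> > 0 \<Longrightarrow> f \<tau> = 0 \<Longrightarrow> f (2 * \<tau>) = 0"
    and \<tau>: "Im \<tau> > 0"
  shows "f \<tau> \<noteq> 0"
proof
  assume zero: "f \<tau> = 0"
  have im: "Im (2 ^ n * \<tau>) = 2 ^ n * Im \<tau>" for n
    by (induction n) (auto simp: mult.assoc)
  have zeros: "f (2 ^ n * \<tau>) = 0" for n
  proof (induction n)
    case (Suc n)
    then show ?case
      using double [of "2 ^ n * \<tau>"] \<tau> by (simp add: im mult.assoc)
  qed (use zero in simp)
  have "(\<lambda>n. exp (- pi * Im \<tau>) ^ n) \<longlonglongrightarrow> 0"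
    using \<tau> by (intro LIMSEQ_power_zero) simp
  then have lim: "(\<lambda>n. norm (exp (of_real pi * \<i> * (2 ^ n * \<tau>)))) \<longlonglongrightarrow> 0"
  proof (rule tendsto_sandwich [rotated 3, where f = "\<lambda>_. 0"])
    show "\<forall>\<^sub>F n in sequentially. norm (exp (of_real pi * \<i> * (2 ^ n * \<tau>))) \<le> exp (- pi * Im \<tau>) ^ n"
    proof (rule always_eventually, rule allI)
      fix n
      have "real n \<le> 2 ^ n"
        using of_nat_less_two_power [of n] by (metis less_imp_le)
      then have "real n * (pi * Im \<tau>) \<le> 2 ^ n * (pi * Im \<tau>)"
        using \<tau> by (intro mult_right_mono) auto
      then show "norm (exp (of_real pi * \<i> * (2 ^ n * \<tau>))) \<le> exp (- pi * Im \<tau>) ^ n"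
        unfolding norm_nome im by (simp add: exp_of_nat_mult [symmetric] mult_ac)
    qed
  qed auto
  then have "(\<lambda>n. exp (of_real pi * \<i> * (2 ^ n * \<tau>))) \<longlonglongrightarrow> 0"
    by (rule tendsto_norm_zero_cancel)
  moreover have "isCont (eval_fps a) 0"
    using has_qexp_in_disk [OF f, of 0] by (intro continuous_eval_fps) (auto simp: zero_ereal_def)
  ultimately have "(\<lambda>n. eval_fps a (exp (of_real pi * \<i> * (2 ^ n * \<tau>)))) \<longlonglongrightarrow> eval_fps a 0"
    by (rule isCont_tendsto_compose [rotated])
  moreover have "eval_fps a (exp (of_real pi * \<i> * (2 ^ n * \<tau>))) = 0" for n
    using has_qexpD [OF f, of "2 ^ n * \<tau>"] zeros [of n] \<tau> by (simp add: im)
  ultimately have "eval_fps a 0 = 0"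
    using LIMSEQ_unique [OF _ tendsto_const] by simp
  then show False
    using a0 by (simp add: eval_fps_at_0)
qed

lemma theta4_nonzero: "Im \<tau> > 0 \<Longrightarrow> theta (-1) 0 \<tau> \<noteq> 0"
proof (rule qexp_nonvanishing [OF has_qexp_theta])
  fix \<tau> assume "Im \<tau> > 0" "theta (-1) 0 \<tau> = 0"
  then show "theta (-1) 0 (2 * \<tau>) = 0"
    using theta_34 [of \<tau>] by simp
qed (auto simp: theta_fps_0)

lemma theta3_nonzero: "Im \<tau> > 0 \<Longrightarrow> theta 1 0 \<tau> \<noteq> 0"
  using theta_34 [of \<tau>] theta4_nonzero [of "2 * \<tau>"] by auto

text \<open>The doubling argument requires a nonzero constant term. It is applied to
  \<open>psi\<close> because \<open>theta 1 (1/2)\<close> itself tends to 0 at the cusp.\<close>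

lemma psi_nonzero: "Im \<tau> > 0 \<Longrightarrow> psi \<tau> \<noteq> 0"
proof (rule qexp_nonvanishing [OF has_qexp_psi])
  fix \<tau> assume "Im \<tau> > 0" "psi \<tau> = 0"
  then show "psi (2 * \<tau>) = 0"
    using theta_22 [of \<tau>] theta3_nonzero [of "2 * \<tau>"] theta_half_psi(1) [of \<tau>] theta_half_psi(1) [of "2 * \<tau>"] by simp
qed (auto simp: psi_fps_0)

lemma theta2_nonzero: "Im \<tau> > 0 \<Longrightarrow> theta 1 (1/2) \<tau> \<noteq> 0"
  using theta_half_psi(1) [of \<tau>] psi_nonzero [of \<tau>] by simp

lemma exp_pi_i_of_int: "exp (of_real pi * \<i> * of_int m) = (-1) powi m"
proof -
  have "exp (of_real pi * \<i>) powi m = exp (of_int m * (of_real pi * \<i>))"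
    by (rule exp_power_int)
  then show ?thesis
    by (simp add: mult.commute)
qed

lemma neg_one_powi_square: "(-1 :: complex) powi (n\<^sup>2) = (-1) powi n"
  by (auto simp: power_int_minus_left)

lemma theta_shift_0:
  assumes "\<epsilon> = 1 \<or> \<epsilon> = -1"
  shows "theta \<epsilon> 0 (\<tau> + 1) = theta (- \<epsilon>) 0 \<tau>"
  unfolding theta_def
proof (rule infsum_cong)
  fix n :: int
  have "of_real pi * \<i> * (of_int n + 0)\<^sup>2 * (\<tau> + 1) =
      of_real pi * \<i> * of_int (n\<^sup>2) + of_real pi * \<i> * (of_int n + 0)\<^sup>2 * \<tau>"
    by (simp add: algebra_simps)
  then have "exp (of_real pi * \<i> * (of_int n + 0)\<^sup>2 * (\<tau> + 1)) =
      (-1) powi n * exp (of_real pi * \<i> * (of_int n + 0)\<^sup>2 * \<tau>)"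
    by (simp only: exp_add exp_pi_i_of_int neg_one_powi_square)
  moreover have "(- \<epsilon>) powi n = \<epsilon> powi n * (-1) powi n"
    using assms by (auto simp: power_int_minus_left)
  ultimately show "theta_term \<epsilon> 0 (\<tau> + 1) n = theta_term (- \<epsilon>) 0 \<tau> n"
    by (simp only: theta_term_def mult_ac)
qed

lemma theta_shift_half: "theta 1 (1/2) (\<tau> + 1) = exp (of_real pi * \<i> / 4) * theta 1 (1/2) \<tau>"
proof -
  have "theta_term 1 (1/2) (\<tau> + 1) n = exp (of_real pi * \<i> / 4) * theta_term 1 (1/2) \<tau> n" for n
  proof -
    have "even (n\<^sup>2 + n)"
      by simp
    then have e: "exp (of_real pi * \<i> * of_int (n\<^sup>2 + n)) = 1"
      unfolding exp_pi_i_of_int by (simp add: power_int_minus_left)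
    have "of_real pi * \<i> * (of_int n + 1/2)\<^sup>2 * (\<tau> + 1) =
        of_real pi * \<i> / 4 + of_real pi * \<i> * of_int (n\<^sup>2 + n) + of_real pi * \<i> * (of_int n + 1/2)\<^sup>2 * \<tau>"
      by (simp add: power2_sum power_divide) (simp add: algebra_simps)
    then show ?thesis
      by (simp only: theta_term_def exp_add e power_int_1_left mult_1_left mult_1_right)
  qed
  then show ?thesis
    by (simp add: theta_def infsum_cmult_right')
qed

subsection \<open>Gaussian Riemann sums\<close>

lemma gaussian_integral_Icc:
  "((\<lambda>y. integral {0..y} (\<lambda>x::real. exp (- x\<^sup>2))) \<longlongrightarrow> sqrt pi / 2) at_top"
proof -
  let ?g = "\<lambda>x::real. indicator {0..} x *\<^sub>R exp (- x\<^sup>2)"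
  have g: "integrable lborel ?g" "integral\<^sup>L lborel ?g = sqrt pi / 2"
    using gaussian_moment_0 by (auto simp: has_bochner_integral_iff)
  have "((\<lambda>y. \<integral>x. indicator {..y} x *\<^sub>R ?g x \<partial>lborel) \<longlongrightarrow> sqrt pi / 2) at_top"
    unfolding g(2) [symmetric] by (rule tendsto_integral_at_top [OF _ g(1)]) simp
  moreover have "(\<integral>x. indicator {..y} x *\<^sub>R ?g x \<partial>lborel) = integral {0..y} (\<lambda>x. exp (- x\<^sup>2))" for y
  proof -
    have "set_integrable lborel {0..y} (\<lambda>x::real. exp (- x\<^sup>2))"
      by (intro borel_integrable_atLeastAtMost') (intro continuous_intros)
    then have "integral {0..y} (\<lambda>x::real. exp (- x\<^sup>2)) = (LINT x:{0..y}|lborel. exp (- x\<^sup>2))"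
      by (simp add: set_borel_integral_eq_integral(2))
    also have "\<dots> = (\<integral>x. indicator {..y} x *\<^sub>R ?g x \<partial>lborel)"
      unfolding set_lebesgue_integral_def by (intro Bochner_Integration.integral_cong) (auto simp: indicator_def)
    finally show ?thesis ..
  qed
  ultimately show ?thesis
    by simp
qed

lemma gaussian_integral_step:
  assumes h: "h > 0"
  shows "integral {0..real (Suc n) * h} (\<lambda>x::real. exp (- x\<^sup>2)) - integral {0..real n * h} (\<lambda>x::real. exp (- x\<^sup>2))
    \<in> {h * exp (- (real (Suc n) * h)\<^sup>2)..h * exp (- (real n * h)\<^sup>2)}"
proof -
  let ?f = "\<lambda>x::real. exp (- x\<^sup>2)"
  define a b where "a = real n * h" and "b = real (Suc n) * h"
  have ab: "0 \<le> a" "a \<le> b" "b - a = h"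
    using h by (auto simp: a_def b_def algebra_simps)
  have int: "?f integrable_on {c..d}" for c d
    by (intro integrable_continuous_interval continuous_intros)
  have mono: "?f y \<le> ?f x" if "0 \<le> x" "x \<le> y" for x y
    using that by (simp add: power_mono)
  have "integral {0..a} ?f + integral {a..b} ?f = integral {0..b} ?f"
    by (intro Henstock_Kurzweil_Integration.integral_combine ab int)
  moreover have "integral {a..b} (\<lambda>_. ?f b) \<le> integral {a..b} ?f"
    by (intro integral_le int integrable_const_ivl mono) (use ab in auto)
  moreover have "integral {a..b} ?f \<le> integral {a..b} (\<lambda>_. ?f a)"
    by (intro integral_le int integrable_const_ivl mono) (use ab in auto)
  moreover have const: "integral {a..b} (\<lambda>_. c) = h * c" for c :: real
    using ab by simp
  ultimately show ?thesis
    unfolding a_def [symmetric] b_def [symmetric] const atLeastAtMost_iff by linarith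
qed

text \<open>The integrand decreases, so its integral lies between the right and the left Riemann
  sum, and these differ by at most h times the value 1 at 0.\<close>

lemma gaussian_sum_bounds:
  assumes h: "h > 0" and s: "summable (\<lambda>n. exp (- (real (Suc n) * h)\<^sup>2))"
  shows "h * suminf (\<lambda>n. exp (- (real (Suc n) * h)\<^sup>2)) \<in> {sqrt pi / 2 - h..sqrt pi / 2}"
proof -
  let ?f = "\<lambda>x::real. exp (- x\<^sup>2)"
  let ?I = "\<lambda>n. integral {0..real n * h} ?f"
  let ?S = "\<lambda>n. h * (\<Sum>i<n. ?f (real (Suc i) * h))"
  have "filterlim (\<lambda>n. real n * h) at_top sequentially"
    by (rule filterlim_at_top_mult_tendsto_pos [OF tendsto_const h filterlim_real_sequentially])
  then have I: "?I \<longlonglongrightarrow> sqrt pi / 2"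
    by (rule filterlim_compose [OF gaussian_integral_Icc])
  have S: "?S \<longlonglongrightarrow> h * suminf (\<lambda>n. ?f (real (Suc n) * h))"
    using s by (intro tendsto_mult tendsto_const summable_LIMSEQ)
  \<comment> \<open>The upper bound is the left Riemann sum, written through the right one by adding
    the value at 0 and dropping the value at n h.\<close>
  have "?S n \<le> ?I n \<and> ?I n \<le> h + ?S n - h * ?f (real n * h)" for n
  proof (induction n)
    case (Suc n)
    then show ?case
      using gaussian_integral_step [OF h, of n] by (auto simp: distrib_left)
  qed simp
  then have b: "?S n \<le> ?I n" "?I n \<le> h + ?S n" for n
    using h by (auto simp: less_imp_le intro: order_trans [of _ "h + ?S n - h * ?f (real n * h)"])
  have "h * suminf (\<lambda>n. ?f (real (Suc n) * h)) \<le> sqrt pi / 2"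
    using b(1) by (intro LIMSEQ_le [OF S I]) auto
  moreover have "sqrt pi / 2 \<le> h + h * suminf (\<lambda>n. ?f (real (Suc n) * h))"
    using b(2) by (intro LIMSEQ_le [OF I tendsto_add [OF tendsto_const S]]) auto
  ultimately show ?thesis
    by auto
qed

definition theta_re :: "complex \<Rightarrow> complex \<Rightarrow> real \<Rightarrow> real" where
  "theta_re \<epsilon> r t = Re (theta \<epsilon> r (\<i> * of_real t))"

lemma theta_term_imaginary_axis:
  assumes "\<epsilon> = 1 \<or> \<epsilon> = -1" "r = of_real s"
  shows "theta_term \<epsilon> r (\<i> * of_real t) n = of_real (Re \<epsilon> powi n * exp (- pi * (of_int n + s)\<^sup>2 * t))"
proof -
  have "of_real pi * \<i> * (of_int n + r)\<^sup>2 * (\<i> * of_real t) = complex_of_real (- pi * (of_int n + s)\<^sup>2 * t)"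
    by (simp add: assms(2) complex_eq_iff)
  moreover have "\<epsilon> powi n = of_real (Re \<epsilon> powi n)"
    using assms(1) by (auto simp: power_int_minus_left)
  ultimately show ?thesis
    unfolding theta_term_def of_real_mult [of "Re \<epsilon> powi n"] exp_of_real [symmetric] by (simp only:)
qed

lemma theta_imaginary_axis:
  assumes "\<epsilon> = 1 \<or> \<epsilon> = -1" "r = 0 \<or> r = 1/2" "t > 0"
  shows "theta \<epsilon> r (\<i> * of_real t) = of_real (theta_re \<epsilon> r t)"
    and "\<epsilon> = 1 \<Longrightarrow> theta_re \<epsilon> r t \<ge> 0"
proof -
  obtain s where s: "r = of_real s"
    using assms(2) by (metis of_real_0 of_real_1 of_real_divide of_real_numeral)
  have sm: "theta_term \<epsilon> r (\<i> * of_real t) summable_on UNIV"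
    using assms by (intro theta_summable') auto
  have "Im (theta \<epsilon> r (\<i> * of_real t)) = 0"
    unfolding theta_def infsum_Im [OF sm, symmetric] theta_term_imaginary_axis [OF assms(1) s]
    by (simp only: Im_complex_of_real infsum_0_simp)
  then show "theta \<epsilon> r (\<i> * of_real t) = of_real (theta_re \<epsilon> r t)"
    by (simp add: theta_re_def complex_eq_iff)
  show "theta_re \<epsilon> r t \<ge> 0" if "\<epsilon> = 1"
    unfolding theta_re_def theta_def infsum_Re [OF sm, symmetric] theta_term_imaginary_axis [OF assms(1) s]
    by (rule infsum_nonneg) (simp only: Re_complex_of_real, simp add: that)
qed

text \<open>With step h = sqrt (pi t) the series is 1 + 2G, where G sums the Gaussian at the points
  h, 2h, 3h, and so on. This is the source of the asymptotics \<theta>_3(it) ~ t^(-1/2) for t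
  tending to 0.\<close>

lemma theta3_riemann_sum:
  assumes t: "t > 0"
  shows "sqrt (pi * t) * theta_re 1 0 t \<in> {sqrt pi - sqrt (pi * t)..sqrt pi + sqrt (pi * t)}"
proof -
  define h where "h = sqrt (pi * t)"
  have h: "h > 0" "h\<^sup>2 = pi * t"
    using t by (auto simp: h_def)
  define g where "g n = exp (- (real (Suc n) * h)\<^sup>2)" for n
  have trm: "theta_term 1 0 (\<i> * of_real t) n = of_real (exp (- (of_int n * h)\<^sup>2))" for n
    unfolding theta_term_imaginary_axis [of 1 0 0 t n, simplified] by (simp add: power_mult_distrib h mult_ac)
  have sm: "theta_term 1 0 (\<i> * of_real t) summable_on UNIV"
    using t by (intro theta_summable') auto
  have inj: "inj (\<lambda>n. int (Suc n))" "inj (\<lambda>n. - 1 - int n)"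
    by (auto simp: inj_on_def)
  have neg: "theta_term 1 0 (\<i> * of_real t) (- 1 - int n) = complex_of_real (g n)" for n
  proof -
    have "(of_int (- 1 - int n) * h)\<^sup>2 = (real (Suc n) * h)\<^sup>2"
      by (simp add: power_mult_distrib) (simp add: power2_eq_square algebra_simps)
    then show ?thesis
      by (simp only: trm g_def)
  qed
  have pos: "theta_term 1 0 (\<i> * of_real t) (int (Suc n)) = complex_of_real (g n)" for n
    unfolding trm g_def of_int_of_nat_eq ..
  have "theta_term 1 0 (\<i> * of_real t) summable_on range (\<lambda>n. int (Suc n))"
    using sm by (rule summable_on_subset_banach) auto
  then have "(\<lambda>n. complex_of_real (g n)) summable_on UNIV"
    unfolding summable_on_reindex [OF inj(1)] by (simp only: o_def pos)
  from summable_on_Re [OF this] have gs: "g summable_on UNIV"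
    by simp
  then have gsum: "summable g"
    by (rule summable_on_imp_summable)
  define G where "G = infsum g UNIV"
  have G: "(g has_sum G) UNIV"
    unfolding G_def by (rule has_sum_infsum [OF gs])
  have "g sums G"
    by (rule has_sum_imp_sums [OF G])
  then have G_suminf: "suminf g = G"
    by (simp add: sums_iff)
  have h1: "(theta_term 1 0 (\<i> * of_real t) has_sum of_real G) (range (\<lambda>n. int (Suc n)))"
    unfolding has_sum_reindex [OF inj(1)] using has_sum_of_real [OF G] by (simp only: o_def pos)
  have h2: "(theta_term 1 0 (\<i> * of_real t) has_sum of_real G) (range (\<lambda>n. - 1 - int n))"
    unfolding has_sum_reindex [OF inj(2)] using has_sum_of_real [OF G] by (simp only: o_def neg)
  have disj: "range (\<lambda>n. int (Suc n)) \<inter> range (\<lambda>n. - 1 - int n) = {}"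
    by auto
  have univ: "insert 0 (range (\<lambda>n. int (Suc n)) \<union> range (\<lambda>n. - 1 - int n)) = UNIV"
  proof -
    have "n \<in> insert 0 (range (\<lambda>n. int (Suc n)) \<union> range (\<lambda>n. - 1 - int n))" for n
    proof -
      consider "n = 0" | "n > 0" | "n < 0"
        by linarith
      then show ?thesis
      proof cases
        case 2
        then have "n = int (Suc (nat (n - 1)))" by simp
        then show ?thesis by blast
      next
        case 3
        then have "n = - 1 - int (nat (- 1 - n))" by simp
        then show ?thesis by blast
      qed simp
    qed
    then show ?thesis by blast
  qed
  have "(theta_term 1 0 (\<i> * of_real t) has_sum (theta_term 1 0 (\<i> * of_real t) 0 + (of_real G + of_real G))) UNIV"
    unfolding univ [symmetric] by (intro has_sum_insert has_sum_Un_disjoint h1 h2 disj) auto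
  then have "theta 1 0 (\<i> * of_real t) = of_real (1 + 2 * G)"
    unfolding theta_def by (simp add: infsumI trm)
  then have "theta_re 1 0 t = 1 + 2 * G"
    by (simp add: theta_re_def)
  moreover have "h * G \<in> {sqrt pi / 2 - h..sqrt pi / 2}"
    using gaussian_sum_bounds [OF h(1)] gsum G_suminf unfolding g_def by simp
  ultimately show ?thesis
    unfolding h_def [symmetric] by (auto simp: algebra_simps)
qed

subsection \<open>Inversion by the arithmetic-geometric mean\<close>

text \<open>The n-th arithmetic mean of the iteration, not the limit; for quotients of theta
  constants the limits are computed in \<open>agm_theta_limits\<close>.\<close>

fun agm :: "nat \<Rightarrow> real \<Rightarrow> real \<Rightarrow> real" where
  "agm 0 a b = a"
| "agm (Suc n) a b = agm n ((a + b) / 2) (sqrt (a * b))"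

lemma agm_mono:
  "0 \<le> a \<Longrightarrow> a \<le> a' \<Longrightarrow> 0 \<le> b \<Longrightarrow> b \<le> b' \<Longrightarrow> agm n a b \<le> agm n a' b'"
proof (induction n arbitrary: a b a' b')
  case (Suc n)
  then show ?case
    by (auto intro!: Suc.IH mult_mono)
qed simp

lemma agm_scale: "0 \<le> c \<Longrightarrow> 0 \<le> a \<Longrightarrow> 0 \<le> b \<Longrightarrow> agm n (c * a) (c * b) = c * agm n a b"
proof (induction n arbitrary: a b)
  case (Suc n)
  have "sqrt (c * a * (c * b)) = c * sqrt (a * b)"
  proof -
    have "c * a * (c * b) = c\<^sup>2 * (a * b)"
      by (simp add: power2_eq_square)
    then show ?thesis
      using Suc.prems by (simp add: real_sqrt_mult)
  qed
  moreover have "(c * a + c * b) / 2 = c * ((a + b) / 2)"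
    by (simp add: distrib_left)
  ultimately have "agm (Suc n) (c * a) (c * b) = agm n (c * ((a + b) / 2)) (c * sqrt (a * b))"
    by (simp only: agm.simps)
  also have "\<dots> = c * agm n ((a + b) / 2) (sqrt (a * b))"
    using Suc.prems by (intro Suc.IH) auto
  finally show ?case
    by simp
qed simp

text \<open>Monotonicity of each iterate would only give a weak inequality. After one step, however,
  both means have grown at least by a common factor c > 1, and by homogeneity this factor survives
  in the limit.\<close>

lemma agm_limit_strict_mono:
  assumes k: "0 < k1" "k1 < k2"
    and L1: "(\<lambda>n. agm n 1 k1) \<longlonglongrightarrow> L1" and L2: "(\<lambda>n. agm n 1 k2) \<longlonglongrightarrow> L2" and pos: "L1 > 0"
  shows "L1 < L2"
proof -
  define c where "c = min ((1 + k2) / (1 + k1)) (sqrt (k2 / k1))"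
  have c: "c > 1" "c * (1 + k1) \<le> 1 + k2" "c * sqrt k1 \<le> sqrt k2"
  proof -
    show "c > 1"
      using k by (simp add: c_def)
    have "c * (1 + k1) \<le> (1 + k2) / (1 + k1) * (1 + k1)"
      using k by (intro mult_right_mono) (auto simp: c_def)
    then show "c * (1 + k1) \<le> 1 + k2"
      using k by simp
    have "c * sqrt k1 \<le> sqrt (k2 / k1) * sqrt k1"
      using k by (intro mult_right_mono) (auto simp: c_def)
    also have "\<dots> = sqrt k2"
      using k by (simp add: real_sqrt_mult [symmetric])
    finally show "c * sqrt k1 \<le> sqrt k2" .
  qed
  have "c * agm (Suc n) 1 k1 \<le> agm (Suc n) 1 k2" for n
  proof -
    have "c * agm (Suc n) 1 k1 = agm n (c * ((1 + k1) / 2)) (c * sqrt k1)"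
      using agm_scale [of c "(1 + k1) / 2" "sqrt k1" n] c k by simp
    also have "\<dots> \<le> agm n ((1 + k2) / 2) (sqrt k2)"
      using c k by (intro agm_mono) auto
    finally show ?thesis by simp
  qed
  then have "c * L1 \<le> L2"
    by (intro LIMSEQ_le [OF tendsto_mult [OF tendsto_const LIMSEQ_Suc [OF L1]] LIMSEQ_Suc [OF L2]]) auto
  moreover have "L1 < c * L1"
    using c pos by simp
  ultimately show ?thesis
    by simp
qed

context
  fixes a b c :: "real \<Rightarrow> real"
  defines "a \<equiv> \<lambda>t. theta_re 1 0 t ^ 2" and "b \<equiv> \<lambda>t. theta_re (-1) 0 t ^ 2"
    and "c \<equiv> \<lambda>t. theta_re 1 (1/2) t ^ 2"
begin

text \<open>\<theta>_3 and \<theta>_2 have nonnegative terms on the imaginary axis. The series of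
  \<theta>_4 alternates, so its sign is taken from \<theta>_3 \<theta>_4 being a nonzero
  square.\<close>

lemma theta_re_pos:
  assumes t: "t > 0"
  shows "theta_re 1 0 t > 0" "theta_re 1 (1/2) t > 0" "theta_re (-1) 0 t > 0"
proof -
  note ax = theta_imaginary_axis(1) [OF _ _ t]
  have im: "Im (\<i> * of_real t) > 0"
    using t by simp
  have "theta_re 1 0 t \<noteq> 0"
    using theta3_nonzero [OF im] by (simp add: ax)
  then show 3: "theta_re 1 0 t > 0"
    using theta_imaginary_axis(2) [of 1 0 t] t by simp
  have "theta_re 1 (1/2) t \<noteq> 0"
    using theta2_nonzero [OF im] by (simp add: ax)
  then show "theta_re 1 (1/2) t > 0"
    using theta_imaginary_axis(2) [of 1 "1/2" t] t by simp
  have dbl: "2 * (\<i> * complex_of_real t) = \<i> * complex_of_real (2 * t)"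
    by simp
  have "complex_of_real (theta_re 1 0 t * theta_re (-1) 0 t) = of_real (theta_re (-1) 0 (2 * t) ^ 2)"
    using theta_34 [OF im] theta_imaginary_axis(1) [of "-1" 0 "2 * t"] t unfolding dbl by (simp add: ax)
  then have "theta_re 1 0 t * theta_re (-1) 0 t = theta_re (-1) 0 (2 * t) ^ 2"
    by (simp only: of_real_eq_iff)
  moreover have "theta_re (-1) 0 (2 * t) \<noteq> 0"
    using theta4_nonzero [of "\<i> * of_real (2 * t)"] theta_imaginary_axis(1) [of "-1" 0 "2 * t"] t by auto
  ultimately have "theta_re 1 0 t * theta_re (-1) 0 t > 0"
    by simp
  then show "theta_re (-1) 0 t > 0"
    using 3 by (simp add: zero_less_mult_iff)
qed

lemma theta_re_doubling:
  assumes t: "t > 0"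
  shows "a (2 * t) = (a t + b t) / 2" "c (2 * t) = (a t - b t) / 2"
    "b (2 * t) = sqrt (a t * b t)" "c t = 2 * sqrt (a (2 * t) * c (2 * t))" "a t ^ 2 = b t ^ 2 + c t ^ 2"
proof -
  have ax: "theta 1 0 (\<i> * of_real u) = of_real (theta_re 1 0 u)"
    "theta (-1) 0 (\<i> * of_real u) = of_real (theta_re (-1) 0 u)"
    "theta 1 (1/2) (\<i> * of_real u) = of_real (theta_re 1 (1/2) u)" if "u > 0" for u
    using that by (simp_all add: theta_imaginary_axis(1))
  have t2: "2 * t > 0"
    using t by simp
  have dbl: "2 * (\<i> * complex_of_real t) = \<i> * complex_of_real (2 * t)"
    by simp
  note ax12 = ax [OF t] ax [OF t2]
  have im: "Im (\<i> * of_real t) > 0"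
    using t by simp
  have "complex_of_real (a t) = of_real (a (2 * t) + c (2 * t))"
    using theta_33 [OF im] unfolding dbl ax12 by (simp only: a_def c_def of_real_power of_real_add)
  moreover have "complex_of_real (b t) = of_real (a (2 * t) - c (2 * t))"
    using theta_44 [OF im] unfolding dbl ax12 by (simp only: a_def b_def c_def of_real_power of_real_diff)
  ultimately have "a t = a (2 * t) + c (2 * t)" "b t = a (2 * t) - c (2 * t)"
    by (simp_all only: of_real_eq_iff)
  then show "a (2 * t) = (a t + b t) / 2" "c (2 * t) = (a t - b t) / 2"
    by simp_all
  have "complex_of_real (b (2 * t)) = of_real (theta_re 1 0 t * theta_re (-1) 0 t)"
    using theta_34 [OF im] unfolding dbl ax12 by (simp only: b_def of_real_power of_real_mult)
  then have "b (2 * t) = theta_re 1 0 t * theta_re (-1) 0 t"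
    by (simp only: of_real_eq_iff)
  then show "b (2 * t) = sqrt (a t * b t)"
    using theta_re_pos [OF t] by (simp add: a_def b_def real_sqrt_mult)
  have "complex_of_real (c t) = of_real (2 * theta_re 1 (1/2) (2 * t) * theta_re 1 0 (2 * t))"
    using theta_22 [OF im] unfolding dbl ax12 by (simp only: c_def of_real_power of_real_mult of_real_numeral)
  then have "c t = 2 * theta_re 1 (1/2) (2 * t) * theta_re 1 0 (2 * t)"
    by (simp only: of_real_eq_iff)
  then show "c t = 2 * sqrt (a (2 * t) * c (2 * t))"
    using theta_re_pos [OF t2] by (simp add: a_def c_def real_sqrt_mult)
  have "complex_of_real (theta_re 1 0 t ^ 4) = of_real (theta_re 1 (1/2) t ^ 4 + theta_re (-1) 0 t ^ 4)"
    using jacobi_identity [OF im] unfolding ax12 by (simp only: of_real_power of_real_add)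
  then have "theta_re 1 0 t ^ 4 = theta_re 1 (1/2) t ^ 4 + theta_re (-1) 0 t ^ 4"
    by (simp only: of_real_eq_iff)
  then show "a t ^ 2 = b t ^ 2 + c t ^ 2"
    by (simp add: a_def b_def c_def)
qed

lemma theta_re_sq_pos: "t > 0 \<Longrightarrow> a t > 0" "t > 0 \<Longrightarrow> b t > 0" "t > 0 \<Longrightarrow> c t > 0"
  using theta_re_pos [of t] by (auto simp: a_def b_def c_def)

text \<open>Passing from t to 2t is one step of the iteration started at \<open>a t\<close> and
  \<open>b t\<close>.\<close>

lemma agm_theta_ab: "t > 0 \<Longrightarrow> agm n (a t) (b t) = a (2 ^ n * t)"
proof (induction n arbitrary: t)
  case (Suc n)
  have "agm (Suc n) (a t) (b t) = agm n (a (2 * t)) (b (2 * t))"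
    using Suc.prems by (simp add: theta_re_doubling(1,3))
  also have "\<dots> = a (2 ^ n * (2 * t))"
    using Suc by simp
  finally show ?case
    by (simp add: mult_ac)
qed simp

text \<open>With c in place of b the iteration runs towards 0: the two means of \<open>a t\<close>
  and \<open>c t\<close> are half of \<open>a (t / 2)\<close> and \<open>c (t / 2)\<close>, and
  these halves accumulate to the power of 2 in the denominator.\<close>

lemma agm_theta_ac: "t > 0 \<Longrightarrow> agm n (a t) (c t) = a (t / 2 ^ n) / 2 ^ n"
proof (induction n arbitrary: t)
  case (Suc n)
  have t: "t / 2 > 0"
    using Suc.prems by simp
  note d = theta_re_doubling [OF t]
  have tt: "2 * (t / 2) = t"
    by simp
  have "(a t + c t) / 2 = 1/2 * a (t / 2)" "sqrt (a t * c t) = 1/2 * c (t / 2)"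
    using d unfolding tt by simp_all
  then have "agm (Suc n) (a t) (c t) = agm n (1/2 * a (t / 2)) (1/2 * c (t / 2))"
    by (simp only: agm.simps)
  also have "\<dots> = 1/2 * agm n (a (t / 2)) (c (t / 2))"
    using theta_re_sq_pos [OF t] by (intro agm_scale) auto
  also have "\<dots> = 1/2 * (a (t / 2 / 2 ^ n) / 2 ^ n)"
    using Suc.IH [OF t] by simp
  finally show ?case
    by (simp add: mult_ac)
qed simp

lemma theta_re_limit_infinity:
  assumes t: "t > 0"
  shows "(\<lambda>n. a (2 ^ n * t)) \<longlonglongrightarrow> 1"
proof -
  have "(\<lambda>n. exp (- pi * t) ^ n) \<longlonglongrightarrow> 0"
    using t by (intro LIMSEQ_power_zero) simp
  then have lim: "(\<lambda>n. norm (exp (of_real pi * \<i> * (\<i> * of_real (2 ^ n * t))))) \<longlonglongrightarrow> 0"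
  proof (rule tendsto_sandwich [rotated 3, where f = "\<lambda>_. 0"])
    show "\<forall>\<^sub>F n in sequentially. norm (exp (of_real pi * \<i> * (\<i> * of_real (2 ^ n * t)))) \<le> exp (- pi * t) ^ n"
    proof (rule always_eventually, rule allI)
      fix n
      have "real n \<le> 2 ^ n"
        using of_nat_less_two_power [of n] by (metis less_imp_le)
      then have "real n * (pi * t) \<le> 2 ^ n * (pi * t)"
        using t by (intro mult_right_mono) auto
      then show "norm (exp (of_real pi * \<i> * (\<i> * of_real (2 ^ n * t)))) \<le> exp (- pi * t) ^ n"
        unfolding norm_nome by (simp add: exp_of_nat_mult [symmetric] mult_ac)
    qed
  qed auto
  then have "(\<lambda>n. exp (of_real pi * \<i> * (\<i> * of_real (2 ^ n * t)))) \<longlonglongrightarrow> 0"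
    by (rule tendsto_norm_zero_cancel)
  moreover have q: "has_qexp (theta 1 0) (theta_fps 1)"
    by (rule has_qexp_theta) simp
  then have "isCont (eval_fps (theta_fps 1)) 0"
    using has_qexp_in_disk [OF q, of 0] by (intro continuous_eval_fps) (auto simp: zero_ereal_def)
  ultimately have "(\<lambda>n. eval_fps (theta_fps 1) (exp (of_real pi * \<i> * (\<i> * of_real (2 ^ n * t))))) \<longlonglongrightarrow> eval_fps (theta_fps 1) 0"
    by (rule isCont_tendsto_compose [rotated])
  moreover have "eval_fps (theta_fps 1) (exp (of_real pi * \<i> * (\<i> * of_real (2 ^ n * t)))) = of_real (theta_re 1 0 (2 ^ n * t))" for n
    using has_qexpD [OF q, of "\<i> * of_real (2 ^ n * t)"] theta_imaginary_axis(1) [of 1 0 "2 ^ n * t"] t by simp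
  ultimately have "(\<lambda>n. complex_of_real (theta_re 1 0 (2 ^ n * t))) \<longlonglongrightarrow> of_real 1"
    by (simp add: eval_fps_at_0 theta_fps_0)
  then have "(\<lambda>n. theta_re 1 0 (2 ^ n * t)) \<longlonglongrightarrow> 1"
    by (simp only: tendsto_of_real_iff)
  from tendsto_power [OF this, of 2] show ?thesis
    by (simp add: a_def)
qed

lemma theta_re_limit_zero:
  assumes t: "t > 0"
  shows "(\<lambda>n. a (t / 2 ^ n) / 2 ^ n) \<longlonglongrightarrow> 1 / t"
proof -
  define s where "s n = sqrt (pi * (t / 2 ^ n))" for n
  have "(\<lambda>n. (1/2 :: real) ^ n) \<longlonglongrightarrow> 0"
    by (rule LIMSEQ_power_zero) simp
  then have "(\<lambda>n. sqrt (pi * (t * (1/2) ^ n))) \<longlonglongrightarrow> sqrt (pi * (t * 0))"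
    by (intro tendsto_intros) simp_all
  then have s: "s \<longlonglongrightarrow> 0"
    by (simp add: s_def [abs_def] power_divide)
  have R: "s n * theta_re 1 0 (t / 2 ^ n) \<in> {sqrt pi - s n..sqrt pi + s n}" for n
    unfolding s_def using t by (intro theta3_riemann_sum) simp
  have "(\<lambda>n. s n * theta_re 1 0 (t / 2 ^ n)) \<longlonglongrightarrow> sqrt pi"
  proof (rule tendsto_sandwich)
    show "(\<lambda>n. sqrt pi - s n) \<longlonglongrightarrow> sqrt pi" "(\<lambda>n. sqrt pi + s n) \<longlonglongrightarrow> sqrt pi"
      using tendsto_diff [OF tendsto_const s] tendsto_add [OF tendsto_const s] by simp_all
  qed (use R in auto)
  from tendsto_power [OF this, of 2] have "(\<lambda>n. (pi * t) * (a (t / 2 ^ n) / 2 ^ n)) \<longlonglongrightarrow> pi"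
    using t by (simp add: power_mult_distrib s_def a_def)
  from tendsto_mult [OF tendsto_const [of "1 / (pi * t)"] this] show ?thesis
    using t by (simp add: field_simps)
qed

text \<open>Upwards \<open>a\<close> tends to 1, downwards \<open>a (t / 2 ^ n) / 2 ^ n\<close>
  tends to 1/t; homogeneity divides both by \<open>a t\<close>.\<close>

lemma agm_theta_limits:
  assumes t: "t > 0"
  shows "(\<lambda>n. agm n 1 (b t / a t)) \<longlonglongrightarrow> 1 / a t" "(\<lambda>n. agm n 1 (c t / a t)) \<longlonglongrightarrow> 1 / (t * a t)"
proof -
  note pos = theta_re_sq_pos [OF t]
  have sc: "agm n 1 (x / a t) = 1 / a t * agm n (a t) x" if "x > 0" for x n
    using agm_scale [of "1 / a t" "a t" x n] pos that by simp
  show "(\<lambda>n. agm n 1 (b t / a t)) \<longlonglongrightarrow> 1 / a t"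
    unfolding sc [OF pos(2)] agm_theta_ab [OF t]
    using tendsto_mult [OF tendsto_const [of "1 / a t"] theta_re_limit_infinity [OF t]] by simp
  show "(\<lambda>n. agm n 1 (c t / a t)) \<longlonglongrightarrow> 1 / (t * a t)"
    unfolding sc [OF pos(3)] agm_theta_ac [OF t]
    using tendsto_mult [OF tendsto_const [of "1 / a t"] theta_re_limit_zero [OF t]] by (simp add: mult.commute)
qed

text \<open>The moduli \<open>k = c/a\<close> and \<open>k' = b/a\<close> satisfy \<open>AGM(1, k')/AGM(1, k) = t\<close> with
  \<open>k\<^sup>2 + k'\<^sup>2 = 1\<close>. The left side is strictly monotone in \<open>k\<close>, and \<open>1/t\<close> exchanges the two means.\<close>

lemma theta_re_inversion:
  assumes t: "t > 0"
  shows "c (1 / t) = t * b t"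
proof -
  define s where "s = 1 / t"
  have s: "s > 0"
    using t by (simp add: s_def)
  note pt = theta_re_sq_pos [OF t] and ps = theta_re_sq_pos [OF s]
  note lt = agm_theta_limits [OF t] and ls = agm_theta_limits [OF s]
  have sq: "(b u / a u)\<^sup>2 + (c u / a u)\<^sup>2 = 1" if u: "u > 0" for u
    using theta_re_doubling(5) [OF u] theta_re_sq_pos [OF u]
    by (simp add: power_divide add_divide_distrib [symmetric])
  have kt: "b t / a t > 0" "c t / a t > 0" and ks: "b s / a s > 0" "c s / a s > 0"
    using pt ps by simp_all
  have Lpos: "1 / a t > 0" "1 / (t * a t) > 0" "1 / a s > 0" "1 / (s * a s) > 0"
    using pt ps s t by simp_all
  \<comment> \<open>If the modulus at s exceeds the complementary modulus at t, then, the squares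
    adding up to 1, the complementary modulus at s is below the modulus at t. Strict monotonicity of
    the means turns these two inequalities into \<open>a s < t * a t\<close> and
    \<open>a s > t * a t\<close>. The opposite case is symmetric.\<close>
  have eq: "c s / a s = b t / a t"
  proof (rule ccontr)
    assume "c s / a s \<noteq> b t / a t"
    then consider "c s / a s > b t / a t" | "c s / a s < b t / a t"
      by linarith
    then show False
    proof cases
      case 1
      then have "(c s / a s)\<^sup>2 > (b t / a t)\<^sup>2"
        using kt by (intro power_strict_mono) auto
      then have "(b s / a s)\<^sup>2 < (c t / a t)\<^sup>2"
        using sq [OF s] sq [OF t] by linarith
      then have "b s / a s < c t / a t"
        by (rule power_less_imp_less_base) (use kt in auto)
      then have "1 / a s < 1 / (t * a t)"
        by (rule agm_limit_strict_mono [OF ks(1) _ ls(1) lt(2) Lpos(3)])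
      moreover have "1 / a t < 1 / (s * a s)"
        by (rule agm_limit_strict_mono [OF kt(1) 1 lt(1) ls(2) Lpos(1)])
      ultimately show False
        using t pt ps by (simp add: s_def field_simps)
    next
      case 2
      then have "(c s / a s)\<^sup>2 < (b t / a t)\<^sup>2"
        using ks by (intro power_strict_mono) auto
      then have "(c t / a t)\<^sup>2 < (b s / a s)\<^sup>2"
        using sq [OF s] sq [OF t] by linarith
      then have "c t / a t < b s / a s"
        by (rule power_less_imp_less_base) (use ks in auto)
      then have "1 / (t * a t) < 1 / a s"
        by (rule agm_limit_strict_mono [OF kt(2) _ lt(2) ls(1) Lpos(2)])
      moreover have "1 / (s * a s) < 1 / a t"
        by (rule agm_limit_strict_mono [OF ks(2) 2 ls(2) lt(1) Lpos(4)])
      ultimately show False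
        using t pt ps by (simp add: s_def field_simps)
    qed
  qed
  have "1 / (s * a s) = 1 / a t"
    using LIMSEQ_unique [OF ls(2)] lt(1) unfolding eq by blast
  then have "a s = t * a t"
    using t pt ps by (simp add: s_def field_simps)
  with eq show ?thesis
    using pt t by (simp add: s_def field_simps)
qed

end

section \<open>The inversion formulas on the half plane\<close>

lemma half_plane: "open {z. Im z > 0}" "connected {z. Im z > 0}"
  by (auto simp: open_halfspace_Im_gt intro!: convex_connected convex_halfspace_Im_gt)

lemma inversion_half_plane: "Im \<tau> > 0 \<Longrightarrow> Im (- 1 / \<tau>) > 0"
  by (auto simp: Im_divide zero_less_divide_iff sum_power2_gt_zero_iff)

text \<open>Fourth powers avoid choosing a branch of the square root of \<tau>. The identity known
  on the imaginary axis extends by analytic continuation, as the axis accumulates at \<i>.\<close>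

theorem theta2_inversion:
  assumes \<tau>: "Im \<tau> > 0"
  shows "theta 1 (1/2) (- 1 / \<tau>) ^ 4 = - \<tau>\<^sup>2 * theta (-1) 0 \<tau> ^ 4"
proof -
  let ?H = "{z. Im z > 0}"
  let ?f = "\<lambda>\<tau>. theta 1 (1/2) (- 1 / \<tau>) ^ 4 + \<tau>\<^sup>2 * theta (-1) 0 \<tau> ^ 4"
  have q2: "(\<lambda>\<tau>. 2 * exp (of_real pi * \<i> * \<tau> / 4) * psi \<tau>) holomorphic_on ?H"
    by (intro holomorphic_intros has_qexp_holomorphic [OF has_qexp_psi]) auto
  have h2: "theta 1 (1/2) holomorphic_on ?H"
    using q2 by (rule holomorphic_transform) (simp add: theta_half_psi(1))
  have inv: "(\<lambda>\<tau>. - 1 / \<tau>) holomorphic_on ?H"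
    by (intro holomorphic_intros) auto
  have h2': "(\<lambda>\<tau>. theta 1 (1/2) (- 1 / \<tau>)) holomorphic_on ?H"
  proof -
    have "(\<lambda>\<tau>. - 1 / \<tau>) ` ?H \<subseteq> ?H"
      using inversion_half_plane by blast
    from holomorphic_on_compose_gen [OF inv h2 this] show ?thesis
      unfolding o_def .
  qed
  have h4: "theta (-1) 0 holomorphic_on ?H"
    by (rule has_qexp_holomorphic [OF has_qexp_theta]) simp
  have hol: "?f holomorphic_on ?H"
    by (intro holomorphic_on_add holomorphic_on_mult holomorphic_on_power h2' h4 holomorphic_on_ident)
  let ?U = "(\<lambda>t. \<i> * complex_of_real t) ` {0<..}"
  have lim: "\<i> islimpt ?U"
    unfolding islimpt_sequential
  proof (intro exI conjI allI)
    show "\<i> * of_real (1 + inverse (real (Suc n))) \<in> ?U - {\<i>}" for n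
    proof -
      have "1 + inverse (real (Suc n)) > 0" "1 + inverse (real (Suc n)) \<noteq> 1"
        by (auto intro: add_pos_pos)
      moreover have "\<i> * complex_of_real x = \<i> \<longleftrightarrow> x = 1" for x
        by (simp add: complex_eq_iff)
      ultimately show ?thesis
        by blast
    qed
    have "(\<lambda>n. \<i> * complex_of_real (1 + inverse (real (Suc n)))) \<longlonglongrightarrow> \<i> * of_real (1 + 0)"
      by (intro tendsto_intros LIMSEQ_inverse_real_of_nat)
    then show "(\<lambda>n. \<i> * complex_of_real (1 + inverse (real (Suc n)))) \<longlonglongrightarrow> \<i>"
      by simp
  qed
  have zero: "?f z = 0" if z: "z \<in> ?U" for z
  proof -
    obtain t where t: "t > 0" "z = \<i> * of_real t"
      using z by auto
    have "- 1 / z = \<i> * of_real (1 / t)"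
      using t by (simp add: field_simps)
    moreover have "theta_re 1 (1/2) (1 / t) ^ 2 = t * theta_re (-1) 0 t ^ 2"
      using theta_re_inversion [OF t(1)] .
    then have "(theta_re 1 (1/2) (1 / t) ^ 2) ^ 2 = t ^ 2 * (theta_re (-1) 0 t ^ 2) ^ 2"
      by (simp only: power_mult_distrib)
    then have "complex_of_real (theta_re 1 (1/2) (1 / t) ^ 4) = of_real (t ^ 2 * theta_re (-1) 0 t ^ 4)"
      by simp
    ultimately show ?thesis
      using theta_imaginary_axis(1) [of 1 "1/2" "1 / t"] theta_imaginary_axis(1) [of "-1" 0 t] t
      by (simp add: power_mult_distrib)
  qed
  have "?U \<subseteq> ?H" "\<i> \<in> ?H" "\<tau> \<in> ?H"
    using \<tau> by auto
  then have "?f \<tau> = 0"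
    using analytic_continuation [OF hol half_plane _ _ lim zero] by blast
  then show ?thesis
    by (simp add: add_eq_0_iff2)
qed

lemma theta4_inversion:
  assumes \<tau>: "Im \<tau> > 0"
  shows "theta (-1) 0 (- 1 / \<tau>) ^ 4 = - \<tau>\<^sup>2 * theta 1 (1/2) \<tau> ^ 4"
proof -
  have nz: "\<tau> \<noteq> 0"
    using \<tau> by auto
  have "theta 1 (1/2) \<tau> ^ 4 = - (- 1 / \<tau>)\<^sup>2 * theta (-1) 0 (- 1 / \<tau>) ^ 4"
    using theta2_inversion [OF inversion_half_plane [OF \<tau>]] nz by simp
  then show ?thesis
    using nz by (simp add: power_divide)
qed

no_notation fps_nth (infixl "$" 75)

subsection \<open>Generators of the group\<close>

definition mat22 :: "complex \<Rightarrow> complex \<Rightarrow> complex \<Rightarrow> complex \<Rightarrow> complex^2^2" where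
  "mat22 a b c d = vector [vector [a, b], vector [c, d]]"

lemma mat22_nth [simp]:
  "mat22 a b c d $ 1 $ 1 = a" "mat22 a b c d $ 1 $ 2 = b" "mat22 a b c d $ 2 $ 1 = c" "mat22 a b c d $ 2 $ 2 = d"
  by (simp_all add: mat22_def)

lemma mat22_eqI:
  assumes "A $ 1 $ 1 = B $ 1 $ 1" "A $ 1 $ 2 = B $ 1 $ 2" "A $ 2 $ 1 = B $ 2 $ 1" "A $ 2 $ 2 = B $ 2 $ 2"
  shows "A = (B :: complex^2^2)"
  using assms by (simp add: vec_eq_iff forall_2)

lemma mat22_collapse: "mat22 (A $ 1 $ 1) (A $ 1 $ 2) (A $ 2 $ 1) (A $ 2 $ 2) = A"
  by (rule mat22_eqI) simp_all

lemma matrix_mult_nth2: "(A ** B) $ i $ j = A $ i $ 1 * B $ 1 $ j + A $ i $ 2 * B $ 2 $ j" for A B :: "complex^2^2"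
  by (simp add: matrix_matrix_mult_def sum_2)

lemma mat22_mult: "mat22 a b c d ** mat22 a' b' c' d' = mat22 (a * a' + b * c') (a * b' + b * d') (c * a' + d * c') (c * b' + d * d')"
  by (rule mat22_eqI) (simp_all add: matrix_mult_nth2)

lemma cayley_eq: "cayley = mat22 (1 / of_real (sqrt 2)) (\<i> / of_real (sqrt 2)) (\<i> / of_real (sqrt 2)) (1 / of_real (sqrt 2))"
  by (simp add: cayley_def mat22_def)

lemma sqrt2_sq: "complex_of_real (sqrt 2) * complex_of_real (sqrt 2) = 2"
  by (metis of_real_mult of_real_numeral real_sqrt_mult_self abs_numeral)

lemma matrix_inv_cayley:
  "matrix_inv cayley = mat22 (1 / of_real (sqrt 2)) (- \<i> / of_real (sqrt 2)) (- \<i> / of_real (sqrt 2)) (1 / of_real (sqrt 2))"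
proof -
  define C where "C = mat22 (1 / of_real (sqrt 2)) (- \<i> / of_real (sqrt 2)) (- \<i> / of_real (sqrt 2)) (1 / of_real (sqrt 2))"
  have one: "mat 1 = mat22 1 0 0 1"
    by (rule mat22_eqI) (simp_all add: mat_def)
  have C: "cayley ** C = mat 1" "C ** cayley = mat 1"
    unfolding C_def cayley_eq mat22_mult one by (simp_all add: sqrt2_sq)
  have "matrix_inv cayley = C"
    unfolding matrix_inv_def
  proof (rule some_equality)
    fix B assume B: "cayley ** B = mat 1 \<and> B ** cayley = mat 1"
    have "B = B ** (cayley ** C)"
      by (simp add: C)
    also have "\<dots> = C"
      by (simp add: matrix_mul_assoc B)
    finally show "B = C" .
  qed (simp add: C)
  then show ?thesis
    by (simp only: C_def)
qed

lemma cayley_conj: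
  "cayley ** mat22 a b c d ** matrix_inv cayley =
    mat22 ((a + \<i> * c - \<i> * b + d) / 2) ((b + \<i> * d - \<i> * a + c) / 2)
      ((\<i> * a + c + b - \<i> * d) / 2) ((d + \<i> * b + a - \<i> * c) / 2)"
proof -
  have s: "x / complex_of_real (sqrt 2) * (y / complex_of_real (sqrt 2)) = x * y / 2" for x y
    by (simp add: sqrt2_sq)
  have s': "x / complex_of_real (sqrt 2) * z * (y / complex_of_real (sqrt 2)) = x * z * y / 2" for x y z
    by (simp add: sqrt2_sq)
  show ?thesis
    unfolding matrix_inv_cayley unfolding cayley_eq mat22_mult
    by (simp add: distrib_right s' add_divide_distrib diff_divide_distrib minus_divide_left [symmetric] algebra_simps sqrt2_sq)
qed

text \<open>u is the determinant: a Gaussian integer of norm 1, hence one of the four units.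
  Splitting off diag(1, u) leaves a matrix of determinant 1, which conjugation by
  \<open>cayley\<close> makes real.\<close>

lemma U11_decompose:
  assumes g: "g \<in> U11"
  obtains a c u where "a \<in> gauss_ints" "c \<in> gauss_ints" "u \<in> {1, -1, \<i>, -\<i>}"
    "a * cnj a - c * cnj c = 1" "g = mat22 a (cnj c) c (cnj a) ** mat22 1 0 0 u"
proof -
  define a b c d where "a = g $ 1 $ 1" and "b = g $ 1 $ 2" and "c = g $ 2 $ 1" and "d = g $ 2 $ 2"
  have ints: "a \<in> gauss_ints" "b \<in> gauss_ints" "c \<in> gauss_ints" "d \<in> gauss_ints"
    using g by (auto simp: U11_def a_def b_def c_def d_def)
  have geq: "g = mat22 a b c d"
    by (simp add: a_def b_def c_def d_def mat22_collapse)
  have "transpose (\<chi> i j. cnj (g $ i $ j)) = mat22 (cnj a) (cnj c) (cnj b) (cnj d)"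
    by (rule mat22_eqI) (simp_all add: transpose_def a_def b_def c_def d_def)
  moreover have herm: "herm_form = mat22 1 0 0 (-1)"
    by (simp add: herm_form_def mat22_def)
  ultimately have "mat22 (cnj a) (cnj c) (cnj b) (cnj d) ** mat22 1 0 0 (-1) ** mat22 a b c d = mat22 1 0 0 (-1)"
    using g geq by (simp add: U11_def)
  then have eqs: "cnj a * a - cnj c * c = 1" "cnj a * b - cnj c * d = 0" "cnj b * b - cnj d * d = -1"
    unfolding mat22_mult by (auto simp: mat22_def vec_eq_iff forall_2)
  define u where "u = a * d - b * c"
  have "cnj a * u = (cnj a * a - cnj c * c) * d - (cnj a * b - cnj c * d) * c"
    "cnj c * u = (cnj a * a - cnj c * c) * b - a * (cnj a * b - cnj c * d)"
    by (simp_all add: u_def algebra_simps)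
  then have d: "d = cnj a * u" and b: "b = cnj c * u"
    unfolding eqs by simp_all
  have "u * cnj u = u * cnj u * (cnj a * a - cnj c * c)"
    by (simp add: eqs)
  also have "\<dots> = - (cnj b * b - cnj d * d)"
    by (simp add: b d algebra_simps)
  finally have "u * cnj u = 1"
    by (simp add: eqs)
  then have "complex_of_real ((Re u)\<^sup>2 + (Im u)\<^sup>2) = of_real 1"
    by (simp add: complex_mult_cnj)
  then have nu: "(Re u)\<^sup>2 + (Im u)\<^sup>2 = 1"
    by (simp only: of_real_eq_iff)
  have "Re u \<in> \<int>" "Im u \<in> \<int>"
    using ints by (auto simp: u_def gauss_ints_def intro!: Ints_diff Ints_add Ints_mult)
  then obtain m n where mn: "Re u = of_int m" "Im u = of_int n"
    by (auto elim!: Ints_cases)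
  have "real_of_int (m\<^sup>2 + n\<^sup>2) = of_int 1"
    using nu by (simp add: mn)
  then have mn1: "m\<^sup>2 + n\<^sup>2 = 1"
    by (simp only: of_int_eq_iff)
  have "m\<^sup>2 \<ge> 0" "n\<^sup>2 \<ge> 0"
    by simp_all
  then have "(m\<^sup>2 = 0 \<and> n\<^sup>2 = 1) \<or> (m\<^sup>2 = 1 \<and> n\<^sup>2 = 0)"
    using mn1 by linarith
  then have "(m = 0 \<and> (n = 1 \<or> n = -1)) \<or> ((m = 1 \<or> m = -1) \<and> n = 0)"
    by (simp add: power2_eq_1_iff)
  then have u: "u \<in> {1, -1, \<i>, -\<i>}"
    by (auto simp: complex_eq_iff mn)
  show ?thesis
  proof (rule that [OF ints(1,3) u])
    show "a * cnj a - c * cnj c = 1"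
      using eqs(1) by (simp add: mult.commute)
    show "g = mat22 a (cnj c) c (cnj a) ** mat22 1 0 0 u"
      unfolding geq mat22_mult by (simp add: b d)
  qed
qed

text \<open>Stability of the half plane and the nonzero denominator are included so that the
  property passes to products, see \<open>slash_inv_mult\<close>; there the inner value must again
  be a legitimate argument.\<close>

definition slash_inv :: "nat \<Rightarrow> (complex \<Rightarrow> complex) \<Rightarrow> complex^2^2 \<Rightarrow> bool" where
  "slash_inv k f g \<longleftrightarrow> (\<forall>\<tau>. Im \<tau> > 0 \<longrightarrow> Im (moebius g \<tau>) > 0 \<and> aut_factor g \<tau> \<noteq> 0 \<and>
     f (moebius g \<tau>) = aut_factor g \<tau> ^ k * f \<tau>)"

lemma slash_inv_mult:
  assumes "slash_inv k f g" "slash_inv k f h"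
  shows "slash_inv k f (g ** h)"
  unfolding slash_inv_def
proof (intro allI impI)
  fix \<tau> :: complex assume \<tau>: "Im \<tau> > 0"
  let ?w = "moebius h \<tau>"
  have h: "Im ?w > 0" "aut_factor h \<tau> \<noteq> 0" "f ?w = aut_factor h \<tau> ^ k * f \<tau>"
    using assms(2) \<tau> by (auto simp: slash_inv_def)
  have g: "Im (moebius g ?w) > 0" "aut_factor g ?w \<noteq> 0" "f (moebius g ?w) = aut_factor g ?w ^ k * f ?w"
    using assms(1) h(1) by (auto simp: slash_inv_def)
  have w: "?w * aut_factor h \<tau> = h $ 1 $ 1 * \<tau> + h $ 1 $ 2"
    using h(2) by (simp add: moebius_def)
  have aut: "aut_factor (g ** h) \<tau> = aut_factor g ?w * aut_factor h \<tau>"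
  proof -
    have "aut_factor g ?w * aut_factor h \<tau> = g $ 2 $ 1 * (?w * aut_factor h \<tau>) + g $ 2 $ 2 * aut_factor h \<tau>"
      by (simp add: aut_factor_def [of g] algebra_simps)
    also have "\<dots> = aut_factor (g ** h) \<tau>"
      unfolding w by (simp add: aut_factor_def matrix_mult_nth2 algebra_simps)
    finally show ?thesis ..
  qed
  have "moebius (g ** h) \<tau> = moebius g ?w"
  proof -
    have "(g $ 1 $ 1 * ?w + g $ 1 $ 2) * aut_factor h \<tau> = g $ 1 $ 1 * (?w * aut_factor h \<tau>) + g $ 1 $ 2 * aut_factor h \<tau>"
      by (simp add: algebra_simps)
    also have "\<dots> = (g ** h) $ 1 $ 1 * \<tau> + (g ** h) $ 1 $ 2"
      unfolding w by (simp add: aut_factor_def matrix_mult_nth2 algebra_simps)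
    finally show ?thesis
      using h(2) unfolding moebius_def [of g] moebius_def [of "g ** h"] aut by (metis mult_divide_mult_cancel_right)
  qed
  then show "Im (moebius (g ** h) \<tau>) > 0 \<and> aut_factor (g ** h) \<tau> \<noteq> 0 \<and>
      f (moebius (g ** h) \<tau>) = aut_factor (g ** h) \<tau> ^ k * f \<tau>"
    using g h by (simp add: aut power_mult_distrib mult_ac)
qed

lemma slash_inv_mat22:
  "slash_inv k f (mat22 a b c d) \<longleftrightarrow> (\<forall>\<tau>. Im \<tau> > 0 \<longrightarrow> Im ((a * \<tau> + b) / (c * \<tau> + d)) > 0 \<and> c * \<tau> + d \<noteq> 0 \<and>
     f ((a * \<tau> + b) / (c * \<tau> + d)) = (c * \<tau> + d) ^ k * f \<tau>)"
  by (simp add: slash_inv_def moebius_def aut_factor_def)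

lemma periodic_2_int:
  assumes per: "\<And>\<tau>. Im \<tau> > 0 \<Longrightarrow> f (\<tau> + 2) = f \<tau>" and \<tau>: "Im \<tau> > 0"
  shows "f (\<tau> + 2 * of_int n) = (f \<tau> :: complex)"
proof -
  have nat: "f (\<sigma> + 2 * of_nat m) = f \<sigma>" if "Im \<sigma> > 0" for m \<sigma>
    using that
  proof (induction m)
    case (Suc m)
    have "f (\<sigma> + 2 * of_nat m + 2) = f (\<sigma> + 2 * of_nat m)"
      using Suc.prems by (intro per) simp
    then show ?case
      using Suc by (simp add: algebra_simps)
  qed simp
  show ?thesis
  proof (cases "n \<ge> 0")
    case True
    then show ?thesis
      using nat [OF \<tau>, of "nat n"] by simp
  next
    case False
    then show ?thesis
      using nat [of "\<tau> + 2 * of_int n" "nat (- n)"] \<tau> by simp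
  qed
qed

text \<open>Subtracting even multiples of C alone brings A to absolute value at most \<bar>C\<bar>.
  Equality would make C a divisor of the determinant 1 and both A and C odd; then D and B are odd as
  well and the determinant is even.\<close>

lemma even_division:
  fixes A C :: int
  assumes "C \<noteq> 0" "A * D - B * C = 1" "even (A + D)" "even (B + C)"
  obtains n where "\<bar>A - 2 * n * C\<bar> < \<bar>C\<bar>"
proof -
  let ?m = "2 * \<bar>C\<bar>"
  define r q where "r = A mod ?m" and "q = A div ?m"
  have A: "A = ?m * q + r"
    by (simp add: r_def q_def)
  have r: "0 \<le> r" "r < ?m"
    using assms(1) by (auto simp: r_def)
  have s: "\<bar>C\<bar> = sgn C * C"
    by (simp add: abs_sgn mult.commute)
  have "r \<noteq> \<bar>C\<bar>"
  proof
    assume rC: "r = \<bar>C\<bar>"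
    then have "C dvd A"
      using A by simp
    then have "C dvd A * D - B * C"
      by simp
    then have "C dvd 1"
      using assms(2) by simp
    then have "\<bar>C\<bar> = 1"
      by simp
    then have "odd C" "odd A"
      using A rC by (auto simp: abs_if split: if_splits)
    then have "even (A * D - B * C)"
      using assms(3,4) by auto
    then show False
      using assms(2) by simp
  qed
  then consider "r < \<bar>C\<bar>" | "r > \<bar>C\<bar>"
    by linarith
  then show ?thesis
  proof cases
    case 1
    have "A - 2 * (sgn C * q) * C = r"
      unfolding A by (subst s) (simp add: algebra_simps)
    then show ?thesis
      using that [of "sgn C * q"] 1 r by simp
  next
    case 2
    have "A - 2 * (sgn C * (q + 1)) * C = r - ?m"
      unfolding A by (subst (1 2) s) (simp add: algebra_simps)
    then show ?thesis
      using that [of "sgn C * (q + 1)"] 2 r by simp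
  qed
qed

text \<open>The parity conditions describe the theta group, generated up to sign by \<tau> \<mapsto>
  \<tau> + 2 and \<tau> \<mapsto> -1/\<tau>. The proof is a Euclidean descent on \<bar>C\<bar>, with
  k even to absorb the sign.\<close>

lemma theta_group_slash:
  fixes A B C D :: int
  assumes k: "4 dvd k" and per: "\<And>\<tau>. Im \<tau> > 0 \<Longrightarrow> f (\<tau> + 2) = f \<tau>"
    and inv: "\<And>\<tau>. Im \<tau> > 0 \<Longrightarrow> f (- 1 / \<tau>) = \<tau> ^ k * f \<tau>"
    and M: "A * D - B * C = 1" "even (A + D)" "even (B + C)"
  shows "slash_inv k f (mat22 (of_int A) (of_int B) (of_int C) (of_int D))"
  using M
proof (induction "nat \<bar>C\<bar>" arbitrary: A B C D rule: less_induct)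
  case less
  have even_k: "even k"
    using k by (meson dvd_trans even_numeral)
  have T: "slash_inv k f (mat22 1 (2 * of_int n) 0 1)" for n
    unfolding slash_inv_mat22 using periodic_2_int [of f, OF per] by simp
  have S: "slash_inv k f (mat22 0 1 (-1) 0)"
    unfolding slash_inv_mat22
  proof (intro allI impI conjI)
    fix \<tau> :: complex assume \<tau>: "Im \<tau> > 0"
    have eq: "(0 * \<tau> + 1) / (- 1 * \<tau> + 0) = - 1 / \<tau>"
      by simp
    show "Im ((0 * \<tau> + 1) / (- 1 * \<tau> + 0)) > 0"
      unfolding eq by (rule inversion_half_plane [OF \<tau>])
    show "- 1 * \<tau> + 0 \<noteq> 0"
      using \<tau> by auto
    show "f ((0 * \<tau> + 1) / (- 1 * \<tau> + 0)) = (- 1 * \<tau> + 0) ^ k * f \<tau>"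
      unfolding eq inv [OF \<tau>] using even_k by simp
  qed
  show ?case
  proof (cases "C = 0")
    case True
    then have "A * D = 1"
      using less.prems by simp
    then have AD: "(A = 1 \<and> D = 1) \<or> (A = -1 \<and> D = -1)"
      by (simp add: zmult_eq_1_iff)
    obtain n where n: "B = 2 * n"
      using less.prems True by auto
    from AD show ?thesis
    proof
      assume "A = 1 \<and> D = 1"
      then show ?thesis
        using T [of n] by (simp add: True n)
    next
      assume *: "A = -1 \<and> D = -1"
      have "slash_inv k f (mat22 (-1) 0 0 (-1))"
        unfolding slash_inv_mat22 using even_k by simp
      from slash_inv_mult [OF this T [of "- n"]] show ?thesis
        using * by (simp add: True n mat22_mult)
    qed
  next
    case False
    then obtain n where n: "\<bar>A - 2 * n * C\<bar> < \<bar>C\<bar>"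
      using even_division less.prems by blast
    \<comment> \<open>Undoing first the translation by 2n and then the inversion: multiplied from
      the left by S and by the translation, this matrix gives back the original one.\<close>
    have "slash_inv k f (mat22 (of_int (- C)) (of_int (- D)) (of_int (A - 2 * n * C)) (of_int (B - 2 * n * D)))"
    proof (rule less.hyps)
      show "- C * (B - 2 * n * D) - - D * (A - 2 * n * C) = 1"
        using less.prems by (simp add: algebra_simps)
      show "even (- C + (B - 2 * n * D))" "even (- D + (A - 2 * n * C))"
        using less.prems by auto
    qed (use n in simp)
    from slash_inv_mult [OF T [of n] slash_inv_mult [OF S this]]
    show ?thesis
      by (simp add: mat22_mult)
  qed
qed

text \<open>Conjugation by \<open>cayley\<close> turns the factor of determinant 1 into an integral
  matrix with diagonal sum 2 a1 and antidiagonal sum 2 c1, an element of the theta group, and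
  diag(1, \<i>) into the matrix of the hypothesis \<open>rot\<close>; the other units are powers of
  \<i>.\<close>

lemma G_slash:
  assumes k: "4 dvd k" and per: "\<And>\<tau>. Im \<tau> > 0 \<Longrightarrow> f (\<tau> + 2) = f \<tau>"
    and inv: "\<And>\<tau>. Im \<tau> > 0 \<Longrightarrow> f (- 1 / \<tau>) = \<tau> ^ k * f \<tau>"
    and rot: "slash_inv k f (mat22 ((1 + \<i>) / 2) (- (1 + \<i>) / 2) ((1 + \<i>) / 2) ((1 + \<i>) / 2))"
    and g: "g \<in> G_group"
  shows "slash_inv k f g"
proof -
  obtain h where h: "h \<in> U11" "g = cayley ** h ** matrix_inv cayley"
    using g by (auto simp: G_group_def)
  obtain a c u where ac: "a \<in> gauss_ints" "c \<in> gauss_ints" and u: "u \<in> {1, -1, \<i>, -\<i>}"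
    and n: "a * cnj a - c * cnj c = 1" and heq: "h = mat22 a (cnj c) c (cnj a) ** mat22 1 0 0 u"
    using U11_decompose [OF h(1)] by metis
  have inv_cancel: "matrix_inv cayley ** cayley = mat 1"
  proof -
    have one: "mat 1 = mat22 1 0 0 1"
      by (rule mat22_eqI) (simp_all add: mat_def)
    show ?thesis
      unfolding matrix_inv_cayley unfolding cayley_eq mat22_mult one by (simp add: sqrt2_sq)
  qed
  have geq: "g = (cayley ** mat22 a (cnj c) c (cnj a) ** matrix_inv cayley) ** (cayley ** mat22 1 0 0 u ** matrix_inv cayley)"
  proof -
    have "(cayley ** x ** matrix_inv cayley) ** (cayley ** y ** matrix_inv cayley) =
        cayley ** x ** (matrix_inv cayley ** cayley) ** y ** matrix_inv cayley" for x y
      by (simp only: matrix_mul_assoc)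
    then show ?thesis
      by (simp add: h(2) heq inv_cancel matrix_mul_assoc)
  qed
  obtain a1 a2 where a: "Re a = of_int a1" "Im a = of_int a2"
    using ac(1) by (auto simp: gauss_ints_def elim!: Ints_cases)
  obtain c1 c2 where c: "Re c = of_int c1" "Im c = of_int c2"
    using ac(2) by (auto simp: gauss_ints_def elim!: Ints_cases)
  have ma: "a = of_int a1 + \<i> * of_int a2" and mc: "c = of_int c1 + \<i> * of_int c2"
    using a c by (auto simp: complex_eq_iff)
  have "cayley ** mat22 a (cnj c) c (cnj a) ** matrix_inv cayley =
      mat22 (of_int (a1 - c2)) (of_int (a2 + c1)) (of_int (c1 - a2)) (of_int (a1 + c2))"
    unfolding cayley_conj by (rule mat22_eqI) (simp_all add: ma mc complex_eq_iff)
  moreover have "slash_inv k f (mat22 (of_int (a1 - c2)) (of_int (a2 + c1)) (of_int (c1 - a2)) (of_int (a1 + c2)))"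
  proof (rule theta_group_slash [OF k per inv])
    have "real_of_int ((a1 - c2) * (a1 + c2) - (a2 + c1) * (c1 - a2)) = of_int 1"
      using n by (simp add: ma mc complex_eq_iff algebra_simps)
    then show "(a1 - c2) * (a1 + c2) - (a2 + c1) * (c1 - a2) = 1"
      by (simp only: of_int_eq_iff)
  qed auto
  moreover have "slash_inv k f (cayley ** mat22 1 0 0 u ** matrix_inv cayley)"
  proof -
    let ?W = "mat22 ((1 + \<i>) / 2) (- (1 + \<i>) / 2) ((1 + \<i>) / 2) ((1 + \<i>) / 2)"
    have 1: "cayley ** mat22 1 0 0 \<i> ** matrix_inv cayley = ?W"
      unfolding cayley_conj by (rule mat22_eqI) (simp_all add: complex_eq_iff)
    have 2: "cayley ** mat22 1 0 0 (-1) ** matrix_inv cayley = ?W ** ?W"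
      unfolding cayley_conj mat22_mult by (rule mat22_eqI) (simp_all add: complex_eq_iff)
    have 3: "cayley ** mat22 1 0 0 (-\<i>) ** matrix_inv cayley = ?W ** (?W ** ?W)"
      unfolding cayley_conj mat22_mult by (rule mat22_eqI) (simp_all add: complex_eq_iff)
    have 4: "cayley ** mat22 1 0 0 1 ** matrix_inv cayley = mat22 1 0 0 1"
      unfolding cayley_conj by simp
    have "slash_inv k f (mat22 1 0 0 1)"
      by (simp add: slash_inv_mat22)
    then show ?thesis
      using u rot slash_inv_mult [OF rot rot] slash_inv_mult [OF rot slash_inv_mult [OF rot rot]]
      by (auto simp: 1 2 3 4)
  qed
  ultimately show ?thesis
    unfolding geq by (metis slash_inv_mult)
qed

lemma rotation_in_G: "mat22 ((1 + \<i>) / 2) (- (1 + \<i>) / 2) ((1 + \<i>) / 2) ((1 + \<i>) / 2) \<in> G_group"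
proof -
  have "mat22 1 0 0 \<i> \<in> U11"
    unfolding U11_def
  proof (intro CollectI conjI)
    show "\<forall>i j. mat22 1 0 0 \<i> $ i $ j \<in> gauss_ints"
      by (simp add: forall_2 gauss_ints_def)
    have t: "transpose (\<chi> i j. cnj (mat22 1 0 0 \<i> $ i $ j)) = mat22 1 0 0 (- \<i>)"
      by (rule mat22_eqI) (simp_all add: transpose_def)
    have h: "herm_form = mat22 1 0 0 (-1)"
      by (simp add: herm_form_def mat22_def)
    show "transpose (\<chi> i j. cnj (mat22 1 0 0 \<i> $ i $ j)) ** herm_form ** mat22 1 0 0 \<i> = herm_form"
      unfolding t h mat22_mult by simp
  qed
  moreover have "cayley ** mat22 1 0 0 \<i> ** matrix_inv cayley = mat22 ((1 + \<i>) / 2) (- (1 + \<i>) / 2) ((1 + \<i>) / 2) ((1 + \<i>) / 2)"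
    unfolding cayley_conj by (rule mat22_eqI) (simp_all add: complex_eq_iff)
  ultimately show ?thesis
    unfolding G_group_def by (metis image_eqI)
qed

subsection \<open>Automorphy of the forms\<close>

definition X4 :: "complex \<Rightarrow> complex" where "X4 \<tau> = theta 1 (1/2) \<tau> ^ 4"
definition Y4 :: "complex \<Rightarrow> complex" where "Y4 \<tau> = theta (-1) 0 \<tau> ^ 4"

definition alpha_h :: "complex \<Rightarrow> complex" where
  "alpha_h \<tau> = X4 \<tau> ^ 2 + 6 * X4 \<tau> * Y4 \<tau> + Y4 \<tau> ^ 2"

text \<open>By Jacobi's identity the squared factor is \<theta>_3^8. The denominator 16 cancels the
  16 in the expansion of \<open>X4\<close>, so the leading coefficient is 1 and the expansion stays
  integral.\<close>

definition disc_h :: "complex \<Rightarrow> complex" where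
  "disc_h \<tau> = X4 \<tau> * Y4 \<tau> * (X4 \<tau> + Y4 \<tau>) ^ 2 / 16"

definition beta_h :: "complex \<Rightarrow> complex" where
  "beta_h \<tau> = (X4 \<tau> - Y4 \<tau>) ^ 4"

lemma beta_alpha_disc: "beta_h \<tau> = alpha_h \<tau> ^ 2 - 256 * disc_h \<tau>"
  by (simp add: alpha_h_def beta_h_def disc_h_def power2_eq_square power4_eq_xxxx algebra_simps)

lemma XY_shift: "X4 (\<tau> + 1) = - X4 \<tau>" "Im \<tau> > 0 \<Longrightarrow> Y4 (\<tau> + 1) = X4 \<tau> + Y4 \<tau>"
proof -
  have "exp (of_real pi * \<i> / 4) ^ 4 = exp (of_real pi * \<i>)"
    unfolding exp_of_nat_mult [symmetric] by simp
  then show "X4 (\<tau> + 1) = - X4 \<tau>"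
    by (simp add: X4_def theta_shift_half power_mult_distrib)
  show "Y4 (\<tau> + 1) = X4 \<tau> + Y4 \<tau>" if "Im \<tau> > 0"
    using jacobi_identity [OF that] theta_shift_0 [of "-1" \<tau>] by (simp add: X4_def Y4_def)
qed

lemma XY_inversion: "Im \<tau> > 0 \<Longrightarrow> X4 (- 1 / \<tau>) = - \<tau>\<^sup>2 * Y4 \<tau>" "Im \<tau> > 0 \<Longrightarrow> Y4 (- 1 / \<tau>) = - \<tau>\<^sup>2 * X4 \<tau>"
  unfolding X4_def Y4_def by (rule theta2_inversion theta4_inversion; assumption)+

lemma XY_double:
  assumes "Im \<tau> > 0"
  shows "Y4 (2 * \<tau>) ^ 2 = (X4 \<tau> + Y4 \<tau>) * Y4 \<tau>" "16 * (X4 (2 * \<tau>) * (X4 (2 * \<tau>) + Y4 (2 * \<tau>))) = X4 \<tau> ^ 2"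
proof -
  have Z: "X4 \<sigma> + Y4 \<sigma> = theta 1 0 \<sigma> ^ 4" if "Im \<sigma> > 0" for \<sigma>
    using jacobi_identity [OF that] by (simp add: X4_def Y4_def)
  have "Y4 (2 * \<tau>) ^ 2 = (theta (-1) 0 (2 * \<tau>) ^ 2) ^ 4"
    by (simp add: Y4_def power_mult [symmetric])
  then show "Y4 (2 * \<tau>) ^ 2 = (X4 \<tau> + Y4 \<tau>) * Y4 \<tau>"
    unfolding theta_34 [OF assms, symmetric] Z [OF assms] unfolding Y4_def power_mult_distrib .
  have "X4 \<tau> ^ 2 = (theta 1 (1/2) \<tau> ^ 2) ^ 4"
    by (simp add: X4_def power_mult [symmetric])
  then show "16 * (X4 (2 * \<tau>) * (X4 (2 * \<tau>) + Y4 (2 * \<tau>))) = X4 \<tau> ^ 2"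
    unfolding theta_22 [OF assms] using Z [of "2 * \<tau>"] assms by (simp add: X4_def power_mult_distrib)
qed

lemma period_2:
  assumes \<tau>: "Im \<tau> > 0"
  shows "alpha_h (\<tau> + 2) = alpha_h \<tau>" "disc_h (\<tau> + 2) = disc_h \<tau>"
proof -
  have "X4 (\<tau> + 2) = X4 \<tau>" "Y4 (\<tau> + 2) = Y4 \<tau>"
    using XY_shift [of "\<tau> + 1"] XY_shift [of \<tau>] \<tau> by (simp_all add: add.assoc)
  then show "alpha_h (\<tau> + 2) = alpha_h \<tau>" "disc_h (\<tau> + 2) = disc_h \<tau>"
    by (simp_all add: alpha_h_def disc_h_def)
qed

lemma form_inversion:
  assumes \<tau>: "Im \<tau> > 0"
  shows "alpha_h (- 1 / \<tau>) = \<tau> ^ 4 * alpha_h \<tau>" "disc_h (- 1 / \<tau>) = \<tau> ^ 8 * disc_h \<tau>"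
proof -
  define V where "V = \<tau>\<^sup>2"
  have p: "\<tau> ^ 4 = V * V" "\<tau> ^ 8 = V * V * V * V"
    by (simp_all add: V_def power_add [symmetric])
  show "alpha_h (- 1 / \<tau>) = \<tau> ^ 4 * alpha_h \<tau>" "disc_h (- 1 / \<tau>) = \<tau> ^ 8 * disc_h \<tau>"
    unfolding alpha_h_def disc_h_def XY_inversion [OF \<tau>] p V_def [symmetric]
    by (simp_all add: power2_eq_square algebra_simps)
qed

text \<open>\<open>Y4 ^ 2\<close> and \<open>X4 * (X4 + Y4)\<close> are the combinations whose
  values at 2\<tau> are given by \<open>XY_double\<close> in terms of \<tau>. The same holds for
  \<beta> below, and both are the bridge to the rotation.\<close>

lemma alpha_shift_double:
  assumes "Im \<tau> > 0"
  shows "alpha_h (\<tau> + 1) = Y4 \<tau> ^ 2 - 4 * (X4 \<tau> * (X4 \<tau> + Y4 \<tau>))"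
  unfolding alpha_h_def XY_shift(1) XY_shift(2) [OF assms] by (simp add: power2_eq_square algebra_simps)

lemma beta_shift_double:
  assumes "Im \<tau> > 0"
  shows "beta_h (\<tau> + 1) = (Y4 \<tau> ^ 2 + 4 * (X4 \<tau> * (X4 \<tau> + Y4 \<tau>))) ^ 2"
  unfolding beta_h_def XY_shift(1) XY_shift(2) [OF assms]
  by (simp add: power2_eq_square power4_eq_xxxx algebra_simps)

lemma rotation_half_plane:
  assumes \<tau>: "Im \<tau> > 0"
  shows "Im ((\<tau> - 1) / (\<tau> + 1)) = 2 * Im \<tau> / (norm (\<tau> + 1))\<^sup>2"
  by (simp add: Im_divide cmod_power2) (simp add: algebra_simps)

text \<open>With \<open>v = \<tau> + 1\<close> the rotation is \<open>\<tau> \<mapsto> 1 - 2/v\<close>, so the doubling formulas at \<open>w = -1/v\<close> apply.\<close>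

lemma form_rotation:
  assumes \<tau>: "Im \<tau> > 0"
  shows "alpha_h ((\<tau> - 1) / (\<tau> + 1)) = - ((\<tau> + 1) ^ 4) / 4 * alpha_h \<tau>"
    and "beta_h ((\<tau> - 1) / (\<tau> + 1)) = (\<tau> + 1) ^ 8 / 16 * beta_h \<tau>"
proof -
  define v where "v = \<tau> + 1"
  define w where "w = - 1 / v"
  have v: "Im v > 0"
    using \<tau> by (simp add: v_def)
  then have v0: "v \<noteq> 0"
    by auto
  have w1: "Im w > 0"
    unfolding w_def by (rule inversion_half_plane [OF v])
  then have w: "Im w > 0" "Im (2 * w) > 0"
    by simp_all
  have eq: "(\<tau> - 1) / (\<tau> + 1) = 2 * w + 1"
    using v0 by (simp add: w_def v_def field_simps)
  have X: "X4 w = - v\<^sup>2 * Y4 v" "Y4 w = - v\<^sup>2 * X4 v"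
    unfolding w_def by (rule XY_inversion [OF v])+
  have XX: "X4 (2 * w) * (X4 (2 * w) + Y4 (2 * w)) = X4 w ^ 2 / 16"
    unfolding XY_double(2) [OF w(1), symmetric] by simp
  have \<tau>v: "\<tau> + 2 = v + 1"
    by (simp add: v_def)
  have p: "v ^ 4 = v\<^sup>2 * v\<^sup>2" "v ^ 8 = v\<^sup>2 * v\<^sup>2 * (v\<^sup>2 * v\<^sup>2)"
    by (simp_all add: power_add [symmetric])
  define V where "V = v\<^sup>2"
  have "alpha_h (2 * w + 1) = (X4 w + Y4 w) * Y4 w - X4 w ^ 2 / 4"
    unfolding alpha_shift_double [OF w(2)] XY_double(1) [OF w(1)] XX by simp
  also have "\<dots> = - (v ^ 4) / 4 * (Y4 v ^ 2 - 4 * (X4 v * (X4 v + Y4 v)))"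
    unfolding X p V_def [symmetric] by (simp add: power2_eq_square field_simps)
  also have "\<dots> = - (v ^ 4) / 4 * alpha_h \<tau>"
    unfolding alpha_shift_double [OF v, symmetric] \<tau>v [symmetric] period_2(1) [OF \<tau>] ..
  finally show "alpha_h ((\<tau> - 1) / (\<tau> + 1)) = - ((\<tau> + 1) ^ 4) / 4 * alpha_h \<tau>"
    unfolding eq v_def .
  have "beta_h (2 * w + 1) = ((X4 w + Y4 w) * Y4 w + X4 w ^ 2 / 4) ^ 2"
    unfolding beta_shift_double [OF w(2)] XY_double(1) [OF w(1)] XX by simp
  also have "\<dots> = v ^ 8 / 16 * (Y4 v ^ 2 + 4 * (X4 v * (X4 v + Y4 v))) ^ 2"
    unfolding X p V_def [symmetric] by (simp add: power2_eq_square field_simps)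
  also have "\<dots> = v ^ 8 / 16 * beta_h (\<tau> + 2)"
    unfolding beta_shift_double [OF v, symmetric] \<tau>v ..
  also have "beta_h (\<tau> + 2) = beta_h \<tau>"
    by (simp add: beta_alpha_disc period_2 \<tau>)
  finally show "beta_h ((\<tau> - 1) / (\<tau> + 1)) = (\<tau> + 1) ^ 8 / 16 * beta_h \<tau>"
    unfolding eq v_def .
qed

lemma rotation_slash:
  assumes f: "\<And>\<tau>. Im \<tau> > 0 \<Longrightarrow> f ((\<tau> - 1) / (\<tau> + 1)) = ((1 + \<i>) / 2 * (\<tau> + 1)) ^ k * f \<tau>"
  shows "slash_inv k f (mat22 ((1 + \<i>) / 2) (- (1 + \<i>) / 2) ((1 + \<i>) / 2) ((1 + \<i>) / 2))"
  unfolding slash_inv_mat22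
proof (intro allI impI)
  fix \<tau> :: complex assume \<tau>: "Im \<tau> > 0"
  have c0: "(1 + \<i>) / 2 \<noteq> 0" and \<tau>1: "\<tau> + 1 \<noteq> 0"
    using \<tau> by (auto simp: complex_eq_iff)
  have den: "(1 + \<i>) / 2 * \<tau> + (1 + \<i>) / 2 = (1 + \<i>) / 2 * (\<tau> + 1)"
    and num: "(1 + \<i>) / 2 * \<tau> + - (1 + \<i>) / 2 = (1 + \<i>) / 2 * (\<tau> - 1)"
    by (simp_all add: algebra_simps)
  have "Im ((\<tau> - 1) / (\<tau> + 1)) > 0"
    unfolding rotation_half_plane [OF \<tau>] using \<tau> \<tau>1 by simp
  then show "Im (((1 + \<i>) / 2 * \<tau> + - (1 + \<i>) / 2) / ((1 + \<i>) / 2 * \<tau> + (1 + \<i>) / 2)) > 0 \<and>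
      (1 + \<i>) / 2 * \<tau> + (1 + \<i>) / 2 \<noteq> 0 \<and>
      f (((1 + \<i>) / 2 * \<tau> + - (1 + \<i>) / 2) / ((1 + \<i>) / 2 * \<tau> + (1 + \<i>) / 2)) = ((1 + \<i>) / 2 * \<tau> + (1 + \<i>) / 2) ^ k * f \<tau>"
    unfolding den num mult_divide_mult_cancel_left [OF c0] using c0 \<tau>1 f [OF \<tau>] by simp
qed

text \<open>These are the scalars -1/4 and 1/16 of \<open>form_rotation\<close>: the constants of
  the rotation formulas are exactly the powers of the automorphy factor in weights 4 and 8.\<close>

lemma half_one_plus_i_power: "((1 + \<i>) / 2) ^ 4 = - 1 / 4" "((1 + \<i>) / 2) ^ 8 = 1 / 16"
proof -
  have 2: "((1 + \<i>) / 2) ^ 2 = \<i> / 2"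
    by (simp add: power2_eq_square field_simps)
  have p: "x ^ 4 = (x ^ 2) ^ 2" "x ^ 8 = ((x ^ 2) ^ 2) ^ 2" for x :: complex
    by (simp_all add: power_mult [symmetric])
  show "((1 + \<i>) / 2) ^ 4 = - 1 / 4" "((1 + \<i>) / 2) ^ 8 = 1 / 16"
    unfolding p 2 by (simp_all add: power2_eq_square)
qed

theorem alpha_slash: "g \<in> G_group \<Longrightarrow> slash_inv 4 alpha_h g"
proof (rule G_slash)
  show "slash_inv 4 alpha_h (mat22 ((1 + \<i>) / 2) (- (1 + \<i>) / 2) ((1 + \<i>) / 2) ((1 + \<i>) / 2))"
    by (rule rotation_slash) (simp only: form_rotation power_mult_distrib half_one_plus_i_power, simp)
qed (rule period_2 form_inversion, assumption | simp)+

theorem disc_slash: "g \<in> G_group \<Longrightarrow> slash_inv 8 disc_h g"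
proof (rule G_slash)
  \<comment> \<open>Read off from the rotation formulas for \<alpha> and \<beta>, since 256 times
    \<open>disc_h\<close> is \<alpha>^2 - \<beta>.\<close>
  have "disc_h ((\<tau> - 1) / (\<tau> + 1)) = (\<tau> + 1) ^ 8 / 16 * disc_h \<tau>" if \<tau>: "Im \<tau> > 0" for \<tau>
  proof -
    define w where "w = (\<tau> - 1) / (\<tau> + 1)"
    have "256 * disc_h w = alpha_h w ^ 2 - beta_h w"
      by (simp add: beta_alpha_disc)
    also have "\<dots> = (- ((\<tau> + 1) ^ 4) / 4 * alpha_h \<tau>) ^ 2 - (\<tau> + 1) ^ 8 / 16 * beta_h \<tau>"
      unfolding w_def form_rotation [OF \<tau>] ..
    also have "\<dots> = (\<tau> + 1) ^ 8 / 16 * (alpha_h \<tau> ^ 2 - beta_h \<tau>)"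
      by (simp add: power_mult_distrib power_divide power_mult [symmetric] right_diff_distrib)
    also have "\<dots> = 256 * ((\<tau> + 1) ^ 8 / 16 * disc_h \<tau>)"
      by (simp add: beta_alpha_disc)
    finally have "disc_h w = (\<tau> + 1) ^ 8 / 16 * disc_h \<tau>"
      by (simp only: mult_cancel_left) simp
    then show ?thesis
      by (simp only: w_def)
  qed
  then show "slash_inv 8 disc_h (mat22 ((1 + \<i>) / 2) (- (1 + \<i>) / 2) ((1 + \<i>) / 2) ((1 + \<i>) / 2))"
    by (intro rotation_slash) (simp only: power_mult_distrib half_one_plus_i_power, simp)
qed (rule period_2 form_inversion, assumption | simp)+

subsection \<open>Automorphic forms through their expansions\<close>

text \<open>The expansion is carried along explicitly, so that constant terms can be compared and
  the coefficient ring changed for a fixed function.\<close>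

definition form_with :: "complex set \<Rightarrow> int \<Rightarrow> (uhp \<Rightarrow> complex) \<Rightarrow> complex fps \<Rightarrow> bool" where
  "form_with R k f a \<longleftrightarrow> has_qexp (\<lambda>z. f (to_uhp z)) a \<and> a \<in> fps_over R \<and>
     (\<forall>g\<in>G_group. \<forall>\<tau>. f (to_uhp (moebius g (of_uhp \<tau>))) = aut_factor g (of_uhp \<tau>) powi k * f \<tau>)"

lemma Im_of_uhp: "Im (of_uhp \<tau>) > 0"
  using of_uhp [of \<tau>] by simp

lemma of_to_uhp: "Im z > 0 \<Longrightarrow> of_uhp (to_uhp z) = z"
  by (simp add: to_uhp_inverse)

lemma has_qexp_uhp: "has_qexp (\<lambda>z. f (to_uhp z)) a \<longleftrightarrow>
    (\<forall>\<tau>. (\<lambda>n. fps_nth a n * exp (of_real pi * \<i> * of_uhp \<tau>) ^ n) sums f \<tau>)"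
proof
  assume q: "has_qexp (\<lambda>z. f (to_uhp z)) a"
  show "\<forall>\<tau>. (\<lambda>n. fps_nth a n * exp (of_real pi * \<i> * of_uhp \<tau>) ^ n) sums f \<tau>"
  proof
    fix \<tau>
    show "(\<lambda>n. fps_nth a n * exp (of_real pi * \<i> * of_uhp \<tau>) ^ n) sums f \<tau>"
      using has_qexp_sums [OF q Im_of_uhp [of \<tau>]] by (simp only: of_uhp_inverse)
  qed
next
  assume s: "\<forall>\<tau>. (\<lambda>n. fps_nth a n * exp (of_real pi * \<i> * of_uhp \<tau>) ^ n) sums f \<tau>"
  show "has_qexp (\<lambda>z. f (to_uhp z)) a"
  proof (rule has_qexpI_sums)
    fix \<tau> :: complex assume "Im \<tau> > 0"
    then show "(\<lambda>n. fps_nth a n * exp (of_real pi * \<i> * \<tau>) ^ n) sums f (to_uhp \<tau>)"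
      using spec [OF s, of "to_uhp \<tau>"] by (simp only: of_to_uhp)
  qed
qed

lemma automorphic_form_iff: "automorphic_form R k f \<longleftrightarrow> (\<exists>a. form_with R k f a)"
proof
  assume f: "automorphic_form R k f"
  then obtain a where a: "\<And>n. a n \<in> R"
    "\<And>\<tau>. (\<lambda>n. a n * exp (of_real pi * \<i> * of_uhp \<tau>) ^ n) sums f \<tau>"
    by (auto simp: automorphic_form_def)
  then have "form_with R k f (Abs_fps a)"
    using f unfolding form_with_def has_qexp_uhp by (simp add: automorphic_form_def fps_over_def)
  then show "\<exists>a. form_with R k f a" ..
next
  assume "\<exists>a. form_with R k f a"
  then obtain a where a: "form_with R k f a" ..
  then have q: "has_qexp (\<lambda>z. f (to_uhp z)) a"
    by (simp add: form_with_def)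
  show "automorphic_form R k f"
    unfolding automorphic_form_def
  proof (intro conjI exI [of _ "fps_nth a"])
    show "(\<lambda>z. f (to_uhp z)) holomorphic_on {z. Im z > 0}"
      by (rule has_qexp_holomorphic [OF q])
    show "\<forall>\<tau>. (\<lambda>n. fps_nth a n * exp (of_real pi * \<i> * of_uhp \<tau>) ^ n) sums f \<tau>"
      by (rule q [unfolded has_qexp_uhp])
  qed (use a in \<open>auto simp: form_with_def fps_over_def\<close>)
qed

lemma form_withD:
  assumes "form_with R k f a"
  shows "has_qexp (\<lambda>z. f (to_uhp z)) a" "fps_nth a n \<in> R"
    "g \<in> G_group \<Longrightarrow> f (to_uhp (moebius g (of_uhp \<tau>))) = aut_factor g (of_uhp \<tau>) powi k * f \<tau>"
  using assms by (auto simp: form_with_def fps_over_def)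

lemma form_with_unique: "form_with R k f a \<Longrightarrow> form_with R' k' f b \<Longrightarrow> a = b"
  using form_withD(1) [of R k f a] form_withD(1) [of R' k' f b] by (rule has_qexp_unique)

lemma form_with_mono: "form_with R k f a \<Longrightarrow> a \<in> fps_over R' \<Longrightarrow> form_with R' k f a"
  by (simp add: form_with_def)

lemma aut_factor_G_nonzero: "g \<in> G_group \<Longrightarrow> aut_factor g (of_uhp \<tau>) \<noteq> 0"
  using alpha_slash Im_of_uhp by (auto simp: slash_inv_def)

lemma moebius_G: "g \<in> G_group \<Longrightarrow> Im (moebius g (of_uhp \<tau>)) > 0"
  using alpha_slash Im_of_uhp by (auto simp: slash_inv_def)

locale coefficient_ring =
  fixes R :: "complex set"
  assumes one_R: "1 \<in> R" and add_R: "x \<in> R \<Longrightarrow> y \<in> R \<Longrightarrow> x + y \<in> R"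
    and neg_R: "x \<in> R \<Longrightarrow> - x \<in> R" and mult_R: "x \<in> R \<Longrightarrow> y \<in> R \<Longrightarrow> x * y \<in> R"
begin

lemma zero_R: "0 \<in> R"
  using add_R [OF one_R neg_R [OF one_R]] by simp

lemma sum_R: "(\<And>i. i \<in> I \<Longrightarrow> f i \<in> R) \<Longrightarrow> sum f I \<in> R"
  by (induction I rule: infinite_finite_induct) (auto intro: zero_R add_R)

lemma of_nat_R: "of_nat n \<in> R"
  by (induction n) (auto intro: zero_R one_R add_R)

lemma of_int_R: "of_int n \<in> R"
  using of_nat_R [of "nat n"] neg_R [OF of_nat_R [of "nat (- n)"]] by (cases "n \<ge> 0") auto

lemma fps_R_mult: "a \<in> fps_over R \<Longrightarrow> b \<in> fps_over R \<Longrightarrow> a * b \<in> fps_over R"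
  by (auto simp: fps_over_def fps_mult_nth intro!: sum_R mult_R)

lemma form_const: "c \<in> R \<Longrightarrow> form_with R 0 (\<lambda>_. c) (fps_const c)"
  by (auto simp: form_with_def fps_over_def has_qexp_const zero_R)

lemma form_add: "form_with R k f a \<Longrightarrow> form_with R k g b \<Longrightarrow> form_with R k (\<lambda>\<tau>. f \<tau> + g \<tau>) (a + b)"
  by (auto simp: form_with_def has_qexp_add fps_over_def distrib_left intro: add_R)

lemma form_neg: "form_with R k f a \<Longrightarrow> form_with R k (\<lambda>\<tau>. - f \<tau>) (- a)"
  by (auto simp: form_with_def has_qexp_minus fps_over_def intro: neg_R)

lemma form_diff: "form_with R k f a \<Longrightarrow> form_with R k g b \<Longrightarrow> form_with R k (\<lambda>\<tau>. f \<tau> - g \<tau>) (a - b)"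
  using form_add [OF _ form_neg] by fastforce

lemma form_mult: "form_with R k f a \<Longrightarrow> form_with R l g b \<Longrightarrow> form_with R (k + l) (\<lambda>\<tau>. f \<tau> * g \<tau>) (a * b)"
  by (auto simp: form_with_def has_qexp_mult fps_R_mult power_int_add aut_factor_G_nonzero mult_ac)

lemma form_cmult: "c \<in> R \<Longrightarrow> form_with R k f a \<Longrightarrow> form_with R k (\<lambda>\<tau>. c * f \<tau>) (fps_const c * a)"
  using form_mult [OF form_const] by fastforce

lemma form_power: "form_with R k f a \<Longrightarrow> form_with R (int n * k) (\<lambda>\<tau>. f \<tau> ^ n) (a ^ n)"
proof (induction n)
  case 0
  then show ?case
    using form_const [OF one_R] by simp
next
  case (Suc n)
  then show ?case
    using form_mult [OF Suc.prems Suc.IH] by (simp add: algebra_simps)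
qed

lemma form_zero: "form_with R k (\<lambda>_. 0) 0"
  using has_qexp_const [of 0] by (auto simp: form_with_def fps_over_def zero_R)

lemma form_sum:
  "(\<And>i. i \<in> I \<Longrightarrow> form_with R k (f i) (a i)) \<Longrightarrow> form_with R k (\<lambda>\<tau>. \<Sum>i\<in>I. f i \<tau>) (\<Sum>i\<in>I. a i)"
  by (induction I rule: infinite_finite_induct) (auto intro: form_zero form_add)

end

interpretation Cx: coefficient_ring UNIV
  by unfold_locales auto

interpretation Zx: coefficient_ring \<int>
  by unfold_locales auto

subsection \<open>The expansions of \<open>\<alpha>\<close>, \<open>\<beta>\<close> and the cusp form\<close>

definition X4_fps :: "complex fps" where "X4_fps = fps_X * (fps_const 16 * psi_fps ^ 4)"
definition Y4_fps :: "complex fps" where "Y4_fps = theta_fps (-1) ^ 4"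
definition alpha_fps :: "complex fps" where
  "alpha_fps = X4_fps ^ 2 + fps_const 6 * X4_fps * Y4_fps + Y4_fps ^ 2"
definition disc_unit :: "complex fps" where
  "disc_unit = psi_fps ^ 4 * Y4_fps * (X4_fps + Y4_fps) ^ 2"
definition beta_fps :: "complex fps" where "beta_fps = (X4_fps - Y4_fps) ^ 4"
definition disc :: "uhp \<Rightarrow> complex" where "disc \<tau> = disc_h (of_uhp \<tau>)"

lemma has_qexp_X4: "has_qexp X4 X4_fps"
proof -
  have "has_qexp (\<lambda>\<tau>. exp (of_real pi * \<i> * \<tau>) * (16 * psi \<tau> ^ 4)) X4_fps"
    unfolding X4_fps_def by (intro has_qexp_mult has_qexp_nome has_qexp_power has_qexp_psi has_qexp_const)
  then show ?thesis
  proof (rule has_qexp_cong)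
    fix \<tau> :: complex assume "Im \<tau> > 0"
    have "exp (of_real pi * \<i> * \<tau> / 4) ^ 4 = exp (of_real pi * \<i> * \<tau>)"
      unfolding exp_of_nat_mult [symmetric] by simp
    then show "exp (of_real pi * \<i> * \<tau>) * (16 * psi \<tau> ^ 4) = X4 \<tau>"
      unfolding X4_def theta_half_psi(1) [OF \<open>Im \<tau> > 0\<close>] power_mult_distrib by simp
  qed
qed

lemma has_qexp_Y4: "has_qexp Y4 Y4_fps"
  unfolding Y4_fps_def Y4_def [abs_def] by (intro has_qexp_power has_qexp_theta) simp

lemma has_qexp_alpha: "has_qexp alpha_h alpha_fps"
  unfolding alpha_fps_def alpha_h_def [abs_def]
  by (intro has_qexp_add has_qexp_mult has_qexp_power has_qexp_X4 has_qexp_Y4 has_qexp_const)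

lemma has_qexp_beta: "has_qexp beta_h beta_fps"
  unfolding beta_fps_def beta_h_def [abs_def]
  by (intro has_qexp_diff has_qexp_power has_qexp_X4 has_qexp_Y4)

lemma has_qexp_disc: "has_qexp disc_h (fps_X * disc_unit)"
proof -
  have "has_qexp (\<lambda>\<tau>. 1/16 * (X4 \<tau> * Y4 \<tau> * (X4 \<tau> + Y4 \<tau>) ^ 2)) (fps_const (1/16) * (X4_fps * Y4_fps * (X4_fps + Y4_fps) ^ 2))"
    by (intro has_qexp_add has_qexp_mult has_qexp_power has_qexp_X4 has_qexp_Y4 has_qexp_const)
  moreover have "fps_const (1/16) * (X4_fps * Y4_fps * (X4_fps + Y4_fps) ^ 2) = fps_X * disc_unit"
  proof -
    have "fps_const (1/16) * (X4_fps * Y4_fps * (X4_fps + Y4_fps) ^ 2) =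
        fps_const (1/16) * fps_const 16 * (fps_X * (psi_fps ^ 4 * Y4_fps * (X4_fps + Y4_fps) ^ 2))"
      by (simp only: X4_fps_def [THEN arg_cong, of "\<lambda>x. x * _"] mult_ac)
    also have "fps_const (1/16) * fps_const 16 = (1 :: complex fps)"
      by simp
    finally show ?thesis
      by (simp add: disc_unit_def)
  qed
  ultimately show ?thesis
    by (simp add: disc_h_def [abs_def])
qed

lemma X4_nth_0: "fps_nth X4_fps 0 = 0" and Y4_nth_0: "fps_nth Y4_fps 0 = 1"
  by (simp_all add: X4_fps_def Y4_fps_def fps_nth_power_0 theta_fps_0)

lemma nth_0:
  "fps_nth alpha_fps 0 = 1" "fps_nth disc_unit 0 = 1" "fps_nth beta_fps 0 = 1"
  by (simp_all add: alpha_fps_def disc_unit_def beta_fps_def X4_nth_0 Y4_nth_0 psi_fps_0 fps_nth_power_0)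

lemma Ints_fps:
  "psi_fps \<in> fps_over \<int>" "Y4_fps \<in> fps_over \<int>" "X4_fps \<in> fps_over \<int>"
  "alpha_fps \<in> fps_over \<int>" "beta_fps \<in> fps_over \<int>" "disc_unit \<in> fps_over \<int>" "fps_X * disc_unit \<in> fps_over \<int>"
proof -
  have pow: "a ^ n \<in> fps_over \<int>" if "a \<in> fps_over \<int>" for a :: "complex fps" and n
  proof (induction n)
    case (Suc n)
    show ?case
      using Zx.fps_R_mult [OF that Suc] by simp
  qed (simp add: fps_over_def)
  have add: "a + b \<in> fps_over \<int>" "a - b \<in> fps_over \<int>" if "a \<in> fps_over \<int>" "b \<in> fps_over \<int>" for a b :: "complex fps"
    using that by (auto simp: fps_over_def)
  have const: "fps_const (of_int n) \<in> fps_over \<int>" "fps_X \<in> fps_over \<int>" for n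
    by (auto simp: fps_over_def fps_X_def)
  note const' = const(1) [of 16, simplified] const(1) [of 6, simplified] const(2)
  show psi: "psi_fps \<in> fps_over \<int>"
    by (simp add: fps_over_def psi_fps_Ints)
  show Y: "Y4_fps \<in> fps_over \<int>"
    unfolding Y4_fps_def by (rule pow) (simp add: fps_over_def theta_fps_Ints)
  show X: "X4_fps \<in> fps_over \<int>"
    unfolding X4_fps_def by (intro Zx.fps_R_mult const' pow psi)
  show "alpha_fps \<in> fps_over \<int>" "beta_fps \<in> fps_over \<int>"
    unfolding alpha_fps_def beta_fps_def by (intro Zx.fps_R_mult const' pow add X Y)+
  show "disc_unit \<in> fps_over \<int>"
    unfolding disc_unit_def by (intro Zx.fps_R_mult const' pow add X Y psi)
  then show "fps_X * disc_unit \<in> fps_over \<int>"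
    by (intro Zx.fps_R_mult const')
qed

lemma alpha_eq: "alpha \<tau> = alpha_h (of_uhp \<tau>)" and beta_eq: "beta \<tau> = beta_h (of_uhp \<tau>)"
proof -
  have X: "theta10 \<tau> ^ 4 = X4 (of_uhp \<tau>)"
    by (simp add: theta10_def X4_def theta_def theta_term_def)
  have Y: "theta01 \<tau> ^ 4 = Y4 (of_uhp \<tau>)"
    by (simp add: theta01_def Y4_def theta_def theta_term_def)
  show "alpha \<tau> = alpha_h (of_uhp \<tau>)"
    by (simp add: alpha_def epsilon'_def delta'_def alpha_h_def X Y) (simp add: power2_eq_square algebra_simps add_divide_distrib diff_divide_distrib)
  show "beta \<tau> = beta_h (of_uhp \<tau>)"
    by (simp add: beta_def delta'_def beta_h_def X Y power_mult_distrib power_divide)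
qed

lemma slash_uhp:
  assumes "\<And>g. g \<in> G_group \<Longrightarrow> slash_inv k f g" "has_qexp f a" "a \<in> fps_over \<int>"
  shows "form_with \<int> (int k) (\<lambda>\<tau>. f (of_uhp \<tau>)) a"
  unfolding form_with_def
proof (intro conjI ballI allI)
  show "has_qexp (\<lambda>z. f (of_uhp (to_uhp z))) a"
    using assms(2) by (rule has_qexp_cong) (simp add: of_to_uhp)
  fix g \<tau> assume g: "g \<in> G_group"
  show "f (of_uhp (to_uhp (moebius g (of_uhp \<tau>)))) = aut_factor g (of_uhp \<tau>) powi int k * f (of_uhp \<tau>)"
    using assms(1) [OF g] Im_of_uhp [of \<tau>] moebius_G [OF g] by (simp add: slash_inv_def of_to_uhp)
qed (fact assms)

lemma alpha_form: "form_with \<int> 4 alpha alpha_fps"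
  using slash_uhp [OF alpha_slash has_qexp_alpha] Ints_fps by (simp add: alpha_eq [abs_def])

lemma disc_form: "form_with \<int> 8 disc (fps_X * disc_unit)"
  using slash_uhp [OF disc_slash has_qexp_disc] Ints_fps by (simp add: disc_def [abs_def])

lemma beta_disc: "beta \<tau> = alpha \<tau> ^ 2 - 256 * disc \<tau>"
  by (simp add: alpha_eq beta_eq disc_def beta_alpha_disc)

text \<open>Automorphy is inherited from \<alpha>^2 - 256 D; uniqueness of expansions identifies the
  resulting series with \<open>beta_fps\<close>.\<close>

lemma beta_form: "form_with \<int> 8 beta beta_fps"
proof -
  have "form_with \<int> 8 (\<lambda>\<tau>. alpha \<tau> ^ 2 - 256 * disc \<tau>) (alpha_fps ^ 2 - fps_const 256 * (fps_X * disc_unit))"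
  proof (rule Zx.form_diff)
    show "form_with \<int> 8 (\<lambda>\<tau>. alpha \<tau> ^ 2) (alpha_fps ^ 2)"
      using Zx.form_power [OF alpha_form, of 2] by simp
    show "form_with \<int> 8 (\<lambda>\<tau>. 256 * disc \<tau>) (fps_const 256 * (fps_X * disc_unit))"
      by (rule Zx.form_cmult [OF _ disc_form]) simp
  qed
  then have b: "form_with \<int> 8 beta (alpha_fps ^ 2 - fps_const 256 * (fps_X * disc_unit))"
    by (simp add: beta_disc [abs_def])
  have "has_qexp (\<lambda>z. beta (to_uhp z)) beta_fps"
    using has_qexp_beta by (rule has_qexp_cong) (simp add: beta_eq of_to_uhp)
  then have "beta_fps = alpha_fps ^ 2 - fps_const 256 * (fps_X * disc_unit)"
    using form_withD(1) [OF b] by (rule has_qexp_unique)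
  with b show ?thesis
    by simp
qed

lemma disc_nonzero: "disc \<tau> \<noteq> 0"
  using theta2_nonzero [OF Im_of_uhp] theta4_nonzero [OF Im_of_uhp] theta3_nonzero [OF Im_of_uhp]
    jacobi_identity [OF Im_of_uhp, symmetric]
  by (simp add: disc_def disc_h_def X4_def Y4_def)

subsection \<open>Forms of small weight\<close>

text \<open>By periodicity and the rotation \<open>\<tau> \<mapsto> (\<tau> - 1)/(\<tau> + 1)\<close>, which raises the imaginary part of the
  points with \<open>Im \<tau> = 1/2\<close> in the period strip, the maximum of the modulus on \<open>Im \<tau> \<ge> 1/2\<close> is
  attained in the interior.\<close>

lemma weight_0_vanishing:
  assumes f: "form_with R 0 f a" and a0: "fps_nth a 0 = 0"
  shows "f \<tau> = 0"
proof -
  define g where "g z = f (to_uhp z)" for z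
  have q: "has_qexp g a"
    unfolding g_def [abs_def] by (rule form_withD(1) [OF f])
  let ?t = "\<lambda>z. exp (of_real pi * \<i> * z)"
  let ?H = "{z. Im z > 0}"
  have per: "g (z + 2 * of_int n) = g z" if "Im z > 0" for z n
    using that by (intro periodic_2_int) (auto intro: has_qexp_periodic [OF q])
  have rot: "g ((z - 1) / (z + 1)) = g z" if z: "Im z > 0" for z
  proof -
    have c0: "(1 + \<i>) / 2 \<noteq> 0"
      by (simp add: complex_eq_iff)
    have "((1 + \<i>) / 2 * z + - (1 + \<i>) / 2) = (1 + \<i>) / 2 * (z - 1)" "((1 + \<i>) / 2 * z + (1 + \<i>) / 2) = (1 + \<i>) / 2 * (z + 1)"
      by (simp_all add: algebra_simps)
    then have "moebius (mat22 ((1 + \<i>) / 2) (- (1 + \<i>) / 2) ((1 + \<i>) / 2) ((1 + \<i>) / 2)) z = (z - 1) / (z + 1)"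
      unfolding moebius_def aut_factor_def mat22_nth using mult_divide_mult_cancel_left [OF c0] by (simp only:)
    then show ?thesis
      using form_withD(3) [OF f rotation_in_G, of "to_uhp z"] z by (simp add: g_def of_to_uhp)
  qed
  define r where "r = exp (- pi / 2)"
  have r: "0 < r" "r < 1"
    by (auto simp: r_def)
  have cont: "continuous_on (cball 0 r) (eval_fps a)"
  proof (rule continuous_on_eval_fps [THEN continuous_on_subset])
    show "cball (0::complex) r \<subseteq> eball 0 (fps_conv_radius a)"
      using has_qexp_in_disk [OF q le_less_trans [OF _ r(2)]] by (auto simp: dist_0_norm)
  qed
  \<comment> \<open>The nomes of the region Im \<tau> \<ge> 1/2, together with the cusp 0, form the
    closed disc of radius r = exp(-pi/2), where compactness provides a maximum.\<close>
  have "\<exists>t0\<in>cball 0 r. \<forall>t\<in>cball 0 r. norm (eval_fps a t) \<le> norm (eval_fps a t0)"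
    using r by (intro continuous_attains_sup continuous_on_norm cont) auto
  then obtain t0 where t0: "norm t0 \<le> r" "\<And>t. norm t \<le> r \<Longrightarrow> norm (eval_fps a t) \<le> norm (eval_fps a t0)"
    by auto
  have small: "norm (?t z) \<le> r \<longleftrightarrow> Im z \<ge> 1/2" for z
    unfolding norm_nome r_def by simp
  have "\<exists>z0. Im z0 > 1/2 \<and> (\<forall>z. Im z > 1/2 \<longrightarrow> norm (g z) \<le> norm (g z0))"
  proof (cases "t0 = 0")
    case True
    \<comment> \<open>A maximum at the cusp is 0, because the constant term vanishes; any interior
      point may then serve as the place of the maximum.\<close>
    have "norm (g z) \<le> norm (g \<i>)" if "Im z > 1/2" for z
    proof -
      have "norm (g z) \<le> norm (eval_fps a t0)"
        using t0(2) [of "?t z"] small [of z] that by (simp add: has_qexpD [OF q])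
      then show ?thesis
        using a0 by (simp add: True eval_fps_at_0)
    qed
    then show ?thesis
      by (intro exI [of _ \<i>]) auto
  next
    case False
    then obtain w where w: "Im w > 0" "t0 = ?t w"
      using t0(1) r nome_surj [of t0] by (metis le_less_trans)
    have Imw: "Im w \<ge> 1/2"
      using small [of w] t0(1) w(2) by simp
    have max: "norm (g z) \<le> norm (g w)" if "Im z \<ge> 1/2" for z
      using t0(2) [of "?t z"] small [of z] that by (simp add: has_qexpD [OF q] w)
    show ?thesis
    proof (cases "Im w > 1/2")
      case True
      then show ?thesis
        using max by (intro exI [of _ w]) auto
    next
      case False
      then have w12: "Im w = 1/2"
        using Imw by simp
      \<comment> \<open>Rounding moves w by an even integer to v with \<bar>Re v + 1\<bar> at most
        1. Then \<bar>v + 1\<bar>^2 is at most 5/4, and the rotation raises the imaginary part from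
        1/2 to at least 4/5.\<close>
      define n where "n = round ((Re w + 1) / 2)"
      define v where "v = w + 2 * of_int (- n)"
      have "\<bar>(Re w + 1) / 2 - of_int n\<bar> \<le> 1/2"
        unfolding n_def using of_int_round_abs_le [of "(Re w + 1) / 2"] by (simp add: abs_minus_commute)
      then have "\<bar>2 * ((Re w + 1) / 2 - of_int n)\<bar> \<le> 1"
        unfolding abs_mult by simp
      moreover have "Re v + 1 = 2 * ((Re w + 1) / 2 - of_int n)"
        by (simp add: v_def)
      ultimately have "\<bar>Re v + 1\<bar> \<le> 1"
        by (simp only:)
      then have "(Re v + 1)\<^sup>2 \<le> 1"
        by (simp add: abs_square_le_1)
      then have nv: "(norm (v + 1))\<^sup>2 \<le> 5/4"
        by (simp add: cmod_power2 v_def w12 power_divide)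
      have v: "Im v = 1/2"
        by (simp add: v_def w12)
      have "v + 1 \<noteq> 0"
        using v by (auto simp: complex_eq_iff)
      then have "(norm (v + 1))\<^sup>2 > 0"
        by simp
      then have "1 / (5/4) \<le> 1 / (norm (v + 1))\<^sup>2"
        using nv by (intro divide_left_mono) auto
      moreover have "Im ((v - 1) / (v + 1)) = 1 / (norm (v + 1))\<^sup>2"
        using rotation_half_plane [of v] v by simp
      ultimately have "Im ((v - 1) / (v + 1)) > 1/2"
        by simp
      moreover have "g ((v - 1) / (v + 1)) = g w"
        using rot [of v] per [of w "- n"] v w(1) by (simp add: v_def)
      ultimately show ?thesis
        using max by (intro exI [of _ "(v - 1) / (v + 1)"]) auto
    qed
  qed
  then obtain z0 where z0: "Im z0 > 1/2" "\<And>z. Im z > 1/2 \<Longrightarrow> norm (g z) \<le> norm (g z0)"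
    by blast
  have "g constant_on ?H"
  proof (rule maximum_modulus_principle [where U = "{z. Im z > 1/2}" and \<xi> = z0])
    show "g holomorphic_on ?H"
      by (rule has_qexp_holomorphic [OF q])
    show "open {z. Im z > 1/2}"
      by (rule open_halfspace_Im_gt)
  qed (use z0 half_plane in auto)
  then obtain c where c: "\<And>z. Im z > 0 \<Longrightarrow> g z = c"
    by (auto simp: constant_on_def)
  have "has_qexp g (fps_const c)"
    using has_qexp_const [of c] by (rule has_qexp_cong) (simp add: c)
  then have "a = fps_const c"
    using q has_qexp_unique by blast
  then have "c = 0"
    using a0 by simp
  then show ?thesis
    using c [OF Im_of_uhp [of \<tau>]] by (simp add: g_def of_uhp_inverse)
qed

lemma weight_0_constant:
  assumes f: "form_with R 0 f a"
  shows "f \<tau> = fps_nth a 0"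
proof -
  have "form_with UNIV 0 (\<lambda>\<tau>. f \<tau> - fps_nth a 0) (a - fps_const (fps_nth a 0))"
    using Cx.form_diff [OF form_with_mono [OF f] Cx.form_const] by (simp add: fps_over_def)
  from weight_0_vanishing [OF this, of \<tau>] show ?thesis
    by simp
qed

text \<open>The square has weight -8; multiplied by D it becomes a form of weight 0 without constant
  term. D has no zeros.\<close>

lemma weight_minus_4_zero:
  assumes f: "form_with R (-4) f a"
  shows "f \<tau> = 0"
proof -
  have f': "form_with UNIV (-4) f a"
    using f by (rule form_with_mono) (simp add: fps_over_def)
  have d: "form_with UNIV 8 disc (fps_X * disc_unit)"
    using disc_form by (rule form_with_mono) (simp add: fps_over_def)
  have "form_with UNIV 0 (\<lambda>\<tau>. f \<tau> ^ 2 * disc \<tau>) (a ^ 2 * (fps_X * disc_unit))"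
    using Cx.form_mult [OF Cx.form_power [OF f', of 2] d] by simp
  from weight_0_vanishing [OF this, of \<tau>] show ?thesis
    using disc_nonzero [of \<tau>] by simp
qed

context coefficient_ring
begin

text \<open>As u has constant term 1, the coefficients of b are determined recursively by those of u
  b. J = R gives integrality of quotients, J = pR divisibility by p.\<close>

lemma fps_unit_cancel:
  assumes u: "u \<in> fps_over R" "fps_nth u 0 = 1"
    and J: "0 \<in> J" "\<And>x y. x \<in> J \<Longrightarrow> y \<in> J \<Longrightarrow> x - y \<in> J" "\<And>x y. x \<in> R \<Longrightarrow> y \<in> J \<Longrightarrow> x * y \<in> J"
    and ub: "\<And>n. fps_nth (u * b) n \<in> J"
  shows "fps_nth b n \<in> J"
proof (induction n rule: less_induct)
  case (less n)
  have "fps_nth (u * b) n = (\<Sum>i\<in>insert 0 {1..n}. fps_nth u i * fps_nth b (n - i))"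
    unfolding fps_mult_nth by (rule sum.cong) auto
  also have "\<dots> = fps_nth b n + (\<Sum>i\<in>{1..n}. fps_nth u i * fps_nth b (n - i))"
    by (subst sum.insert) (auto simp: u)
  finally have "fps_nth b n = fps_nth (u * b) n - (\<Sum>i\<in>{1..n}. fps_nth u i * fps_nth b (n - i))"
    by simp
  have "x + y \<in> J" if "x \<in> J" "y \<in> J" for x y
    using J(2) [OF that(1) J(2) [OF J(1) that(2)]] by simp
  then have Jsum: "sum h I \<in> J" if "\<And>i. i \<in> I \<Longrightarrow> h i \<in> J" for h and I :: "nat set"
    using that by (induction I rule: infinite_finite_induct) (auto simp: J(1))
  have "(\<Sum>i\<in>{1..n}. fps_nth u i * fps_nth b (n - i)) \<in> J"
    by (rule Jsum) (use less u(1) in \<open>auto simp: fps_over_def intro!: J(3)\<close>)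
  with \<open>fps_nth b n = _\<close> show ?case
    using J(2) [OF ub] by simp
qed

lemma Ints_R: "a \<in> fps_over \<int> \<Longrightarrow> a \<in> fps_over R"
  by (auto simp: fps_over_def elim!: Ints_cases intro: of_int_R) (metis Ints_cases of_int_R)

lemma alpha_R: "form_with R 4 alpha alpha_fps"
  and beta_R: "form_with R 8 beta beta_fps"
  and disc_R: "form_with R 8 disc (fps_X * disc_unit)"
  using alpha_form beta_form disc_form Ints_R Ints_fps form_with_mono by blast+

lemma divide_by_disc:
  assumes f: "form_with R k f a" and a0: "fps_nth a 0 = 0"
  obtains b where "form_with R (k - 8) (\<lambda>\<tau>. f \<tau> / disc \<tau>) b"
proof -
  define a' where "a' = fps_shift 1 a"
  have a: "a = fps_X * a'"
    using a0 by (auto simp: fps_eq_iff a'_def)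
  obtain b where b: "has_qexp (\<lambda>z. f (to_uhp z) / disc (to_uhp z)) b" "disc_unit * b = a'"
    using has_qexp_quotient [OF form_withD(1) [OF f, unfolded a] form_withD(1) [OF disc_form]] disc_nonzero
    by (metis nth_0(2) zero_neq_one)
  have "fps_nth b n \<in> R" for n
  proof (rule fps_unit_cancel [of disc_unit])
    show "disc_unit \<in> fps_over R"
      by (rule Ints_R [OF Ints_fps(6)])
    show "fps_nth (disc_unit * b) n \<in> R" for n
      using form_withD(2) [OF f] by (simp add: b(2) a'_def)
  qed (use add_R [OF _ neg_R] in \<open>fastforce intro: zero_R mult_R simp: nth_0\<close>)+
  then have "form_with R (k - 8) (\<lambda>\<tau>. f \<tau> / disc \<tau>) b"
    using f b(1) disc_form unfolding form_with_def
    by (auto simp: fps_over_def power_int_diff aut_factor_G_nonzero)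
  then show ?thesis
    by (rule that)
qed

lemma no_disc_power_relation:
  assumes c: "\<And>z. z \<in> R \<Longrightarrow> c \<noteq> P * z" and P: "P \<in> R"
    and f: "form_with R (8 * int m) f a" and g: "form_with R (8 * int m - 4) g b"
    and eq: "\<And>\<tau>. c * disc \<tau> ^ m = P * f \<tau> + alpha \<tau> * g \<tau>"
  shows False
  using f g eq
proof (induction m arbitrary: f g a b)
  case 0
  have "g \<tau> = 0" for \<tau>
    using 0 weight_minus_4_zero by simp
  moreover have "f \<tau> = fps_nth a 0" for \<tau>
    using 0 weight_0_constant by simp
  ultimately have "c = P * fps_nth a 0"
    using 0 by simp
  then show ?case
    using c form_withD(2) [OF 0(1)] by blast
next
  case (Suc m)
  define n where "n = Suc m"
  let ?a0 = "fps_nth a 0" and ?b0 = "fps_nth b 0"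
  note f = Suc.prems(1) and g = Suc.prems(2) and eq = Suc.prems(3)
  have "form_with UNIV (8 * int n) (\<lambda>\<tau>. c * disc \<tau> ^ n) (fps_const c * (fps_X * disc_unit) ^ n)"
    using Cx.form_cmult [OF UNIV_I Cx.form_power [OF Cx.disc_R, of n], of c] by (simp add: mult.commute)
  moreover have "form_with R (8 * int n) (\<lambda>\<tau>. P * f \<tau> + alpha \<tau> * g \<tau>) (fps_const P * a + alpha_fps * b)"
    using form_add [OF form_cmult [OF P f] ] form_mult [OF alpha_R g] by (simp add: n_def)
  then have "form_with R (8 * int n) (\<lambda>\<tau>. c * disc \<tau> ^ n) (fps_const P * a + alpha_fps * b)"
    using eq by (simp add: n_def)
  ultimately have "fps_const P * a + alpha_fps * b = fps_const c * (fps_X * disc_unit) ^ n"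
    by (metis form_with_unique)
  then have "fps_nth (fps_const P * a + alpha_fps * b) 0 = fps_nth (fps_const c * (fps_X * disc_unit) ^ n) 0"
    by (rule arg_cong)
  then have b0: "P * ?a0 + ?b0 = 0"
    by (simp add: nth_0 fps_nth_power_0 n_def)
  have a0R: "?a0 \<in> R"
    by (rule form_withD(2) [OF f])
  \<comment> \<open>Since \<alpha> has constant term 1, subtracting this multiple of a power of
    \<alpha> kills the constant term of f. The correction of g compensates it in P f + \<alpha> g,
    as \<alpha> \<alpha>^(2m+1) = \<alpha>^(2n), and by \<open>b0\<close> it kills the constant term
    of g at the same time.\<close>
  define f' where "f' \<tau> = f \<tau> - ?a0 * alpha \<tau> ^ (2 * n)" for \<tau>
  define g' where "g' \<tau> = g \<tau> + P * ?a0 * alpha \<tau> ^ (2 * m + 1)" for \<tau>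
  have "form_with R (8 * int n) (\<lambda>\<tau>. ?a0 * alpha \<tau> ^ (2 * n)) (fps_const ?a0 * alpha_fps ^ (2 * n))"
    using form_cmult [OF a0R form_power [OF alpha_R, of "2 * n"]] by (simp add: mult_ac)
  then have f': "form_with R (8 * int n) f' (a - fps_const ?a0 * alpha_fps ^ (2 * n))"
    unfolding f'_def [abs_def] using f by (intro form_diff) (auto simp: n_def)
  have "form_with R (8 * int n - 4) (\<lambda>\<tau>. P * ?a0 * alpha \<tau> ^ (2 * m + 1)) (fps_const (P * ?a0) * alpha_fps ^ (2 * m + 1))"
    using form_cmult [OF mult_R [OF P a0R] form_power [OF alpha_R, of "2 * m + 1"]] by (simp add: n_def algebra_simps)
  then have g': "form_with R (8 * int n - 4) g' (b + fps_const (P * ?a0) * alpha_fps ^ (2 * m + 1))"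
    unfolding g'_def [abs_def] using g by (intro form_add) (auto simp: n_def)
  obtain b1 where b1: "form_with R (8 * int n - 8) (\<lambda>\<tau>. f' \<tau> / disc \<tau>) b1"
    using divide_by_disc [OF f'] by (auto simp: fps_nth_power_0 nth_0)
  have "fps_nth (b + fps_const (P * ?a0) * alpha_fps ^ (2 * m + 1)) 0 = 0"
    using b0 by (simp add: fps_nth_power_0 nth_0 add.commute)
  from divide_by_disc [OF g' this]
  obtain b2 where b2: "form_with R (8 * int n - 4 - 8) (\<lambda>\<tau>. g' \<tau> / disc \<tau>) b2" .
  show ?case
  proof (rule Suc.IH)
    show "form_with R (8 * int m) (\<lambda>\<tau>. f' \<tau> / disc \<tau>) b1"
      using b1 by (simp add: n_def algebra_simps)
    show "form_with R (8 * int m - 4) (\<lambda>\<tau>. g' \<tau> / disc \<tau>) b2"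
      using b2 by (simp add: n_def algebra_simps)
    fix \<tau>
    have "P * f' \<tau> + alpha \<tau> * g' \<tau> = P * f \<tau> + alpha \<tau> * g \<tau>"
      by (simp add: f'_def g'_def n_def algebra_simps)
    also have "\<dots> = c * disc \<tau> ^ n"
      using eq by (simp add: n_def)
    finally have "(P * f' \<tau> + alpha \<tau> * g' \<tau>) / disc \<tau> = c * disc \<tau> ^ m"
      using disc_nonzero [of \<tau>] by (simp add: n_def)
    then show "c * disc \<tau> ^ m = P * (f' \<tau> / disc \<tau>) + alpha \<tau> * (g' \<tau> / disc \<tau>)"
      by (simp add: add_divide_distrib)
  qed
qed

lemma beta_power_mod_alpha:
  "\<exists>h a. form_with R (8 * int m - 4) h a \<and> (\<forall>\<tau>. beta \<tau> ^ m = (- 256) ^ m * disc \<tau> ^ m + alpha \<tau> * h \<tau>)"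
proof (induction m)
  case 0
  show ?case
    using form_zero by (intro exI [of _ "\<lambda>_. 0"] exI [of _ 0]) simp
next
  case (Suc m)
  then obtain h a where h: "form_with R (8 * int m - 4) h a"
    and eq: "\<And>\<tau>. beta \<tau> ^ m = (- 256) ^ m * disc \<tau> ^ m + alpha \<tau> * h \<tau>"
    by blast
  \<comment> \<open>From \<beta>^(m+1) = (\<alpha>^2 - 256 D) \<beta>^m, with the induction
    hypothesis inserted only behind D.\<close>
  let ?h = "\<lambda>\<tau>. alpha \<tau> * beta \<tau> ^ m - 256 * (disc \<tau> * h \<tau>)"
  have c: "256 \<in> R"
    using of_nat_R [of 256] by simp
  have 1: "form_with R (8 * int (Suc m) - 4) (\<lambda>\<tau>. alpha \<tau> * beta \<tau> ^ m) (alpha_fps * beta_fps ^ m)"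
    using form_mult [OF alpha_R form_power [OF beta_R, of m]] by (simp add: algebra_simps)
  have 2: "form_with R (8 * int (Suc m) - 4) (\<lambda>\<tau>. 256 * (disc \<tau> * h \<tau>)) (fps_const 256 * (fps_X * disc_unit * a))"
    using form_cmult [OF c form_mult [OF disc_R h]] by (simp add: algebra_simps)
  have "beta \<tau> ^ Suc m = (- 256) ^ Suc m * disc \<tau> ^ Suc m + alpha \<tau> * ?h \<tau>" for \<tau>
  proof -
    have "beta \<tau> ^ Suc m = (alpha \<tau> ^ 2 - 256 * disc \<tau>) * beta \<tau> ^ m"
      by (simp add: beta_disc)
    also have "\<dots> = alpha \<tau> ^ 2 * beta \<tau> ^ m - 256 * disc \<tau> * beta \<tau> ^ m"
      by (simp add: algebra_simps)
    also have "256 * disc \<tau> * beta \<tau> ^ m = 256 * disc \<tau> * ((- 256) ^ m * disc \<tau> ^ m + alpha \<tau> * h \<tau>)"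
      by (simp only: eq)
    finally show ?thesis
      by (simp add: power2_eq_square algebra_simps)
  qed
  then show ?case
    using form_diff [OF 1 2] by blast
qed

end

subsection \<open>Legendre polynomials of the forms\<close>

text \<open>n is the exponent in the binomial series of y = -2au + bu^2, and k - n of the n factors
  y contribute bu^2. For n < k - n the exponent \<open>n - (k - n)\<close> below is truncated to 0,
  but then the binomial coefficient is 0.\<close>

definition leg_coeff :: "nat \<Rightarrow> nat \<Rightarrow> 'a::field_char_0" where
  "leg_coeff k n = ((-1/2) gchoose n) * of_nat (n choose (k - n))"

lemma legendre_P_explicit:
  "legendre_P k a b = (\<Sum>n=0..k. leg_coeff k n * ((- 2 * a) ^ (n - (k - n)) * b ^ (k - n)))"
proof -
  have pow: "fps_nth ((fps_const c * fps_X + fps_const d * fps_X ^ 2) ^ n) k =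
      of_nat (n choose (k - n)) * (c ^ (n - (k - n)) * d ^ (k - n))" if "n \<le> k" for c d :: 'a and n
  proof -
    have "fps_const c * fps_X + fps_const d * fps_X ^ 2 = (fps_const d * fps_X + fps_const c) * (fps_X :: 'a fps)"
      by (simp add: power2_eq_square algebra_simps)
    then have "(fps_const c * fps_X + fps_const d * fps_X ^ 2) ^ n = (fps_const d * fps_X + fps_const c) ^ n * (fps_X :: 'a fps) ^ n"
      by (simp only: power_mult_distrib)
    then have "fps_nth ((fps_const c * fps_X + fps_const d * fps_X ^ 2) ^ n) k = fps_nth ((fps_const d * fps_X + fps_const c) ^ n) (k - n)"
      using that by (simp only: fps_X_power_mult_right_nth) simp
    also have "(fps_const d * fps_X + fps_const c) ^ n =
        (\<Sum>i\<le>n. fps_const (of_nat (n choose i) * (d ^ i * c ^ (n - i))) * fps_X ^ i)"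
      unfolding binomial_ring
      by (intro sum.cong refl) (simp add: power_mult_distrib fps_const_power fps_of_nat [symmetric] mult_ac)
    also have "fps_nth \<dots> (k - n) = (\<Sum>i\<le>n. if i = k - n then of_nat (n choose i) * (d ^ i * c ^ (n - i)) else 0)"
      unfolding fps_sum_nth by (intro sum.cong refl) (simp add: fps_X_power_nth)
    also have "\<dots> = of_nat (n choose (k - n)) * (c ^ (n - (k - n)) * d ^ (k - n))"
      by (simp add: mult_ac)
    finally show ?thesis .
  qed
  show ?thesis
    unfolding legendre_P_def legendre_gf_def fps_compose_nth fps_binomial_nth leg_coeff_def
    by (intro sum.cong refl) (simp only: pow atLeastAtMost_iff mult.assoc)
qed

text \<open>At (1, 1) the generating function is 1/(1 - u); the sign of the square root is fixed by
  the constant term. This is the constant term of every P_k(\<alpha>, \<beta>), because \<alpha> and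
  \<beta> have constant term 1.\<close>

lemma legendre_P_1_1: "legendre_P k (1::complex) 1 = 1"
proof -
  let ?L = "legendre_gf (1::complex) 1"
  have "(?L * (1 - fps_X)) ^ 2 = ?L ^ 2 * (1 - fps_const (2 * 1) * fps_X + fps_const 1 * fps_X ^ 2)"
    by (simp add: power2_eq_square algebra_simps numeral_fps_const [symmetric])
  then have "(?L * (1 - fps_X)) ^ 2 = 1"
    by (simp only: legendre_gf_square)
  then have "?L * (1 - fps_X) = 1 \<or> ?L * (1 - fps_X) = - 1"
    by (simp add: power2_eq_1_iff)
  moreover have nth: "fps_nth (?L * (1 - fps_X)) 0 = 1"
    by (simp add: legendre_gf_nth_0)
  have "?L * (1 - fps_X) \<noteq> - 1"
  proof
    assume "?L * (1 - fps_X) = - 1"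
    with nth have "fps_nth (- 1 :: complex fps) 0 = 1"
      by (simp only:)
    then show False
      by simp
  qed
  ultimately have L: "?L * (1 - fps_X) = 1"
    by blast
  have "fps_nth ?L n = 1" for n
  proof (induction n)
    case (Suc n)
    have "fps_nth (?L * (1 - fps_X)) (Suc n) = fps_nth ?L (Suc n) - fps_nth ?L n"
      by (simp add: right_diff_distrib)
    then show ?case
      using Suc by (simp add: L)
  qed (simp add: legendre_gf_nth_0)
  then show ?thesis
    by (simp add: legendre_P_def)
qed

definition leg_fps :: "nat \<Rightarrow> complex fps" where
  "leg_fps k = (\<Sum>n=0..k. fps_const (leg_coeff k n) * ((fps_const (- 2) * alpha_fps) ^ (n - (k - n)) * beta_fps ^ (k - n)))"

lemma leg_fps_nth_0: "fps_nth (leg_fps k) 0 = 1"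
proof -
  have "fps_nth (leg_fps k) 0 = legendre_P k 1 1"
    unfolding leg_fps_def legendre_P_explicit fps_sum_nth
    by (intro sum.cong refl) (simp add: fps_nth_power_0 nth_0)
  then show ?thesis
    by (simp add: legendre_P_1_1)
qed

text \<open>The denominators are powers of 4, so these coefficients are integral at odd primes; the
  central binomial coefficient carries the valuation studied later.\<close>

lemma gchoose_minus_half: "((-1/2) gchoose n :: 'a::field_char_0) = (-1) ^ n * of_nat ((2 * n) choose n) / 4 ^ n"
proof -
  have "((-1/2) gchoose n :: 'a) = (-1) ^ n * (fact (2 * n) / (fact n * fact n)) / 4 ^ n"
  proof (induction n)
    case (Suc n)
    have "(of_nat (Suc n) :: 'a) * ((-1/2) gchoose Suc n) = (-1/2 - of_nat n) * ((-1/2) gchoose n)"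
      using gbinomial_mult_1 [of "-1/2 :: 'a" n] by (simp add: algebra_simps)
    then have "((-1/2) gchoose Suc n :: 'a) = (-1/2 - of_nat n) * ((-1/2) gchoose n) / of_nat (Suc n)"
      by (simp add: nonzero_eq_divide_eq mult.commute del: of_nat_Suc)
    also have "\<dots> = (-1/2 - of_nat n) * ((-1) ^ n * (fact (2 * n) / (fact n * fact n)) / 4 ^ n) / of_nat (Suc n)"
      by (simp only: Suc)
    also have "(-1/2 - of_nat n :: 'a) = - (of_nat (2 * n + 1)) / 2"
      by (simp add: field_simps)
    also have "- (of_nat (2 * n + 1)) / 2 * ((-1) ^ n * (fact (2 * n) / (fact n * fact n)) / 4 ^ n) / of_nat (Suc n) =
        (-1) ^ Suc n * (of_nat (2 * Suc n) * (of_nat (2 * n + 1) * fact (2 * n)) / (of_nat (Suc n) * fact n * (of_nat (Suc n) * fact n))) / (4 ^ Suc n :: 'a)"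
      by (simp add: divide_simps del: of_nat_Suc) (simp add: algebra_simps)
    also have "of_nat (2 * Suc n) * (of_nat (2 * n + 1) * fact (2 * n)) = (fact (2 * Suc n) :: 'a)"
      by (simp add: algebra_simps)
    also have "of_nat (Suc n) * fact n = (fact (Suc n) :: 'a)"
      by simp
    finally show ?case .
  qed simp
  moreover have "(of_nat ((2 * n) choose n) :: 'a) = fact (2 * n) / (fact n * fact n)"
    by (subst binomial_fact) (simp_all add: mult_2)
  ultimately show ?thesis
    by simp
qed

context coefficient_ring
begin

context
  assumes half: "\<And>n. ((-1/2) gchoose n) \<in> R"
begin

lemma leg_coeff_R: "leg_coeff k n \<in> R"
  unfolding leg_coeff_def by (intro mult_R half of_nat_R)

lemma legendre_form: "form_with R (4 * int k) (\<lambda>\<tau>. legendre_P k (alpha \<tau>) (beta \<tau>)) (leg_fps k)"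
  unfolding legendre_P_explicit leg_fps_def
proof (rule form_sum)
  fix n assume n: "n \<in> {0..k}"
  show "form_with R (4 * int k) (\<lambda>\<tau>. leg_coeff k n * ((- 2 * alpha \<tau>) ^ (n - (k - n)) * beta \<tau> ^ (k - n)))
      (fps_const (leg_coeff k n) * ((fps_const (- 2) * alpha_fps) ^ (n - (k - n)) * beta_fps ^ (k - n)))"
  proof (cases "k - n \<le> n")
    case True
    have m2: "- 2 \<in> R"
      using of_int_R [of "- 2"] by simp
    have "form_with R (int (n - (k - n)) * 4 + int (k - n) * 8)
      (\<lambda>\<tau>. (- 2 * alpha \<tau>) ^ (n - (k - n)) * beta \<tau> ^ (k - n))
      ((fps_const (- 2) * alpha_fps) ^ (n - (k - n)) * beta_fps ^ (k - n))"
      by (intro form_mult form_power form_cmult m2 alpha_R beta_R)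
    moreover have "int (n - (k - n)) * 4 + int (k - n) * 8 = 4 * int k"
      using True n by (simp add: of_nat_diff)
    ultimately show ?thesis
      by (intro form_cmult leg_coeff_R) simp
  next
    case False
    then have "leg_coeff k n = (0 :: complex)"
      by (simp add: leg_coeff_def binomial_eq_0)
    then show ?thesis
      using form_zero by simp
  qed
qed

text \<open>In the n-th term \<alpha> has exponent 2n - k, so only n = k/2 is free of \<alpha>; the
  terms with 2n < k have coefficient 0.\<close>

lemma legendre_mod_alpha:
  "\<exists>h a. form_with R (4 * int k - 4) h a \<and> (\<forall>\<tau>. legendre_P k (alpha \<tau>) (beta \<tau>) =
     (if even k then ((-1/2) gchoose (k div 2)) * beta \<tau> ^ (k div 2) else 0) + alpha \<tau> * h \<tau>)"
proof -
  define f where "f n \<tau> = (if k - n < n then (- 2 * leg_coeff k n) * ((- 2 * alpha \<tau>) ^ (n - (k - n) - 1) * beta \<tau> ^ (k - n)) else 0)" for n \<tau>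
  have "\<exists>b. form_with R (4 * int k - 4) (f n) b" if n: "n \<in> {0..k}" for n
  proof (cases "k - n < n")
    case True
    have m2: "- 2 \<in> R"
      using of_int_R [of "- 2"] by simp
    have "form_with R (int (n - (k - n) - 1) * 4 + int (k - n) * 8)
      (\<lambda>\<tau>. (- 2 * alpha \<tau>) ^ (n - (k - n) - 1) * beta \<tau> ^ (k - n))
      ((fps_const (- 2) * alpha_fps) ^ (n - (k - n) - 1) * beta_fps ^ (k - n))"
      by (intro form_mult form_power form_cmult m2 alpha_R beta_R)
    moreover have "int (n - (k - n) - 1) * 4 + int (k - n) * 8 = 4 * int k - 4"
      using True n by (simp add: of_nat_diff)
    ultimately have "form_with R (4 * int k - 4) (\<lambda>\<tau>. (- 2 * leg_coeff k n) * ((- 2 * alpha \<tau>) ^ (n - (k - n) - 1) * beta \<tau> ^ (k - n)))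
       (fps_const (- 2 * leg_coeff k n) * ((fps_const (- 2) * alpha_fps) ^ (n - (k - n) - 1) * beta_fps ^ (k - n)))"
      by (intro form_cmult mult_R m2 leg_coeff_R) (simp only:)
    then show ?thesis
      using True by (auto simp: f_def [abs_def])
  next
    case False
    then show ?thesis
      using form_zero by (auto simp: f_def [abs_def])
  qed
  then obtain b where b: "\<And>n. n \<in> {0..k} \<Longrightarrow> form_with R (4 * int k - 4) (f n) (b n)"
    by metis
  have h: "form_with R (4 * int k - 4) (\<lambda>\<tau>. \<Sum>n=0..k. f n \<tau>) (\<Sum>n=0..k. b n)"
    by (rule form_sum [OF b])
  have split: "leg_coeff k n * ((- 2 * alpha \<tau>) ^ (n - (k - n)) * beta \<tau> ^ (k - n)) =
      (if even k \<and> n = k div 2 then ((-1/2) gchoose (k div 2)) * beta \<tau> ^ (k div 2) else 0) + alpha \<tau> * f n \<tau>"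
    if n: "n \<in> {0..k}" for n \<tau>
  proof -
    consider "k - n < n" | "k - n = n" | "n < k - n"
      by linarith
    then show ?thesis
    proof cases
      case 1
      then have "n - (k - n) = Suc (n - (k - n) - 1)"
        by simp
      then have pw: "(- 2 * alpha \<tau>) ^ (n - (k - n)) = (- 2 * alpha \<tau>) * (- 2 * alpha \<tau>) ^ (n - (k - n) - 1)"
        by (metis power_Suc)
      have nc: "\<not> (even k \<and> n = k div 2)"
        using 1 by auto
      show ?thesis
        unfolding if_not_P [OF nc] f_def if_P [OF 1] pw by (simp add: mult_ac)
    next
      case 2
      then have k: "k = 2 * n"
        using n by auto
      have "even k" "k div 2 = n"
        by (simp_all add: k)
      then show ?thesis
        by (simp add: 2 f_def leg_coeff_def)
    next
      case 3
      then have "leg_coeff k n = (0 :: complex)"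
        by (simp add: leg_coeff_def binomial_eq_0)
      moreover have nc: "\<not> (even k \<and> n = k div 2)"
        using 3 by auto
      ultimately show ?thesis
        unfolding if_not_P [OF nc] using 3 by (simp add: f_def)
    qed
  qed
  have "legendre_P k (alpha \<tau>) (beta \<tau>) =
     (if even k then ((-1/2) gchoose (k div 2)) * beta \<tau> ^ (k div 2) else 0) + alpha \<tau> * (\<Sum>n=0..k. f n \<tau>)" for \<tau>
  proof -
    have "legendre_P k (alpha \<tau>) (beta \<tau>) =
      (\<Sum>n=0..k. (if even k \<and> n = k div 2 then ((-1/2) gchoose (k div 2)) * beta \<tau> ^ (k div 2) else 0) + alpha \<tau> * f n \<tau>)"
      unfolding legendre_P_explicit by (intro sum.cong refl split)
    also have "\<dots> = (\<Sum>n=0..k. (if n = k div 2 then (if even k then ((-1/2) gchoose (k div 2)) * beta \<tau> ^ (k div 2) else 0) else 0)) + alpha \<tau> * (\<Sum>n=0..k. f n \<tau>)"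
      unfolding sum.distrib sum_distrib_left by (intro arg_cong2 [where f = "(+)"] sum.cong refl) auto
    also have "(\<Sum>n=0..k. (if n = k div 2 then (if even k then ((-1/2) gchoose (k div 2)) * beta \<tau> ^ (k div 2) else 0) else 0)) =
        (if even k then ((-1/2) gchoose (k div 2)) * beta \<tau> ^ (k div 2) else (0::complex))"
      by (subst sum.delta) auto
    finally show ?thesis .
  qed
  with h show ?thesis
    by blast
qed

end

end

section \<open>The Legendre generating function over expansions\<close>

lemma qexp_family_mult:
  assumes "\<And>n. has_qexp (\<lambda>z. fps_nth (A z) n) (fps_nth A' n)" "\<And>n. has_qexp (\<lambda>z. fps_nth (B z) n) (fps_nth B' n)"
  shows "has_qexp (\<lambda>z. fps_nth (A z * B z) n) (fps_nth (A' * B') n)"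
  unfolding fps_mult_nth by (intro has_qexp_sum has_qexp_mult assms)

text \<open>At each point of the half plane this is \<open>legendre_gf_square\<close>. Every
  coefficient in u is a function with an expansion, and uniqueness of expansions makes the identity
  formal.\<close>

lemma legendre_fps_square:
  "Abs_fps leg_fps ^ 2 * (1 - fps_const (2 * alpha_fps) * fps_X + fps_const beta_fps * fps_X ^ 2) = (1 :: complex fps fps)"
proof (rule fps_ext)
  fix n
  let ?a = "\<lambda>z. alpha (to_uhp z)" and ?b = "\<lambda>z. beta (to_uhp z)"
  have L: "has_qexp (\<lambda>z. fps_nth (legendre_gf (?a z) (?b z)) n) (fps_nth (Abs_fps leg_fps) n)" for n
    using form_withD(1) [OF Cx.legendre_form [OF UNIV_I, of n]] by (simp add: legendre_P_def)
  have D: "has_qexp (\<lambda>z. fps_nth (1 - fps_const (2 * ?a z) * fps_X + fps_const (?b z) * fps_X ^ 2) n)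
      (fps_nth (1 - fps_const (2 * alpha_fps) * fps_X + fps_const beta_fps * fps_X ^ 2) n)" for n
  proof -
    have t: "has_qexp (\<lambda>z. 2 * ?a z) (2 * alpha_fps)"
      using has_qexp_mult [OF has_qexp_const [of 2] form_withD(1) [OF alpha_form]] by (simp add: numeral_fps_const)
    note b = form_withD(1) [OF beta_form]
    consider "n = 0" | "n = 1" | "n = 2" | "n > 2"
      by linarith
    then show ?thesis
      using t b has_qexp_const [of 1] has_qexp_const [of 0] has_qexp_minus [OF t]
      by cases (auto simp: fps_X_power_nth)
  qed
  have "has_qexp (\<lambda>z. fps_nth (legendre_gf (?a z) (?b z) ^ 2 * (1 - fps_const (2 * ?a z) * fps_X + fps_const (?b z) * fps_X ^ 2)) n)
    (fps_nth (Abs_fps leg_fps ^ 2 * (1 - fps_const (2 * alpha_fps) * fps_X + fps_const beta_fps * fps_X ^ 2)) n)"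
    unfolding power2_eq_square [of "legendre_gf _ _"] power2_eq_square [of "Abs_fps _"]
    by (intro qexp_family_mult L D)
  moreover have "has_qexp (\<lambda>z. fps_nth (legendre_gf (?a z) (?b z) ^ 2 * (1 - fps_const (2 * ?a z) * fps_X + fps_const (?b z) * fps_X ^ 2)) n)
    (fps_nth 1 n)"
    unfolding legendre_gf_square using has_qexp_const [of 1] has_qexp_const [of 0] by simp
  ultimately show "fps_nth (Abs_fps leg_fps ^ 2 * (1 - fps_const (2 * alpha_fps) * fps_X + fps_const beta_fps * fps_X ^ 2)) n = fps_nth 1 n"
    by (rule has_qexp_unique)
qed

text \<open>Substituting u^4 for u makes the exponent of u the complex dimension of the projective
  space, whose class has nonzero image only in dimensions divisible by 4.\<close>

lemma legendre_fps_square_4: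
  "Abs_fps (\<lambda>n. if 4 dvd n then leg_fps (n div 4) else 0) ^ 2 *
     (1 - fps_const (2 * alpha_fps) * fps_X ^ 4 + fps_const beta_fps * fps_X ^ 8) = (1 :: complex fps fps)"
proof -
  let ?X = "fps_X ^ 4 :: complex fps fps"
  have X0: "fps_nth ?X 0 = 0"
    by simp
  have comp: "Abs_fps leg_fps oo ?X = Abs_fps (\<lambda>n. if 4 dvd n then leg_fps (n div 4) else 0)"
  proof (rule fps_ext)
    fix n
    have "fps_nth (Abs_fps leg_fps oo ?X) n = (\<Sum>i=0..n. if n = 4 * i then leg_fps i else 0)"
      unfolding fps_compose_nth by (intro sum.cong refl) (simp add: power_mult [symmetric] fps_X_power_nth)
    also have "\<dots> = (if 4 dvd n then leg_fps (n div 4) else 0)"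
    proof (cases "4 dvd n")
      case True
      then obtain m where m: "n = 4 * m" ..
      have "(\<Sum>i=0..n. if n = 4 * i then leg_fps i else 0) = (\<Sum>i=0..n. if i = m then leg_fps i else 0)"
        by (intro sum.cong refl) (auto simp: m)
      then show ?thesis
        by (simp add: m)
    qed (auto intro!: sum.neutral)
    finally show "fps_nth (Abs_fps leg_fps oo ?X) n = fps_nth (Abs_fps (\<lambda>n. if 4 dvd n then leg_fps (n div 4) else 0)) n"
      by simp
  qed
  have "(Abs_fps leg_fps ^ 2 * (1 - fps_const (2 * alpha_fps) * fps_X + fps_const beta_fps * fps_X ^ 2)) oo ?X = 1 oo ?X"
    by (simp only: legendre_fps_square)
  then have "(Abs_fps leg_fps oo ?X) ^ 2 * (1 - fps_const (2 * alpha_fps) * ?X + fps_const beta_fps * ?X ^ 2) = 1"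
    unfolding power2_eq_square
    by (simp only: fps_compose_mult_distrib [OF X0] fps_compose_add_distrib fps_compose_sub_distrib fps_compose_1
        fps_const_compose fps_X_fps_compose_startby0 [OF X0])
  then show ?thesis
    by (simp add: comp power_mult [symmetric])
qed

subsection \<open>The images of the Hazewinkel generators\<close>

lemma fun_power_apply: "((f :: 'b \<Rightarrow> 'c::comm_semiring_1) ^ n) x = f x ^ n"
  by (induction n) (auto simp: one_fun_def times_fun_def)

lemma single_power: "Poly_Mapping.single (a::int) (f :: uhp \<Rightarrow> complex) ^ n = Poly_Mapping.single (int n * a) (f ^ n)"
proof (induction n)
  case 0
  have "Poly_Mapping.single (0 :: int) (1 :: uhp \<Rightarrow> complex) = 1"
    by (rule single_one)
  then show ?case
    by (simp only: power_0 of_nat_0 mult_zero_left)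
next
  case (Suc n)
  have "a + int n * a = int (Suc n) * a"
    by (simp add: algebra_simps)
  then show ?case
    by (simp only: power_Suc Suc mult_single)
qed

lemma sum_uhp_apply: "(\<Sum>i\<in>I. f i :: uhp \<Rightarrow> complex) \<tau> = (\<Sum>i\<in>I. f i \<tau>)"
  by (induction I rule: infinite_finite_induct) auto

lemma single_sum: "finite I \<Longrightarrow> (\<Sum>i\<in>I. Poly_Mapping.single d (f i)) = Poly_Mapping.single d (\<Sum>i\<in>I. f i)"
  by (induction I rule: finite_induct) (auto simp: single_add)

lemma genus_neg: "genus (- x) = - genus x"
  using genus_add [of x "- x"] by (simp add: genus_0 add_eq_0_iff)

lemma genus_diff: "genus (x - y) = genus x - genus y"
  using genus_add [of x "- y"] by (simp add: genus_neg)

lemma genus_power: "genus (x ^ n) = genus x ^ n"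
  by (induction n) (auto simp: genus_1 genus_mult)

lemma genus_of_nat: "genus (of_nat n) = of_nat n"
  by (induction n) (auto simp: genus_0 genus_1 genus_add)

lemma of_nat_const_form: "(of_nat n :: gforms) = const_form (of_nat n)"
  by (induction n) (auto simp: const_form_0 const_form_1 const_form_add)

lemma const_form_single: "const_form c * Poly_Mapping.single d f = Poly_Mapping.single d (\<lambda>\<tau>. c * f \<tau>)"
  by (simp add: const_form_def mult_single times_fun_def)

context
  fixes p :: nat
  assumes p: "Factorial_Ring.prime p" and p4: "p mod 4 = 1"
begin

lemma p_power_mod_4: "4 dvd p ^ j - 1" "p ^ j \<ge> 1" "4 * int ((p ^ j - 1) div 4) = int p ^ j - 1"
proof -
  have "p ^ j mod 4 = 1"
    using power_mod [of p 4 j] p4 by simp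
  then show 4: "4 dvd p ^ j - 1"
    by presburger
  show 1: "p ^ j \<ge> 1"
    using p prime_gt_0_nat by (simp add: Suc_leI)
  have "int (4 * ((p ^ j - 1) div 4)) = int (p ^ j - 1)"
    using 4 by simp
  then show "4 * int ((p ^ j - 1) div 4) = int p ^ j - 1"
    using 1 by (simp add: of_nat_diff)
qed

definition log_form :: "nat \<Rightarrow> uhp \<Rightarrow> complex" where
  "log_form j \<tau> = (1 / of_nat p) ^ j * legendre_P ((p ^ j - 1) div 4) (alpha \<tau>) (beta \<tau>)"

lemma genus_log_coeff: "genus (log_coeff p j) = Poly_Mapping.single (2 * (int p ^ j - 1)) (log_form j)"
proof -
  have "of_rat (1 / of_nat (p ^ j)) = (1 / of_nat p :: complex) ^ j"
    by (simp add: of_rat_divide power_divide of_rat_power)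
  moreover have "2 * int (p ^ j - 1) = 2 * (int p ^ j - 1)"
    using p_power_mod_4 [of j] by (simp add: of_nat_diff)
  ultimately show ?thesis
    using p_power_mod_4(1) [of j]
    by (simp add: log_coeff_def genus_mult genus_mu_const genus_CP genus_CP_def const_form_single log_form_def [abs_def])
qed

lemma log_form_form: "form_with UNIV (int p ^ j - 1) (log_form j) (fps_const (1 / of_nat p) ^ j * leg_fps ((p ^ j - 1) div 4))"
  using Cx.form_cmult [OF UNIV_I Cx.legendre_form [OF UNIV_I, of "(p ^ j - 1) div 4"], of "(1 / of_nat p) ^ j"]
  unfolding log_form_def [abs_def] fps_const_power p_power_mod_4(3) .

lemma hazewinkel_degree: "j \<le> n \<Longrightarrow> (int p ^ j - 1) + int (p ^ j) * (int p ^ (n - j) - 1) = int p ^ n - 1"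
  by (simp add: right_diff_distrib power_add [symmetric])

text \<open>Homogeneity and automorphy are settled over the complex numbers; the denominators in the
  recursion are treated afterwards on the expansions.\<close>

lemma genus_hazewinkel_exists:
  "n \<ge> 1 \<Longrightarrow> \<exists>V a. genus (hazewinkel p n) = Poly_Mapping.single (2 * (int p ^ n - 1)) V \<and> form_with UNIV (int p ^ n - 1) V a"
proof (induction n rule: less_induct)
  case (less n)
  then have "\<forall>j. \<exists>V a. 1 \<le> j \<and> j < n \<longrightarrow> genus (hazewinkel p j) = Poly_Mapping.single (2 * (int p ^ j - 1)) V \<and> form_with UNIV (int p ^ j - 1) V a"
    by blast
  then obtain V a where V: "\<And>j. 1 \<le> j \<Longrightarrow> j < n \<Longrightarrow> genus (hazewinkel p j) = Poly_Mapping.single (2 * (int p ^ j - 1)) (V j)"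
    and a: "\<And>j. 1 \<le> j \<Longrightarrow> j < n \<Longrightarrow> form_with UNIV (int p ^ j - 1) (V j) (a j)"
    by metis
  let ?d = "2 * (int p ^ n - 1)"
  define T where "T j = (\<lambda>\<tau>. log_form j \<tau> * V (n - j) \<tau> ^ (p ^ j))" for j
  have trm: "genus (log_coeff p j * hazewinkel p (n - j) ^ (p ^ j)) = Poly_Mapping.single ?d (T j)" if j: "j \<in> {0<..<n}" for j
  proof -
    have "genus (log_coeff p j * hazewinkel p (n - j) ^ (p ^ j)) =
        Poly_Mapping.single (2 * ((int p ^ j - 1) + int (p ^ j) * (int p ^ (n - j) - 1))) (log_form j * V (n - j) ^ (p ^ j))"
    proof -
      have v: "genus (hazewinkel p (n - j)) = Poly_Mapping.single (2 * (int p ^ (n - j) - 1)) (V (n - j))"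
        using j by (intro V) auto
      have "2 * (int p ^ j - 1) + int (p ^ j) * (2 * (int p ^ (n - j) - 1)) = 2 * ((int p ^ j - 1) + int (p ^ j) * (int p ^ (n - j) - 1))"
        by (simp add: algebra_simps)
      then show ?thesis
        by (simp only: genus_mult genus_power genus_log_coeff v single_power mult_single)
    qed
    also have "log_form j * V (n - j) ^ (p ^ j) = T j"
      by (simp add: fun_eq_iff T_def times_fun_def fun_power_apply)
    finally show ?thesis
      using j by (simp only: hazewinkel_degree greaterThanLessThan_iff less_imp_le)
  qed
  have T: "\<exists>b. form_with UNIV (int p ^ n - 1) (T j) b" if j: "j \<in> {0<..<n}" for j
  proof -
    have "form_with UNIV ((int p ^ j - 1) + int (p ^ j) * (int p ^ (n - j) - 1)) (T j)
        ((fps_const (1 / of_nat p) ^ j * leg_fps ((p ^ j - 1) div 4)) * a (n - j) ^ (p ^ j))"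
      unfolding T_def using j by (intro Cx.form_mult log_form_form Cx.form_power a) auto
    then show ?thesis
      using j by (metis hazewinkel_degree greaterThanLessThan_iff less_imp_le)
  qed
  then obtain b where b: "\<And>j. j \<in> {0<..<n} \<Longrightarrow> form_with UNIV (int p ^ n - 1) (T j) (b j)"
    by metis
  define W where "W = (\<lambda>\<tau>. of_nat p * log_form n \<tau> - (\<Sum>j\<in>{0<..<n}. T j \<tau>))"
  have "hazewinkel p n = of_nat p * log_coeff p n - (\<Sum>j\<in>{0<..<n}. log_coeff p j * hazewinkel p (n - j) ^ (p ^ j))"
    using less.prems by (subst hazewinkel.simps) simp
  moreover have "genus (\<Sum>j\<in>{0<..<n}. log_coeff p j * hazewinkel p (n - j) ^ (p ^ j)) = Poly_Mapping.single ?d (\<Sum>j\<in>{0<..<n}. T j)"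
    unfolding genus_sum by (simp only: trm cong: sum.cong) (rule single_sum, simp)
  ultimately have "genus (hazewinkel p n) = Poly_Mapping.single ?d (\<lambda>\<tau>. of_nat p * log_form n \<tau>) - Poly_Mapping.single ?d (\<Sum>j\<in>{0<..<n}. T j)"
    by (simp only: genus_diff genus_mult genus_of_nat genus_log_coeff of_nat_const_form const_form_single)
  also have "\<dots> = Poly_Mapping.single ?d W"
  proof -
    have "W = (\<lambda>\<tau>. of_nat p * log_form n \<tau>) - (\<Sum>j\<in>{0<..<n}. T j)"
      by (simp add: W_def fun_eq_iff sum_uhp_apply)
    then show ?thesis
      by (simp only: single_diff)
  qed
  finally have "genus (hazewinkel p n) = Poly_Mapping.single ?d W" .
  moreover have "form_with UNIV (int p ^ n - 1) W
      (fps_const (of_nat p) * (fps_const (1 / of_nat p) ^ n * leg_fps ((p ^ n - 1) div 4)) - (\<Sum>j\<in>{0<..<n}. b j))"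
    unfolding W_def by (intro Cx.form_diff Cx.form_cmult log_form_form Cx.form_sum b) auto
  ultimately show ?case
    by blast
qed

end

section \<open>Integrality of the images\<close>

lemma coefficient_ring_local_ints:
  assumes "Factorial_Ring.prime p"
  shows "coefficient_ring (local_ints p)"
proof -
  interpret F: frobenius_lift p "local_ints p :: complex set" "\<lambda>x. x"
    by (rule local_ints_frobenius [OF assms])
  show ?thesis
    by unfold_locales (rule F.one_mem F.add_mem F.neg_mem F.mult_mem; assumption)+
qed

lemma local_intsI: "\<not> int p dvd b \<Longrightarrow> of_int a / of_int b \<in> local_ints p"
  unfolding local_ints_def by blast

lemma prime_not_dvd_4_power:
  assumes "Factorial_Ring.prime p" "p mod 4 = 1"
  shows "\<not> int p dvd 4 ^ n"
proof
  assume "int p dvd 4 ^ n"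
  then have "int p dvd int (2 ^ (2 * n))"
    by (simp add: power_mult)
  then have "p dvd 2 ^ (2 * n)"
    by (simp only: int_dvd_int_iff)
  then have "p dvd 2"
    using assms(1) prime_dvd_power by blast
  then have "p \<le> 2"
    by (rule dvd_imp_le) simp
  then have "p = 0 \<or> p = 1 \<or> p = 2"
    by linarith
  then show False
    using assms by auto
qed

lemma gchoose_minus_half_local:
  assumes "Factorial_Ring.prime p" "p mod 4 = 1"
  shows "((-1/2) gchoose n) \<in> (local_ints p :: complex set)"
proof -
  have "((-1/2) gchoose n :: complex) = of_int ((-1) ^ n * int ((2 * n) choose n)) / of_int (4 ^ n)"
    by (simp only: gchoose_minus_half of_int_mult of_int_power of_int_minus of_int_1 of_int_numeral of_int_of_nat_eq)
  then show ?thesis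
    using local_intsI [OF prime_not_dvd_4_power [OF assms]] by metis
qed

context
  fixes p :: nat
  assumes p: "Factorial_Ring.prime p" and p4: "p mod 4 = 1"
begin

interpretation Zp: coefficient_ring "local_ints p"
  by (rule coefficient_ring_local_ints [OF p])

lemma p_nonzero: "of_nat p \<noteq> (0 :: complex)"
  using p by auto

text \<open>The recursion is transported to expansions, where
  \<open>hazewinkel_legendre_integral\<close> applies with the Frobenius lift q \<mapsto> q^p. It
  also stays part of the conclusion, as the first two images are computed from it.\<close>

lemma genus_hazewinkel:
  "\<exists>V a. (\<forall>n\<ge>1. genus (hazewinkel p n) = Poly_Mapping.single (2 * (int p ^ n - 1)) (V n) \<and>
      form_with (local_ints p) (int p ^ n - 1) (V n) (a n)) \<and>
    (\<forall>n\<ge>1. \<forall>\<tau>. of_nat p * log_form p n \<tau> = (\<Sum>j<n. log_form p j \<tau> * V (n - j) \<tau> ^ (p ^ j)))"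
proof -
  have "\<forall>n. \<exists>V a. n \<ge> 1 \<longrightarrow> genus (hazewinkel p n) = Poly_Mapping.single (2 * (int p ^ n - 1)) V \<and> form_with UNIV (int p ^ n - 1) V a"
    using genus_hazewinkel_exists [OF p p4] by blast
  then obtain V a where V: "\<And>n. n \<ge> 1 \<Longrightarrow> genus (hazewinkel p n) = Poly_Mapping.single (2 * (int p ^ n - 1)) (V n)"
    and a: "\<And>n. n \<ge> 1 \<Longrightarrow> form_with UNIV (int p ^ n - 1) (V n) (a n)"
    by metis
  note log = genus_log_coeff [OF p p4] and lform = log_form_form [OF p p4]
  have rec: "of_nat p * log_form p n \<tau> = (\<Sum>j<n. log_form p j \<tau> * V (n - j) \<tau> ^ (p ^ j))" if n: "n \<ge> 1" for n \<tau>
  proof -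
    let ?d = "2 * (int p ^ n - 1)"
    have trm: "genus (log_coeff p j * hazewinkel p (n - j) ^ (p ^ j)) = Poly_Mapping.single ?d (log_form p j * V (n - j) ^ (p ^ j))"
      if j: "j \<in> {..<n}" for j
    proof -
      have v: "genus (hazewinkel p (n - j)) = Poly_Mapping.single (2 * (int p ^ (n - j) - 1)) (V (n - j))"
        using j by (intro V) auto
      have jn: "j \<le> n"
        using j by simp
      have "2 * (int p ^ j - 1) + int (p ^ j) * (2 * (int p ^ (n - j) - 1)) = 2 * ((int p ^ j - 1) + int (p ^ j) * (int p ^ (n - j) - 1))"
        by (simp add: algebra_simps)
      then have "2 * (int p ^ j - 1) + int (p ^ j) * (2 * (int p ^ (n - j) - 1)) = ?d"
        by (simp only: hazewinkel_degree [OF p p4 jn])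
      then show ?thesis
        by (simp only: genus_mult genus_power log v single_power mult_single)
    qed
    have "genus (of_nat p * log_coeff p n) = genus (\<Sum>j<n. log_coeff p j * hazewinkel p (n - j) ^ (p ^ j))"
      by (simp only: hazewinkel_relation [OF n])
    also have "\<dots> = Poly_Mapping.single ?d (\<Sum>j<n. log_form p j * V (n - j) ^ (p ^ j))"
      unfolding genus_sum by (simp only: trm cong: sum.cong) (rule single_sum, simp)
    also have "genus (of_nat p * log_coeff p n) = Poly_Mapping.single ?d (\<lambda>\<tau>. of_nat p * log_form p n \<tau>)"
      by (simp only: genus_mult genus_of_nat log of_nat_const_form const_form_single)
    finally have "Poly_Mapping.lookup (Poly_Mapping.single ?d (\<lambda>\<tau>. of_nat p * log_form p n \<tau>)) ?d =
        Poly_Mapping.lookup (Poly_Mapping.single ?d (\<Sum>j<n. log_form p j * V (n - j) ^ (p ^ j))) ?d"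
      by (simp only:)
    then have "(\<lambda>\<tau>. of_nat p * log_form p n \<tau>) = (\<Sum>j<n. log_form p j * V (n - j) ^ (p ^ j))"
      by (simp only: lookup_single_eq)
    from fun_cong [OF this, of \<tau>] show ?thesis
      by (simp add: sum_uhp_apply times_fun_def fun_power_apply)
  qed
  define \<pi> :: "complex fps" where "\<pi> = fps_const (1 / of_nat p)"
  have frec: "of_nat p * (\<pi> ^ n * leg_fps ((p ^ n - 1) div 4)) =
      (\<Sum>j<n. \<pi> ^ j * leg_fps ((p ^ j - 1) div 4) * a (n - j) ^ (p ^ j))" if n: "n \<ge> 1" for n
  proof -
    have "form_with UNIV (int p ^ n - 1) (\<lambda>\<tau>. of_nat p * log_form p n \<tau>)
        (fps_const (of_nat p) * (\<pi> ^ n * leg_fps ((p ^ n - 1) div 4)))"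
      unfolding \<pi>_def by (intro Cx.form_cmult lform) simp
    moreover have "form_with UNIV (int p ^ n - 1) (\<lambda>\<tau>. \<Sum>j<n. log_form p j \<tau> * V (n - j) \<tau> ^ (p ^ j))
        (\<Sum>j<n. \<pi> ^ j * leg_fps ((p ^ j - 1) div 4) * a (n - j) ^ (p ^ j))"
    proof (rule Cx.form_sum)
      fix j assume j: "j \<in> {..<n}"
      then have jn: "j \<le> n" "n - j \<ge> 1"
        by auto
      show "form_with UNIV (int p ^ n - 1) (\<lambda>\<tau>. log_form p j \<tau> * V (n - j) \<tau> ^ (p ^ j))
        (\<pi> ^ j * leg_fps ((p ^ j - 1) div 4) * a (n - j) ^ (p ^ j))"
        unfolding hazewinkel_degree [OF p p4 jn(1), symmetric] \<pi>_def
        by (intro Cx.form_mult lform Cx.form_power a jn)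
    qed
    then have "form_with UNIV (int p ^ n - 1) (\<lambda>\<tau>. of_nat p * log_form p n \<tau>)
        (\<Sum>j<n. \<pi> ^ j * leg_fps ((p ^ j - 1) div 4) * a (n - j) ^ (p ^ j))"
      by (simp only: rec [OF n])
    ultimately have "fps_const (of_nat p) * (\<pi> ^ n * leg_fps ((p ^ n - 1) div 4)) =
        (\<Sum>j<n. \<pi> ^ j * leg_fps ((p ^ j - 1) div 4) * a (n - j) ^ (p ^ j))"
      by (rule form_with_unique)
    then show ?thesis
      by (simp add: fps_of_nat)
  qed
  interpret F: frobenius_lift p "fps_over (local_ints p :: complex set)" "fps_frob p (\<lambda>x. x)"
    by (rule frobenius_lift.fps_lift [OF local_ints_frobenius [OF p]])
  have leg: "leg_fps k \<in> fps_over (local_ints p)" for k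
    using Zp.legendre_form [OF gchoose_minus_half_local [OF p p4], of k] by (simp add: form_with_def)
  have "a n \<in> fps_over (local_ints p)" if "n \<ge> 1" for n
  proof (rule F.hazewinkel_legendre_integral [where P = leg_fps and v = a and \<pi> = \<pi>, OF p4])
    have "of_nat p * \<pi> = fps_const (of_nat p * (1 / of_nat p))"
      by (simp only: \<pi>_def fps_of_nat [symmetric] fps_const_mult)
    then show "of_nat p * \<pi> = 1"
      using p_nonzero by simp
    show "alpha_fps \<in> fps_over (local_ints p)" "beta_fps \<in> fps_over (local_ints p)"
      using Ints_fps by (auto intro: Zp.Ints_R)
    show "leg_fps 0 = 1"
      by (simp add: leg_fps_def leg_coeff_def)
  qed (fact leg legendre_fps_square_4 frec that)+
  then show ?thesis
    using V a rec form_with_mono by blast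
qed

end

subsection \<open>The second generator modulo \<open>\<alpha>\<close>\<close>

text \<open>Below p^2 each multiple of p contributes exactly one factor p.\<close>

lemma multiplicity_fact_small:
  assumes p: "Factorial_Ring.prime p" and n: "n < p ^ 2"
  shows "multiplicity p (fact n :: nat) = n div p"
  using n
proof (induction n)
  case (Suc n)
  have pe: "prime_elem p"
    using p by (rule prime_imp_prime_elem)
  have p0: "p > 0" "\<not> p dvd 1"
    using p prime_gt_0_nat not_prime_unit by auto
  have "multiplicity p (fact (Suc n) :: nat) = multiplicity p (Suc n * fact n)"
    by simp
  also have "\<dots> = multiplicity p (Suc n) + multiplicity p (fact n :: nat)"
    by (rule prime_elem_multiplicity_mult_distrib [OF pe]) auto
  also have "multiplicity p (fact n :: nat) = n div p"
    using Suc by simp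
  also have "multiplicity p (Suc n) = (if p dvd Suc n then 1 else 0)"
  proof (cases "p dvd Suc n")
    case True
    have "\<not> p ^ Suc 1 dvd Suc n"
      using Suc.prems by (auto dest: dvd_imp_le simp: power2_eq_square)
    then have "multiplicity p (Suc n) = 1"
      using True by (intro multiplicity_eqI) auto
    then show ?thesis
      using True by simp
  qed (simp add: not_dvd_imp_multiplicity_0)
  also have "(if p dvd Suc n then 1 else 0) + n div p = Suc n div p"
    by (simp add: div_Suc dvd_eq_mod_eq_0)
  finally show ?case .
qed simp

text \<open>Adding \<open>m = q p + (5 q + 3)\<close> to itself in base \<open>p = 8 q + 5\<close> produces exactly one carry.\<close>

lemma central_binomial_valuation:
  assumes p: "Factorial_Ring.prime p" and p5: "p mod 8 = 5" and m: "8 * m + 1 = p ^ 2"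
  obtains N where "(2 * m) choose m = p * N" "\<not> p dvd N"
proof -
  define q where "q = p div 8"
  have pq: "p = 8 * q + 5"
    using p5 by (simp add: q_def) (metis mult_div_mod_eq)
  have "8 * m + 1 = 64 * (q * q) + 80 * q + 25"
    unfolding m pq by (simp add: power2_eq_square algebra_simps)
  then have mq: "m = 8 * (q * q) + 10 * q + 3"
    by simp
  \<comment> \<open>The remainder of m is 5q + 3, and its double is p + (2q + 1). Hence the quotient
    of 2m is 2q + 1, and the valuation is (2q + 1) - q - q = 1.\<close>
  have "m div p = q"
  proof (rule div_nat_eqI)
    show "p * q \<le> m" "m < p * Suc q"
      by (simp_all add: mq pq algebra_simps)
  qed
  moreover have "(2 * m) div p = 2 * q + 1"
  proof (rule div_nat_eqI)
    show "p * (2 * q + 1) \<le> 2 * m" "2 * m < p * Suc (2 * q + 1)"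
      by (simp_all add: mq pq algebra_simps)
  qed
  moreover have pe: "prime_elem p"
    using p by (rule prime_imp_prime_elem)
  have "fact m * fact m * ((2 * m) choose m) = (fact (2 * m) :: nat)"
    using binomial_fact_lemma [of m "2 * m"] by (simp add: mult_2)
  then have "multiplicity p (fact (2 * m) :: nat) = multiplicity p (fact m * fact m * ((2 * m) choose m))"
    by simp
  then have "multiplicity p (fact (2 * m) :: nat) =
      multiplicity p (fact m :: nat) + multiplicity p (fact m :: nat) + multiplicity p ((2 * m) choose m)"
    by (simp add: prime_elem_multiplicity_mult_distrib [OF pe])
  ultimately have 1: "multiplicity p ((2 * m) choose m) = 1"
    using multiplicity_fact_small [OF p, of m] multiplicity_fact_small [OF p, of "2 * m"] m by simp
  have nz: "(2 * m) choose m \<noteq> 0"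
    by simp
  have nu: "\<not> is_unit p"
    using p not_prime_unit by blast
  have "p ^ 1 dvd (2 * m) choose m"
    unfolding 1 [symmetric] by (rule multiplicity_dvd)
  then obtain N where N: "(2 * m) choose m = p * N"
    by auto
  have "\<not> p ^ Suc 1 dvd (2 * m) choose m"
    using power_dvd_iff_le_multiplicity [OF nz nu, of "Suc 1"] 1 by simp
  then have "\<not> p dvd N"
    unfolding N by (auto simp: dvd_def)
  with N show ?thesis
    by (rule that)
qed

context
  fixes p :: nat
  assumes p: "Factorial_Ring.prime p" and p5: "p mod 8 = 5"
begin

lemma p4: "p mod 4 = 1"
  using p5 by presburger

interpretation Zp: coefficient_ring "local_ints p"
  by (rule coefficient_ring_local_ints [OF p])

text \<open>Constant term 1 of \<alpha> again: integrality of the product \<alpha> h descends to h,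
  which is constructed with a denominator p.\<close>

lemma divide_by_alpha:
  assumes h: "form_with UNIV k h b" and f: "form_with (local_ints p) l f a" and eq: "\<And>\<tau>. f \<tau> = alpha \<tau> * h \<tau>"
  shows "form_with (local_ints p) k h b"
proof (rule form_with_mono [OF h])
  have "form_with UNIV (4 + k) (\<lambda>\<tau>. alpha \<tau> * h \<tau>) (alpha_fps * b)"
    by (rule Cx.form_mult [OF Cx.alpha_R h])
  moreover have "f = (\<lambda>\<tau>. alpha \<tau> * h \<tau>)"
    using eq by auto
  ultimately have ab: "a = alpha_fps * b"
    using f form_with_unique by blast
  have "fps_nth b n \<in> local_ints p" for n
  proof (rule Zp.fps_unit_cancel [of alpha_fps])
    show "alpha_fps \<in> fps_over (local_ints p)"
      by (rule Zp.Ints_R [OF Ints_fps(4)])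
    show "fps_nth (alpha_fps * b) n \<in> local_ints p" for n
      using form_withD(2) [OF f] by (simp add: ab)
    show "x - y \<in> local_ints p" if "x \<in> local_ints p" "y \<in> local_ints p" for x y :: complex
      using Zp.add_R [OF that(1) Zp.neg_R [OF that(2)]] by simp
  qed (auto simp: nth_0 Zp.zero_R Zp.mult_R)
  then show "b \<in> fps_over (local_ints p)"
    by (simp add: fps_over_def)
qed

lemma generators_mod_alpha:
  assumes V: "\<And>n. n \<ge> 1 \<Longrightarrow> form_with (local_ints p) (int p ^ n - 1) (V n) (a n)"
    and rec: "\<And>n \<tau>. n \<ge> 1 \<Longrightarrow> of_nat p * log_form p n \<tau> = (\<Sum>j<n. log_form p j \<tau> * V (n - j) \<tau> ^ (p ^ j))"
  obtains m N Q b h b' where "8 * int m = int p ^ 2 - 1" "\<not> p dvd N"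
    "form_with (local_ints p) (int p - 5) Q b" "\<And>\<tau>. V 1 \<tau> = alpha \<tau> * Q \<tau>"
    "form_with (local_ints p) (8 * int m - 4) h b'"
    "\<And>\<tau>. V 2 \<tau> = (-1) ^ m * of_nat N / 4 ^ m * beta \<tau> ^ m + alpha \<tau> * h \<tau>"
    "fps_nth (a 1) 0 = 1"
proof -
  define q where "q = p div 8"
  have pq: "p = 8 * q + 5"
    using p5 by (simp add: q_def) (metis mult_div_mod_eq)
  \<comment> \<open>This is (p^2 - 1)/8 for p = 8q + 5.\<close>
  define m where "m = 8 * (q * q) + 10 * q + 3"
  have m: "8 * m + 1 = p ^ 2"
    by (simp add: pq m_def power2_eq_square algebra_simps)
  then have im: "8 * int m = int p ^ 2 - 1"
    by (metis add_diff_cancel_right' of_nat_1 of_nat_add of_nat_mult of_nat_numeral of_nat_power)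
  obtain N where N: "(2 * m) choose m = p * N" "\<not> p dvd N"
    using central_binomial_valuation [OF p p5 m] .
  define k where "k = 2 * q + 1"
  have k1: "(p - 1) div 4 = k" and k2: "(p ^ 2 - 1) div 4 = 2 * m"
    using m by (simp_all add: pq k_def)
  have pk: "4 * int k = int p - 1"
    by (simp add: pq k_def)
  let ?P = "\<lambda>j \<tau>. legendre_P j (alpha \<tau>) (beta \<tau>)"
  note half = gchoose_minus_half_local [OF p p4]
  have log0: "log_form p 0 \<tau> = 1" for \<tau>
    by (simp add: log_form_def [OF p p4] legendre_P_def legendre_gf_nth_0)
  have log1: "log_form p 1 \<tau> = ?P k \<tau> / of_nat p" for \<tau>
    by (simp add: log_form_def [OF p p4] k1 [simplified])
  have log2: "log_form p 2 \<tau> = ?P (2 * m) \<tau> / of_nat p ^ 2" for \<tau>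
    by (simp add: log_form_def [OF p p4] k2 [simplified] power_divide)
  note p0 = p_nonzero [OF p p4]
  have V1: "V 1 \<tau> = ?P k \<tau>" for \<tau>
    using rec [of 1 \<tau>] p0 by (simp add: log0 log1 [simplified])
  have V2: "V 2 \<tau> = (?P (2 * m) \<tau> - ?P k \<tau> ^ (p + 1)) / of_nat p" for \<tau>
  proof -
    have "{..<2} = {0, 1 :: nat}"
      by auto
    then have "of_nat p * log_form p 2 \<tau> = V 2 \<tau> + log_form p 1 \<tau> * V 1 \<tau> ^ p"
      using rec [of 2 \<tau>] by (simp add: log0)
    then have "V 2 \<tau> = of_nat p * (?P (2 * m) \<tau> / of_nat p ^ 2) - ?P k \<tau> / of_nat p * ?P k \<tau> ^ p"
      unfolding log1 log2 V1 by (simp add: eq_diff_eq)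
    also have "\<dots> = (?P (2 * m) \<tau> - ?P k \<tau> ^ (p + 1)) / of_nat p"
      using p0 by (simp add: power2_eq_square diff_divide_distrib)
    finally show ?thesis .
  qed
  obtain Q b where Q: "form_with (local_ints p) (4 * int k - 4) Q b"
    and PQ: "\<And>\<tau>. ?P k \<tau> = alpha \<tau> * Q \<tau>"
    using Zp.legendre_mod_alpha [OF half, of k] by (auto simp: k_def)
  obtain h2 b2 where h2: "form_with UNIV (4 * int (2 * m) - 4) h2 b2"
    and Ph2: "\<And>\<tau>. ?P (2 * m) \<tau> = ((-1/2) gchoose m) * beta \<tau> ^ m + alpha \<tau> * h2 \<tau>"
    using Cx.legendre_mod_alpha [OF UNIV_I, of "2 * m"] by auto
  define c :: complex where "c = (-1) ^ m * of_nat N / 4 ^ m"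
  have pc: "((-1/2) gchoose m) = of_nat p * c"
    unfolding gchoose_minus_half c_def N(1) by simp
  \<comment> \<open>In (P_2m - P_k^(p+1)) / p the part of P_2m free of \<alpha> is p c \<beta>^m,
    and the power of P_k contains \<alpha> through Q. So the 1/p remains only in front of the
    multiple of \<alpha>; that \<open>h\<close> is integral follows afterwards, because V 2 - c
    \<beta>^m is.\<close>
  define h where "h \<tau> = 1 / of_nat p * (h2 \<tau> - Q \<tau> * ?P k \<tau> ^ p)" for \<tau>
  have V2h: "V 2 \<tau> = c * beta \<tau> ^ m + alpha \<tau> * h \<tau>" for \<tau>
  proof -
    have "?P k \<tau> ^ (p + 1) = alpha \<tau> * Q \<tau> * ?P k \<tau> ^ p"
      by (simp add: PQ)
    moreover have "(of_nat p * c * x + y * z - y * u * w) / of_nat p = c * x + y * (1 / of_nat p * (z - u * w))"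
      for x y z u w :: complex
      using p0 by (simp add: field_simps)
    ultimately show ?thesis
      unfolding V2 Ph2 pc h_def by (simp only:)
  qed
  have Q': "form_with UNIV (4 * int k - 4) Q b"
    using Q by (rule form_with_mono) (simp add: fps_over_def)
  have "(4 * int k - 4) + int p * (4 * int k) = 8 * int m - 4"
    unfolding pk im by (simp add: power2_eq_square algebra_simps)
  then have "form_with UNIV (8 * int m - 4) (\<lambda>\<tau>. Q \<tau> * ?P k \<tau> ^ p) (b * leg_fps k ^ p)"
    using Cx.form_mult [OF Q' Cx.form_power [OF Cx.legendre_form [OF UNIV_I, of k], of p]] by (simp only:)
  moreover have "form_with UNIV (8 * int m - 4) h2 b2"
    using h2 by simp
  ultimately have h: "form_with UNIV (8 * int m - 4) h (fps_const (1 / of_nat p) * (b2 - b * leg_fps k ^ p))"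
    unfolding h_def [abs_def] by (intro Cx.form_cmult UNIV_I Cx.form_diff)
  have "c = of_int ((-1) ^ m * int N) / of_int (4 ^ m)"
    by (simp add: c_def)
  then have cR: "c \<in> local_ints p"
    using local_intsI [OF prime_not_dvd_4_power [OF p p4]] by metis
  have "form_with (local_ints p) (int p ^ 2 - 1) (\<lambda>\<tau>. c * beta \<tau> ^ m) (fps_const c * beta_fps ^ m)"
    using Zp.form_cmult [OF cR Zp.form_power [OF Zp.beta_R, of m]] im by (simp add: mult.commute)
  then have "form_with (local_ints p) (int p ^ 2 - 1) (\<lambda>\<tau>. V 2 \<tau> - c * beta \<tau> ^ m) (a 2 - fps_const c * beta_fps ^ m)"
    using V [of 2] by (intro Zp.form_diff) auto
  then have hR: "form_with (local_ints p) (8 * int m - 4) h (fps_const (1 / of_nat p) * (b2 - b * leg_fps k ^ p))"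
    by (rule divide_by_alpha [OF h]) (simp add: V2h)
  have "V 1 = ?P k"
    using V1 by auto
  then have a1: "a 1 = leg_fps k"
    using V [of 1] form_with_unique Cx.legendre_form [OF UNIV_I, of k] by (metis le_refl)
  show ?thesis
  proof (rule that [OF im N(2)])
    show "form_with (local_ints p) (int p - 5) Q b"
      using Q unfolding pk by simp
    show "V 1 \<tau> = alpha \<tau> * Q \<tau>" for \<tau>
      by (simp only: V1 PQ)
    show "V 2 \<tau> = (-1) ^ m * of_nat N / 4 ^ m * beta \<tau> ^ m + alpha \<tau> * h \<tau>" for \<tau>
      using V2h unfolding c_def .
    show "fps_nth (a 1) 0 = 1"
      unfolding a1 by (rule leg_fps_nth_0)
  qed (fact hR)
qed

lemma no_power_relation:
  assumes m: "8 * int m = int p ^ 2 - 1" and N: "\<not> p dvd N"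
    and h: "form_with (local_ints p) (8 * int m - 4) h b"
    and v2: "\<And>\<tau>. v2 \<tau> = (-1) ^ m * of_nat N / 4 ^ m * beta \<tau> ^ m + alpha \<tau> * h \<tau>"
    and v2R: "form_with (local_ints p) (8 * int m) v2 a"
    and f: "form_with (local_ints p) (8 * int (m * K)) f a1"
    and g: "form_with (local_ints p) (8 * int (m * K) - 4) g a2"
    and eq: "\<And>\<tau>. v2 \<tau> ^ K = of_nat p * f \<tau> + alpha \<tau> * g \<tau>"
  shows False
proof -
  define c :: complex where "c = (-1) ^ m * of_nat N / 4 ^ m"
  have "c = of_int ((-1) ^ m * int N) / of_int (4 ^ m)"
    by (simp add: c_def)
  then have cR: "c \<in> local_ints p"
    using local_intsI [OF prime_not_dvd_4_power [OF p p4]] by metis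
  have cpow: "c ^ n \<in> local_ints p" for n
    by (induction n) (auto intro: Zp.one_R Zp.mult_R cR)
  have "\<exists>h' b'. form_with (local_ints p) (8 * int (m * K) - 4) h' b' \<and>
      (\<forall>\<tau>. v2 \<tau> ^ K = c ^ K * beta \<tau> ^ (m * K) + alpha \<tau> * h' \<tau>)" for K
  proof (induction K)
    case 0
    show ?case
      using Zp.form_zero by (intro exI [of _ "\<lambda>_. 0"] exI [of _ 0]) simp
  next
    case (Suc K)
    then obtain h' b' where h': "form_with (local_ints p) (8 * int (m * K) - 4) h' b'"
      and eq': "\<And>\<tau>. v2 \<tau> ^ K = c ^ K * beta \<tau> ^ (m * K) + alpha \<tau> * h' \<tau>"
      by blast
    have 1: "form_with (local_ints p) (8 * int (m * Suc K) - 4) (\<lambda>\<tau>. v2 \<tau> * h' \<tau>) (a * b')"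
      using Zp.form_mult [OF v2R h'] by (simp add: algebra_simps)
    have 2: "form_with (local_ints p) (8 * int (m * Suc K) - 4) (\<lambda>\<tau>. h \<tau> * (c ^ K * beta \<tau> ^ (m * K)))
        (b * (fps_const (c ^ K) * beta_fps ^ (m * K)))"
      using Zp.form_mult [OF h Zp.form_cmult [OF cpow Zp.form_power [OF Zp.beta_R, of "m * K"]]]
      by (simp add: algebra_simps)
    have "v2 \<tau> ^ Suc K = c ^ Suc K * beta \<tau> ^ (m * Suc K) + alpha \<tau> * (v2 \<tau> * h' \<tau> + h \<tau> * (c ^ K * beta \<tau> ^ (m * K)))" for \<tau>
    proof -
      have v: "v2 \<tau> = c * beta \<tau> ^ m + alpha \<tau> * h \<tau>"
        by (simp add: v2 c_def)
      have "v2 \<tau> ^ Suc K = v2 \<tau> * (c ^ K * beta \<tau> ^ (m * K)) + alpha \<tau> * (v2 \<tau> * h' \<tau>)"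
        by (simp add: eq' algebra_simps)
      also have "v2 \<tau> * (c ^ K * beta \<tau> ^ (m * K)) = c ^ Suc K * beta \<tau> ^ (m * Suc K) + alpha \<tau> * (h \<tau> * (c ^ K * beta \<tau> ^ (m * K)))"
        by (subst v) (simp add: power_add algebra_simps)
      finally show ?thesis
        by (simp add: algebra_simps)
    qed
    then show ?case
      using Zp.form_add [OF 1 2] by blast
  qed
  then obtain h' b' where h': "form_with (local_ints p) (8 * int (m * K) - 4) h' b'"
    and eq': "\<And>\<tau>. v2 \<tau> ^ K = c ^ K * beta \<tau> ^ (m * K) + alpha \<tau> * h' \<tau>"
    by blast
  obtain h'' b'' where h'': "form_with (local_ints p) (8 * int (m * K) - 4) h'' b''"
    and eq'': "\<And>\<tau>. beta \<tau> ^ (m * K) = (- 256) ^ (m * K) * disc \<tau> ^ (m * K) + alpha \<tau> * h'' \<tau>"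
    using Zp.beta_power_mod_alpha [of "m * K"] by blast
  \<comment> \<open>Signs and denominators cancel: c (-256)^m = 64^m N, an integer prime to
    p.\<close>
  let ?c = "c ^ K * (- 256) ^ (m * K)"
  have "?c = (c * (- 256) ^ m) ^ K"
    by (simp add: power_mult_distrib power_mult)
  also have "c * (- 256) ^ m = of_nat N * 64 ^ m"
  proof -
    have "(- 256 :: complex) ^ m = (-1) ^ m * (4 ^ m * 64 ^ m)"
      by (simp add: power_mult_distrib [symmetric])
    then have "c * (- 256) ^ m = ((-1) ^ m * (-1) ^ m) * (of_nat N * 64 ^ m)"
      by (simp add: c_def)
    then show ?thesis
      by (simp add: power_mult_distrib [symmetric])
  qed
  finally have cint: "?c = of_int ((int N * 64 ^ m) ^ K)"
    by simp
  have pp: "Factorial_Ring.prime (int p)"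
    using p by simp
  have "\<not> int p dvd 64 ^ m"
  proof -
    have "(64 :: int) ^ m = 4 ^ (3 * m)"
      by (simp add: power_mult)
    then show ?thesis
      using prime_not_dvd_4_power [OF p p4] by metis
  qed
  have ndvd: "\<not> int p dvd (int N * 64 ^ m) ^ K"
  proof -
    have "\<not> int p dvd int N * 64 ^ m"
      using N pp \<open>\<not> int p dvd 64 ^ m\<close> by (simp add: prime_dvd_mult_iff)
    then show ?thesis
      using prime_dvd_power [OF pp] by blast
  qed
  show False
  proof (rule Zp.no_disc_power_relation [where P = "of_nat p" and c = ?c])
    show "?c \<noteq> of_nat p * z" if zR: "z \<in> local_ints p" for z
    proof
      assume *: "?c = of_nat p * z"
      obtain x y where z: "z = of_int x / of_int y" and y: "\<not> int p dvd y"
        using zR by (auto simp: local_ints_def)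
      have y0: "complex_of_int y \<noteq> 0"
        using y by auto
      have "of_int ((int N * 64 ^ m) ^ K) = of_nat p * (of_int x / complex_of_int y)"
        using * unfolding cint z .
      then have "complex_of_int ((int N * 64 ^ m) ^ K * y) = of_int (int p * x)"
        using y0 by (simp add: field_simps)
      then have "(int N * 64 ^ m) ^ K * y = int p * x"
        by (simp only: of_int_eq_iff)
      then have "int p dvd (int N * 64 ^ m) ^ K * y"
        by simp
      then show False
        using ndvd y pp by (simp add: prime_dvd_mult_iff)
    qed
    show "(of_nat p :: complex) \<in> local_ints p"
      by (rule Zp.of_nat_R)
    show "form_with (local_ints p) (8 * int (m * K)) f a1"
      by (rule f)
    show "form_with (local_ints p) (8 * int (m * K) - 4) (\<lambda>\<tau>. g \<tau> - h' \<tau> - c ^ K * h'' \<tau>) (a2 - b' - fps_const (c ^ K) * b'')"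
      by (intro Zp.form_diff Zp.form_cmult cpow g h' h'')
    fix \<tau>
    have "c ^ K * beta \<tau> ^ (m * K) = of_nat p * f \<tau> + alpha \<tau> * g \<tau> - alpha \<tau> * h' \<tau>"
      using eq [of \<tau>] eq' [of \<tau>] by (simp add: algebra_simps)
    then show "?c * disc \<tau> ^ (m * K) = of_nat p * f \<tau> + alpha \<tau> * (g \<tau> - h' \<tau> - c ^ K * h'' \<tau>)"
      unfolding eq''
      by (simp add: algebra_simps)
  qed
qed

end

subsection \<open>Commutative algebra\<close>

context cring
begin

lemma genideal_pair:
  assumes a: "a \<in> carrier R" and b: "b \<in> carrier R" and x: "x \<in> Idl {a, b}"
  shows "\<exists>r\<in>carrier R. \<exists>s\<in>carrier R. x = r \<otimes> a \<oplus> s \<otimes> b"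
proof -
  have "ideal (PIdl a <+> PIdl b) R"
    by (rule add_ideals [OF cgenideal_ideal [OF a] cgenideal_ideal [OF b]])
  moreover have mem: "r \<otimes> a \<oplus> s \<otimes> b \<in> PIdl a <+> PIdl b" if "r \<in> carrier R" "s \<in> carrier R" for r s
    using that unfolding set_add_defs cgenideal_def by auto
  have "{a, b} \<subseteq> PIdl a <+> PIdl b"
    using mem [of \<one> \<zero>] mem [of \<zero> \<one>] a b by simp
  ultimately have "Idl {a, b} \<subseteq> PIdl a <+> PIdl b"
    by (rule genideal_minimal)
  then have "x \<in> PIdl a <+> PIdl b"
    using x by blast
  then show ?thesis
    by (auto simp: set_add_defs cgenideal_def)
qed

lemma genideal_singleton:
  assumes a: "a \<in> carrier R" and x: "x \<in> Idl {a}"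
  shows "\<exists>r\<in>carrier R. x = r \<otimes> a"
  using x unfolding cgenideal_eq_genideal [OF a, symmetric] cgenideal_def by blast

lemma quotient_coset_eq_zero:
  assumes I: "ideal I R" and x: "x \<in> carrier R"
  shows "I +> x = I \<longleftrightarrow> x \<in> I"
proof -
  interpret I: ideal I R by (rule I)
  show ?thesis
    using I.a_rcos_self [OF x] I.a_rcos_const by blast
qed

lemma nonzerodivisor_quotient:
  assumes I: "ideal I R" and x: "x \<in> carrier R"
    and nzd: "\<And>y. y \<in> carrier R \<Longrightarrow> x \<otimes> y \<in> I \<Longrightarrow> y \<in> I"
  shows "nonzerodivisor (R Quot I) (I +> x)"
  unfolding nonzerodivisor_def
proof (intro conjI ballI impI)
  interpret I: ideal I R by (rule I)
  show "I +> x \<in> carrier (R Quot I)"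
    using x by (auto simp: FactRing_def A_RCOSETS_def')
  fix Y assume "Y \<in> carrier (R Quot I)" and zero: "(I +> x) \<otimes>\<^bsub>R Quot I\<^esub> Y = \<zero>\<^bsub>R Quot I\<^esub>"
  then obtain y where y: "y \<in> carrier R" "Y = I +> y"
    by (auto simp: FactRing_def A_RCOSETS_def')
  have "I +> (x \<otimes> y) = I"
    using zero x y by (simp add: FactRing_def I.rcoset_mult_add)
  then have "x \<otimes> y \<in> I"
    using quotient_coset_eq_zero [OF I m_closed [OF x y(1)]] by simp
  then show "Y = \<zero>\<^bsub>R Quot I\<^esub>"
    using nzd [OF y(1)] quotient_coset_eq_zero [OF I y(1)] y(2) by (simp add: FactRing_def)
qed

lemma quotient_unit:
  assumes I: "ideal I R" and x: "x \<in> carrier R" and u: "u \<in> carrier R" and xu: "x \<otimes> u = \<one>"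
  shows "I +> x \<in> Units (R Quot I)"
proof -
  interpret I: ideal I R by (rule I)
  have ux: "u \<otimes> x = \<one>"
    using xu x u by (simp add: m_comm)
  have carr: "I +> y \<in> carrier (R Quot I)" if "y \<in> carrier R" for y
    using that by (auto simp: FactRing_def A_RCOSETS_def')
  have "(I +> u) \<otimes>\<^bsub>R Quot I\<^esub> (I +> x) = \<one>\<^bsub>R Quot I\<^esub>" "(I +> x) \<otimes>\<^bsub>R Quot I\<^esub> (I +> u) = \<one>\<^bsub>R Quot I\<^esub>"
    using x u xu ux by (simp_all add: FactRing_def I.rcoset_mult_add)
  then show ?thesis
    unfolding Units_def using carr [OF x] carr [OF u] by blast
qed

lemma quotient_nonzero:
  assumes I: "ideal I R" and one: "\<one> \<notin> I"
  shows "carrier (R Quot I) \<noteq> {\<zero>\<^bsub>R Quot I\<^esub>}"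
proof
  assume "carrier (R Quot I) = {\<zero>\<^bsub>R Quot I\<^esub>}"
  moreover have "I +> \<one> \<in> carrier (R Quot I)"
    by (auto simp: FactRing_def A_RCOSETS_def')
  ultimately have "I +> \<one> = I"
    by (simp add: FactRing_def)
  then show False
    using quotient_coset_eq_zero [OF I one_closed] one by simp
qed

end

text \<open>Only the first two generators and the powers of the third enter: the third becomes invertible, so all
  later quotients vanish.\<close>

lemma landweber_exact_localization:
  assumes M: "cring M" and g: "g \<in> ring_hom (BP p) M"
    and v: "\<And>n. g (hazewinkel p n) \<in> carrier M" and v0: "hazewinkel p 0 = of_nat p"
    and p_tf: "\<And>a. a \<in> carrier M \<Longrightarrow> g (hazewinkel p 0) \<otimes>\<^bsub>M\<^esub> a = \<zero>\<^bsub>M\<^esub> \<Longrightarrow> a = \<zero>\<^bsub>M\<^esub>"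
    and v1_nzd: "\<And>a b. a \<in> carrier M \<Longrightarrow> b \<in> carrier M \<Longrightarrow>
      g (hazewinkel p 1) \<otimes>\<^bsub>M\<^esub> a = g (hazewinkel p 0) \<otimes>\<^bsub>M\<^esub> b \<Longrightarrow> \<exists>c\<in>carrier M. a = g (hazewinkel p 0) \<otimes>\<^bsub>M\<^esub> c"
    and v2: "\<And>k a b. a \<in> carrier M \<Longrightarrow> b \<in> carrier M \<Longrightarrow>
      g (hazewinkel p 2) [^]\<^bsub>M\<^esub> (k::nat) \<noteq> a \<otimes>\<^bsub>M\<^esub> g (hazewinkel p 0) \<oplus>\<^bsub>M\<^esub> b \<otimes>\<^bsub>M\<^esub> g (hazewinkel p 1)"
  shows "landweber_exact_height_two p (localization M (g (hazewinkel p 2))) (\<lambda>x. loc_map M (g (hazewinkel p 2)) (g x))"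
proof -
  interpret M: cring M by (rule M)
  define s where "s = g (hazewinkel p 2)"
  define P where "P = g (hazewinkel p 0)"
  define v1 where "v1 = g (hazewinkel p 1)"
  have s: "s \<in> carrier M" and P: "P \<in> carrier M" and v1: "v1 \<in> carrier M"
    using v by (simp_all add: s_def P_def v1_def)
  define L where "L = localization M s"
  interpret L: cring L
    unfolding L_def by (rule M.localization_cring [OF s])
  define h where "h x = loc_map M s (g x)" for x
  let ?fr = "loc_frac M s"
  have fr_carrier: "?fr a n \<in> carrier L" if "a \<in> carrier M" for a n
    using that by (auto simp: L_def M.localization_carrier)
  have Lcarr: "\<exists>a n. a \<in> carrier M \<and> x = ?fr a n" if "x \<in> carrier L" for x
    using that by (auto simp: L_def M.localization_carrier)
  note fr_mult = M.loc_frac_mult [OF s, folded L_def] and fr_add = M.loc_frac_add [OF s, folded L_def]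
  note fr_eq = M.loc_frac_eq_iff [OF s]
  have Lone: "\<one>\<^bsub>L\<^esub> = ?fr \<one>\<^bsub>M\<^esub> 0" and Lzero: "\<zero>\<^bsub>L\<^esub> = ?fr \<zero>\<^bsub>M\<^esub> 0"
    by (simp_all add: L_def M.localization_one M.localization_zero)
  have h0: "h (hazewinkel p 0) = ?fr P 0" and h1: "h (hazewinkel p 1) = ?fr v1 0" and h2: "h (hazewinkel p 2) = ?fr s 0"
    by (simp_all add: h_def loc_map_def P_def v1_def s_def)
  have hn: "h (hazewinkel p n) \<in> carrier L" for n
    unfolding h_def loc_map_def by (rule fr_carrier [OF v])
  have pw: "s [^]\<^bsub>M\<^esub> (k::nat) \<in> carrier M" for k
    using s by simp
  have unit: "?fr s 0 \<otimes>\<^bsub>L\<^esub> ?fr \<one>\<^bsub>M\<^esub> 1 = \<one>\<^bsub>L\<^esub>"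
    using M.loc_map_unit [OF s] by (simp add: L_def loc_map_def)
  have "loc_map M s \<circ> g \<in> ring_hom (BP p) L"
    unfolding L_def by (rule ring_hom_trans [OF g M.loc_map_hom [OF s]])
  then have hom: "h \<in> ring_hom (BP p) L"
    by (simp add: h_def [abs_def] o_def)
  define I where "I = landweber_ideal p L h"
  have Iideal: "ideal (I n) L" for n
    unfolding I_def landweber_ideal_def by (rule L.genideal_ideal) (use hn in auto)
  have I1: "I 1 = Idl\<^bsub>L\<^esub> {?fr P 0}"
    by (simp add: I_def landweber_ideal_def lessThan_Suc h0)
  have "{..<2} = {0, 1::nat}"
    by auto
  then have I2: "I 2 = Idl\<^bsub>L\<^esub> {?fr P 0, ?fr v1 0}"
    using h0 h1 by (simp add: I_def landweber_ideal_def)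
  have nzd_p: "nonzerodivisor L (h (of_nat p))"
    unfolding nonzerodivisor_def v0 [symmetric] h0
  proof (intro conjI ballI impI fr_carrier P)
    fix y assume "y \<in> carrier L" and zero: "?fr P 0 \<otimes>\<^bsub>L\<^esub> y = \<zero>\<^bsub>L\<^esub>"
    then obtain a n where a: "a \<in> carrier M" and y: "y = ?fr a n"
      using Lcarr by blast
    have "?fr (P \<otimes>\<^bsub>M\<^esub> a) n = ?fr \<zero>\<^bsub>M\<^esub> 0"
      using zero P a by (simp add: y fr_mult Lzero)
    then obtain k :: nat where "s [^]\<^bsub>M\<^esub> k \<otimes>\<^bsub>M\<^esub> (s [^]\<^bsub>M\<^esub> (0::nat) \<otimes>\<^bsub>M\<^esub> (P \<otimes>\<^bsub>M\<^esub> a)) = s [^]\<^bsub>M\<^esub> k \<otimes>\<^bsub>M\<^esub> (s [^]\<^bsub>M\<^esub> n \<otimes>\<^bsub>M\<^esub> \<zero>\<^bsub>M\<^esub>)"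
      using fr_eq P a by auto
    then have "P \<otimes>\<^bsub>M\<^esub> (s [^]\<^bsub>M\<^esub> k \<otimes>\<^bsub>M\<^esub> a) = \<zero>\<^bsub>M\<^esub>"
      using P a s by (simp add: M.m_lcomm)
    then have "s [^]\<^bsub>M\<^esub> k \<otimes>\<^bsub>M\<^esub> a = \<zero>\<^bsub>M\<^esub>"
      using p_tf a pw by (simp add: P_def)
    then have "\<exists>k::nat. s [^]\<^bsub>M\<^esub> k \<otimes>\<^bsub>M\<^esub> (s [^]\<^bsub>M\<^esub> (0::nat) \<otimes>\<^bsub>M\<^esub> a) = s [^]\<^bsub>M\<^esub> k \<otimes>\<^bsub>M\<^esub> (s [^]\<^bsub>M\<^esub> n \<otimes>\<^bsub>M\<^esub> \<zero>\<^bsub>M\<^esub>)"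
      using a s by (intro exI [of _ k]) simp
    then show "y = \<zero>\<^bsub>L\<^esub>"
      using fr_eq [of a "\<zero>\<^bsub>M\<^esub>" n 0] a by (simp add: y Lzero)
  qed
  \<comment> \<open>As s is a unit of L, it can be cancelled modulo every ideal. This settles n = 2,
    where s is the generator in question, and n > 2, where s already lies in the ideal.\<close>
  have s_in_I: "y \<in> I n" if y: "y \<in> carrier L" and sy: "?fr s 0 \<otimes>\<^bsub>L\<^esub> y \<in> I n" for y n
  proof -
    interpret I: ideal "I n" L by (rule Iideal)
    have c: "?fr s 0 \<in> carrier L" "?fr \<one>\<^bsub>M\<^esub> 1 \<in> carrier L"
      using s by (auto intro: fr_carrier)
    have "?fr \<one>\<^bsub>M\<^esub> 1 \<otimes>\<^bsub>L\<^esub> (?fr s 0 \<otimes>\<^bsub>L\<^esub> y) \<in> I n"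
      by (rule I.I_l_closed [OF sy c(2)])
    also have "?fr \<one>\<^bsub>M\<^esub> 1 \<otimes>\<^bsub>L\<^esub> (?fr s 0 \<otimes>\<^bsub>L\<^esub> y) = (?fr s 0 \<otimes>\<^bsub>L\<^esub> ?fr \<one>\<^bsub>M\<^esub> 1) \<otimes>\<^bsub>L\<^esub> y"
      using c y by (simp add: L.m_ac)
    also have "\<dots> = y"
      unfolding unit by (rule L.l_one [OF y])
    finally show ?thesis .
  qed
  have nzd_n: "nonzerodivisor (L Quot I n) (I n +>\<^bsub>L\<^esub> h (hazewinkel p n))" if n: "n \<ge> 1" for n
  proof (rule L.nonzerodivisor_quotient [OF Iideal hn])
    fix y assume y: "y \<in> carrier L" and vy: "h (hazewinkel p n) \<otimes>\<^bsub>L\<^esub> y \<in> I n"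
    consider "n = 1" | "n = 2" | "n > 2"
      using n by linarith
    then show "y \<in> I n"
    proof cases
      case 1
      obtain a j where a: "a \<in> carrier M" and yf: "y = ?fr a j"
        using Lcarr y by blast
      have "?fr v1 0 \<otimes>\<^bsub>L\<^esub> ?fr a j \<in> Idl\<^bsub>L\<^esub> {?fr P 0}"
        using vy h1 unfolding 1 I1 yf by simp
      then obtain r where r: "r \<in> carrier L" "?fr v1 0 \<otimes>\<^bsub>L\<^esub> ?fr a j = r \<otimes>\<^bsub>L\<^esub> ?fr P 0"
        using L.genideal_singleton [OF fr_carrier [OF P]] by blast
      obtain b m where b: "b \<in> carrier M" "r = ?fr b m"
        using Lcarr r(1) by blast
      have "?fr (v1 \<otimes>\<^bsub>M\<^esub> a) j = ?fr (b \<otimes>\<^bsub>M\<^esub> P) m"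
        using r(2) a b v1 P by (simp add: fr_mult)
      then obtain k :: nat where "s [^]\<^bsub>M\<^esub> k \<otimes>\<^bsub>M\<^esub> (s [^]\<^bsub>M\<^esub> m \<otimes>\<^bsub>M\<^esub> (v1 \<otimes>\<^bsub>M\<^esub> a)) = s [^]\<^bsub>M\<^esub> k \<otimes>\<^bsub>M\<^esub> (s [^]\<^bsub>M\<^esub> j \<otimes>\<^bsub>M\<^esub> (b \<otimes>\<^bsub>M\<^esub> P))"
        using fr_eq a b v1 P by auto
      \<comment> \<open>Clearing denominators gives an equation in M, to which \<open>v1_nzd\<close>
        applies; the powers of s are then put back into the denominator.\<close>
      then have "v1 \<otimes>\<^bsub>M\<^esub> (s [^]\<^bsub>M\<^esub> (k + m) \<otimes>\<^bsub>M\<^esub> a) = P \<otimes>\<^bsub>M\<^esub> (s [^]\<^bsub>M\<^esub> (k + j) \<otimes>\<^bsub>M\<^esub> b)"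
        using a b v1 P s by (simp add: M.nat_pow_mult [symmetric] M.m_ac)
      then obtain c where c: "c \<in> carrier M" "s [^]\<^bsub>M\<^esub> (k + m) \<otimes>\<^bsub>M\<^esub> a = P \<otimes>\<^bsub>M\<^esub> c"
        using v1_nzd [of "s [^]\<^bsub>M\<^esub> (k + m) \<otimes>\<^bsub>M\<^esub> a" "s [^]\<^bsub>M\<^esub> (k + j) \<otimes>\<^bsub>M\<^esub> b"] a b(1) pw by (auto simp: P_def v1_def)
      have "y = ?fr (c \<otimes>\<^bsub>M\<^esub> P) (j + (k + m))"
        unfolding yf
      proof (subst fr_eq)
        show "\<exists>l::nat. s [^]\<^bsub>M\<^esub> l \<otimes>\<^bsub>M\<^esub> (s [^]\<^bsub>M\<^esub> (j + (k + m)) \<otimes>\<^bsub>M\<^esub> a) = s [^]\<^bsub>M\<^esub> l \<otimes>\<^bsub>M\<^esub> (s [^]\<^bsub>M\<^esub> j \<otimes>\<^bsub>M\<^esub> (c \<otimes>\<^bsub>M\<^esub> P))"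
        proof (rule exI [of _ 0])
          have "s [^]\<^bsub>M\<^esub> (j + (k + m)) \<otimes>\<^bsub>M\<^esub> a = s [^]\<^bsub>M\<^esub> j \<otimes>\<^bsub>M\<^esub> (s [^]\<^bsub>M\<^esub> (k + m) \<otimes>\<^bsub>M\<^esub> a)"
            using s a by (simp add: M.nat_pow_mult [symmetric] M.m_assoc)
          also have "\<dots> = s [^]\<^bsub>M\<^esub> j \<otimes>\<^bsub>M\<^esub> (c \<otimes>\<^bsub>M\<^esub> P)"
            using c P by (simp add: M.m_comm)
          finally show "s [^]\<^bsub>M\<^esub> (0::nat) \<otimes>\<^bsub>M\<^esub> (s [^]\<^bsub>M\<^esub> (j + (k + m)) \<otimes>\<^bsub>M\<^esub> a) = s [^]\<^bsub>M\<^esub> (0::nat) \<otimes>\<^bsub>M\<^esub> (s [^]\<^bsub>M\<^esub> j \<otimes>\<^bsub>M\<^esub> (c \<otimes>\<^bsub>M\<^esub> P))"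
            by simp
        qed
      qed (use a c P in auto)
      also have "\<dots> = ?fr c (j + (k + m)) \<otimes>\<^bsub>L\<^esub> ?fr P 0"
        using c P by (simp add: fr_mult)
      finally have yP: "y = ?fr c (j + (k + m)) \<otimes>\<^bsub>L\<^esub> ?fr P 0" .
      interpret I: ideal "I 1" L by (rule Iideal)
      have "?fr P 0 \<in> I 1"
        unfolding I1 using L.genideal_self [of "{?fr P 0}"] fr_carrier [OF P] by simp
      then show ?thesis
        unfolding 1 yP using c by (intro I.I_l_closed fr_carrier)
    next
      case 2
      then show ?thesis
        using s_in_I [OF y, of 2] vy h2 by simp
    next
      case 3
      interpret I: ideal "I n" L by (rule Iideal)
      have "h (hazewinkel p 2) \<in> (\<lambda>i. h (hazewinkel p i)) ` {..<n}"
        using 3 by blast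
      then have "?fr s 0 \<in> I n"
        unfolding h2 [symmetric] I_def landweber_ideal_def
        using L.genideal_self [of "(\<lambda>i. h (hazewinkel p i)) ` {..<n}"] hn by blast
      then have "?fr s 0 \<otimes>\<^bsub>L\<^esub> y \<in> I n"
        using y by (intro I.I_r_closed)
      then show ?thesis
        by (rule s_in_I [OF y])
    qed
  qed
  \<comment> \<open>If 1 were in the ideal, clearing denominators would express a power of s through
    p and v1 inside M.\<close>
  have one_notin: "\<one>\<^bsub>L\<^esub> \<notin> I 2"
  proof
    assume "\<one>\<^bsub>L\<^esub> \<in> I 2"
    then obtain x y where xy: "x \<in> carrier L" "y \<in> carrier L" "\<one>\<^bsub>L\<^esub> = x \<otimes>\<^bsub>L\<^esub> ?fr P 0 \<oplus>\<^bsub>L\<^esub> y \<otimes>\<^bsub>L\<^esub> ?fr v1 0"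
      using L.genideal_pair [OF fr_carrier [OF P] fr_carrier [OF v1]] unfolding I2 by blast
    obtain a n where a: "a \<in> carrier M" "x = ?fr a n"
      using Lcarr xy(1) by blast
    obtain b m where b: "b \<in> carrier M" "y = ?fr b m"
      using Lcarr xy(2) by blast
    let ?z = "s [^]\<^bsub>M\<^esub> m \<otimes>\<^bsub>M\<^esub> (a \<otimes>\<^bsub>M\<^esub> P) \<oplus>\<^bsub>M\<^esub> s [^]\<^bsub>M\<^esub> n \<otimes>\<^bsub>M\<^esub> (b \<otimes>\<^bsub>M\<^esub> v1)"
    have "?fr \<one>\<^bsub>M\<^esub> 0 = ?fr ?z (n + m)"
      using xy(3) a b P v1 by (simp add: fr_mult fr_add Lone)
    moreover have "?z \<in> carrier M"
      using a b P v1 s by simp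
    ultimately obtain k :: nat where
      "s [^]\<^bsub>M\<^esub> k \<otimes>\<^bsub>M\<^esub> (s [^]\<^bsub>M\<^esub> (n + m) \<otimes>\<^bsub>M\<^esub> \<one>\<^bsub>M\<^esub>) = s [^]\<^bsub>M\<^esub> k \<otimes>\<^bsub>M\<^esub> (s [^]\<^bsub>M\<^esub> (0::nat) \<otimes>\<^bsub>M\<^esub> ?z)"
      using fr_eq [of "\<one>\<^bsub>M\<^esub>" ?z 0 "n + m"] by auto
    then have "s [^]\<^bsub>M\<^esub> (k + (n + m)) =
        (s [^]\<^bsub>M\<^esub> k \<otimes>\<^bsub>M\<^esub> s [^]\<^bsub>M\<^esub> m \<otimes>\<^bsub>M\<^esub> a) \<otimes>\<^bsub>M\<^esub> P \<oplus>\<^bsub>M\<^esub> (s [^]\<^bsub>M\<^esub> k \<otimes>\<^bsub>M\<^esub> s [^]\<^bsub>M\<^esub> n \<otimes>\<^bsub>M\<^esub> b) \<otimes>\<^bsub>M\<^esub> v1"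
      using a b P v1 s by (simp add: M.nat_pow_mult [symmetric] M.r_distr M.m_assoc)
    moreover have "s [^]\<^bsub>M\<^esub> k \<otimes>\<^bsub>M\<^esub> s [^]\<^bsub>M\<^esub> m \<otimes>\<^bsub>M\<^esub> a \<in> carrier M" "s [^]\<^bsub>M\<^esub> k \<otimes>\<^bsub>M\<^esub> s [^]\<^bsub>M\<^esub> n \<otimes>\<^bsub>M\<^esub> b \<in> carrier M"
      using a b s by simp_all
    ultimately show False
      using v2 unfolding s_def P_def v1_def by blast
  qed
  have "landweber_exact p L h"
    unfolding landweber_exact_def BP_algebra_def using L.cring_axioms hom nzd_p nzd_n by (auto simp: I_def)
  moreover have "I 2 +>\<^bsub>L\<^esub> h (hazewinkel p 2) \<in> Units (L Quot I 2)"
    unfolding h2 using s by (intro L.quotient_unit [OF Iideal _ _ unit] fr_carrier) auto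
  ultimately have "landweber_exact_height_two p L h"
    unfolding landweber_exact_height_two_def Let_def I_def [symmetric]
    using L.quotient_nonzero [OF Iideal one_notin] by blast
  then show ?thesis
    by (simp add: L_def h_def [abs_def] s_def)
qed

subsection \<open>The ring of automorphic forms\<close>

lemma type_ring_simps:
  "carrier (ring_of_type_algebra :: 'a::ring_1 ring) = UNIV"
  "x \<otimes>\<^bsub>(ring_of_type_algebra :: 'a::ring_1 ring)\<^esub> y = x * y"
  "x \<oplus>\<^bsub>(ring_of_type_algebra :: 'a::ring_1 ring)\<^esub> y = x + y"
  "\<one>\<^bsub>(ring_of_type_algebra :: 'a::ring_1 ring)\<^esub> = 1"
  "\<zero>\<^bsub>(ring_of_type_algebra :: 'a::ring_1 ring)\<^esub> = 0"
  by (simp_all add: ring_of_type_algebra_def)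

lemma type_ring_minus: "\<ominus>\<^bsub>(ring_of_type_algebra :: 'a::comm_ring_1 ring)\<^esub> x = - x"
proof -
  interpret cring "ring_of_type_algebra :: 'a ring"
    by (rule cring_from_type_algebra)
  show ?thesis
    by (rule minus_equality) (simp_all add: type_ring_simps)
qed

lemma lookup_single_mult:
  fixes f :: "uhp \<Rightarrow> complex" and Y :: gforms
  shows "Poly_Mapping.lookup (Poly_Mapping.single d f * Y) e = f * Poly_Mapping.lookup Y (e - d)"
proof -
  let ?S = "\<Sum>k\<in>Poly_Mapping.keys Y. Poly_Mapping.single k (Poly_Mapping.lookup Y k)"
  have single: "Poly_Mapping.lookup (Poly_Mapping.single d f * Poly_Mapping.single k h) e =
      f * Poly_Mapping.lookup (Poly_Mapping.single k h) (e - d)" for k h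
    by (auto simp: mult_single lookup_single when_def)
  have Y: "?S = Y"
    by (rule poly_mapping_eqI) (auto simp: lookup_sum lookup_single when_def in_keys_iff sum.delta)
  have "Poly_Mapping.lookup (Poly_Mapping.single d f * ?S) e = f * Poly_Mapping.lookup ?S (e - d)"
    by (simp only: sum_distrib_left lookup_sum single)
  then show ?thesis
    unfolding Y .
qed

context
  fixes R :: "complex set"
  assumes R: "coefficient_ring R"
begin

interpretation R: coefficient_ring R by (rule R)

lemma forms_ring_simps:
  "x \<otimes>\<^bsub>forms_ring R\<^esub> y = x * y" "x \<oplus>\<^bsub>forms_ring R\<^esub> y = x + y"
  "\<one>\<^bsub>forms_ring R\<^esub> = 1" "\<zero>\<^bsub>forms_ring R\<^esub> = 0"
  by (simp_all add: forms_ring_def ring_of_type_algebra_def)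

text \<open>The zero function is a form of every weight, so the condition on the support becomes a
  uniform one on all even degrees.\<close>

lemma forms_ring_carrier:
  "F \<in> carrier (forms_ring R) \<longleftrightarrow> (\<forall>d. odd d \<longrightarrow> Poly_Mapping.lookup F d = 0) \<and>
     (\<forall>k. \<exists>a. form_with R k (Poly_Mapping.lookup F (2 * k)) a)" (is "?l \<longleftrightarrow> ?r")
proof
  assume l: ?l
  have l': "\<forall>d. Poly_Mapping.lookup F d \<noteq> 0 \<longrightarrow> (\<exists>k. d = 2 * k \<and> automorphic_form R k (Poly_Mapping.lookup F d))"
    using l by (simp add: forms_ring_def)
  have "\<exists>a. form_with R k (Poly_Mapping.lookup F (2 * k)) a" for k
  proof (cases "Poly_Mapping.lookup F (2 * k) = 0")
    case True
    then show ?thesis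
      using R.form_zero [of k] by (auto simp: zero_fun_def)
  next
    case False
    obtain j where j: "2 * k = 2 * j" "automorphic_form R j (Poly_Mapping.lookup F (2 * k))"
      using l' [rule_format, OF False] by (rule exE) (erule conjE)
    then have "j = k"
      by simp
    then show ?thesis
      using j(2) unfolding automorphic_form_iff by simp
  qed
  then show ?r
    using l' by fastforce
next
  assume r: ?r
  have "\<exists>k. d = 2 * k \<and> automorphic_form R k (Poly_Mapping.lookup F d)" if "Poly_Mapping.lookup F d \<noteq> 0" for d
  proof -
    have "even d"
      using r that by blast
    then obtain k where "d = 2 * k" ..
    then show ?thesis
      using r by (auto simp: automorphic_form_iff)
  qed
  then show ?l
    by (simp add: forms_ring_def)
qed

lemma single_in_forms_ring: "form_with R k f a \<Longrightarrow> Poly_Mapping.single (2 * k) f \<in> carrier (forms_ring R)"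
  unfolding forms_ring_carrier using R.form_zero
  by (auto simp: lookup_single when_def zero_fun_def)

lemma forms_ring_add: "F \<in> carrier (forms_ring R) \<Longrightarrow> G \<in> carrier (forms_ring R) \<Longrightarrow> F + G \<in> carrier (forms_ring R)"
  unfolding forms_ring_carrier lookup_add plus_fun_def using R.form_add by (simp add: zero_fun_def) meson

lemma forms_ring_neg: "F \<in> carrier (forms_ring R) \<Longrightarrow> - F \<in> carrier (forms_ring R)"
  unfolding forms_ring_carrier lookup_uminus fun_Compl_def using R.form_neg by (simp add: zero_fun_def) meson

lemma forms_ring_single_mult:
  assumes f: "form_with R k f a" and G: "G \<in> carrier (forms_ring R)"
  shows "Poly_Mapping.single (2 * k) f * G \<in> carrier (forms_ring R)"
  unfolding forms_ring_carrier lookup_single_mult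
proof (intro conjI allI impI)
  fix d :: int assume "odd d"
  then have "Poly_Mapping.lookup G (d - 2 * k) = 0"
    using G unfolding forms_ring_carrier by simp
  then show "f * Poly_Mapping.lookup G (d - 2 * k) = 0"
    by simp
next
  fix l
  obtain b where b: "form_with R (l - k) (Poly_Mapping.lookup G (2 * (l - k))) b"
    using G unfolding forms_ring_carrier by blast
  have "form_with R l (\<lambda>\<tau>. f \<tau> * Poly_Mapping.lookup G (2 * (l - k)) \<tau>) (a * b)"
    using R.form_mult [OF f b] by simp
  then show "\<exists>a. form_with R l (f * Poly_Mapping.lookup G (2 * l - 2 * k)) a"
    by (auto simp: times_fun_def right_diff_distrib)
qed

lemma forms_ring_sum: "(\<And>i. i \<in> I \<Longrightarrow> F i \<in> carrier (forms_ring R)) \<Longrightarrow> sum F I \<in> carrier (forms_ring R)"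
proof (induction I rule: infinite_finite_induct)
  case (insert i I)
  then show ?case
    by (simp add: forms_ring_add)
qed (use single_in_forms_ring [OF R.form_zero, of 0] in \<open>simp_all add: zero_fun_def [symmetric]\<close>)

lemma forms_ring_mult:
  assumes F: "F \<in> carrier (forms_ring R)" and G: "G \<in> carrier (forms_ring R)"
  shows "F * G \<in> carrier (forms_ring R)"
proof -
  have F': "F = (\<Sum>d\<in>Poly_Mapping.keys F. Poly_Mapping.single d (Poly_Mapping.lookup F d))"
    by (rule poly_mapping_eqI) (auto simp: lookup_sum lookup_single when_def in_keys_iff sum.delta)
  have "F * G = (\<Sum>d\<in>Poly_Mapping.keys F. Poly_Mapping.single d (Poly_Mapping.lookup F d) * G)"
    using arg_cong [OF F', of "\<lambda>z. z * G"] unfolding sum_distrib_right .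
  also have "\<dots> \<in> carrier (forms_ring R)"
  proof (rule forms_ring_sum)
    fix d assume "d \<in> Poly_Mapping.keys F"
    then have "even d"
      using F unfolding forms_ring_carrier by (auto simp: in_keys_iff)
    then obtain k where d: "d = 2 * k" ..
    obtain a where "form_with R k (Poly_Mapping.lookup F d) a"
      using F unfolding forms_ring_carrier d by blast
    then show "Poly_Mapping.single d (Poly_Mapping.lookup F d) * G \<in> carrier (forms_ring R)"
      unfolding d by (rule forms_ring_single_mult [OF _ G])
  qed
  finally show ?thesis .
qed

lemma const_in_forms_ring: "c \<in> R \<Longrightarrow> const_form c \<in> carrier (forms_ring R)"
  using single_in_forms_ring [OF R.form_const] by (simp add: const_form_def)

lemma forms_ring_cring: "cring (forms_ring R)"
proof -
  interpret T: cring "ring_of_type_algebra :: gforms ring"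
    by (rule cring_from_type_algebra)
  have one: "1 \<in> carrier (forms_ring R)"
    using const_in_forms_ring [OF R.one_R] by (simp add: const_form_1)
  have "subring (carrier (forms_ring R)) (ring_of_type_algebra :: gforms ring)"
    by (rule T.subringI)
      (auto simp: type_ring_simps type_ring_minus one forms_ring_neg forms_ring_mult forms_ring_add)
  then have "subcring (carrier (forms_ring R)) (ring_of_type_algebra :: gforms ring)"
    by (rule T.subcringI')
  then have "cring (ring_of_type_algebra \<lparr>carrier := carrier (forms_ring R)\<rparr>)"
    using T.subcring_iff by (metis type_ring_simps(1) subset_UNIV)
  then show ?thesis
    by (simp add: forms_ring_def)
qed

lemma forms_ring_power: "x [^]\<^bsub>forms_ring R\<^esub> (n::nat) = x ^ n"
proof -
  interpret M: cring "forms_ring R"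
    by (rule forms_ring_cring)
  show ?thesis
  proof (induction n)
    case 0
    show ?case
      unfolding M.nat_pow_0 forms_ring_simps power_0 ..
  next
    case (Suc n)
    show ?case
      unfolding M.nat_pow_Suc forms_ring_simps Suc power_Suc2 ..
  qed
qed

end

section \<open>The genus on BP and divisibility in the ring of forms\<close>

lemma of_rat_local_ints: "c \<in> local_ints p \<Longrightarrow> of_rat c \<in> (local_ints p :: 'a::field_char_0 set)"
  by (auto simp: local_ints_def [of p, where 'a = rat] of_rat_divide intro: local_intsI)

lemma lookup_const_form_mult:
  "Poly_Mapping.lookup (const_form c * F) e = (\<lambda>\<tau>. c * Poly_Mapping.lookup F e \<tau>)"
  by (simp add: const_form_def lookup_single_mult times_fun_def)

context
  fixes p :: nat
  assumes p: "Factorial_Ring.prime p" and p5: "p mod 8 = 5"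
begin

interpretation Zp: coefficient_ring "local_ints p"
  by (rule coefficient_ring_local_ints [OF p])

lemma genus_in_forms_ring:
  assumes v: "\<And>n. genus (hazewinkel p n) \<in> carrier (forms_ring (local_ints p))"
  shows "genus \<in> ring_hom (BP p) (forms_ring (local_ints p))"
proof (rule ring_hom_memI)
  note Zpc = Zp.coefficient_ring_axioms
  fix x y assume x: "x \<in> carrier (BP p)"
  then have "x \<in> generate_ring ring_of_type_algebra (mu_const ` local_ints p \<union> hazewinkel p ` {1..})"
    by (simp add: BP_def)
  then show "genus x \<in> carrier (forms_ring (local_ints p))"
  proof (induction x rule: generate_ring.induct)
    case one
    show ?case
      unfolding type_ring_simps genus_1 const_form_1 [symmetric]
      by (rule const_in_forms_ring [OF Zpc Zp.one_R])
  next
    case (incl h)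
    then show ?case
      using v by (auto simp: genus_mu_const intro!: const_in_forms_ring [OF Zpc] of_rat_local_ints)
  next
    case (a_inv h)
    then show ?case
      unfolding type_ring_minus genus_neg by (intro forms_ring_neg [OF Zpc])
  next
    case (eng_add h1 h2)
    then show ?case
      unfolding type_ring_simps genus_add by (intro forms_ring_add [OF Zpc])
  next
    case (eng_mult h1 h2)
    then show ?case
      unfolding type_ring_simps genus_mult by (intro forms_ring_mult [OF Zpc])
  qed
  show "genus (x \<otimes>\<^bsub>BP p\<^esub> y) = genus x \<otimes>\<^bsub>forms_ring (local_ints p)\<^esub> genus y"
    by (simp add: BP_def type_ring_simps forms_ring_simps [OF Zpc] ring_of_type_algebra_def genus_mult)
  show "genus (x \<oplus>\<^bsub>BP p\<^esub> y) = genus x \<oplus>\<^bsub>forms_ring (local_ints p)\<^esub> genus y"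
    by (simp add: BP_def type_ring_simps forms_ring_simps [OF Zpc] ring_of_type_algebra_def genus_add)
next
  show "genus \<one>\<^bsub>BP p\<^esub> = \<one>\<^bsub>forms_ring (local_ints p)\<^esub>"
    by (simp add: BP_def forms_ring_simps [OF Zp.coefficient_ring_axioms] ring_of_type_algebra_def genus_1)
qed

text \<open>Applied to the first generator: constant term 1 makes its expansion invertible, so in
  each degree divisibility by p passes from u A to A. The quotient A / p is automorphic over the
  complex numbers, and its expansion is integral.\<close>

lemma divide_by_p:
  assumes u: "form_with (local_ints p) l u a" "fps_nth a 0 = 1"
    and A: "A \<in> carrier (forms_ring (local_ints p))" and B: "B \<in> carrier (forms_ring (local_ints p))"
    and eq: "Poly_Mapping.single (2 * l) u * A = of_nat p * B"
  shows "\<exists>C\<in>carrier (forms_ring (local_ints p)). A = of_nat p * C"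
proof (rule bexI)
  note Zpc = Zp.coefficient_ring_axioms
  let ?C = "const_form (1 / of_nat p) * A"
  have p0: "of_nat p \<noteq> (0 :: complex)"
    using p by auto
  have "of_nat p * ?C = const_form (of_nat p * (1 / of_nat p)) * A"
    unfolding of_nat_const_form const_form_mult by (rule mult.assoc [symmetric])
  also have "\<dots> = A"
    using p0 by (simp add: const_form_1)
  finally show "A = of_nat p * ?C" ..
  show "?C \<in> carrier (forms_ring (local_ints p))"
    unfolding forms_ring_carrier [OF Zpc] lookup_const_form_mult
  proof (intro conjI allI impI)
    fix d :: int assume "odd d"
    then have "Poly_Mapping.lookup A d = 0"
      using A unfolding forms_ring_carrier [OF Zpc] by simp
    then show "(\<lambda>\<tau>. 1 / of_nat p * Poly_Mapping.lookup A d \<tau>) = 0"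
      by (simp add: zero_fun_def)
  next
    fix k
    let ?f = "Poly_Mapping.lookup A (2 * k)" and ?g = "Poly_Mapping.lookup B (2 * (l + k))"
    obtain b where b: "form_with (local_ints p) k ?f b"
      using A unfolding forms_ring_carrier [OF Zpc] by blast
    obtain c where c: "form_with (local_ints p) (l + k) ?g c"
      using B unfolding forms_ring_carrier [OF Zpc] by blast
    have "u * Poly_Mapping.lookup A (2 * (l + k) - 2 * l) = (\<lambda>\<tau>. of_nat p * ?g \<tau>)"
      using arg_cong [OF eq, of "\<lambda>z. Poly_Mapping.lookup z (2 * (l + k))"]
      unfolding of_nat_const_form lookup_const_form_mult lookup_single_mult .
    moreover have "2 * (l + k) - 2 * l = 2 * k"
      by simp
    ultimately have "(\<lambda>\<tau>. u \<tau> * ?f \<tau>) = (\<lambda>\<tau>. of_nat p * ?g \<tau>)"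
      unfolding times_fun_def by simp
    then have ab: "a * b = fps_const (of_nat p) * c"
      using form_with_unique [OF Zp.form_mult [OF u(1) b]] Zp.form_cmult [OF Zp.of_nat_R c] by metis
    have bJ: "fps_nth b n \<in> (*) (of_nat p) ` local_ints p" for n
    proof (rule Zp.fps_unit_cancel [of a])
      show "a \<in> fps_over (local_ints p)"
        using form_withD(2) [OF u(1)] by (simp add: fps_over_def)
      show "0 \<in> (*) (of_nat p) ` (local_ints p :: complex set)"
        using Zp.zero_R by (intro image_eqI [of _ _ 0]) simp_all
      show "x - y \<in> (*) (of_nat p) ` local_ints p"
        if x: "x \<in> (*) (of_nat p) ` local_ints p" and y: "y \<in> (*) (of_nat p) ` local_ints p" for x y :: complex
      proof -
        obtain x' y' where "x = of_nat p * x'" "x' \<in> local_ints p" "y = of_nat p * y'" "y' \<in> local_ints p"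
          using x y by blast
        then show ?thesis
          using Zp.add_R [OF _ Zp.neg_R, of x' y'] by (intro image_eqI [of _ _ "x' - y'"]) (simp_all add: right_diff_distrib)
      qed
      show "x * y \<in> (*) (of_nat p) ` local_ints p"
        if x: "x \<in> local_ints p" and y: "y \<in> (*) (of_nat p) ` local_ints p" for x y :: complex
      proof -
        obtain y' where "y = of_nat p * y'" "y' \<in> local_ints p"
          using y by blast
        then show ?thesis
          using Zp.mult_R [OF x, of y'] by (intro image_eqI [of _ _ "x * y'"]) simp_all
      qed
      show "fps_nth (a * b) n \<in> (*) (of_nat p) ` local_ints p" for n
        using form_withD(2) [OF c, of n] unfolding ab by (simp only: fps_mult_left_const_nth imageI)
    qed (rule u(2))
    have "form_with UNIV k ?f b"
      using b by (rule form_with_mono) (simp add: fps_over_def)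
    then have "form_with UNIV k (\<lambda>\<tau>. 1 / of_nat p * ?f \<tau>) (fps_const (1 / of_nat p) * b)"
      by (rule Cx.form_cmult [OF UNIV_I])
    moreover have "fps_const (1 / of_nat p) * b \<in> fps_over (local_ints p)"
      unfolding fps_over_def
    proof (intro CollectI allI)
      fix n
      obtain z where "fps_nth b n = of_nat p * z" "z \<in> local_ints p"
        using bJ [of n] by blast
      then show "fps_nth (fps_const (1 / of_nat p) * b) n \<in> local_ints p"
        using p0 by simp
    qed
    ultimately show "\<exists>a. form_with (local_ints p) k (\<lambda>\<tau>. 1 / of_nat p * ?f \<tau>) a"
      using form_with_mono by blast
  qed
qed

lemma p_torsion_free: "(of_nat p :: gforms) * A = 0 \<Longrightarrow> A = 0"
proof -
  assume "(of_nat p :: gforms) * A = 0"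
  then have "const_form (1 / of_nat p) * (const_form (of_nat p) * A) = 0"
    by (simp add: of_nat_const_form)
  then have "const_form (1 / of_nat p * of_nat p) * A = 0"
    unfolding const_form_mult mult.assoc .
  moreover have "(1 / of_nat p * of_nat p :: complex) = 1"
    using p by auto
  ultimately show "A = 0"
    by (simp only: const_form_1 mult_1_left)
qed

text \<open>Only the component in the degree of the left side matters. There the factor Q of V 1 =
  \<alpha> Q joins the component of G, giving a relation modulo p and \<alpha> in the form excluded
  by \<open>no_power_relation\<close>.\<close>

lemma v2_power_notin:
  assumes V: "\<And>n. n \<ge> 1 \<Longrightarrow> form_with (local_ints p) (int p ^ n - 1) (V n) (a n)"
    and rec: "\<And>n \<tau>. n \<ge> 1 \<Longrightarrow> of_nat p * log_form p n \<tau> = (\<Sum>j<n. log_form p j \<tau> * V (n - j) \<tau> ^ (p ^ j))"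
    and F: "F \<in> carrier (forms_ring (local_ints p))" and G: "G \<in> carrier (forms_ring (local_ints p))"
  shows "Poly_Mapping.single (2 * (int p ^ 2 - 1)) (V 2) ^ K \<noteq>
    of_nat p * F + Poly_Mapping.single (2 * (int p ^ 1 - 1)) (V 1) * G"
proof
  assume eq: "Poly_Mapping.single (2 * (int p ^ 2 - 1)) (V 2) ^ K =
    of_nat p * F + Poly_Mapping.single (2 * (int p ^ 1 - 1)) (V 1) * G"
  note Zpc = Zp.coefficient_ring_axioms
  obtain m N Q b h b' where m: "8 * int m = int p ^ 2 - 1" and N: "\<not> p dvd N"
    and Q: "form_with (local_ints p) (int p - 5) Q b" and V1: "\<And>\<tau>. V 1 \<tau> = alpha \<tau> * Q \<tau>"
    and h: "form_with (local_ints p) (8 * int m - 4) h b'"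
    and V2: "\<And>\<tau>. V 2 \<tau> = (-1) ^ m * of_nat N / 4 ^ m * beta \<tau> ^ m + alpha \<tau> * h \<tau>"
    using generators_mod_alpha [OF p p5 V rec] by metis
  define k where "k = 8 * int (m * K)"
  let ?f = "Poly_Mapping.lookup F (2 * k)" and ?g = "Poly_Mapping.lookup G (2 * (k - (int p - 1)))"
  obtain a1 where f: "form_with (local_ints p) k ?f a1"
    using F unfolding forms_ring_carrier [OF Zpc] by blast
  obtain a2 where g: "form_with (local_ints p) (k - (int p - 1)) ?g a2"
    using G unfolding forms_ring_carrier [OF Zpc] by blast
  have "form_with (local_ints p) ((int p - 5) + (k - (int p - 1))) (\<lambda>\<tau>. Q \<tau> * ?g \<tau>) (b * a2)"
    by (rule Zp.form_mult [OF Q g])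
  then have Qg: "form_with (local_ints p) (8 * int (m * K) - 4) (\<lambda>\<tau>. Q \<tau> * ?g \<tau>) (b * a2)"
    by (simp add: k_def)
  have deg: "int K * (2 * (int p ^ 2 - 1)) = 2 * k"
    unfolding m [symmetric] k_def by simp
  have deg': "2 * k - 2 * (int p ^ 1 - 1) = 2 * (k - (int p - 1))"
    by simp
  have "V 2 ^ K = (\<lambda>\<tau>. of_nat p * ?f \<tau>) + V 1 * ?g"
    using arg_cong [OF eq, of "\<lambda>z. Poly_Mapping.lookup z (2 * k)"]
    unfolding single_power deg lookup_single_eq of_nat_const_form lookup_add lookup_const_form_mult
      lookup_single_mult deg' .
  have rel: "V 2 \<tau> ^ K = of_nat p * ?f \<tau> + alpha \<tau> * (Q \<tau> * ?g \<tau>)" for \<tau>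
    using fun_cong [OF \<open>V 2 ^ K = _\<close>, of \<tau>]
    unfolding fun_power_apply plus_fun_def times_fun_def V1 mult.assoc .
  have "form_with (local_ints p) (8 * int m) (V 2) (a 2)"
    using V [of 2] unfolding m by simp
  moreover have "form_with (local_ints p) (8 * int (m * K)) ?f a1"
    unfolding k_def [symmetric] by (rule f)
  ultimately show False
    using no_power_relation [OF p p5 m N h V2 _ _ Qg rel] by blast
qed

end

theorem corollary2:
  fixes p :: nat
  assumes "Factorial_Ring.prime p" and "p mod 8 = 5"
  shows "(let M = forms_ring (local_ints p); v = (\<lambda>k. genus (hazewinkel p k)) in
    v 2 \<in> carrier M \<and> v 2 \<notin> Idl\<^bsub>M\<^esub> {of_nat p, v 1} \<and>
    landweber_exact_height_two p (localization M (v 2)) (\<lambda>x. loc_map M (v 2) (genus x)))"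
proof -
  let ?M = "forms_ring (local_ints p)" and ?v = "\<lambda>k. genus (hazewinkel p k)"
  note p = assms(1) and p5 = assms(2)
  note Zpc = coefficient_ring_local_ints [OF p]
  interpret Zp: coefficient_ring "local_ints p"
    by (rule Zpc)
  interpret M: cring ?M
    by (rule forms_ring_cring [OF Zpc])
  note simps = forms_ring_simps [OF Zpc]
  obtain V a where genus: "\<And>n. n \<ge> 1 \<Longrightarrow> ?v n = Poly_Mapping.single (2 * (int p ^ n - 1)) (V n)"
    and V: "\<And>n. n \<ge> 1 \<Longrightarrow> form_with (local_ints p) (int p ^ n - 1) (V n) (a n)"
    and rec: "\<And>n \<tau>. n \<ge> 1 \<Longrightarrow> of_nat p * log_form p n \<tau> = (\<Sum>j<n. log_form p j \<tau> * V (n - j) \<tau> ^ (p ^ j))"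
    using genus_hazewinkel [OF p p4 [OF p p5]] by blast
  have a1: "fps_nth (a 1) 0 = 1"
    using generators_mod_alpha [OF p p5 V rec] by metis
  have haz0: "hazewinkel p 0 = of_nat p"
    by (simp add: hazewinkel.simps)
  have v0: "?v 0 = of_nat p"
    unfolding haz0 by (rule genus_of_nat)
  have pM: "of_nat p \<in> carrier ?M"
    unfolding of_nat_const_form by (rule const_in_forms_ring [OF Zpc Zp.of_nat_R])
  have v: "?v n \<in> carrier ?M" for n
  proof (cases "n = 0")
    case True
    then show ?thesis
      using pM v0 by simp
  next
    case False
    then have "n \<ge> 1"
      by simp
    then show ?thesis
      unfolding genus [OF \<open>n \<ge> 1\<close>] using single_in_forms_ring [OF Zpc V] by blast
  qed
  \<comment> \<open>K = 1 gives the first claim, all K together the nontriviality of the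
    localization modulo p and v_1.\<close>
  have notin: "?v 2 ^ K \<noteq> x * of_nat p + y * ?v 1" if "x \<in> carrier ?M" "y \<in> carrier ?M" for K x y
    unfolding genus [OF one_le_numeral] genus [of 1, OF order_refl] mult.commute [of x] mult.commute [of y]
    by (rule v2_power_notin [OF p p5 V rec that])
  have "?v 2 \<notin> Idl\<^bsub>?M\<^esub> {of_nat p, ?v 1}"
  proof
    assume "?v 2 \<in> Idl\<^bsub>?M\<^esub> {of_nat p, ?v 1}"
    then obtain x y where "x \<in> carrier ?M" "y \<in> carrier ?M" "?v 2 = x * of_nat p + y * ?v 1"
      using M.genideal_pair [OF pM v] unfolding simps by blast
    then show False
      using notin [of x y 1] unfolding power_one_right by blast
  qed
  moreover have "landweber_exact_height_two p (localization ?M (?v 2)) (\<lambda>x. loc_map ?M (?v 2) (genus x))"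
  proof (rule landweber_exact_localization)
    show "genus \<in> ring_hom (BP p) ?M"
      by (rule genus_in_forms_ring [OF p p5 v])
    show "A = \<zero>\<^bsub>?M\<^esub>" if "A \<in> carrier ?M" "?v 0 \<otimes>\<^bsub>?M\<^esub> A = \<zero>\<^bsub>?M\<^esub>" for A
      using that(2) unfolding simps v0 by (rule p_torsion_free [OF p p5])
    show "\<exists>C\<in>carrier ?M. A = ?v 0 \<otimes>\<^bsub>?M\<^esub> C"
      if "A \<in> carrier ?M" "B \<in> carrier ?M" "?v 1 \<otimes>\<^bsub>?M\<^esub> A = ?v 0 \<otimes>\<^bsub>?M\<^esub> B" for A B
      using that(3) unfolding simps v0 genus [of 1, OF order_refl]
      by (rule divide_by_p [OF p p5 V [OF order_refl] a1 that(1,2)])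
    show "?v 2 [^]\<^bsub>?M\<^esub> K \<noteq> x \<otimes>\<^bsub>?M\<^esub> ?v 0 \<oplus>\<^bsub>?M\<^esub> y \<otimes>\<^bsub>?M\<^esub> ?v 1"
      if "x \<in> carrier ?M" "y \<in> carrier ?M" for K :: nat and x y
      unfolding simps v0 forms_ring_power [OF Zpc] by (rule notin [OF that])
  qed (rule M.cring_axioms v haz0)+
  ultimately show ?thesis
    using v unfolding Let_def by blast
qed

end
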